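(* Let $a,b,c,\alpha,\beta,\sigma>0$ with $b>a\beta$ and $2bc\ge\sigma^2$, and let $(r_t)_{t\ge0}$ be the Cox-Ingersoll-Ross process with Hawkes jumps. (i) For any $s>t\ge0$, $$\mathbb{E}[r_s|r_t]=\frac{bc+a\alpha}{b-a\beta}-e^{-(b-a\beta)(s-t)}\left[\frac{bc+a\alpha}{b-a\beta}-r_t\right].$$ (ii) For any $s>t\ge0$, $$\begin{aligned} \mathbb{E}[r_s^2|r_t]={}&r_t^2e^{-2(b-a\beta)(s-t)}\\ &+\left[(2bc+\sigma^2+2a\alpha+a^2\beta)\frac{bc+a\alpha}{2(b-a\beta)^2}+\frac{a^2\alpha}{2(b-a\beta)}\right]\left[1-e^{-2(b-a\beta)(s-t)}\right]\\ &-(2bc+\sigma^2+2a\alpha+a^2\beta)\frac{bc+a\alpha}{(b-a\beta)^2}\left[e^{-(b-a\beta)(s-t)}-e^{-2(b-a\beta)(s-t)}\right]\\ &+(2bc+\sigma^2+2a\alpha+a^2\beta)\frac{r_t}{b-a\beta}\left[e^{-(b-a\beta)(s-t)}-e^{-2(b-a\beta)(s-t)}\right]. \end{aligned}$$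
   Context: The Cox-Ingersoll-Ross process with Hawkes jumps with parameters $a,b,c,\alpha,\beta,\sigma>0$ is the nonnegative càdlàg process $r_t$, adapted to a filtration on a probability space with measure $\mathbb{P}$, with initial value $r_0\ge0$ measurable at time $0$, satisfying $$dr_t=b(c-r_t)\,dt+a\,dN_t+\sigma\sqrt{r_t}\,dW_t,$$ where $W_t$ is a standard Brownian motion for the filtration and $N_t$ is a simple point process with $N_0=0$ (jumps of size $1$) having intensity $\lambda_t=\alpha+\beta r_t$ at time $t$ (with $r$ evaluated at the left limit $r_{t-}$ to make the intensity predictable; thus $N_t-\int_0^t(\alpha+\beta r_s)\,ds$ is a local martingale). The process $r_t$ is Markov with generator $$\mathcal{A}f(r)=bcf'(r)-brf'(r)+\tfrac12\sigma^2 r f''(r)+(\alpha+\beta r)[f(r+a)-f(r)].$$ Standing assumptions: $b>a\beta$ and $2bc\ge\sigma^2$. Conditional expectations are those of nonnegative random variables, and the identities hold almost surely. *)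

theory Defs
  imports "HOL-Probability.Probability"
begin

definition cadlag :: "(real \<Rightarrow> real) \<Rightarrow> bool" where
  "cadlag f \<longleftrightarrow>
     (\<forall>t\<ge>0. (f \<longlongrightarrow> f t) (at_right t)) \<and> (\<forall>t>0. \<exists>l. (f \<longlongrightarrow> l) (at_left t))"

text \<open>The left limit of a path on the half line, with the convention that the value at time 0-
  is the value at time 0.\<close>

definition left_lim :: "(real \<Rightarrow> real) \<Rightarrow> real \<Rightarrow> real" where
  "left_lim f t = (if t \<le> 0 then f 0 else Lim (at_left t) f)"

text \<open>A path of a simple point process without explosion: a counting path started at 0 all of
  whose jumps have size 1. As the path is monotone and takes values in the natural numbers, it is
  constant on some interval to the left of t, so the condition on \<open>at_left t\<close> says that the
  jump at t is at most 1.\<close>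

definition simple_counting_path :: "(real \<Rightarrow> nat) \<Rightarrow> bool" where
  "simple_counting_path f \<longleftrightarrow>
     f 0 = 0 \<and> mono_on {0..} f \<and>
     (\<forall>t\<ge>0. (f \<longlongrightarrow> f t) (at_right t)) \<and>
     (\<forall>t>0. \<forall>\<^sub>F s in at_left t. f t \<le> f s + 1)"

text \<open>The time set is the half line of nonnegative reals. The filtration of the library is indexed
  by a whole linearly ordered type; its members at negative times play no role.\<close>

locale filtered_prob_space = prob_space M + filtration "space M" F
  for M :: "'a measure" and F :: "real \<Rightarrow> 'a measure" +
  assumes sets_F_subset: "\<And>t. sets (F t) \<subseteq> sets M"
begin

definition adapted :: "(real \<Rightarrow> 'a \<Rightarrow> 'b::topological_space) \<Rightarrow> bool" where
  "adapted X \<longleftrightarrow> (\<forall>t\<ge>0. X t \<in> borel_measurable (F t))"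

definition progressively_measurable :: "(real \<Rightarrow> 'a \<Rightarrow> real) \<Rightarrow> bool" where
  "progressively_measurable X \<longleftrightarrow>
     (\<forall>t\<ge>0. (\<lambda>(u, \<omega>). X u \<omega>) \<in> borel_measurable (restrict_space borel {0..t} \<Otimes>\<^sub>M F t))"

definition predictable_sigma :: "(real \<times> 'a) measure" where
  "predictable_sigma = sigma ({0..} \<times> space M)
     ({{0} \<times> A | A. A \<in> sets (F 0)} \<union>
      {{s<..t} \<times> A | s t A. 0 \<le> s \<and> s \<le> t \<and> A \<in> sets (F s)})"

definition predictable :: "(real \<Rightarrow> 'a \<Rightarrow> real) \<Rightarrow> bool" where
  "predictable X \<longleftrightarrow> (\<lambda>(u, \<omega>). X u \<omega>) \<in> borel_measurable predictable_sigma"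

definition martingale :: "(real \<Rightarrow> 'a \<Rightarrow> real) \<Rightarrow> bool" where
  "martingale X \<longleftrightarrow>
     adapted X \<and> (\<forall>t\<ge>0. integrable M (X t)) \<and>
     (\<forall>s t. 0 \<le> s \<and> s \<le> t \<longrightarrow> (AE \<omega> in M. real_cond_exp M (F s) (X t) \<omega> = X s \<omega>))"

text \<open>Restricting to finite localizing times is harmless: an extended localizing sequence may be
  replaced by its minimum with n.\<close>

definition local_martingale :: "(real \<Rightarrow> 'a \<Rightarrow> real) \<Rightarrow> bool" where
  "local_martingale X \<longleftrightarrow>
     adapted X \<and>
     (\<exists>\<tau> :: nat \<Rightarrow> 'a \<Rightarrow> real.
        (\<forall>n. stopping_time F (\<tau> n) \<and> (\<forall>\<omega>\<in>space M. 0 \<le> \<tau> n \<omega>)) \<and>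
        (AE \<omega> in M. incseq (\<lambda>n. \<tau> n \<omega>) \<and> filterlim (\<lambda>n. \<tau> n \<omega>) at_top sequentially) \<and>
        (\<forall>n. martingale (\<lambda>t \<omega>. X (min t (\<tau> n \<omega>)) \<omega> - X 0 \<omega>)))"

definition brownian_motion :: "(real \<Rightarrow> 'a \<Rightarrow> real) \<Rightarrow> bool" where
  "brownian_motion W \<longleftrightarrow>
     adapted W \<and>
     (AE \<omega> in M. W 0 \<omega> = 0) \<and>
     (AE \<omega> in M. continuous_on {0..} (\<lambda>t. W t \<omega>)) \<and>
     (\<forall>s t. 0 \<le> s \<and> s < t \<longrightarrow>
        distributed M lborel (\<lambda>\<omega>. W t \<omega> - W s \<omega>) (normal_density 0 (sqrt (t - s))) \<and>
        indep_set (sets (F s)) {(\<lambda>\<omega>. W t \<omega> - W s \<omega>) -` B \<inter> space M | B. B \<in> sets borel})"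

definition simple_point_process :: "(real \<Rightarrow> 'a \<Rightarrow> nat) \<Rightarrow> bool" where
  "simple_point_process N \<longleftrightarrow>
     adapted N \<and> (\<forall>\<omega>\<in>space M. simple_counting_path (\<lambda>t. N t \<omega>))"

definition has_intensity :: "(real \<Rightarrow> 'a \<Rightarrow> nat) \<Rightarrow> (real \<Rightarrow> 'a \<Rightarrow> real) \<Rightarrow> bool" where
  "has_intensity N l \<longleftrightarrow>
     predictable l \<and>
     (\<forall>t\<ge>0. \<forall>\<omega>\<in>space M. 0 \<le> l t \<omega>) \<and>
     (AE \<omega> in M. \<forall>t\<ge>0. set_integrable lborel {0..t} (\<lambda>u. l u \<omega>)) \<and>
     local_martingale (\<lambda>t \<omega>. real (N t \<omega>) - (LINT u:{0..t}|lborel. l u \<omega>))"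

definition tendsto_0_in_prob :: "(nat \<Rightarrow> 'a \<Rightarrow> ennreal) \<Rightarrow> bool" where
  "tendsto_0_in_prob X \<longleftrightarrow>
     (\<forall>\<epsilon>>0. (\<lambda>k. prob {\<omega> \<in> space M. X k \<omega> > ennreal \<epsilon>}) \<longlonglongrightarrow> 0)"

text \<open>A simple integrand is given by a number n, times \<open>p 0 \<le> \<dots> \<le> p n\<close> and bounded weights
  \<open>x i\<close>, measurable at time \<open>p i\<close>, which are the values on the interval from \<open>p i\<close> (exclusive) to
  \<open>p (Suc i)\<close> (inclusive).\<close>

definition simple_integrand :: "nat \<Rightarrow> (nat \<Rightarrow> real) \<Rightarrow> (nat \<Rightarrow> 'a \<Rightarrow> real) \<Rightarrow> bool" where
  "simple_integrand n p x \<longleftrightarrow>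
     0 \<le> p 0 \<and>
     (\<forall>i<n. p i \<le> p (Suc i) \<and> x i \<in> borel_measurable (F (p i)) \<and>
        (\<exists>C. \<forall>\<omega>\<in>space M. \<bar>x i \<omega>\<bar> \<le> C))"

definition simple_value ::
    "nat \<Rightarrow> (nat \<Rightarrow> real) \<Rightarrow> (nat \<Rightarrow> 'a \<Rightarrow> real) \<Rightarrow> real \<Rightarrow> 'a \<Rightarrow> real" where
  "simple_value n p x u \<omega> = (\<Sum>i<n. x i \<omega> * indicator {p i<..p (Suc i)} u)"

definition simple_integral ::
    "(real \<Rightarrow> 'a \<Rightarrow> real) \<Rightarrow> nat \<Rightarrow> (nat \<Rightarrow> real) \<Rightarrow> (nat \<Rightarrow> 'a \<Rightarrow> real) \<Rightarrow> real \<Rightarrow> 'a \<Rightarrow> real" where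
  "simple_integral W n p x t \<omega> =
     (\<Sum>i<n. x i \<omega> * (W (min t (p (Suc i))) \<omega> - W (min t (p i)) \<omega>))"

text \<open>The process I is a continuous version of the Ito integral of H with respect to W. The integrand
  is approximated by simple ones in the sense that the integral over \<open>[0, t]\<close> of the
  squared difference tends to 0 in probability, for every t; such a sequence exists exactly if the
  progressively measurable process H is almost surely square integrable on bounded intervals, and
  the limit in probability of the integrals does not depend on it. The squared difference is
  integrated as a nonnegative function, so that non-integrability cannot pass for a zero integral.\<close>

definition ito_integral ::
    "(real \<Rightarrow> 'a \<Rightarrow> real) \<Rightarrow> (real \<Rightarrow> 'a \<Rightarrow> real) \<Rightarrow> (real \<Rightarrow> 'a \<Rightarrow> real) \<Rightarrow> bool" where
  "ito_integral W H I \<longleftrightarrow>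
     progressively_measurable H \<and>
     (\<forall>t\<ge>0. I t \<in> borel_measurable M) \<and>
     (AE \<omega> in M. continuous_on {0..} (\<lambda>t. I t \<omega>)) \<and>
     (\<exists>(n :: nat \<Rightarrow> nat) p x.
        (\<forall>k. simple_integrand (n k) (p k) (x k)) \<and>
        (\<forall>t\<ge>0. tendsto_0_in_prob (\<lambda>k \<omega>.
           \<integral>\<^sup>+u\<in>{0..t}. ennreal ((simple_value (n k) (p k) (x k) u \<omega> - H u \<omega>)\<^sup>2) \<partial>lborel)) \<and>
        (\<forall>t\<ge>0. tendsto_0_in_prob (\<lambda>k \<omega>.
           ennreal \<bar>simple_integral W (n k) (p k) (x k) t \<omega> - I t \<omega>\<bar>)))"

end

text \<open>The stochastic differential equation is understood in integral form.\<close>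

locale cir_hawkes = filtered_prob_space M F
  for M :: "'a measure" and F :: "real \<Rightarrow> 'a measure" +
  fixes a b c \<alpha> \<beta> \<sigma> :: real
    and W :: "real \<Rightarrow> 'a \<Rightarrow> real"
    and N :: "real \<Rightarrow> 'a \<Rightarrow> nat"
    and r :: "real \<Rightarrow> 'a \<Rightarrow> real"
  assumes brownian: "brownian_motion W"
    and point_process: "simple_point_process N"
    and intensity: "has_intensity N (\<lambda>t \<omega>. \<alpha> + \<beta> * left_lim (\<lambda>u. r u \<omega>) t)"
    and r_adapted: "adapted r"
    and r_cadlag: "\<And>\<omega>. \<omega> \<in> space M \<Longrightarrow> cadlag (\<lambda>t. r t \<omega>)"
    and r_nonneg: "\<And>t \<omega>. t \<ge> 0 \<Longrightarrow> \<omega> \<in> space M \<Longrightarrow> r t \<omega> \<ge> 0"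
    and sde: "\<exists>I. ito_integral W (\<lambda>t \<omega>. sqrt (r t \<omega>)) I \<and>
      (AE \<omega> in M. \<forall>t\<ge>0.
         r t \<omega> = r 0 \<omega> + (LINT u:{0..t}|lborel. b * (c - r u \<omega>)) + a * real (N t \<omega>) + \<sigma> * I t \<omega>)"

text \<open>Conditional expectation of a nonnegative random variable X given (the sigma-algebra generated
  by) a real random variable Y.\<close>

definition nn_cond_exp_given ::
    "'a measure \<Rightarrow> ('a \<Rightarrow> real) \<Rightarrow> ('a \<Rightarrow> real) \<Rightarrow> 'a \<Rightarrow> ennreal" where
  "nn_cond_exp_given M X Y =
     nn_cond_exp M (vimage_algebra (space M) Y borel) (\<lambda>\<omega>. ennreal (X \<omega>))"

end

theory Submission
  imports Defs
begin

text \<open>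
  Write \<open>\<kappa> = b - a * \<beta>\<close> and \<open>\<mu> = b * c + a * \<alpha>\<close>. Subtracting from the counting process its
  compensator turns the equation into
  \<open>r u = r 0 + \<mu> * u - \<kappa> * (\<integral>v\<in>{0..u}. r v) + noise u\<close>, where \<open>noise\<close> is \<open>a\<close> times the compensated
  counting process plus \<open>\<sigma>\<close> times the Ito integral of \<open>sqrt r\<close>. Suppose that the increments of
  \<open>noise\<close> after time \<open>t\<close> have conditional mean zero given the past, and that their squares have the
  mean of \<open>\<sigma>\<^sup>2 * (\<integral>r) + a\<^sup>2 * (\<integral>\<alpha> + \<beta> * r)\<close>. Then both formulas are solutions of linear equations: for
  an event \<open>A\<close> of time \<open>t\<close> on which \<open>r t\<close> is bounded, the mean \<open>m\<close> of \<open>r\<close> on \<open>A\<close> satisfies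
  \<open>m' = \<mu> * P A - \<kappa> * m\<close>, and the second moment \<open>S\<close> satisfies
  \<open>S' = 2 * (\<mu> * m - \<kappa> * S) + (\<sigma>\<^sup>2 + a\<^sup>2 * \<beta>) * m + a\<^sup>2 * \<alpha> * P A\<close> (\<open>mean_formula\<close>,
  \<open>second_moment_formula\<close>). Solving them, and letting \<open>A\<close> run through the events \<open>r t \<in> B\<close>,
  \<open>r t \<le> k\<close>, gives the conditional expectations (\<open>nn_cond_exp_given_r\<close>).

  The equation for \<open>S\<close> needs no Ito formula. The square of the drift integral is expanded by Fubini
  (\<open>square_path_expansion\<close>) so that the drift at time \<open>u\<close> is multiplied by the noise increment from
  \<open>u\<close> to the end of the interval; such products have mean zero, and only the square of the noise is
  left.

  The work is in the moments of \<open>noise\<close>, which a priori is only locally a martingale. It is stopped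
  when \<open>N + (\<integral>r)\<close> has grown by a given amount; the growth until then is bounded because jumps
  have size 1. For the stopped process, optional stopping treats the compensated jumps
  (\<open>compensated_stopped\<close>), a stopped form of the Ito isometry treats the diffusion
  (\<open>stopped_ito_integral\<close>), and sums over fine grids give the remaining second moments
  (\<open>stopped_products\<close>): the squared increments of \<open>N\<close> add up to \<open>N\<close>, as all jumps are units, and
  the products with increments of the continuous Ito integral vanish in the limit.

  The stopping is removed by \<open>\<kappa> > 0\<close>: the mean of \<open>r + \<kappa> * (\<integral>r)\<close> at the stopping time is bounded
  by initial data and \<open>\<mu> * (s - t)\<close>, whatever the stopping time, and both terms are nonnegative. So
  Fatou's lemma shows that \<open>r s\<close> and the integral are integrable (\<open>noise_integrability\<close>), the
  stopped noise is bounded in mean square, and its mean passes to the limit. Its second moment does so,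
  too, because stopping only discards some of the orthogonal increments of the noise
  (\<open>noise_second_moment\<close>).

  Completeness and right-continuity of the filtration are not assumed. Therefore the Ito integral
  is replaced by an adapted version with right-continuous paths, read off from the equation
  (\<open>ito_part\<close>), and the stopping times used are hitting times of increasing right-continuous
  adapted processes, which are stopping times without these properties
  (\<open>stopping_time_hitting\<close>).
\<close>

section \<open>Passing to the limit under the expectation\<close>

text \<open>Uniform integrability is expressed by the mean excess of \<open>\<bar>V m\<bar>\<close> over
  \<open>K\<close>, which is exactly the mean error made by clipping \<open>V m\<close> to
  \<open>[-K, K]\<close>. The clipped variables converge by dominated convergence, and Fatou's lemma passes
  the bound on the excess to the limit. The excess is a convex function of \<open>V m\<close>, so that in
  this form the hypothesis can be verified for martingales by Jensen's inequality.\<close>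

lemma (in prob_space) Vitali_convergence:
  fixes V :: "nat \<Rightarrow> 'a \<Rightarrow> real" and U :: "'a \<Rightarrow> real"
  assumes int: "\<And>m. integrable M (V m)" and U [measurable]: "U \<in> borel_measurable M"
    and lim: "AE \<omega> in M. (\<lambda>m. V m \<omega>) \<longlonglongrightarrow> U \<omega>"
    and ui: "\<And>\<epsilon>. \<epsilon> > 0 \<Longrightarrow> \<exists>K. \<forall>m. (\<integral>\<omega>. max 0 (\<bar>V m \<omega>\<bar> - K) \<partial>M) \<le> \<epsilon>"
  shows "integrable M U" "(\<lambda>m. \<integral>\<omega>. V m \<omega> \<partial>M) \<longlonglongrightarrow> (\<integral>\<omega>. U \<omega> \<partial>M)"
proof -
  have Vm [measurable]: "V m \<in> borel_measurable M" for m using int by auto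
  have exint: "integrable M (\<lambda>\<omega>. max 0 (\<bar>V m \<omega>\<bar> - K))" for m K
    by (intro integrable_max integrable_zero Bochner_Integration.integrable_diff integrable_abs int) auto
  have ui0: "\<exists>K\<ge>0. \<forall>m. (\<integral>\<omega>. max 0 (\<bar>V m \<omega>\<bar> - K) \<partial>M) \<le> \<epsilon>" if \<epsilon>: "\<epsilon> > 0" for \<epsilon>
  proof -
    obtain K where K: "\<And>m. (\<integral>\<omega>. max 0 (\<bar>V m \<omega>\<bar> - K) \<partial>M) \<le> \<epsilon>" using ui[OF \<epsilon>] by blast
    have "(\<integral>\<omega>. max 0 (\<bar>V m \<omega>\<bar> - max 0 K) \<partial>M) \<le> \<epsilon>" for m
      by (rule order_trans[OF integral_mono[OF exint exint] K[of m]]) auto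
    then show ?thesis by (intro exI[of _ "max 0 K"]) auto
  qed
  have exU: "(\<integral>\<^sup>+\<omega>. ennreal (max 0 (\<bar>U \<omega>\<bar> - K)) \<partial>M) \<le> ennreal \<epsilon>"
    if K: "\<And>m. (\<integral>\<omega>. max 0 (\<bar>V m \<omega>\<bar> - K) \<partial>M) \<le> \<epsilon>" for K \<epsilon>
  proof -
    have "(\<integral>\<^sup>+\<omega>. ennreal (max 0 (\<bar>U \<omega>\<bar> - K)) \<partial>M)
        = (\<integral>\<^sup>+\<omega>. liminf (\<lambda>m. ennreal (max 0 (\<bar>V m \<omega>\<bar> - K))) \<partial>M)"
    proof (rule nn_integral_cong_AE, use lim in eventually_elim)
      fix \<omega> assume "(\<lambda>m. V m \<omega>) \<longlonglongrightarrow> U \<omega>"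
      then have "(\<lambda>m. ennreal (max 0 (\<bar>V m \<omega>\<bar> - K))) \<longlonglongrightarrow> ennreal (max 0 (\<bar>U \<omega>\<bar> - K))"
        by (intro tendsto_ennrealI tendsto_max tendsto_diff tendsto_rabs tendsto_const)
      then show "ennreal (max 0 (\<bar>U \<omega>\<bar> - K)) = liminf (\<lambda>m. ennreal (max 0 (\<bar>V m \<omega>\<bar> - K)))"
        by (rule lim_imp_Liminf[OF trivial_limit_sequentially, symmetric])
    qed
    also have "\<dots> \<le> liminf (\<lambda>m. \<integral>\<^sup>+\<omega>. ennreal (max 0 (\<bar>V m \<omega>\<bar> - K)) \<partial>M)"
      by (rule nn_integral_liminf) auto
    also have "\<dots> \<le> ennreal \<epsilon>"
    proof (rule Liminf_le, simp, rule always_eventually, rule allI)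
      fix m show "(\<integral>\<^sup>+\<omega>. ennreal (max 0 (\<bar>V m \<omega>\<bar> - K)) \<partial>M) \<le> ennreal \<epsilon>"
        by (subst nn_integral_eq_integral[OF exint]) (auto intro: ennreal_leI K)
    qed
    finally show ?thesis .
  qed
  show UI: "integrable M U"
  proof -
    obtain K where K: "K \<ge> 0" "\<And>m. (\<integral>\<omega>. max 0 (\<bar>V m \<omega>\<bar> - K) \<partial>M) \<le> 1"
      using ui0[of 1] by auto
    have "(\<integral>\<^sup>+\<omega>. ennreal (max 0 (\<bar>U \<omega>\<bar> - K)) \<partial>M) < \<infinity>"
      using exU[OF K(2)] by (rule le_less_trans) simp
    then have "integrable M (\<lambda>\<omega>. max 0 (\<bar>U \<omega>\<bar> - K))"
      by (intro integrableI_bounded) auto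
    then have "integrable M (\<lambda>\<omega>. K + max 0 (\<bar>U \<omega>\<bar> - K))" by auto
    then show ?thesis by (rule Bochner_Integration.integrable_bound) (use K in auto)
  qed
  show "(\<lambda>m. \<integral>\<omega>. V m \<omega> \<partial>M) \<longlonglongrightarrow> (\<integral>\<omega>. U \<omega> \<partial>M)"
  proof (rule LIMSEQ_I)
    fix e :: real assume "e > 0"
    then have e4: "e/4 > 0" by simp
    obtain K where K: "K \<ge> 0" "\<And>m. (\<integral>\<omega>. max 0 (\<bar>V m \<omega>\<bar> - K) \<partial>M) \<le> e/4"
      using ui0[OF e4] by blast
    \<comment> \<open>clipping to \<open>[-K, K]\<close>, with error equal to the excess\<close>
    define c where "c x = max (-K) (min K x)" for x :: real
    have cm [measurable]: "c \<in> borel_measurable borel" unfolding c_def by measurable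
    have cb: "\<bar>c x\<bar> \<le> K" for x using K(1) by (auto simp: c_def)
    have cx: "\<bar>x - c x\<bar> = max 0 (\<bar>x\<bar> - K)" for x using K(1) by (auto simp: c_def)
    have ci: "integrable M (\<lambda>\<omega>. c (f \<omega>))" if [measurable]: "f \<in> borel_measurable M" for f
      by (rule integrable_const_bound[of _ K]) (auto simp: cb)
    have lc: "(\<lambda>m. \<integral>\<omega>. c (V m \<omega>) \<partial>M) \<longlonglongrightarrow> (\<integral>\<omega>. c (U \<omega>) \<partial>M)"
    proof (rule integral_dominated_convergence[where w="\<lambda>_. K"])
      show "AE \<omega> in M. (\<lambda>m. c (V m \<omega>)) \<longlonglongrightarrow> c (U \<omega>)"
        using lim by eventually_elim (auto simp: c_def intro!: tendsto_intros)
    qed (auto simp: cb)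
    then obtain n0 where n0: "\<And>m. m \<ge> n0 \<Longrightarrow> \<bar>(\<integral>\<omega>. c (V m \<omega>) \<partial>M) - (\<integral>\<omega>. c (U \<omega>) \<partial>M)\<bar> < e/4"
      using e4 by (metis LIMSEQ_D real_norm_def)
    have b1: "\<bar>(\<integral>\<omega>. f \<omega> \<partial>M) - (\<integral>\<omega>. c (f \<omega>) \<partial>M)\<bar> \<le> (\<integral>\<omega>. max 0 (\<bar>f \<omega>\<bar> - K) \<partial>M)"
      if f: "integrable M f" for f
    proof -
      have "(\<integral>\<omega>. f \<omega> \<partial>M) - (\<integral>\<omega>. c (f \<omega>) \<partial>M) = (\<integral>\<omega>. f \<omega> - c (f \<omega>) \<partial>M)"
        using f by (intro Bochner_Integration.integral_diff[symmetric] ci) auto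
      also have "\<bar>\<dots>\<bar> \<le> (\<integral>\<omega>. \<bar>f \<omega> - c (f \<omega>)\<bar> \<partial>M)" by (rule integral_abs_bound)
      finally show ?thesis by (simp add: cx)
    qed
    have exUr: "(\<integral>\<omega>. max 0 (\<bar>U \<omega>\<bar> - K) \<partial>M) \<le> e/4"
      using exU[OF K(2)] e4 UI
      by (subst (asm) nn_integral_eq_integral) (auto intro!: integrable_max)
    show "\<exists>n0. \<forall>m\<ge>n0. norm ((\<integral>\<omega>. V m \<omega> \<partial>M) - (\<integral>\<omega>. U \<omega> \<partial>M)) < e"
    proof (intro exI allI impI)
      fix m assume "n0 \<le> m"
      from b1[OF int[of m]] b1[OF UI] K(2)[of m] exUr n0[OF this]
      show "norm ((\<integral>\<omega>. V m \<omega> \<partial>M) - (\<integral>\<omega>. U \<omega> \<partial>M)) < e"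
        unfolding real_norm_def by linarith
    qed
  qed
qed

lemma (in prob_space) Fatou_square:
  fixes V :: "nat \<Rightarrow> 'a \<Rightarrow> real" and U :: "'a \<Rightarrow> real"
  assumes [measurable]: "\<And>m. V m \<in> borel_measurable M" "U \<in> borel_measurable M"
    and sq: "\<And>m. integrable M (\<lambda>\<omega>. (V m \<omega>)\<^sup>2)"
    and bound: "\<And>m. (\<integral>\<omega>. (V m \<omega>)\<^sup>2 \<partial>M) \<le> C"
    and lim: "AE \<omega> in M. (\<lambda>m. V m \<omega>) \<longlonglongrightarrow> U \<omega>"
  shows "integrable M (\<lambda>\<omega>. (U \<omega>)\<^sup>2)" "(\<integral>\<omega>. (U \<omega>)\<^sup>2 \<partial>M) \<le> C"
proof -
  have "(\<integral>\<^sup>+\<omega>. ennreal ((U \<omega>)\<^sup>2) \<partial>M) = (\<integral>\<^sup>+\<omega>. liminf (\<lambda>m. ennreal ((V m \<omega>)\<^sup>2)) \<partial>M)"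
  proof (rule nn_integral_cong_AE, use lim in eventually_elim)
    fix \<omega> assume "(\<lambda>m. V m \<omega>) \<longlonglongrightarrow> U \<omega>"
    then have "(\<lambda>m. ennreal ((V m \<omega>)\<^sup>2)) \<longlonglongrightarrow> ennreal ((U \<omega>)\<^sup>2)"
      by (intro tendsto_ennrealI tendsto_power)
    then show "ennreal ((U \<omega>)\<^sup>2) = liminf (\<lambda>m. ennreal ((V m \<omega>)\<^sup>2))"
      by (rule lim_imp_Liminf[OF trivial_limit_sequentially, symmetric])
  qed
  also have "\<dots> \<le> liminf (\<lambda>m. \<integral>\<^sup>+\<omega>. ennreal ((V m \<omega>)\<^sup>2) \<partial>M)"
    by (rule nn_integral_liminf) auto
  also have "\<dots> \<le> ennreal C"
    by (rule Liminf_le, simp, rule always_eventually)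
      (auto simp: nn_integral_eq_integral[OF sq] intro: ennreal_leI bound)
  finally have le: "(\<integral>\<^sup>+\<omega>. ennreal ((U \<omega>)\<^sup>2) \<partial>M) \<le> ennreal C" .
  then have "(\<integral>\<^sup>+\<omega>. ennreal ((U \<omega>)\<^sup>2) \<partial>M) < \<infinity>" by (rule le_less_trans) simp
  then show i: "integrable M (\<lambda>\<omega>. (U \<omega>)\<^sup>2)" by (intro integrableI_bounded) auto
  have "C \<ge> 0" using bound[of 0] by (rule order_trans[rotated]) simp
  then show "(\<integral>\<omega>. (U \<omega>)\<^sup>2 \<partial>M) \<le> C" using le by (subst (asm) nn_integral_eq_integral[OF i]) auto
qed

lemma (in prob_space) integrable_of_square:
  fixes f :: "'a \<Rightarrow> real"
  assumes [measurable]: "f \<in> borel_measurable M" and "integrable M (\<lambda>\<omega>. (f \<omega>)\<^sup>2)"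
  shows "integrable M f"
proof (rule Bochner_Integration.integrable_bound)
  show "integrable M (\<lambda>\<omega>. 1 + (f \<omega>)\<^sup>2)" using assms by auto
  show "AE \<omega> in M. norm (f \<omega>) \<le> norm (1 + (f \<omega>)\<^sup>2)"
  proof (rule AE_I2)
    fix \<omega>
    have "0 \<le> (\<bar>f \<omega>\<bar> - 1)\<^sup>2" by simp
    then show "norm (f \<omega>) \<le> norm (1 + (f \<omega>)\<^sup>2)" by (simp add: power2_diff)
  qed
qed auto

lemma indicator_mult_integrable:
  fixes f :: "'a \<Rightarrow> real"
  shows "B \<in> sets M \<Longrightarrow> integrable M f \<Longrightarrow> integrable M (\<lambda>\<omega>. indicator B \<omega> * f \<omega>)"
  using integrable_mult_indicator[of B M f] by simp

lemma integrable_mult_of_squares: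
  fixes f g :: "'a \<Rightarrow> real"
  assumes [measurable]: "f \<in> borel_measurable M" "g \<in> borel_measurable M"
    and "integrable M (\<lambda>\<omega>. (f \<omega>)\<^sup>2)" "integrable M (\<lambda>\<omega>. (g \<omega>)\<^sup>2)"
  shows "integrable M (\<lambda>\<omega>. f \<omega> * g \<omega>)"
proof (rule Bochner_Integration.integrable_bound)
  show "integrable M (\<lambda>\<omega>. (f \<omega>)\<^sup>2 + (g \<omega>)\<^sup>2)" using assms by auto
  show "AE \<omega> in M. norm (f \<omega> * g \<omega>) \<le> norm ((f \<omega>)\<^sup>2 + (g \<omega>)\<^sup>2)"
  proof (rule AE_I2)
    fix \<omega>
    have "0 \<le> (\<bar>f \<omega>\<bar> - \<bar>g \<omega>\<bar>)\<^sup>2" by simp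
    then have "2 * (\<bar>f \<omega>\<bar> * \<bar>g \<omega>\<bar>) \<le> (f \<omega>)\<^sup>2 + (g \<omega>)\<^sup>2" by (simp add: power2_diff)
    moreover have "0 \<le> \<bar>f \<omega>\<bar> * \<bar>g \<omega>\<bar>" by simp
    ultimately have "\<bar>f \<omega>\<bar> * \<bar>g \<omega>\<bar> \<le> (f \<omega>)\<^sup>2 + (g \<omega>)\<^sup>2" by linarith
    then show "norm (f \<omega> * g \<omega>) \<le> norm ((f \<omega>)\<^sup>2 + (g \<omega>)\<^sup>2)" by (simp add: abs_mult)
  qed
qed auto

text \<open>Boundedness in mean square implies uniform integrability: the excess of \<open>\<bar>x\<bar>\<close> over
  \<open>K\<close> is at most \<open>x\<^sup>2 / K\<close>.\<close>

lemma (in prob_space) Vitali_square: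
  fixes V :: "nat \<Rightarrow> 'a \<Rightarrow> real" and U :: "'a \<Rightarrow> real"
  assumes m [measurable]: "\<And>m. V m \<in> borel_measurable M" "U \<in> borel_measurable M"
    and sq: "\<And>m. integrable M (\<lambda>\<omega>. (V m \<omega>)\<^sup>2)"
    and bound: "\<And>m. (\<integral>\<omega>. (V m \<omega>)\<^sup>2 \<partial>M) \<le> C"
    and lim: "AE \<omega> in M. (\<lambda>m. V m \<omega>) \<longlonglongrightarrow> U \<omega>"
  shows "integrable M U" "(\<lambda>m. \<integral>\<omega>. V m \<omega> \<partial>M) \<longlonglongrightarrow> (\<integral>\<omega>. U \<omega> \<partial>M)"
proof -
  have int: "integrable M (V m)" for m by (rule integrable_of_square[OF _ sq]) simp
  have C: "C \<ge> 0" using bound[of 0] by (rule order_trans[rotated]) simp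
  have "\<exists>K. \<forall>m. (\<integral>\<omega>. max 0 (\<bar>V m \<omega>\<bar> - K) \<partial>M) \<le> \<epsilon>" if e: "\<epsilon> > 0" for \<epsilon>
  proof (intro exI allI)
    fix m
    \<comment> \<open>\<open>C + 1\<close> instead of \<open>C\<close> keeps \<open>K\<close> positive\<close>
    define K where "K = (C + 1) / \<epsilon>"
    have K: "K > 0" using C e by (auto simp: K_def)
    have "(\<integral>\<omega>. max 0 (\<bar>V m \<omega>\<bar> - K) \<partial>M) \<le> (\<integral>\<omega>. (V m \<omega>)\<^sup>2 / K \<partial>M)"
    proof (rule integral_mono)
      show "integrable M (\<lambda>\<omega>. max 0 (\<bar>V m \<omega>\<bar> - K))" using int by (auto intro!: integrable_max)
      show "integrable M (\<lambda>\<omega>. (V m \<omega>)\<^sup>2 / K)" using sq by auto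
      fix \<omega>
      have "\<bar>V m \<omega>\<bar> - K \<le> (V m \<omega>)\<^sup>2 / K"
      proof -
        have "0 \<le> (\<bar>V m \<omega>\<bar> - K)\<^sup>2 + \<bar>V m \<omega>\<bar> * K" using K by simp
        then show ?thesis using K by (simp add: field_simps power2_eq_square)
      qed
      then show "max 0 (\<bar>V m \<omega>\<bar> - K) \<le> (V m \<omega>)\<^sup>2 / K" using K by auto
    qed
    also have "\<dots> = (\<integral>\<omega>. (V m \<omega>)\<^sup>2 \<partial>M) / K" by simp
    also have "\<dots> \<le> C / K" using bound K by (intro divide_right_mono) auto
    also have "\<dots> \<le> \<epsilon>" using C e by (simp add: K_def field_simps)
    finally show "(\<integral>\<omega>. max 0 (\<bar>V m \<omega>\<bar> - K) \<partial>M) \<le> \<epsilon>" .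
  qed
  from Vitali_convergence[OF int m(2) lim this]
  show "integrable M U" "(\<lambda>m. \<integral>\<omega>. V m \<omega> \<partial>M) \<longlonglongrightarrow> (\<integral>\<omega>. U \<omega> \<partial>M)" by auto
qed

text \<open>The hypothesis on \<open>D\<close> says that its conditional expectation given \<open>G\<close> vanishes,
  stated without mentioning conditional expectations; this is how martingale increments are handled
  throughout.\<close>

lemma (in prob_space) integral_mult_eq_0_of_subalgebra:
  fixes U D :: "'a \<Rightarrow> real"
  assumes sub: "subalgebra M G" and D: "integrable M D"
    and zero: "\<And>C. C \<in> sets G \<Longrightarrow> (\<integral>\<omega>. indicator C \<omega> * D \<omega> \<partial>M) = 0"
    and U: "U \<in> borel_measurable G" and UD: "integrable M (\<lambda>\<omega>. U \<omega> * D \<omega>)"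
  shows "(\<integral>\<omega>. U \<omega> * D \<omega> \<partial>M) = 0"
proof -
  interpret finite_measure_subalgebra M G using sub by unfold_locales
  have "AE \<omega> in M. real_cond_exp M G D \<omega> = 0"
    by (rule real_cond_exp_charact) (use D zero in \<open>auto simp: set_lebesgue_integral_def\<close>)
  then have "(\<integral>\<omega>. U \<omega> * real_cond_exp M G D \<omega> \<partial>M) = (\<integral>\<omega>. 0 \<partial>M)"
    by (intro integral_cong_AE borel_measurable_times measurable_from_subalg[OF sub U]) auto
  then show ?thesis using real_cond_exp_intg(2)[OF UD U borel_measurable_integrable[OF D]] by simp
qed

lemma square_diff_le:
  fixes x y z :: real
  shows "(x - y)\<^sup>2 \<le> 2 * (x - z)\<^sup>2 + 2 * (y - z)\<^sup>2"
proof -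
  have "0 \<le> ((x - z) + (y - z))\<^sup>2" by simp
  then show ?thesis by (simp add: power2_eq_square algebra_simps)
qed

lemma nn_integral_square_diff_le:
  fixes f g h :: "'b \<Rightarrow> real"
  assumes [measurable]: "f \<in> borel_measurable N" "g \<in> borel_measurable N" "h \<in> borel_measurable N"
  shows "(\<integral>\<^sup>+x. ennreal ((f x - g x)\<^sup>2) \<partial>N)
    \<le> 2 * (\<integral>\<^sup>+x. ennreal ((f x - h x)\<^sup>2) \<partial>N) + 2 * (\<integral>\<^sup>+x. ennreal ((g x - h x)\<^sup>2) \<partial>N)"
proof -
  have "(\<integral>\<^sup>+x. ennreal ((f x - g x)\<^sup>2) \<partial>N) \<le> (\<integral>\<^sup>+x. 2 * ennreal ((f x - h x)\<^sup>2) + 2 * ennreal ((g x - h x)\<^sup>2) \<partial>N)"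
  proof (rule nn_integral_mono)
    fix x
    have "ennreal ((f x - g x)\<^sup>2) \<le> ennreal (2 * (f x - h x)\<^sup>2 + 2 * (g x - h x)\<^sup>2)"
      by (rule ennreal_leI) (rule square_diff_le)
    also have "\<dots> = 2 * ennreal ((f x - h x)\<^sup>2) + 2 * ennreal ((g x - h x)\<^sup>2)"
      by (simp add: ennreal_mult)
    finally show "ennreal ((f x - g x)\<^sup>2) \<le> 2 * ennreal ((f x - h x)\<^sup>2) + 2 * ennreal ((g x - h x)\<^sup>2)" .
  qed
  then show ?thesis by (simp add: nn_integral_add nn_integral_cmult)
qed

text \<open>Continuity of the mean-square norm, for extended nonnegative integrals. Both directions rest on
  \<open>(x + y)\<^sup>2 \<le> (1 + d) * x\<^sup>2 + (1 + 1/d) * y\<^sup>2\<close> with small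
  \<open>d\<close>.\<close>

lemma nn_integral_square_tendsto:
  fixes f :: "'a \<Rightarrow> real" and g :: "nat \<Rightarrow> 'a \<Rightarrow> real"
  assumes [measurable]: "f \<in> borel_measurable M" "\<And>k. g k \<in> borel_measurable M"
    and fin: "(\<integral>\<^sup>+x. ennreal ((f x)\<^sup>2) \<partial>M) < \<infinity>"
    and lim: "(\<lambda>k. \<integral>\<^sup>+x. ennreal ((g k x - f x)\<^sup>2) \<partial>M) \<longlonglongrightarrow> 0"
  shows "(\<lambda>k. \<integral>\<^sup>+x. ennreal ((g k x)\<^sup>2) \<partial>M) \<longlonglongrightarrow> (\<integral>\<^sup>+x. ennreal ((f x)\<^sup>2) \<partial>M)"
proof -
  have sq: "(x + y)\<^sup>2 \<le> (1 + d) * x\<^sup>2 + (1 + 1/d) * y\<^sup>2" if "d > 0" for x y d :: real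
  proof -
    have "0 \<le> (d * x - y)\<^sup>2 / d" using that by simp
    then show ?thesis using that by (simp add: field_simps power2_eq_square)
  qed
  have le: "(\<integral>\<^sup>+x. ennreal ((p x)\<^sup>2) \<partial>M)
     \<le> ennreal (1 + d) * (\<integral>\<^sup>+x. ennreal ((q x)\<^sup>2) \<partial>M) + ennreal (1 + 1/d) * (\<integral>\<^sup>+x. ennreal ((p x - q x)\<^sup>2) \<partial>M)"
    if d: "d > 0" and [measurable]: "p \<in> borel_measurable M" "q \<in> borel_measurable M" for p q :: "'a \<Rightarrow> real" and d
  proof -
    have "(\<integral>\<^sup>+x. ennreal ((p x)\<^sup>2) \<partial>M) \<le> (\<integral>\<^sup>+x. ennreal (1 + d) * ennreal ((q x)\<^sup>2) + ennreal (1 + 1/d) * ennreal ((p x - q x)\<^sup>2) \<partial>M)"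
    proof (rule nn_integral_mono)
      fix x
      have "(p x)\<^sup>2 \<le> (1 + d) * (q x)\<^sup>2 + (1 + 1/d) * (p x - q x)\<^sup>2"
        using sq[OF d, of "q x" "p x - q x"] by simp
      then show "ennreal ((p x)\<^sup>2) \<le> ennreal (1 + d) * ennreal ((q x)\<^sup>2) + ennreal (1 + 1/d) * ennreal ((p x - q x)\<^sup>2)"
        using d by (simp flip: ennreal_mult ennreal_plus add: ennreal_leI)
    qed
    then show ?thesis by (simp add: nn_integral_add nn_integral_cmult)
  qed
  define b where "b = enn2real (\<integral>\<^sup>+x. ennreal ((f x)\<^sup>2) \<partial>M)"
  have b: "(\<integral>\<^sup>+x. ennreal ((f x)\<^sup>2) \<partial>M) = ennreal b" "b \<ge> 0" using fin by (auto simp: b_def)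
  define e where "e k = enn2real (\<integral>\<^sup>+x. ennreal ((g k x - f x)\<^sup>2) \<partial>M)" for k
  define a where "a k = enn2real (\<integral>\<^sup>+x. ennreal ((g k x)\<^sup>2) \<partial>M)" for k
  have ev: "\<forall>\<^sub>F k in sequentially. (\<integral>\<^sup>+x. ennreal ((g k x - f x)\<^sup>2) \<partial>M) < 1"
    using lim by (rule order_tendstoD) simp
  have ev': "\<forall>\<^sub>F k in sequentially. (\<integral>\<^sup>+x. ennreal ((g k x - f x)\<^sup>2) \<partial>M) = ennreal (e k)
     \<and> (\<integral>\<^sup>+x. ennreal ((g k x)\<^sup>2) \<partial>M) = ennreal (a k)"
    using ev
  proof eventually_elim
    case (elim k)
    then have 1: "(\<integral>\<^sup>+x. ennreal ((g k x - f x)\<^sup>2) \<partial>M) = ennreal (e k)"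
      unfolding e_def by (intro ennreal_enn2real[symmetric]) (metis ennreal_one_less_top order_less_trans)
    have "(\<integral>\<^sup>+x. ennreal ((g k x)\<^sup>2) \<partial>M) \<le> ennreal (1 + 1) * ennreal b + ennreal (1 + 1/1) * ennreal (e k)"
      using le[of 1 "g k" f] by (simp add: 1 b)
    also have "\<dots> < top" by (simp add: ennreal_mult_less_top)
    finally show ?case using 1 by (simp add: a_def)
  qed
  have e0: "e \<longlonglongrightarrow> 0" unfolding e_def
  proof (rule tendsto_enn2real)
    show "(\<lambda>k. \<integral>\<^sup>+x. ennreal ((g k x - f x)\<^sup>2) \<partial>M) \<longlonglongrightarrow> ennreal 0" using lim by simp
  qed simp
  have a0: "a k \<ge> 0" "e k \<ge> 0" for k by (auto simp: a_def e_def)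
  have "a \<longlonglongrightarrow> b"
  proof (rule LIMSEQ_I)
    fix r :: real assume r: "r > 0"
    \<comment> \<open>small enough for \<open>d * b\<close> to stay below \<open>r / 2\<close>\<close>
    define d where "d = min 1 (r / (2 * (b + 2)))"
    have d: "d > 0" "d * (b + 2) \<le> r / 2" "d \<le> 1"
    proof -
      show "d > 0" "d \<le> 1" using r b(2) by (auto simp: d_def)
      have "d * (b + 2) \<le> r / (2 * (b + 2)) * (b + 2)"
        using b(2) by (intro mult_right_mono) (auto simp: d_def)
      also have "\<dots> = r / 2" using b(2) by (simp add: field_simps)
      finally show "d * (b + 2) \<le> r / 2" .
    qed
    have r': "min (r/3) (1/2) / (1 + 1/d) > 0" using r d by (simp add: add_pos_pos)
    have "\<forall>\<^sub>F k in sequentially. e k < min (r/3) (1/2) / (1 + 1/d)"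
      by (rule order_tendstoD(2)[OF e0 r'])
    with ev' have "\<forall>\<^sub>F k in sequentially. norm (a k - b) < r"
    proof eventually_elim
      case (elim k)
      have A: "(1 + 1/d) * e k < min (r/3) (1/2)"
      proof -
        have "1 + 1/d > 0" using d(1) by (simp add: add_pos_pos)
        from pos_less_divide_eq[OF this] elim(2) show ?thesis by (simp add: mult.commute)
      qed
      have 1: "a k \<le> (1 + d) * b + (1 + 1/d) * e k"
        using le[OF d(1), of "g k" f] elim(1) b a0 d(1)
        by (simp flip: ennreal_mult ennreal_plus)
      have 2: "b \<le> (1 + d) * a k + (1 + 1/d) * e k"
        using le[OF d(1), of f "g k"] elim(1) b a0 d(1)
        by (simp add: power2_commute flip: ennreal_mult ennreal_plus)
      have db: "d * b \<le> b" using d b by (simp add: mult_left_le_one_le)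
      have "d * b + d * 2 \<le> r/2" using d(2) by (simp add: algebra_simps)
      moreover have A1: "(1 + 1/d) * e k < r/3" "(1 + 1/d) * e k < 1/2" using A by auto
      ultimately have up: "a k < b + r" using 1 d r by (simp add: algebra_simps)
      have "b < a k + r"
      proof (cases "a k \<le> b")
        case True
        then have "d * a k \<le> d * b" using d by simp
        moreover have "b \<le> a k + d * a k + (1 + 1/d) * e k" using 2 by (simp add: distrib_right)
        ultimately show ?thesis using A1 \<open>d * b + d * 2 \<le> r/2\<close> d r by linarith
      qed (use r in simp)
      with up show ?case by (simp add: abs_less_iff)
    qed
    then show "\<exists>no. \<forall>n\<ge>no. norm (a n - b) < r" by (simp add: eventually_sequentially)
  qed
  then have "(\<lambda>k. ennreal (a k)) \<longlonglongrightarrow> ennreal b" by (rule tendsto_ennrealI)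
  moreover have "\<forall>\<^sub>F k in sequentially. ennreal (a k) = (\<integral>\<^sup>+x. ennreal ((g k x)\<^sup>2) \<partial>M)"
    using ev' by eventually_elim auto
  ultimately show ?thesis unfolding b(1) by (rule Lim_transform_eventually)
qed

text \<open>Expectation of the product of two sums whose off-diagonal terms are orthogonal. Two different families are
  allowed so that covariations are covered along with second moments.\<close>

lemma integral_orthogonal_sums:
  fixes D D' :: "nat \<Rightarrow> 'a \<Rightarrow> real"
  assumes int: "\<And>i j. i < n \<Longrightarrow> j < n \<Longrightarrow> integrable M (\<lambda>\<omega>. D i \<omega> * D' j \<omega>)"
    and orth: "\<And>i j. i < n \<Longrightarrow> j < n \<Longrightarrow> i \<noteq> j \<Longrightarrow> (\<integral>\<omega>. D i \<omega> * D' j \<omega> \<partial>M) = 0"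
  shows "integrable M (\<lambda>\<omega>. (\<Sum>i<n. D i \<omega>) * (\<Sum>i<n. D' i \<omega>))"
    "(\<integral>\<omega>. (\<Sum>i<n. D i \<omega>) * (\<Sum>i<n. D' i \<omega>) \<partial>M) = (\<Sum>i<n. \<integral>\<omega>. D i \<omega> * D' i \<omega> \<partial>M)"
proof -
  have eq: "(\<Sum>i<n. D i \<omega>) * (\<Sum>i<n. D' i \<omega>) = (\<Sum>i<n. \<Sum>j<n. D i \<omega> * D' j \<omega>)" for \<omega>
    by (rule sum_product)
  show "integrable M (\<lambda>\<omega>. (\<Sum>i<n. D i \<omega>) * (\<Sum>i<n. D' i \<omega>))"
    unfolding eq by (intro Bochner_Integration.integrable_sum int) auto
  have "(\<integral>\<omega>. (\<Sum>i<n. D i \<omega>) * (\<Sum>i<n. D' i \<omega>) \<partial>M) = (\<Sum>i<n. \<Sum>j<n. \<integral>\<omega>. D i \<omega> * D' j \<omega> \<partial>M)"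
    unfolding eq
  proof (subst Bochner_Integration.integral_sum)
    show "(\<Sum>i<n. \<integral>\<omega>. (\<Sum>j<n. D i \<omega> * D' j \<omega>) \<partial>M) = (\<Sum>i<n. \<Sum>j<n. \<integral>\<omega>. D i \<omega> * D' j \<omega> \<partial>M)"
      by (intro sum.cong refl Bochner_Integration.integral_sum int) auto
  qed (intro Bochner_Integration.integrable_sum int; simp)
  also have "\<dots> = (\<Sum>i<n. \<integral>\<omega>. D i \<omega> * D' i \<omega> \<partial>M)"
  proof (rule sum.cong[OF refl])
    fix i assume i: "i \<in> {..<n}"
    have "(\<Sum>j<n. \<integral>\<omega>. D i \<omega> * D' j \<omega> \<partial>M) = (\<Sum>j\<in>{i}. \<integral>\<omega>. D i \<omega> * D' j \<omega> \<partial>M)"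
      using i orth by (intro sum.mono_neutral_right) auto
    then show "(\<Sum>j<n. \<integral>\<omega>. D i \<omega> * D' j \<omega> \<partial>M) = (\<integral>\<omega>. D i \<omega> * D' i \<omega> \<partial>M)" by simp
  qed
  finally show "(\<integral>\<omega>. (\<Sum>i<n. D i \<omega>) * (\<Sum>i<n. D' i \<omega>) \<partial>M) = (\<Sum>i<n. \<integral>\<omega>. D i \<omega> * D' i \<omega> \<partial>M)" .
qed

text \<open>For each \<open>m\<close> a finite number of sequences tends to zero in probability; an index
  \<open>\<kappa> m\<close> is chosen so late that all of them are small up to probability
  \<open>(1/2)^m\<close>, and the Borel-Cantelli lemma applies. The number of sequences may grow with
  \<open>m\<close>, as does the number of points of a grid.\<close>

lemma (in prob_space) prob_gt_fast_subsequence: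
  fixes G :: "nat \<Rightarrow> nat \<Rightarrow> nat \<Rightarrow> 'a \<Rightarrow> ennreal" and N :: "nat \<Rightarrow> nat"
  assumes m [measurable]: "\<And>m i k. G m i k \<in> borel_measurable M"
    and lim: "\<And>m i \<epsilon>. \<epsilon> > 0 \<Longrightarrow> (\<lambda>k. prob {\<omega> \<in> space M. G m i k \<omega> > ennreal \<epsilon>}) \<longlonglongrightarrow> 0"
  obtains \<kappa> :: "nat \<Rightarrow> nat" where
    "AE \<omega> in M. \<forall>\<^sub>F m in sequentially. \<forall>i<Suc (N m). G m i (\<kappa> m) \<omega> \<le> ennreal ((1/2)^m)"
proof -
  define B where "B m i k = {\<omega> \<in> space M. G m i k \<omega> > ennreal ((1/2)^m)}" for m i k
  have Bm [measurable]: "B m i k \<in> sets M" for m i k unfolding B_def by measurable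
  have "\<exists>k. \<forall>i\<in>{..<Suc (N m)}. prob (B m i k) < (1/2)^m / real (Suc (N m))" for m
  proof -
    have "\<forall>\<^sub>F k in sequentially. \<forall>i\<in>{..<Suc (N m)}. prob (B m i k) < (1/2)^m / real (Suc (N m))"
    proof (rule eventually_ball_finite, simp, rule ballI)
      fix i
      show "\<forall>\<^sub>F k in sequentially. prob (B m i k) < (1/2)^m / real (Suc (N m))"
        unfolding B_def by (rule order_tendstoD(2)[OF lim]) auto
    qed
    then show ?thesis using eventually_happens trivial_limit_sequentially by blast
  qed
  then obtain \<kappa> where \<kappa>: "\<And>m i. i < Suc (N m) \<Longrightarrow> prob (B m i (\<kappa> m)) < (1/2)^m / real (Suc (N m))"
    by (metis lessThan_iff)
  define U where "U m = (\<Union>i<Suc (N m). B m i (\<kappa> m))" for m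
  have Um [measurable]: "U m \<in> sets M" for m unfolding U_def by measurable
  have Ub: "prob (U m) \<le> (1/2)^m" for m
  proof -
    have "prob (U m) \<le> (\<Sum>i<Suc (N m). prob (B m i (\<kappa> m)))"
      unfolding U_def by (rule finite_measure_subadditive_finite) auto
    also have "\<dots> \<le> (\<Sum>i<Suc (N m). (1/2)^m / real (Suc (N m)))"
      using \<kappa> by (intro sum_mono less_imp_le) auto
    also have "\<dots> = (1/2)^m" by (simp del: sum.lessThan_Suc of_nat_Suc)
    finally show ?thesis .
  qed
  have "AE \<omega> in M. \<forall>\<^sub>F m in sequentially. \<omega> \<in> space M - U m"
  proof (rule borel_cantelli_AE1)
    show "summable (\<lambda>m. prob (U m))"
      by (rule summable_comparison_test'[of "\<lambda>m. (1/2)^m" 0]) (use Ub in \<open>auto simp: summable_geometric\<close>)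
  qed (auto simp: emeasure_eq_measure)
  then have "AE \<omega> in M. \<forall>\<^sub>F m in sequentially. \<forall>i<Suc (N m). G m i (\<kappa> m) \<omega> \<le> ennreal ((1/2)^m)"
    by eventually_elim (auto elim!: eventually_mono simp: U_def B_def not_less)
  then show ?thesis by (rule that)
qed

section \<open>Stopping along a uniform grid\<close>

definition unif_grid :: "real \<Rightarrow> real \<Rightarrow> nat \<Rightarrow> nat \<Rightarrow> real" where
  "unif_grid t s n i = t + real i * ((s - t) / real n)"

lemma unif_grid_0 [simp]: "unif_grid t s n 0 = t"
  and unif_grid_n [simp]: "n > 0 \<Longrightarrow> unif_grid t s n n = s"
  by (auto simp: unif_grid_def)

lemma unif_grid_mono: "t \<le> s \<Longrightarrow> i \<le> j \<Longrightarrow> unif_grid t s n i \<le> unif_grid t s n j"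
  by (auto simp: unif_grid_def intro!: mult_right_mono divide_right_mono)

lemma unif_grid_Suc: "unif_grid t s n (Suc i) = unif_grid t s n i + (s - t) / real n"
  by (simp add: unif_grid_def distrib_right add_divide_distrib)

text \<open>The stochastic integral, over the grid, of the indicator that \<open>T\<close> is not yet reached. The
  weight of a cell depends only on whether its left endpoint lies before \<open>T\<close>, hence is known
  there if \<open>T\<close> is a stopping time.\<close>

definition stopped_sum :: "(real \<Rightarrow> real) \<Rightarrow> real \<Rightarrow> real \<Rightarrow> nat \<Rightarrow> real \<Rightarrow> real" where
  "stopped_sum V t s n T = (\<Sum>i<n. if unif_grid t s n i < T
     then V (unif_grid t s n (Suc i)) - V (unif_grid t s n i) else 0)"

lemma unif_grid_bounds:
  assumes "t \<le> s" "i \<le> n" "n > 0"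
  shows "t \<le> unif_grid t s n i" "unif_grid t s n i \<le> s"
  using unif_grid_mono[OF assms(1), of 0 i n] unif_grid_mono[OF assms(1,2), of n] assms by auto

text \<open>The sum telescopes up to the first grid point at or after \<open>T\<close>. The grid point does not depend
  on \<open>V\<close>, so that several processes, or functions of them, can be stopped at the same time.\<close>

lemma stopped_sum_unif_grid:
  assumes "t \<le> T" "T \<le> s" "n > 0"
  obtains j where "j \<le> n" "T \<le> unif_grid t s n j" "unif_grid t s n j \<le> T + (s - t) / real n"
    "\<And>V. stopped_sum V t s n T = V (unif_grid t s n j) - V t"
proof -
  let ?g = "unif_grid t s n"
  have ts: "t \<le> s" using assms by simp
  define j where "j = (LEAST j. T \<le> ?g j)"
  have ex: "T \<le> ?g n" using assms by simp
  have j: "T \<le> ?g j" unfolding j_def by (rule LeastI[of "\<lambda>j. T \<le> ?g j", OF ex])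
  have jn: "j \<le> n" unfolding j_def by (rule Least_le[of "\<lambda>j. T \<le> ?g j", OF ex])
  have lt: "?g i < T" if "i < j" for i using not_less_Least[of i "\<lambda>j. T \<le> ?g j"] that by (simp add: j_def)
  have ge: "T \<le> ?g i" if "j \<le> i" for i using unif_grid_mono[OF ts that, of n] j by simp
  have up: "?g j \<le> T + (s - t) / real n"
  proof (cases j)
    case 0
    have "0 \<le> (s - t) / real n" using ts by simp
    then have "t \<le> T + (s - t) / real n" using assms(1) by linarith
    then show ?thesis using 0 by simp
  next
    case (Suc i)
    then show ?thesis using lt[of i] unif_grid_Suc[of t s n i] by simp
  qed
  have sum: "stopped_sum V t s n T = V (?g j) - V t" for V
  proof -
    have "stopped_sum V t s n T = (\<Sum>i<j. V (?g (Suc i)) - V (?g i))"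
      unfolding stopped_sum_def using jn lt ge by (intro sum.mono_neutral_cong_right) (auto simp: lt ge[THEN leD])
    also have "\<dots> = V (?g j) - V (?g 0)" by (rule sum_lessThan_telescope)
    finally show ?thesis by simp
  qed
  show ?thesis by (rule that[OF jn j up sum])
qed

lemma continuous_on_imp_right:
  fixes f :: "real \<Rightarrow> real"
  assumes "continuous_on {0..} f" "0 \<le> u"
  shows "(f \<longlongrightarrow> f u) (at_right u)"
proof -
  have "(f \<longlongrightarrow> f u) (at u within {0..})" using assms by (auto simp: continuous_on)
  then show ?thesis by (rule tendsto_mono[rotated]) (use assms(2) in \<open>auto intro!: at_le\<close>)
qed

text \<open>For processes stopped at a localizing time: beyond \<open>k\<close> the path is constant.\<close>

lemma min_right_continuous:
  fixes f :: "real \<Rightarrow> real"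
  assumes "(f \<longlongrightarrow> f (min T k)) (at_right (min T k))"
  shows "((\<lambda>u. f (min u k)) \<longlongrightarrow> f (min T k)) (at_right T)"
proof (cases "T < k")
  case True
  then have "\<forall>\<^sub>F u in at_right T. u < k" by (auto simp: eventually_at_right_field)
  then have "\<forall>\<^sub>F u in at_right T. f u = f (min u k)" by eventually_elim simp
  with assms True show ?thesis by (auto elim: Lim_transform_eventually)
next
  case False
  have "\<forall>\<^sub>F u in at_right T. T < u" by (simp add: eventually_at_right_less)
  then have "\<forall>\<^sub>F u in at_right T. f (min u k) = f (min T k)" by eventually_elim (use False in \<open>simp add: min_def\<close>)
  then show ?thesis by (rule tendsto_eventually)
qed

lemma right_continuous_LIMSEQ:
  fixes V :: "real \<Rightarrow> real"
  assumes "(V \<longlongrightarrow> V T) (at_right T)" "\<And>n. T \<le> x n" "x \<longlonglongrightarrow> T"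
  shows "(\<lambda>n. V (x n)) \<longlonglongrightarrow> V T"
proof (rule tendstoI)
  fix e :: real assume e: "e > 0"
  have "\<forall>\<^sub>F y in at_right T. dist (V y) (V T) < e" by (rule tendstoD[OF assms(1) e])
  then obtain b where b: "b > T" "\<And>y. T < y \<Longrightarrow> y < b \<Longrightarrow> dist (V y) (V T) < e"
    unfolding eventually_at_right_field by auto
  have "\<forall>\<^sub>F n in sequentially. x n < b" by (rule order_tendstoD(2)[OF assms(3) b(1)])
  then show "\<forall>\<^sub>F n in sequentially. dist (V (x n)) (V T) < e"
  proof eventually_elim
    case (elim n)
    show ?case using assms(2)[of n] b(2)[OF _ elim] e by (cases "x n = T") auto
  qed
qed

text \<open>The rounded times converge to \<open>T\<close> and never lie before it, so right-continuity of the path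
  suffices.\<close>

lemma stopped_sum_tendsto:
  fixes V :: "real \<Rightarrow> real"
  assumes "t \<le> T" "T \<le> s" and rc: "(V \<longlongrightarrow> V T) (at_right T)"
  shows "(\<lambda>n. stopped_sum V t s (Suc n) T) \<longlonglongrightarrow> V T - V t"
proof -
  have "\<exists>x. T \<le> x \<and> x \<le> T + (s - t) / real (Suc n) \<and> stopped_sum V t s (Suc n) T = V x - V t" for n
    by (rule stopped_sum_unif_grid[OF assms(1,2), of "Suc n"]) auto
  then obtain x where x: "\<And>n. T \<le> x n" "\<And>n. x n \<le> T + (s - t) / real (Suc n)"
    and eq: "\<And>n. stopped_sum V t s (Suc n) T = V (x n) - V t"
    by metis
  have "(\<lambda>n. (s - t) / real (Suc n)) \<longlonglongrightarrow> 0"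
    by (rule LIMSEQ_Suc) (rule lim_const_over_n)
  then have "(\<lambda>n. T + (s - t) / real (Suc n)) \<longlonglongrightarrow> T + 0" by (intro tendsto_add tendsto_const)
  then have "x \<longlonglongrightarrow> T"
    by (intro tendsto_sandwich[OF _ _ tendsto_const, of T x]) (use x in auto)
  from right_continuous_LIMSEQ[OF rc x(1) this]
  show ?thesis unfolding eq by (intro tendsto_diff tendsto_const)
qed

context filtered_prob_space
begin

lemma subalgebra_F: "subalgebra M (F u)"
  using sets_F_subset space_F by (auto simp: subalgebra_def)

lemma measurable_F_M: "f \<in> measurable (F u) N \<Longrightarrow> f \<in> measurable M N"
  by (rule measurable_from_subalg[OF subalgebra_F])

lemma measurable_F_mono: "f \<in> measurable (F u) N \<Longrightarrow> u \<le> v \<Longrightarrow> f \<in> measurable (F v) N"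
  by (rule measurable_from_subalg[of "F v" "F u"]) (use sets_F_mono space_F in \<open>auto simp: subalgebra_def\<close>)

lemma sets_F_M: "A \<in> sets (F u) \<Longrightarrow> A \<in> sets M"
  using sets_F_subset by blast

lemma stopping_time_sets_F:
  assumes "stopping_time F T" "u \<le> v"
  shows "{\<omega> \<in> space M. u < T \<omega>} \<in> sets (F v)" "{\<omega> \<in> space M. T \<omega> \<le> u} \<in> sets (F v)"
  using stopping_timeD[OF assms(1), of u] stopping_timeD2[OF assms(1), of u] sets_F_mono[OF assms(2)]
  by (auto simp: pred_def space_F)

lemma stopping_time_measurable: "stopping_time F T \<Longrightarrow> T \<in> borel_measurable M"
  by (rule measurable_stopping_time[OF _ sets_F_subset]) (auto simp: space_F)

lemma stopped_value_measurable:
  fixes V :: "real \<Rightarrow> 'a \<Rightarrow> real"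
  assumes V: "\<And>u. 0 \<le> u \<Longrightarrow> V u \<in> borel_measurable (F u)"
    and rc: "\<And>\<omega> u. \<omega> \<in> space M \<Longrightarrow> 0 \<le> u \<Longrightarrow> ((\<lambda>v. V v \<omega>) \<longlongrightarrow> V u \<omega>) (at_right u)"
    and T: "stopping_time F T" and ts: "0 \<le> t" "\<And>\<omega>. \<omega> \<in> space M \<Longrightarrow> t \<le> T \<omega>"
      "\<And>\<omega>. \<omega> \<in> space M \<Longrightarrow> T \<omega> \<le> s"
  shows "(\<lambda>\<omega>. V (T \<omega>) \<omega>) \<in> borel_measurable (F s)"
proof (rule borel_measurable_LIMSEQ_real)
  have le: "t \<le> s" using ts not_empty by (metis equals0I order_trans)
  define g where "g n = unif_grid t s (Suc n)" for n
  have gb: "t \<le> g n i" "g n i \<le> s" if "i \<le> Suc n" for n i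
    using unif_grid_bounds[OF le that] by (auto simp: g_def)
  show "(\<lambda>n. V t \<omega> + stopped_sum (\<lambda>u. V u \<omega>) t s (Suc n) (T \<omega>)) \<longlonglongrightarrow> V (T \<omega>) \<omega>"
    if "\<omega> \<in> space (F s)" for \<omega>
  proof -
    have w: "\<omega> \<in> space M" using that by (simp add: space_F)
    have "0 \<le> T \<omega>" using ts(1) ts(2)[OF w] by simp
    from tendsto_add[OF tendsto_const stopped_sum_tendsto[OF ts(2)[OF w] ts(3)[OF w] rc[OF w this]], of "V t \<omega>"]
    show ?thesis by simp
  qed
  show "(\<lambda>\<omega>. V t \<omega> + stopped_sum (\<lambda>u. V u \<omega>) t s (Suc n) (T \<omega>)) \<in> borel_measurable (F s)" for n
    unfolding stopped_sum_def g_def[symmetric]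
  proof (intro borel_measurable_add borel_measurable_sum measurable_If borel_measurable_diff)
    show "V t \<in> borel_measurable (F s)" by (rule measurable_F_mono[OF V le]) (use ts in auto)
    fix i assume "i \<in> {..<Suc n}"
    then have i: "i \<le> Suc n" "Suc i \<le> Suc n" by auto
    show "V (g n (Suc i)) \<in> borel_measurable (F s)" "V (g n i) \<in> borel_measurable (F s)"
      using gb[OF i(1)] gb[OF i(2)] ts(1) by (auto intro!: measurable_F_mono[OF V])
    show "{\<omega> \<in> space (F s). g n i < T \<omega>} \<in> sets (F s)"
      using stopping_time_sets_F(1)[OF T gb(2)[OF i(1)]] by (simp add: space_F)
  qed auto
qed

end

text \<open>Clamping time to \<open>[0, s]\<close> turns progressive measurability, which concerns a restricted time
  domain, into joint measurability on the whole line.\<close>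

lemma (in filtered_prob_space) progressive_clamped_measurable:
  assumes "progressively_measurable H" "0 \<le> s"
  shows "(\<lambda>(\<omega>, u). H (max 0 (min s u)) \<omega>) \<in> borel_measurable (F s \<Otimes>\<^sub>M borel)"
proof -
  have H: "(\<lambda>(u, \<omega>). H u \<omega>) \<in> borel_measurable (restrict_space borel {0..s} \<Otimes>\<^sub>M F s)"
    using assms by (auto simp: progressively_measurable_def)
  have "(\<lambda>x. (max 0 (min s (snd x)), fst x)) \<in> measurable (F s \<Otimes>\<^sub>M borel) (restrict_space borel {0..s} \<Otimes>\<^sub>M F s)"
    by (intro measurable_Pair measurable_restrict_space2) (use assms(2) in auto)
  from measurable_compose[OF this H] show ?thesis by (simp add: split_beta')
qed

section \<open>Integrals of simple integrands\<close>

text \<open>Splits an increment over the cells of a finer grid. A cell is recognised by its right endpoint, which also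
  copes with repeated grid points.\<close>

lemma sum_cells_telescope:
  fixes f :: "real \<Rightarrow> real" and p :: "nat \<Rightarrow> real"
  assumes mono: "\<And>i j. i \<le> j \<Longrightarrow> j \<le> n \<Longrightarrow> p i \<le> p j" and ab: "\<alpha> \<le> \<beta>" "\<beta> \<le> n"
  shows "(\<Sum>i<n. indicator {p \<alpha><..p \<beta>} (p (Suc i)) * (f (p (Suc i)) - f (p i))) = f (p \<beta>) - f (p \<alpha>)"
proof -
  have "(\<Sum>i<n. indicator {p \<alpha><..p \<beta>} (p (Suc i)) * (f (p (Suc i)) - f (p i)))
      = (\<Sum>i\<in>{\<alpha>..<\<beta>}. f (p (Suc i)) - f (p i))"
  proof (rule sum.mono_neutral_cong_right)
    show "\<forall>i\<in>{..<n} - {\<alpha>..<\<beta>}. indicator {p \<alpha><..p \<beta>} (p (Suc i)) * (f (p (Suc i)) - f (p i)) = 0"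
    proof
      fix i assume i: "i \<in> {..<n} - {\<alpha>..<\<beta>}"
      then consider "i < \<alpha>" | "\<beta> \<le> i" by force
      then show "indicator {p \<alpha><..p \<beta>} (p (Suc i)) * (f (p (Suc i)) - f (p i)) = 0"
      proof cases
        case 1
        then have "p (Suc i) \<le> p \<alpha>" using ab by (intro mono) auto
        then show ?thesis by simp
      next
        case 2
        then have "p \<beta> \<le> p i" "p i \<le> p (Suc i)" using i by (auto intro!: mono)
        then show ?thesis by (cases "p (Suc i) = p i") (auto simp: indicator_def)
      qed
    qed
    fix i assume i: "i \<in> {\<alpha>..<\<beta>}"
    then have "p \<alpha> \<le> p i" "p i \<le> p (Suc i)" "p (Suc i) \<le> p \<beta>" using ab by (auto intro!: mono)
    then show "indicator {p \<alpha><..p \<beta>} (p (Suc i)) * (f (p (Suc i)) - f (p i)) = f (p (Suc i)) - f (p i)"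
      by (cases "p (Suc i) = p i") (auto simp: indicator_def)
  qed (use ab in auto)
  also have "\<dots> = f (p \<beta>) - f (p \<alpha>)" using ab(1) by (rule sum_Suc_diff')
  finally show ?thesis .
qed

locale brownian_space = filtered_prob_space M F
  for M :: "'a measure" and F :: "real \<Rightarrow> 'a measure" +
  fixes W :: "real \<Rightarrow> 'a \<Rightarrow> real"
  assumes W_brownian: "brownian_motion W"
begin

lemma W_measurable: "0 \<le> u \<Longrightarrow> W u \<in> borel_measurable (F u)"
  using W_brownian by (auto simp: brownian_motion_def adapted_def)

lemma W_increment:
  assumes "0 \<le> s" "s < t"
  shows "distributed M lborel (\<lambda>\<omega>. W t \<omega> - W s \<omega>) (normal_density 0 (sqrt (t - s)))"
    and "indep_set (sets (F s)) {(\<lambda>\<omega>. W t \<omega> - W s \<omega>) -` B \<inter> space M | B. B \<in> sets borel}"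
  using W_brownian assms by (auto simp: brownian_motion_def)

lemma W_increment_indep:
  assumes st: "0 \<le> s" "s < t" and U: "U \<in> borel_measurable (F s)"
  shows "indep_var borel U borel (\<lambda>\<omega>. W t \<omega> - W s \<omega>)"
  unfolding indep_var_def indep_vars_def2
proof (intro conjI ballI)
  fix b :: bool assume "b \<in> UNIV"
  show "(case b of True \<Rightarrow> U | False \<Rightarrow> \<lambda>\<omega>. W t \<omega> - W s \<omega>) \<in> measurable M (case b of True \<Rightarrow> borel | False \<Rightarrow> borel)"
    using measurable_F_M[OF U] measurable_F_M[OF W_measurable, of s] measurable_F_M[OF W_measurable, of t] st
    by (cases b) auto
next
  show "indep_sets (\<lambda>i. {(case i of True \<Rightarrow> U | False \<Rightarrow> \<lambda>\<omega>. W t \<omega> - W s \<omega>) -` A \<inter> space M |A.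
       A \<in> sets (case i of True \<Rightarrow> borel | False \<Rightarrow> borel)}) UNIV"
  proof (rule indep_sets_mono_sets[OF W_increment(2)[OF st, unfolded indep_set_def]])
    fix i :: bool
    show "{(case i of True \<Rightarrow> U | False \<Rightarrow> \<lambda>\<omega>. W t \<omega> - W s \<omega>) -` A \<inter> space M |A. A \<in> sets (case i of True \<Rightarrow> borel | False \<Rightarrow> borel)}
      \<subseteq> (case i of True \<Rightarrow> sets (F s) | False \<Rightarrow> {(\<lambda>\<omega>. W t \<omega> - W s \<omega>) -` B \<inter> space M |B. B \<in> sets borel})"
      using measurable_sets[OF U] by (cases i) (auto simp: space_F)
  qed
qed

text \<open>The increment after time \<open>s\<close> is independent of \<open>U\<close>, centred, and has variance
  \<open>t - s\<close>.\<close>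

lemma W_increment_moments:
  assumes st: "0 \<le> s" "s \<le> t" and U: "U \<in> borel_measurable (F s)" "integrable M U"
  shows "integrable M (\<lambda>\<omega>. U \<omega> * (W t \<omega> - W s \<omega>))" "(\<integral>\<omega>. U \<omega> * (W t \<omega> - W s \<omega>) \<partial>M) = 0"
    "integrable M (\<lambda>\<omega>. U \<omega> * (W t \<omega> - W s \<omega>)\<^sup>2)"
    "(\<integral>\<omega>. U \<omega> * (W t \<omega> - W s \<omega>)\<^sup>2 \<partial>M) = (\<integral>\<omega>. U \<omega> \<partial>M) * (t - s)"
proof -
  have "integrable M (\<lambda>\<omega>. U \<omega> * (W t \<omega> - W s \<omega>)) \<and> (\<integral>\<omega>. U \<omega> * (W t \<omega> - W s \<omega>) \<partial>M) = 0 \<and>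
    integrable M (\<lambda>\<omega>. U \<omega> * (W t \<omega> - W s \<omega>)\<^sup>2) \<and>
    (\<integral>\<omega>. U \<omega> * (W t \<omega> - W s \<omega>)\<^sup>2 \<partial>M) = (\<integral>\<omega>. U \<omega> \<partial>M) * (t - s)" if "s \<noteq> t"
  proof -
  have lt: "s < t" using st that by simp
  define X where "X = (\<lambda>\<omega>. W t \<omega> - W s \<omega>)"
  have d: "distributed M lborel X (normal_density 0 (sqrt (t - s)))"
    unfolding X_def by (rule W_increment(1)[OF st(1) lt])
  have pos: "0 < sqrt (t - s)" using lt by simp
  have iX: "integrable M X"
    by (rule distributed_integrable[OF d, of "\<lambda>x. x", THEN iffD1])
      (use integrable_normal_moment_nz_1[OF pos, of 0] in auto)
  have iX2: "integrable M (\<lambda>\<omega>. (X \<omega>)\<^sup>2)"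
    by (rule distributed_integrable[OF d, of "\<lambda>x. x\<^sup>2", THEN iffD1])
      (use integrable_normal_moment[OF pos, of 0 2] in auto)
  have E1: "expectation X = 0" by (rule normal_distributed_expectation[OF pos d])
  have E2: "(\<integral>\<omega>. (X \<omega>)\<^sup>2 \<partial>M) = t - s"
    using normal_distributed_variance[OF pos d] E1 lt by simp
  have ind: "indep_var borel U borel X" unfolding X_def by (rule W_increment_indep[OF st(1) lt U(1)])
  have ind2: "indep_var borel U borel (\<lambda>\<omega>. (X \<omega>)\<^sup>2)"
    using indep_var_compose[OF ind, of "\<lambda>x. x" borel "\<lambda>x. x\<^sup>2" borel] by (simp add: comp_def)
  show ?thesis
    using indep_var_integrable[OF ind U(2) iX] indep_var_lebesgue_integral[OF ind U(2) iX]
      indep_var_integrable[OF ind2 U(2) iX2] indep_var_lebesgue_integral[OF ind2 U(2) iX2] E1 E2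
    by (simp add: X_def)
  qed
  then show "integrable M (\<lambda>\<omega>. U \<omega> * (W t \<omega> - W s \<omega>))" "(\<integral>\<omega>. U \<omega> * (W t \<omega> - W s \<omega>) \<partial>M) = 0"
    "integrable M (\<lambda>\<omega>. U \<omega> * (W t \<omega> - W s \<omega>)\<^sup>2)"
    "(\<integral>\<omega>. U \<omega> * (W t \<omega> - W s \<omega>)\<^sup>2 \<partial>M) = (\<integral>\<omega>. U \<omega> \<partial>M) * (t - s)"
    by (cases "s = t"; auto)+
qed


text \<open>The integral over the whole time axis; the corresponding energy is the integral of the squared integrand, by
  \<open>nn_integral_simple_value_square\<close>.\<close>

definition simple_total :: "nat \<Rightarrow> (nat \<Rightarrow> real) \<Rightarrow> (nat \<Rightarrow> 'a \<Rightarrow> real) \<Rightarrow> 'a \<Rightarrow> real" where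
  "simple_total n p x \<omega> = (\<Sum>i<n. x i \<omega> * (W (p (Suc i)) \<omega> - W (p i) \<omega>))"

definition simple_energy :: "nat \<Rightarrow> (nat \<Rightarrow> real) \<Rightarrow> (nat \<Rightarrow> 'a \<Rightarrow> real) \<Rightarrow> 'a \<Rightarrow> real" where
  "simple_energy n p x \<omega> = (\<Sum>i<n. (x i \<omega>)\<^sup>2 * (p (Suc i) - p i))"

lemma simple_integrand_mono:
  assumes "simple_integrand n p x" "i \<le> j" "j \<le> n"
  shows "p i \<le> p j"
  using assms(2,3)
proof (induction j rule: dec_induct)
  case (step m)
  have "p m \<le> p (Suc m)" using assms(1) step by (auto simp: simple_integrand_def)
  with step show ?case by auto
qed simp

lemma simple_integrand_nonneg: "simple_integrand n p x \<Longrightarrow> i \<le> n \<Longrightarrow> 0 \<le> p i"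
  using simple_integrand_mono[of n p x 0 i] by (auto simp: simple_integrand_def)

text \<open>The Ito isometry for simple integrands: a product of two different cells contains the Brownian increment of
  the later one, multiplied by quantities known when this increment starts.\<close>

lemma simple_isometry:
  assumes S: "simple_integrand n p x"
  shows "integrable M (simple_total n p x)" "(\<integral>\<omega>. simple_total n p x \<omega> \<partial>M) = 0"
    "integrable M (\<lambda>\<omega>. (simple_total n p x \<omega>)\<^sup>2)" "integrable M (simple_energy n p x)"
    "(\<integral>\<omega>. (simple_total n p x \<omega>)\<^sup>2 \<partial>M) = (\<integral>\<omega>. simple_energy n p x \<omega> \<partial>M)"
proof -
  define D where "D i \<omega> = x i \<omega> * (W (p (Suc i)) \<omega> - W (p i) \<omega>)" for i \<omega>
  have p: "0 \<le> p i" "p i \<le> p (Suc i)" if "i < n" for i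
    using that S simple_integrand_nonneg[OF S, of i] by (auto simp: simple_integrand_def)
  have xm: "x i \<in> borel_measurable (F (p i))" if "i < n" for i
    using that S by (auto simp: simple_integrand_def)
  have xM [measurable]: "x i \<in> borel_measurable M" if "i < n" for i
    by (rule measurable_F_M[OF xm[OF that]])
  have xb: "\<exists>C. \<forall>\<omega>\<in>space M. \<bar>x i \<omega>\<bar> \<le> C" if "i < n" for i
    using that S by (auto simp: simple_integrand_def)
  have xi: "integrable M (x i)" if i: "i < n" for i
  proof -
    obtain C where "\<forall>\<omega>\<in>space M. \<bar>x i \<omega>\<bar> \<le> C" using xb[OF i] by blast
    then show ?thesis using i by (intro integrable_const_bound[of _ C]) auto
  qed
  have x2i: "integrable M (\<lambda>\<omega>. (x i \<omega>)\<^sup>2)" if i: "i < n" for i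
  proof -
    obtain C where C: "\<forall>\<omega>\<in>space M. \<bar>x i \<omega>\<bar> \<le> C" using xb[OF i] by blast
    have "\<forall>\<omega>\<in>space M. norm ((x i \<omega>)\<^sup>2) \<le> C\<^sup>2"
    proof
      fix \<omega> assume "\<omega> \<in> space M"
      then have "\<bar>x i \<omega>\<bar>\<^sup>2 \<le> C\<^sup>2" using C by (intro power_mono) auto
      then show "norm ((x i \<omega>)\<^sup>2) \<le> C\<^sup>2" by simp
    qed
    then show ?thesis using i by (intro integrable_const_bound[of _ "C\<^sup>2"]) auto
  qed
  have Wm: "W u \<in> borel_measurable (F v)" if "0 \<le> u" "u \<le> v" for u v
    by (rule measurable_F_mono[OF W_measurable that(2)]) fact
  have DF: "D i \<in> borel_measurable (F v)" if "i < n" "p (Suc i) \<le> v" for i v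
    unfolding D_def using p[OF that(1)] that
    by (intro borel_measurable_times borel_measurable_diff Wm measurable_F_mono[OF xm]) auto
  have DM: "D i \<in> borel_measurable M" if "i < n" for i
    by (rule measurable_F_M[OF DF[OF that order_refl]])
  have Di: "integrable M (D i)" "(\<integral>\<omega>. D i \<omega> \<partial>M) = 0" if i: "i < n" for i
    using W_increment_moments(1,2)[OF p[OF i] xm[OF i] xi[OF i]] by (simp_all add: D_def[abs_def])
  have x2m: "(\<lambda>\<omega>. (x i \<omega>)\<^sup>2) \<in> borel_measurable (F (p i))" if i: "i < n" for i
    using xm[OF i] by auto
  have D2: "integrable M (\<lambda>\<omega>. (D i \<omega>)\<^sup>2)" "(\<integral>\<omega>. (D i \<omega>)\<^sup>2 \<partial>M) = (\<integral>\<omega>. (x i \<omega>)\<^sup>2 \<partial>M) * (p (Suc i) - p i)"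
    if i: "i < n" for i
    using W_increment_moments(3,4)[OF p[OF i] x2m[OF i] x2i[OF i]] by (simp_all add: D_def power_mult_distrib)
  have orth: "(\<integral>\<omega>. D i \<omega> * D j \<omega> \<partial>M) = 0" if ij: "i < j" "j < n" for i j
  proof -
    obtain C where C: "\<forall>\<omega>\<in>space M. \<bar>x j \<omega>\<bar> \<le> C" using xb[OF ij(2)] by blast
    have pj: "p (Suc i) \<le> p j" using ij by (intro simple_integrand_mono[OF S]) auto
    have m: "(\<lambda>\<omega>. D i \<omega> * x j \<omega>) \<in> borel_measurable (F (p j))"
      using ij pj by (intro borel_measurable_times DF xm) auto
    have "integrable M (\<lambda>\<omega>. D i \<omega> * x j \<omega>)"
    proof (rule Bochner_Integration.integrable_bound)
      show "integrable M (\<lambda>\<omega>. C * D i \<omega>)" using Di(1)[of i] ij by auto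
      show "AE \<omega> in M. norm (D i \<omega> * x j \<omega>) \<le> norm (C * D i \<omega>)"
      proof (rule AE_I2)
        fix \<omega> assume "\<omega> \<in> space M"
        then have "\<bar>x j \<omega>\<bar> \<le> C" using C by blast
        then have "\<bar>x j \<omega>\<bar> * \<bar>D i \<omega>\<bar> \<le> \<bar>C\<bar> * \<bar>D i \<omega>\<bar>" by (intro mult_right_mono) auto
        then show "norm (D i \<omega> * x j \<omega>) \<le> norm (C * D i \<omega>)" by (simp add: abs_mult mult.commute)
      qed
    qed (rule measurable_F_M[OF m])
    from W_increment_moments(2)[OF p[OF ij(2)] m this] show ?thesis by (simp add: D_def mult.assoc)
  qed
  have tot: "simple_total n p x = (\<lambda>\<omega>. \<Sum>i<n. D i \<omega>)" by (auto simp: simple_total_def D_def)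
  show "integrable M (simple_total n p x)" "(\<integral>\<omega>. simple_total n p x \<omega> \<partial>M) = 0"
    unfolding tot using Di by auto
  have orth': "(\<integral>\<omega>. D i \<omega> * D j \<omega> \<partial>M) = 0" if "i < n" "j < n" "i \<noteq> j" for i j
    using orth[of i j] orth[of j i] that by (cases i j rule: linorder_cases) (auto simp: mult.commute)
  have int: "integrable M (\<lambda>\<omega>. D i \<omega> * D j \<omega>)" if "i < n" "j < n" for i j
    using that D2(1) DM by (intro integrable_mult_of_squares) auto
  show "integrable M (\<lambda>\<omega>. (simple_total n p x \<omega>)\<^sup>2)"
    unfolding tot power2_eq_square by (rule integral_orthogonal_sums(1)[OF int orth'])
  show "integrable M (simple_energy n p x)" unfolding simple_energy_def using x2i by auto
  have "(\<integral>\<omega>. (simple_total n p x \<omega>)\<^sup>2 \<partial>M) = (\<Sum>i<n. \<integral>\<omega>. D i \<omega> * D i \<omega> \<partial>M)"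
    unfolding tot power2_eq_square by (rule integral_orthogonal_sums(2)[OF int orth'])
  also have "\<dots> = (\<Sum>i<n. (\<integral>\<omega>. (x i \<omega>)\<^sup>2 * (p (Suc i) - p i) \<partial>M))"
    using D2(2) by (intro sum.cong) (auto simp: power2_eq_square)
  also have "\<dots> = (\<integral>\<omega>. simple_energy n p x \<omega> \<partial>M)"
    unfolding simple_energy_def using x2i by (intro Bochner_Integration.integral_sum[symmetric]) auto
  finally show "(\<integral>\<omega>. (simple_total n p x \<omega>)\<^sup>2 \<partial>M) = (\<integral>\<omega>. simple_energy n p x \<omega> \<partial>M)" .
qed

lemma simple_value_square:
  assumes S: "simple_integrand n p x"
  shows "(simple_value n p x u \<omega>)\<^sup>2 = (\<Sum>i<n. (x i \<omega>)\<^sup>2 * indicator {p i<..p (Suc i)} u)"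
proof -
  have disj: "indicator {p i<..p (Suc i)} u * indicator {p j<..p (Suc j)} u = (0::real)"
    if "i < j" "j < n" for i j
  proof -
    have "p (Suc i) \<le> p j" using that by (intro simple_integrand_mono[OF S]) auto
    then show ?thesis by (auto simp: indicator_def)
  qed
  have disj': "indicator {p i<..p (Suc i)} u * indicator {p j<..p (Suc j)} u = (0::real)"
    if "i \<noteq> j" "i < n" "j < n" for i j
    using that disj[of i j] disj[of j i] by (cases i j rule: linorder_cases) (auto simp: mult.commute)
  have "(simple_value n p x u \<omega>)\<^sup>2
      = (\<Sum>i<n. \<Sum>j<n. (x i \<omega> * indicator {p i<..p (Suc i)} u) * (x j \<omega> * indicator {p j<..p (Suc j)} u))"
    unfolding simple_value_def power2_eq_square by (rule sum_product)
  also have "\<dots> = (\<Sum>i<n. (x i \<omega>)\<^sup>2 * indicator {p i<..p (Suc i)} u)"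
  proof (rule sum.cong[OF refl])
    fix i assume i: "i \<in> {..<n}"
    have "(\<Sum>j<n. (x i \<omega> * indicator {p i<..p (Suc i)} u) * (x j \<omega> * indicator {p j<..p (Suc j)} u))
       = (\<Sum>j\<in>{i}. (x i \<omega> * indicator {p i<..p (Suc i)} u) * (x j \<omega> * indicator {p j<..p (Suc j)} u))"
    proof (rule sum.mono_neutral_right)
      show "\<forall>j\<in>{..<n} - {i}. (x i \<omega> * indicator {p i<..p (Suc i)} u) * (x j \<omega> * indicator {p j<..p (Suc j)} u) = 0"
      proof
        fix j assume "j \<in> {..<n} - {i}"
        then have "indicator {p i<..p (Suc i)} u * indicator {p j<..p (Suc j)} u = (0::real)"
          using disj'[of i j] i by auto
        then have "(x i \<omega> * x j \<omega>) * (indicator {p i<..p (Suc i)} u * indicator {p j<..p (Suc j)} u) = 0" by simp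
        then show "(x i \<omega> * indicator {p i<..p (Suc i)} u) * (x j \<omega> * indicator {p j<..p (Suc j)} u) = 0"
          by (simp only: ac_simps)
      qed
    qed (use i in auto)
    then show "(\<Sum>j<n. (x i \<omega> * indicator {p i<..p (Suc i)} u) * (x j \<omega> * indicator {p j<..p (Suc j)} u))
       = (x i \<omega>)\<^sup>2 * indicator {p i<..p (Suc i)} u"
      by (simp add: power2_eq_square indicator_def)
  qed
  finally show ?thesis .
qed

lemma simple_energy_nonneg: "simple_integrand n p x \<Longrightarrow> 0 \<le> simple_energy n p x \<omega>"
  unfolding simple_energy_def by (intro sum_nonneg mult_nonneg_nonneg) (auto simp: simple_integrand_def)

lemma nn_integral_simple_value_square:
  assumes S: "simple_integrand n p x"
  shows "(\<integral>\<^sup>+u. ennreal ((simple_value n p x u \<omega>)\<^sup>2) \<partial>lborel) = ennreal (simple_energy n p x \<omega>)"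
proof -
  have p: "p i \<le> p (Suc i)" if "i < n" for i using that S by (auto simp: simple_integrand_def)
  have "(\<integral>\<^sup>+u. ennreal ((simple_value n p x u \<omega>)\<^sup>2) \<partial>lborel)
      = (\<integral>\<^sup>+u. (\<Sum>i<n. ennreal ((x i \<omega>)\<^sup>2) * indicator {p i<..p (Suc i)} u) \<partial>lborel)"
    unfolding simple_value_square[OF S]
  proof (rule nn_integral_cong)
    fix u
    have "ennreal (\<Sum>i<n. (x i \<omega>)\<^sup>2 * indicator {p i<..p (Suc i)} u)
        = (\<Sum>i<n. ennreal ((x i \<omega>)\<^sup>2 * indicator {p i<..p (Suc i)} u))"
      by (rule sum_ennreal[symmetric]) simp
    also have "\<dots> = (\<Sum>i<n. ennreal ((x i \<omega>)\<^sup>2) * indicator {p i<..p (Suc i)} u)"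
      by (intro sum.cong) (auto simp: indicator_def)
    finally show "ennreal (\<Sum>i<n. (x i \<omega>)\<^sup>2 * indicator {p i<..p (Suc i)} u)
        = (\<Sum>i<n. ennreal ((x i \<omega>)\<^sup>2) * indicator {p i<..p (Suc i)} u)" .
  qed
  also have "\<dots> = (\<Sum>i<n. ennreal ((x i \<omega>)\<^sup>2) * ennreal (p (Suc i) - p i))"
    using p by (subst nn_integral_sum) (auto intro!: sum.cong simp: nn_integral_cmult_indicator)
  also have "\<dots> = ennreal (simple_energy n p x \<omega>)"
    unfolding simple_energy_def using p
    by (subst sum_ennreal[symmetric]) (auto intro!: sum.cong simp: ennreal_mult simp del: sum_ennreal)
  finally show ?thesis .
qed

text \<open>The integrand is cut off as soon as the energy accumulated up to the end of the current cell exceeds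
  \<open>R\<close>. Since weights and cell lengths are known at the left endpoint, this is an adapted
  operation.\<close>

lemma simple_truncation:
  assumes S: "simple_integrand n p x" and R: "0 \<le> R"
  obtains x' where "simple_integrand n p x'" "\<And>\<omega>. simple_energy n p x' \<omega> \<le> R"
    "\<And>\<omega> i. simple_energy n p x \<omega> \<le> R \<Longrightarrow> i < n \<Longrightarrow> x' i \<omega> = x i \<omega>"
proof -
  define e where "e i \<omega> = (x i \<omega>)\<^sup>2 * (p (Suc i) - p i)" for i \<omega>
  \<comment> \<open>the partial sum includes the cell \<open>i\<close> itself, so that the bound \<open>R\<close> is never exceeded\<close>
  define x' where "x' i \<omega> = (if (\<Sum>j\<le>i. e j \<omega>) \<le> R then x i \<omega> else 0)" for i \<omega>
  have e0: "0 \<le> e i \<omega>" if "i < n" for i \<omega> using that S by (auto simp: e_def simple_integrand_def)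
  have xm: "x j \<in> borel_measurable (F (p i))" if "j \<le> i" "i < n" for i j
    by (rule measurable_F_mono[OF _ simple_integrand_mono[OF S]]) (use S that in \<open>auto simp: simple_integrand_def\<close>)
  have "simple_integrand n p x'" unfolding simple_integrand_def
  proof (intro conjI allI impI)
    fix i assume i: "i < n"
    show "x' i \<in> borel_measurable (F (p i))" unfolding x'_def e_def
      by (intro measurable_If borel_measurable_le borel_measurable_sum borel_measurable_times borel_measurable_power
          borel_measurable_const xm) (use i in auto)
    obtain C where "\<forall>\<omega>\<in>space M. \<bar>x i \<omega>\<bar> \<le> C" using S i by (auto simp: simple_integrand_def)
    then have "\<forall>\<omega>\<in>space M. \<bar>x' i \<omega>\<bar> \<le> \<bar>C\<bar>" by (auto simp: x'_def intro: order_trans)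
    then show "\<exists>C. \<forall>\<omega>\<in>space M. \<bar>x' i \<omega>\<bar> \<le> C" by blast
  qed (use S in \<open>auto simp: simple_integrand_def\<close>)
  moreover have "simple_energy n p x' \<omega> \<le> R" for \<omega>
  proof -
    have "(\<Sum>i<m. (x' i \<omega>)\<^sup>2 * (p (Suc i) - p i)) \<le> (if (\<Sum>j<m. e j \<omega>) \<le> R then (\<Sum>j<m. e j \<omega>) else R)"
      if "m \<le> n" for m using that
    proof (induction m)
      case (Suc m)
      have IH: "(\<Sum>i<m. (x' i \<omega>)\<^sup>2 * (p (Suc i) - p i)) \<le> (if (\<Sum>j<m. e j \<omega>) \<le> R then (\<Sum>j<m. e j \<omega>) else R)"
        using Suc by simp
      have "0 \<le> e m \<omega>" using e0 Suc by simp
      moreover have "(\<Sum>j\<le>m. e j \<omega>) = (\<Sum>j<m. e j \<omega>) + e m \<omega>"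
        using sum.lessThan_Suc[of "\<lambda>j. e j \<omega>" m] by (simp add: lessThan_Suc_atMost)
      ultimately show ?case using IH by (auto simp: x'_def e_def[symmetric] split: if_splits)
    qed (use R in simp)
    from this[of n] show ?thesis by (auto simp: simple_energy_def split: if_splits)
  qed
  moreover have "x' i \<omega> = x i \<omega>" if en: "simple_energy n p x \<omega> \<le> R" and i: "i < n" for \<omega> i
  proof -
    have "(\<Sum>j\<le>i. e j \<omega>) \<le> (\<Sum>j<n. e j \<omega>)" by (rule sum_mono2) (use i e0 in auto)
    then show ?thesis using en by (simp add: x'_def simple_energy_def e_def)
  qed
  ultimately show ?thesis by (rule that)
qed

text \<open>Simple integrands together with their integrals, without an ordered partition. Sums of such pairs are again
  such pairs, whereas simple integrands have to be brought to a common grid first.\<close>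

inductive elementary :: "(real \<Rightarrow> 'a \<Rightarrow> real) \<Rightarrow> ('a \<Rightarrow> real) \<Rightarrow> bool" where
  zero: "elementary (\<lambda>u \<omega>. 0) (\<lambda>\<omega>. 0)"
| add: "elementary y Y \<Longrightarrow> 0 \<le> p \<Longrightarrow> p \<le> q \<Longrightarrow> c \<in> borel_measurable (F p) \<Longrightarrow>
    (\<And>\<omega>. \<omega> \<in> space M \<Longrightarrow> \<bar>c \<omega>\<bar> \<le> C) \<Longrightarrow>
    elementary (\<lambda>u \<omega>. y u \<omega> + c \<omega> * indicator {p<..q} u) (\<lambda>\<omega>. Y \<omega> + c \<omega> * (W q \<omega> - W p \<omega>))"

lemma elementary_single:
  assumes "0 \<le> p" "p \<le> q" "c \<in> borel_measurable (F p)" "\<And>\<omega>. \<omega> \<in> space M \<Longrightarrow> \<bar>c \<omega>\<bar> \<le> C"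
  shows "elementary (\<lambda>u \<omega>. c \<omega> * indicator {p<..q} u) (\<lambda>\<omega>. c \<omega> * (W q \<omega> - W p \<omega>))"
  using elementary.add[OF elementary.zero assms] by simp

lemma elementary_plus:
  assumes "elementary y Y" "elementary z Z"
  shows "elementary (\<lambda>u \<omega>. y u \<omega> + z u \<omega>) (\<lambda>\<omega>. Y \<omega> + Z \<omega>)"
  using assms(2)
proof induction
  case zero
  then show ?case using assms(1) by simp
next
  case (add z Z p q c C)
  from elementary.add[OF add.IH add.hyps(2-4), of C] add.hyps(5)
  show ?case by (simp add: add.assoc)
qed

lemma elementary_sum:
  "(\<And>i. i \<in> I \<Longrightarrow> elementary (y i) (Y i)) \<Longrightarrow> elementary (\<lambda>u \<omega>. \<Sum>i\<in>I. y i u \<omega>) (\<lambda>\<omega>. \<Sum>i\<in>I. Y i \<omega>)"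
proof (induction I rule: infinite_finite_induct)
  case (insert i I)
  then show ?case using elementary_plus[of "y i" "Y i"] by simp
qed (auto intro: elementary.zero)

lemma elementary_uminus:
  assumes "elementary y Y" shows "elementary (\<lambda>u \<omega>. - y u \<omega>) (\<lambda>\<omega>. - Y \<omega>)"
  using assms
proof induction
  case (add y Y p q c C)
  have "elementary (\<lambda>u \<omega>. - c \<omega> * indicator {p<..q} u) (\<lambda>\<omega>. - c \<omega> * (W q \<omega> - W p \<omega>))"
    using add.hyps by (intro elementary_single[of p q "\<lambda>\<omega>. - c \<omega>" C]) auto
  from elementary_plus[OF add.IH this] show ?case by (simp add: algebra_simps)
qed (simp add: elementary.zero)

lemma elementary_diff:
  "elementary y Y \<Longrightarrow> elementary z Z \<Longrightarrow> elementary (\<lambda>u \<omega>. y u \<omega> - z u \<omega>) (\<lambda>\<omega>. Y \<omega> - Z \<omega>)"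
  using elementary_plus[OF _ elementary_uminus, of y Y z Z] by simp

lemma elementary_simple:
  assumes "simple_integrand n p x"
  shows "elementary (simple_value n p x) (simple_total n p x)"
proof -
  have "elementary (\<lambda>u \<omega>. \<Sum>i\<in>{..<n}. x i \<omega> * indicator {p i<..p (Suc i)} u)
      (\<lambda>\<omega>. \<Sum>i\<in>{..<n}. x i \<omega> * (W (p (Suc i)) \<omega> - W (p i) \<omega>))"
  proof (rule elementary_sum)
    fix i assume i: "i \<in> {..<n}"
    then obtain C where "\<forall>\<omega>\<in>space M. \<bar>x i \<omega>\<bar> \<le> C" using assms by (auto simp: simple_integrand_def)
    then show "elementary (\<lambda>u \<omega>. x i \<omega> * indicator {p i<..p (Suc i)} u) (\<lambda>\<omega>. x i \<omega> * (W (p (Suc i)) \<omega> - W (p i) \<omega>))"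
      using i assms simple_integrand_nonneg[OF assms, of i]
      by (intro elementary_single[of _ _ _ C]) (auto simp: simple_integrand_def)
  qed
  then show ?thesis by (simp add: simple_value_def[abs_def] simple_total_def[abs_def])
qed

text \<open>On a grid containing all points where the integrand can change, the weight of a cell is the value of the
  integrand at its right endpoint. This describes the weights without referring to the way in which the
  integrand was built.\<close>

lemma elementary_on_grid:
  assumes "elementary y Y"
  shows "\<exists>P. finite P \<and> P \<subseteq> {0..} \<and> (\<forall>n p. 0 \<le> p 0 \<longrightarrow> (\<forall>i<n. p i \<le> p (Suc i)) \<longrightarrow> P \<subseteq> p ` {..n} \<longrightarrow>
    simple_integrand n p (\<lambda>i. y (p (Suc i))) \<and> y = simple_value n p (\<lambda>i. y (p (Suc i))) \<and>
    Y = simple_total n p (\<lambda>i. y (p (Suc i))))"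
  using assms
proof induction
  case zero
  show ?case by (intro exI[of _ "{}"]) (auto simp: simple_integrand_def simple_value_def simple_total_def fun_eq_iff)
next
  case (add y Y a b c C)
  obtain P where P: "finite P" "P \<subseteq> {0..}" and
    IH: "\<And>n p. 0 \<le> p 0 \<Longrightarrow> (\<forall>i<n. p i \<le> p (Suc i)) \<Longrightarrow> P \<subseteq> p ` {..n} \<Longrightarrow>
    simple_integrand n p (\<lambda>i. y (p (Suc i))) \<and> y = simple_value n p (\<lambda>i. y (p (Suc i))) \<and>
    Y = simple_total n p (\<lambda>i. y (p (Suc i)))"
    using add.IH by auto
  let ?y = "\<lambda>u \<omega>. y u \<omega> + c \<omega> * indicator {a<..b} u"
  let ?Y = "\<lambda>\<omega>. Y \<omega> + c \<omega> * (W b \<omega> - W a \<omega>)"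
  show ?case
  proof (intro exI[of _ "insert a (insert b P)"] conjI allI impI)
    show "finite (insert a (insert b P))" "insert a (insert b P) \<subseteq> {0..}" using P add.hyps by auto
    fix n :: nat and p :: "nat \<Rightarrow> real"
    assume p: "0 \<le> p 0" "\<forall>i<n. p i \<le> p (Suc i)" "insert a (insert b P) \<subseteq> p ` {..n}"
    have S: "simple_integrand n p (\<lambda>i. y (p (Suc i)))"
      and y: "y = simple_value n p (\<lambda>i. y (p (Suc i)))" and Y: "Y = simple_total n p (\<lambda>i. y (p (Suc i)))"
      using IH[OF p(1,2)] p(3) by blast+
    note mono = simple_integrand_mono[OF S]
    obtain i0 j0 where ij: "i0 \<le> n" "a = p i0" "j0 \<le> n" "b = p j0" using p(3) by auto
    obtain i j where ij: "i \<le> j" "j \<le> n" "a = p i" "b = p j"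
    proof (cases "i0 \<le> j0")
      case False
      then have "b \<le> a" using mono[of j0 i0] ij by auto
      then have "a = b" using add.hyps by simp
      then show ?thesis using that[of j0 j0] ij by auto
    qed (use that ij in blast)
    show "simple_integrand n p (\<lambda>i. ?y (p (Suc i)))" unfolding simple_integrand_def
    proof (intro conjI allI impI)
      fix k assume k: "k < n"
      have yk: "y (p (Suc k)) \<in> borel_measurable (F (p k))" using S k by (auto simp: simple_integrand_def)
      show "?y (p (Suc k)) \<in> borel_measurable (F (p k))"
      proof (cases "a < p (Suc k)")
        case True
        have "i \<le> k" proof (rule ccontr)
          assume "\<not> i \<le> k"
          then have "p (Suc k) \<le> p i" using ij by (intro mono) auto
          then show False using True ij by simp
        qed
        then have "a \<le> p k" using ij k by (auto intro!: mono)
        then have "c \<in> borel_measurable (F (p k))" by (rule measurable_F_mono[OF add.hyps(4)])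
        then show ?thesis using yk by auto
      qed (use yk in simp)
      obtain C' where "\<forall>\<omega>\<in>space M. \<bar>y (p (Suc k)) \<omega>\<bar> \<le> C'" using S k by (auto simp: simple_integrand_def)
      then have "\<forall>\<omega>\<in>space M. \<bar>?y (p (Suc k)) \<omega>\<bar> \<le> C' + \<bar>C\<bar>"
        using add.hyps(5) by (fastforce simp: indicator_def intro: order_trans[OF abs_triangle_ineq])
      then show "\<exists>C. \<forall>\<omega>\<in>space M. \<bar>?y (p (Suc k)) \<omega>\<bar> \<le> C" by blast
    qed (use p in auto)
    have tele: "(\<Sum>k<n. indicator {a<..b} (p (Suc k)) * (f (p (Suc k)) - f (p k))) = f b - f a" for f :: "real \<Rightarrow> real"
      unfolding ij(3,4) by (rule sum_cells_telescope[OF mono ij(1,2)])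
    \<comment> \<open>an indicator is an increment of a step function, so the telescoping rule gives the integrand as well\<close>
    have ind: "indicator {v<..w} u = (if u \<le> w then 1 else 0) - (if u \<le> v then 1 else (0::real))" if "v \<le> w" for u v w :: real
      using that by (auto simp: indicator_def)
    show "?y = simple_value n p (\<lambda>i. ?y (p (Suc i)))"
    proof (intro ext)
      fix u \<omega>
      have "simple_value n p (\<lambda>i. ?y (p (Suc i))) u \<omega>
         = simple_value n p (\<lambda>i. y (p (Suc i))) u \<omega>
           + c \<omega> * (\<Sum>k<n. indicator {a<..b} (p (Suc k)) * indicator {p k<..p (Suc k)} u)"
        unfolding simple_value_def sum_distrib_left sum.distrib[symmetric]
        by (intro sum.cong refl) (simp only: distrib_right mult.assoc)
      also have "(\<Sum>k<n. indicator {a<..b} (p (Suc k)) * indicator {p k<..p (Suc k)} u)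
          = (\<Sum>k<n. indicator {a<..b} (p (Suc k)) * ((if u \<le> p (Suc k) then 1 else 0) - (if u \<le> p k then 1 else (0::real))))"
        using p(2) by (intro sum.cong refl) (subst ind, auto)
      also have "\<dots> = indicator {a<..b} u"
        using tele[of "\<lambda>w. if u \<le> w then 1 else 0"] ind[of a b u] add.hyps(3) by simp
      finally show "?y u \<omega> = simple_value n p (\<lambda>i. ?y (p (Suc i))) u \<omega>" using fun_cong[OF fun_cong[OF y]] by metis
    qed
    show "?Y = simple_total n p (\<lambda>i. ?y (p (Suc i)))"
    proof
      fix \<omega>
      have "simple_total n p (\<lambda>i. ?y (p (Suc i))) \<omega> = simple_total n p (\<lambda>i. y (p (Suc i))) \<omega>
           + c \<omega> * (\<Sum>k<n. indicator {a<..b} (p (Suc k)) * (W (p (Suc k)) \<omega> - W (p k) \<omega>))"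
        unfolding simple_total_def sum_distrib_left sum.distrib[symmetric]
        by (intro sum.cong refl) (simp only: distrib_right mult.assoc)
      also have "\<dots> = ?Y \<omega>" using tele[of "\<lambda>u. W u \<omega>"] fun_cong[OF Y, of \<omega>] by simp
      finally show "?Y \<omega> = simple_total n p (\<lambda>i. ?y (p (Suc i))) \<omega>" by simp
    qed
  qed
qed

lemma elementary_imp_simple:
  assumes "elementary y Y"
  obtains n p x where "simple_integrand n p x" "y = simple_value n p x" "Y = simple_total n p x"
proof -
  obtain P where P: "finite P" "P \<subseteq> {0..}" and
    *: "\<And>n p. 0 \<le> p 0 \<Longrightarrow> (\<forall>i<n. p i \<le> p (Suc i)) \<Longrightarrow> P \<subseteq> p ` {..n} \<Longrightarrow>
    simple_integrand n p (\<lambda>i. y (p (Suc i))) \<and> y = simple_value n p (\<lambda>i. y (p (Suc i))) \<and>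
    Y = simple_total n p (\<lambda>i. y (p (Suc i)))"
    using elementary_on_grid[OF assms] by auto
  define l where "l = sorted_list_of_set (insert 0 P)"
  have "finite (insert 0 P)" using P by simp
  from set_sorted_list_of_set[OF this] have l: "set l = insert 0 P" "sorted l" "l \<noteq> []"
    unfolding l_def by (force simp del: sorted_list_of_set_insert_remove)+
  then have len: "length l > 0" by auto
  have "0 \<le> l ! 0" using P l len nth_mem[OF len] by auto
  moreover have "\<forall>i<length l - 1. l ! i \<le> l ! Suc i" using l(2) by (auto simp: sorted_iff_nth_mono)
  moreover have "P \<subseteq> (!) l ` {..length l - 1}"
  proof
    fix z assume "z \<in> P"
    then obtain i where "i < length l" "l ! i = z" using l(1) by (metis in_set_conv_nth insertCI)
    then show "z \<in> (!) l ` {..length l - 1}" by (intro image_eqI[of _ _ i]) auto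
  qed
  ultimately show ?thesis using *[of "(!) l" "length l - 1"] that by blast
qed

lemma elementary_truncation:
  assumes "elementary y Y" "0 \<le> R"
  obtains z Z where "elementary z Z" "\<And>\<omega>. (\<integral>\<^sup>+u. ennreal ((z u \<omega>)\<^sup>2) \<partial>lborel) \<le> ennreal R"
    "\<And>\<omega>. (\<integral>\<^sup>+u. ennreal ((y u \<omega>)\<^sup>2) \<partial>lborel) \<le> ennreal R \<Longrightarrow> (\<forall>u. z u \<omega> = y u \<omega>) \<and> Z \<omega> = Y \<omega>"
proof -
  obtain n p x where S: "simple_integrand n p x" and y: "y = simple_value n p x" "Y = simple_total n p x"
    using elementary_imp_simple[OF assms(1)] .
  obtain x' where S': "simple_integrand n p x'" and en: "\<And>\<omega>. simple_energy n p x' \<omega> \<le> R"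
    and eq: "\<And>\<omega> i. simple_energy n p x \<omega> \<le> R \<Longrightarrow> i < n \<Longrightarrow> x' i \<omega> = x i \<omega>"
    using simple_truncation[OF S assms(2)] by metis
  show ?thesis
  proof (rule that[OF elementary_simple[OF S']])
    show "(\<integral>\<^sup>+u. ennreal ((simple_value n p x' u \<omega>)\<^sup>2) \<partial>lborel) \<le> ennreal R" for \<omega>
      unfolding nn_integral_simple_value_square[OF S'] by (rule ennreal_leI[OF en])
    fix \<omega> assume "(\<integral>\<^sup>+u. ennreal ((y u \<omega>)\<^sup>2) \<partial>lborel) \<le> ennreal R"
    then have "simple_energy n p x \<omega> \<le> R"
      unfolding y nn_integral_simple_value_square[OF S] using assms(2) by simp
    then show "(\<forall>u. simple_value n p x' u \<omega> = y u \<omega>) \<and> simple_total n p x' \<omega> = Y \<omega>"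
      using eq unfolding y simple_value_def simple_total_def by auto
  qed
qed

lemma elementary_measurable:
  assumes "elementary y Y"
  shows "(\<lambda>(\<omega>, u). y u \<omega>) \<in> borel_measurable (M \<Otimes>\<^sub>M lborel)"
  using assms
proof induction
  case (add y Y p q c C)
  note [measurable] = add.IH measurable_F_M[OF add.hyps(4)]
  show ?case by measurable
qed simp

lemma elementary_isometry:
  assumes "elementary y Y"
  shows "integrable M Y" "(\<integral>\<omega>. Y \<omega> \<partial>M) = 0" "integrable M (\<lambda>\<omega>. (Y \<omega>)\<^sup>2)"
    "(\<integral>\<^sup>+\<omega>. ennreal ((Y \<omega>)\<^sup>2) \<partial>M) = (\<integral>\<^sup>+\<omega>. \<integral>\<^sup>+u. ennreal ((y u \<omega>)\<^sup>2) \<partial>lborel \<partial>M)"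
proof -
  obtain n p x where S: "simple_integrand n p x" and y: "y = simple_value n p x" "Y = simple_total n p x"
    using elementary_imp_simple[OF assms(1)] .
  note iso = simple_isometry[OF S]
  show "integrable M Y" "(\<integral>\<omega>. Y \<omega> \<partial>M) = 0" "integrable M (\<lambda>\<omega>. (Y \<omega>)\<^sup>2)"
    using iso by (auto simp: y)
  show "(\<integral>\<^sup>+\<omega>. ennreal ((Y \<omega>)\<^sup>2) \<partial>M) = (\<integral>\<^sup>+\<omega>. \<integral>\<^sup>+u. ennreal ((y u \<omega>)\<^sup>2) \<partial>lborel \<partial>M)"
    unfolding y nn_integral_simple_value_square[OF S]
    by (subst (1 2) nn_integral_eq_integral) (use iso simple_energy_nonneg[OF S] in auto)
qed

text \<open>The Ito isometry for a limit \<open>J\<close> of integrals of elementary integrands, assuming only almost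
  sure convergence of the integrals and of the integrands in mean square over time. If the energy of the
  limit is at most \<open>R\<close>, then eventually that of the approximation is at most
  \<open>2 * R + 2\<close>, so truncation at this level changes none of the limits. The truncated integrals
  have bounded energy, converge in mean square by dominated convergence and by the isometry applied to
  differences, and carry the isometry to the limit.\<close>

lemma ito_isometry_limit:
  fixes y :: "nat \<Rightarrow> real \<Rightarrow> 'a \<Rightarrow> real" and h :: "real \<Rightarrow> 'a \<Rightarrow> real"
  assumes el: "\<And>k. elementary (y k) (Y k)"
    and hm [measurable]: "(\<lambda>(\<omega>, u). h u \<omega>) \<in> borel_measurable (M \<Otimes>\<^sub>M lborel)"
    and hR: "AE \<omega> in M. (\<integral>\<^sup>+u. ennreal ((h u \<omega>)\<^sup>2) \<partial>lborel) \<le> ennreal R" and R: "0 \<le> R"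
    and yh: "AE \<omega> in M. (\<lambda>k. \<integral>\<^sup>+u. ennreal ((y k u \<omega> - h u \<omega>)\<^sup>2) \<partial>lborel) \<longlonglongrightarrow> 0"
    and J [measurable]: "J \<in> borel_measurable M" and lim: "AE \<omega> in M. (\<lambda>k. Y k \<omega>) \<longlonglongrightarrow> J \<omega>"
  shows "integrable M (\<lambda>\<omega>. (J \<omega>)\<^sup>2)" "(\<integral>\<omega>. J \<omega> \<partial>M) = 0"
    "(\<integral>\<^sup>+\<omega>. ennreal ((J \<omega>)\<^sup>2) \<partial>M) = (\<integral>\<^sup>+\<omega>. \<integral>\<^sup>+u. ennreal ((h u \<omega>)\<^sup>2) \<partial>lborel \<partial>M)"
proof -
  let ?K = "2 * R + 2"
  have "\<exists>z Z. elementary z Z \<and> (\<forall>\<omega>. (\<integral>\<^sup>+u. ennreal ((z u \<omega>)\<^sup>2) \<partial>lborel) \<le> ennreal ?K) \<and>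
    (\<forall>\<omega>. (\<integral>\<^sup>+u. ennreal ((y k u \<omega>)\<^sup>2) \<partial>lborel) \<le> ennreal ?K \<longrightarrow> (\<forall>u. z u \<omega> = y k u \<omega>) \<and> Z \<omega> = Y k \<omega>)" for k
  proof -
    have "0 \<le> ?K" using R by simp
    from elementary_truncation[OF el[of k] this] show ?thesis by metis
  qed
  then obtain z Z where z: "\<And>k. elementary (z k) (Z k)"
    and zK: "\<And>k \<omega>. (\<integral>\<^sup>+u. ennreal ((z k u \<omega>)\<^sup>2) \<partial>lborel) \<le> ennreal ?K"
    and zy: "\<And>k \<omega>. (\<integral>\<^sup>+u. ennreal ((y k u \<omega>)\<^sup>2) \<partial>lborel) \<le> ennreal ?K \<Longrightarrow> (\<forall>u. z k u \<omega> = y k u \<omega>) \<and> Z k \<omega> = Y k \<omega>"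
    by metis
  note [measurable] = elementary_measurable[OF z] elementary_measurable[OF el]
  note [measurable] = borel_measurable_integrable[OF elementary_isometry(1)[OF z]]
  have hs [measurable]: "(\<lambda>u. h u \<omega>) \<in> borel_measurable lborel" if "\<omega> \<in> space M" for \<omega>
    using measurable_compose[OF measurable_Pair1'[OF that] hm] by simp
  have zs [measurable]: "(\<lambda>u. z k u \<omega>) \<in> borel_measurable lborel" if "\<omega> \<in> space M" for \<omega> k
    using measurable_compose[OF measurable_Pair1'[OF that] elementary_measurable[OF z]] by simp
  have ys [measurable]: "(\<lambda>u. y k u \<omega>) \<in> borel_measurable lborel" if "\<omega> \<in> space M" for \<omega> k
    using measurable_compose[OF measurable_Pair1'[OF that] elementary_measurable[OF el]] by simp
  define q where "q k \<omega> = (\<integral>\<^sup>+u. ennreal ((z k u \<omega> - h u \<omega>)\<^sup>2) \<partial>lborel)" for k \<omega>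
  have qm [measurable]: "q k \<in> borel_measurable M" for k unfolding q_def by measurable
  have ev: "AE \<omega> in M. \<forall>\<^sub>F k in sequentially. (\<forall>u. z k u \<omega> = y k u \<omega>) \<and> Z k \<omega> = Y k \<omega>"
    using hR yh AE_space
  proof eventually_elim
    case (elim \<omega>)
    have "\<forall>\<^sub>F k in sequentially. (\<integral>\<^sup>+u. ennreal ((y k u \<omega> - h u \<omega>)\<^sup>2) \<partial>lborel) < 1"
      using elim(2) by (rule order_tendstoD) simp
    then show ?case
    proof eventually_elim
      case (elim k)
      note w = \<open>\<omega> \<in> space M\<close>
      have "(\<integral>\<^sup>+u. ennreal ((y k u \<omega> - 0)\<^sup>2) \<partial>lborel)
        \<le> 2 * (\<integral>\<^sup>+u. ennreal ((y k u \<omega> - h u \<omega>)\<^sup>2) \<partial>lborel) + 2 * (\<integral>\<^sup>+u. ennreal ((0 - h u \<omega>)\<^sup>2) \<partial>lborel)"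
        using w by (intro nn_integral_square_diff_le) auto
      also have "\<dots> \<le> 2 * 1 + 2 * ennreal R"
        using elim \<open>(\<integral>\<^sup>+u. ennreal ((h u \<omega>)\<^sup>2) \<partial>lborel) \<le> ennreal R\<close>
        by (intro add_mono mult_left_mono) auto
      also have "\<dots> = ennreal ?K" using R
        by (simp add: ennreal_mult mult.commute[of R] flip: ennreal_numeral)
      finally show ?case by (intro zy) simp
    qed
  qed
  have limZ: "AE \<omega> in M. (\<lambda>k. Z k \<omega>) \<longlonglongrightarrow> J \<omega>"
    using ev lim
  proof eventually_elim
    case (elim \<omega>)
    have "\<forall>\<^sub>F k in sequentially. Y k \<omega> = Z k \<omega>" using elim(1) by eventually_elim simp
    with elim(2) show ?case by (rule Lim_transform_eventually)
  qed
  have limq: "AE \<omega> in M. (\<lambda>k. q k \<omega>) \<longlonglongrightarrow> 0"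
    using ev yh
  proof eventually_elim
    case (elim \<omega>)
    have "\<forall>\<^sub>F k in sequentially. (\<integral>\<^sup>+u. ennreal ((y k u \<omega> - h u \<omega>)\<^sup>2) \<partial>lborel) = q k \<omega>"
      using elim(1) by eventually_elim (simp add: q_def)
    with elim(2) show ?case by (rule Lim_transform_eventually)
  qed
  have qB: "AE \<omega> in M. q k \<omega> \<le> 2 * ennreal ?K + 2 * ennreal R" for k
    using hR AE_space
  proof eventually_elim
    case (elim \<omega>)
    have "q k \<omega> \<le> 2 * (\<integral>\<^sup>+u. ennreal ((z k u \<omega> - 0)\<^sup>2) \<partial>lborel) + 2 * (\<integral>\<^sup>+u. ennreal ((h u \<omega> - 0)\<^sup>2) \<partial>lborel)"
      unfolding q_def using elim by (intro nn_integral_square_diff_le) auto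
    also have "\<dots> \<le> 2 * ennreal ?K + 2 * ennreal R"
      using elim zK by (intro add_mono mult_left_mono) auto
    finally show ?case .
  qed
  have Eq: "(\<lambda>k. \<integral>\<^sup>+\<omega>. q k \<omega> \<partial>M) \<longlonglongrightarrow> 0"
  proof -
    have "(\<lambda>k. \<integral>\<^sup>+\<omega>. q k \<omega> \<partial>M) \<longlonglongrightarrow> (\<integral>\<^sup>+\<omega>. 0 \<partial>M)"
      by (rule nn_integral_dominated_convergence[where w="\<lambda>_. 2 * ennreal ?K + 2 * ennreal R"])
        (use qB limq in \<open>auto simp: emeasure_space_1 ennreal_mult_less_top\<close>)
    then show ?thesis by simp
  qed
  have ZZ: "(\<integral>\<^sup>+\<omega>. ennreal ((Z k \<omega> - Z l \<omega>)\<^sup>2) \<partial>M) \<le> 2 * (\<integral>\<^sup>+\<omega>. q k \<omega> \<partial>M) + 2 * (\<integral>\<^sup>+\<omega>. q l \<omega> \<partial>M)" for k l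
  proof -
    have "(\<integral>\<^sup>+\<omega>. ennreal ((Z k \<omega> - Z l \<omega>)\<^sup>2) \<partial>M) = (\<integral>\<^sup>+\<omega>. \<integral>\<^sup>+u. ennreal ((z k u \<omega> - z l u \<omega>)\<^sup>2) \<partial>lborel \<partial>M)"
      by (rule elementary_isometry(4)[OF elementary_diff[OF z z]])
    also have "\<dots> \<le> (\<integral>\<^sup>+\<omega>. 2 * q k \<omega> + 2 * q l \<omega> \<partial>M)"
      unfolding q_def by (intro nn_integral_mono nn_integral_square_diff_le) auto
    finally show ?thesis by (simp add: nn_integral_add nn_integral_cmult)
  qed
  \<comment> \<open>Fatou's lemma identifies the limit of the Cauchy sequence \<open>Z\<close> with \<open>J\<close>\<close>
  have ZJ: "(\<integral>\<^sup>+\<omega>. ennreal ((Z k \<omega> - J \<omega>)\<^sup>2) \<partial>M) \<le> 2 * (\<integral>\<^sup>+\<omega>. q k \<omega> \<partial>M)" for k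
  proof -
    have "(\<integral>\<^sup>+\<omega>. ennreal ((Z k \<omega> - J \<omega>)\<^sup>2) \<partial>M) = (\<integral>\<^sup>+\<omega>. liminf (\<lambda>l. ennreal ((Z k \<omega> - Z l \<omega>)\<^sup>2)) \<partial>M)"
    proof (rule nn_integral_cong_AE, use limZ in eventually_elim)
      case (elim \<omega>)
      then have "(\<lambda>l. ennreal ((Z k \<omega> - Z l \<omega>)\<^sup>2)) \<longlonglongrightarrow> ennreal ((Z k \<omega> - J \<omega>)\<^sup>2)"
        by (intro tendsto_ennrealI tendsto_power tendsto_diff tendsto_const)
      then show ?case by (rule lim_imp_Liminf[OF trivial_limit_sequentially, symmetric])
    qed
    also have "\<dots> \<le> liminf (\<lambda>l. \<integral>\<^sup>+\<omega>. ennreal ((Z k \<omega> - Z l \<omega>)\<^sup>2) \<partial>M)"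
      by (rule nn_integral_liminf) auto
    also have "\<dots> \<le> liminf (\<lambda>l. 2 * (\<integral>\<^sup>+\<omega>. q k \<omega> \<partial>M) + 2 * (\<integral>\<^sup>+\<omega>. q l \<omega> \<partial>M))"
      by (intro Liminf_mono always_eventually allI ZZ)
    also have "\<dots> = 2 * (\<integral>\<^sup>+\<omega>. q k \<omega> \<partial>M) + 2 * 0"
      by (intro lim_imp_Liminf tendsto_add tendsto_const ennreal_tendsto_cmult Eq) auto
    finally show ?thesis by simp
  qed
  have Zsq: "(\<integral>\<^sup>+\<omega>. ennreal ((Z k \<omega>)\<^sup>2) \<partial>M) \<le> ennreal ?K" for k
  proof -
    have "(\<integral>\<^sup>+\<omega>. ennreal ((Z k \<omega>)\<^sup>2) \<partial>M) \<le> (\<integral>\<^sup>+\<omega>. ennreal ?K \<partial>M)"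
      unfolding elementary_isometry(4)[OF z] by (intro nn_integral_mono zK)
    then show ?thesis by (simp add: emeasure_space_1)
  qed
  have Zsq': "(\<integral>\<omega>. (Z k \<omega>)\<^sup>2 \<partial>M) \<le> ?K" for k
  proof -
    have "ennreal (\<integral>\<omega>. (Z k \<omega>)\<^sup>2 \<partial>M) \<le> ennreal ?K"
      using Zsq[of k] nn_integral_eq_integral[OF elementary_isometry(3)[OF z, of k]] by fastforce
    moreover have "0 \<le> ?K" using R by simp
    ultimately show ?thesis using ennreal_le_iff by blast
  qed
  note Fs = Fatou_square[OF _ J elementary_isometry(3)[OF z] Zsq' limZ]
  show J2: "integrable M (\<lambda>\<omega>. (J \<omega>)\<^sup>2)" by (rule Fs) simp
  have "(\<lambda>k. \<integral>\<omega>. Z k \<omega> \<partial>M) \<longlonglongrightarrow> (\<integral>\<omega>. J \<omega> \<partial>M)"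
    by (rule Vitali_square(2)[OF _ J elementary_isometry(3)[OF z] Zsq' limZ]) simp
  then show "(\<integral>\<omega>. J \<omega> \<partial>M) = 0"
    using elementary_isometry(2)[OF z] by (simp add: LIMSEQ_const_iff)
  have L1: "(\<lambda>k. \<integral>\<^sup>+\<omega>. ennreal ((Z k \<omega>)\<^sup>2) \<partial>M) \<longlonglongrightarrow> (\<integral>\<^sup>+\<omega>. ennreal ((J \<omega>)\<^sup>2) \<partial>M)"
  proof (rule nn_integral_square_tendsto)
    show "(\<integral>\<^sup>+\<omega>. ennreal ((J \<omega>)\<^sup>2) \<partial>M) < \<infinity>"
      using J2 by (subst nn_integral_eq_integral) auto
    have "(\<lambda>k. 2 * (\<integral>\<^sup>+\<omega>. q k \<omega> \<partial>M)) \<longlonglongrightarrow> 2 * 0" by (intro ennreal_tendsto_cmult Eq) auto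
    then have "(\<lambda>k. 2 * (\<integral>\<^sup>+\<omega>. q k \<omega> \<partial>M)) \<longlonglongrightarrow> 0" by simp
    from tendsto_sandwich[OF _ _ tendsto_const this] ZJ
    show "(\<lambda>k. \<integral>\<^sup>+\<omega>. ennreal ((Z k \<omega> - J \<omega>)\<^sup>2) \<partial>M) \<longlonglongrightarrow> 0"
      by simp
  qed auto
  let ?P = "M \<Otimes>\<^sub>M lborel :: ('a \<times> real) measure"
  have fst: "(\<integral>\<^sup>+\<omega>. \<integral>\<^sup>+u. ennreal ((f u \<omega>)\<^sup>2) \<partial>lborel \<partial>M) = (\<integral>\<^sup>+x. ennreal ((case x of (\<omega>, u) \<Rightarrow> f u \<omega>)\<^sup>2) \<partial>?P)"
    if [measurable]: "(\<lambda>(\<omega>, u). f u \<omega>) \<in> borel_measurable ?P" for f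
    using lborel.nn_integral_fst[of "\<lambda>x. ennreal ((case x of (\<omega>, u) \<Rightarrow> f u \<omega>)\<^sup>2)" M] by simp
  have L2: "(\<lambda>k. \<integral>\<^sup>+x. ennreal ((case x of (\<omega>, u) \<Rightarrow> z k u \<omega>)\<^sup>2) \<partial>?P)
      \<longlonglongrightarrow> (\<integral>\<^sup>+x. ennreal ((case x of (\<omega>, u) \<Rightarrow> h u \<omega>)\<^sup>2) \<partial>?P)"
  proof (rule nn_integral_square_tendsto)
    have "(\<integral>\<^sup>+\<omega>. \<integral>\<^sup>+u. ennreal ((h u \<omega>)\<^sup>2) \<partial>lborel \<partial>M) \<le> (\<integral>\<^sup>+\<omega>. ennreal R \<partial>M)"
      by (rule nn_integral_mono_AE[OF hR])
    also have "\<dots> < \<infinity>" by (simp add: emeasure_space_1)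
    finally show "(\<integral>\<^sup>+x. ennreal ((case x of (\<omega>, u) \<Rightarrow> h u \<omega>)\<^sup>2) \<partial>?P) < \<infinity>"
      unfolding fst[OF hm, symmetric] .
    have "(\<integral>\<^sup>+x. ennreal (((case x of (\<omega>, u) \<Rightarrow> z k u \<omega>) - (case x of (\<omega>, u) \<Rightarrow> h u \<omega>))\<^sup>2) \<partial>?P)
        = (\<integral>\<^sup>+\<omega>. q k \<omega> \<partial>M)" for k
    proof -
      have "(\<lambda>(\<omega>, u). z k u \<omega> - h u \<omega>) \<in> borel_measurable ?P" by measurable
      from fst[OF this] show ?thesis unfolding q_def by (simp only: split_beta')
    qed
    then show "(\<lambda>k. \<integral>\<^sup>+x. ennreal (((case x of (\<omega>, u) \<Rightarrow> z k u \<omega>) - (case x of (\<omega>, u) \<Rightarrow> h u \<omega>))\<^sup>2) \<partial>?P) \<longlonglongrightarrow> 0"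
      using Eq by (simp only:)
  qed (simp_all add: hm elementary_measurable[OF z])
  have "(\<lambda>k. \<integral>\<^sup>+\<omega>. ennreal ((Z k \<omega>)\<^sup>2) \<partial>M) \<longlonglongrightarrow> (\<integral>\<^sup>+\<omega>. \<integral>\<^sup>+u. ennreal ((h u \<omega>)\<^sup>2) \<partial>lborel \<partial>M)"
    using L2 unfolding elementary_isometry(4)[OF z] fst[OF elementary_measurable[OF z]] fst[OF hm] .
  from LIMSEQ_unique[OF L1 this]
  show "(\<integral>\<^sup>+\<omega>. ennreal ((J \<omega>)\<^sup>2) \<partial>M) = (\<integral>\<^sup>+\<omega>. \<integral>\<^sup>+u. ennreal ((h u \<omega>)\<^sup>2) \<partial>lborel \<partial>M)" .
qed

end

section \<open>The stopped Ito integral\<close>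

context brownian_space
begin

text \<open>Summing this over the cells of a grid, with the indicator of \<open>u < T\<close> as the weight, makes
  simple integrals stopped on the grid elementary. Each cell of the integrand is cut to
  \<open>[u, v]\<close> separately.\<close>

lemma elementary_simple_between:
  assumes S: "simple_integrand n p x" and uv: "0 \<le> u" "u \<le> v"
    and c: "c \<in> borel_measurable (F u)" "\<And>\<omega>. \<omega> \<in> space M \<Longrightarrow> \<bar>c \<omega>\<bar> \<le> 1"
  shows "elementary (\<lambda>w \<omega>. c \<omega> * (simple_value n p x w \<omega> * indicator {u<..v} w))
    (\<lambda>\<omega>. c \<omega> * (simple_integral W n p x v \<omega> - simple_integral W n p x u \<omega>))"
proof -
  let ?D = "\<lambda>j \<omega>. W (min v (p (Suc j))) \<omega> - W (min v (p j)) \<omega> - (W (min u (p (Suc j))) \<omega> - W (min u (p j)) \<omega>)"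
  have "elementary (\<lambda>w \<omega>. \<Sum>j<n. c \<omega> * x j \<omega> * (indicator {p j<..p (Suc j)} w * indicator {u<..v} w))
    (\<lambda>\<omega>. \<Sum>j<n. c \<omega> * x j \<omega> * ?D j \<omega>)"
  proof (rule elementary_sum)
    fix j assume "j \<in> {..<n}"
    then have j: "j < n" by simp
    have p: "0 \<le> p j" "p j \<le> p (Suc j)" using simple_integrand_nonneg[OF S, of j] S j
      by (auto simp: simple_integrand_def)
    show "elementary (\<lambda>w \<omega>. c \<omega> * x j \<omega> * (indicator {p j<..p (Suc j)} w * indicator {u<..v} w))
      (\<lambda>\<omega>. c \<omega> * x j \<omega> * ?D j \<omega>)"
    proof (cases "max u (p j) \<le> min v (p (Suc j))")
      case True
      obtain C where C: "\<forall>\<omega>\<in>space M. \<bar>x j \<omega>\<bar> \<le> C" using S j by (auto simp: simple_integrand_def)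
      have xm: "x j \<in> borel_measurable (F (p j))" using S j by (auto simp: simple_integrand_def)
      have "elementary (\<lambda>w \<omega>. (c \<omega> * x j \<omega>) * indicator {max u (p j)<..min v (p (Suc j))} w)
         (\<lambda>\<omega>. (c \<omega> * x j \<omega>) * (W (min v (p (Suc j))) \<omega> - W (max u (p j)) \<omega>))"
      proof (rule elementary_single[OF _ True])
        show "0 \<le> max u (p j)" using p by simp
        show "(\<lambda>\<omega>. c \<omega> * x j \<omega>) \<in> borel_measurable (F (max u (p j)))"
          by (intro borel_measurable_times measurable_F_mono[OF c(1)] measurable_F_mono[OF xm]) auto
        show "\<bar>c \<omega> * x j \<omega>\<bar> \<le> 1 * C" if "\<omega> \<in> space M" for \<omega>
          unfolding abs_mult using that c(2) C by (intro mult_mono) auto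
      qed
      moreover have "indicator {max u (p j)<..min v (p (Suc j))} w
          = indicator {p j<..p (Suc j)} w * (indicator {u<..v} w :: real)" for w
        by (auto simp: indicator_def)
      moreover have "W (min v (p (Suc j))) \<omega> - W (max u (p j)) \<omega> = ?D j \<omega>" for \<omega>
        using True p uv by (cases "u \<le> p j") (auto simp: min_def max_def)
      ultimately show ?thesis by simp
    next
      case False
      then have D: "?D j \<omega> = 0" for \<omega>
        using p uv by (auto simp: min_def max_def split: if_splits)
      have "indicator {p j<..p (Suc j)} w * (indicator {u<..v} w :: real) = 0" for w
        using False p uv by (auto simp: indicator_def)
      then show ?thesis using elementary.zero by (simp only: D mult_zero_right)
    qed
  qed
  moreover have "(\<Sum>j<n. c \<omega> * x j \<omega> * (indicator {p j<..p (Suc j)} w * indicator {u<..v} w))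
      = c \<omega> * (simple_value n p x w \<omega> * indicator {u<..v} w)" for w \<omega>
    unfolding simple_value_def sum_distrib_left sum_distrib_right
    by (intro sum.cong refl) (simp only: ac_simps)
  moreover have "(\<Sum>j<n. c \<omega> * x j \<omega> * ?D j \<omega>)
      = c \<omega> * (simple_integral W n p x v \<omega> - simple_integral W n p x u \<omega>)" for \<omega>
    unfolding simple_integral_def sum_subtractf[symmetric] sum_distrib_left
    by (intro sum.cong refl) (simp add: algebra_simps)
  ultimately show ?thesis by simp
qed


text \<open>The Ito isometry on a random interval, for a stopping time \<open>T\<close> such that the energy up to
  \<open>T\<close> is bounded on \<open>A\<close>. The Ito integral is a limit in probability at
  deterministic times only, so \<open>T\<close> is rounded up to a grid; the choice of the approximation
  depends on the grid in such a way that it is good at all grid points at once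
  (\<open>prob_gt_fast_subsequence\<close>). Rounding may exceed the energy bound, but the energy in the
  overshoot tends to zero, and \<open>ito_isometry_limit\<close> only asks for a bound on the limit.\<close>

lemma stopped_ito_integral:
  assumes ito: "ito_integral W H I" and T: "stopping_time F T" and ts: "0 \<le> t" "t \<le> s"
    and Tb: "\<And>\<omega>. \<omega> \<in> space M \<Longrightarrow> t \<le> T \<omega>" "\<And>\<omega>. \<omega> \<in> space M \<Longrightarrow> T \<omega> \<le> s"
    and A: "A \<in> sets (F t)"
    and R: "0 \<le> R" "AE \<omega> in M. \<omega> \<in> A \<longrightarrow> (\<integral>\<^sup>+u. ennreal (indicator {t<..T \<omega>} u * (H u \<omega>)\<^sup>2) \<partial>lborel) \<le> ennreal R"
    and J: "J \<in> borel_measurable M" "AE \<omega> in M. J \<omega> = indicator A \<omega> * (I (T \<omega>) \<omega> - I t \<omega>)"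
  shows "integrable M (\<lambda>\<omega>. (J \<omega>)\<^sup>2)" "(\<integral>\<omega>. J \<omega> \<partial>M) = 0"
    "(\<integral>\<^sup>+\<omega>. ennreal ((J \<omega>)\<^sup>2) \<partial>M)
      = (\<integral>\<^sup>+\<omega>. (\<integral>\<^sup>+u. ennreal (indicator A \<omega> * (indicator {t<..T \<omega>} u * (H u \<omega>)\<^sup>2)) \<partial>lborel) \<partial>M)"
proof -
  have s0: "0 \<le> s" using ts by simp
  have prog: "progressively_measurable H" and Im [measurable]: "\<And>u. 0 \<le> u \<Longrightarrow> I u \<in> borel_measurable M"
    and Ic: "AE \<omega> in M. continuous_on {0..} (\<lambda>u. I u \<omega>)"
    using ito by (auto simp: ito_integral_def)
  obtain n p x where S: "\<And>k. simple_integrand (n k) (p k) (x k)"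
    and Hlim: "tendsto_0_in_prob (\<lambda>k \<omega>.
           \<integral>\<^sup>+u\<in>{0..s}. ennreal ((simple_value (n k) (p k) (x k) u \<omega> - H u \<omega>)\<^sup>2) \<partial>lborel)"
    and Ilim: "\<And>u. 0 \<le> u \<Longrightarrow> tendsto_0_in_prob (\<lambda>k \<omega>. ennreal \<bar>simple_integral W (n k) (p k) (x k) u \<omega> - I u \<omega>\<bar>)"
    using ito s0 unfolding ito_integral_def by blast
  define X where "X k = simple_value (n k) (p k) (x k)" for k
  define SI where "SI k = simple_integral W (n k) (p k) (x k)" for k
  define g where "g m = unif_grid t s (Suc m)" for m
  have g: "t \<le> g m i" "g m i \<le> s" if "i \<le> Suc m" for m i
    using unif_grid_bounds[OF ts(2) that] by (auto simp: g_def)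
  have gmono: "g m i \<le> g m (Suc i)" for m i unfolding g_def by (rule unif_grid_mono[OF ts(2)]) simp
  \<comment> \<open>clamping time makes the integrand jointly measurable and does not matter on \<open>[0, s]\<close>\<close>
  define H' where "H' u \<omega> = H (max 0 (min s u)) \<omega>" for u \<omega>
  have H'm: "(\<lambda>(\<omega>, u). H' u \<omega>) \<in> borel_measurable (F s \<Otimes>\<^sub>M borel)"
    unfolding H'_def by (rule progressive_clamped_measurable[OF prog s0])
  have "(\<lambda>x. x) \<in> measurable (M \<Otimes>\<^sub>M lborel) (F s \<Otimes>\<^sub>M (borel :: real measure))"
  proof (rule measurable_pair)
    show "fst \<circ> (\<lambda>x. x) \<in> measurable (M \<Otimes>\<^sub>M lborel) (F s)"
      using measurable_compose[OF measurable_fst measurable_F_M[OF measurable_ident]]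
      by (simp add: comp_def id_def)
    show "snd \<circ> (\<lambda>x. x) \<in> measurable (M \<Otimes>\<^sub>M lborel) (borel :: real measure)"
      by (simp add: comp_def)
  qed
  from measurable_compose[OF this H'm] have H'M [measurable]: "(\<lambda>(\<omega>, u). H' u \<omega>) \<in> borel_measurable (M \<Otimes>\<^sub>M lborel)"
    by simp
  have Xel: "elementary (X k) (simple_total (n k) (p k) (x k))" for k
    unfolding X_def by (rule elementary_simple[OF S])
  note XM [measurable] = elementary_measurable[OF Xel]
  have HH': "H u \<omega> = H' u \<omega>" if "u \<in> {0..s}" for u \<omega> using that by (simp add: H'_def)
  define E where "E k \<omega> = (\<integral>\<^sup>+u. ennreal ((X k u \<omega> - H' u \<omega>)\<^sup>2) * indicator {0..s} u \<partial>lborel)" for k \<omega>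
  have E_eq: "(\<integral>\<^sup>+u\<in>{0..s}. ennreal ((simple_value (n k) (p k) (x k) u \<omega> - H u \<omega>)\<^sup>2) \<partial>lborel) = E k \<omega>" for k \<omega>
    unfolding E_def X_def by (intro nn_integral_cong) (auto simp: HH' indicator_def)
  have Em [measurable]: "E k \<in> borel_measurable M" for k unfolding E_def by measurable
  have Elim: "(\<lambda>k. prob {\<omega> \<in> space M. E k \<omega> > ennreal \<epsilon>}) \<longlonglongrightarrow> 0" if "\<epsilon> > 0" for \<epsilon>
    using Hlim that by (simp add: tendsto_0_in_prob_def E_eq)
  have Wm [measurable]: "W u \<in> borel_measurable M" if "0 \<le> u" for u
    by (rule measurable_F_M[OF W_measurable[OF that]])
  have SIm [measurable]: "SI k u \<in> borel_measurable M" if "0 \<le> u" for k u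
  proof -
    have "x k i \<in> borel_measurable M" if "i < n k" for i
      using S[of k] that by (auto simp: simple_integrand_def intro: measurable_F_M)
    moreover have "0 \<le> p k i" if "i \<le> n k" for i using simple_integrand_nonneg[OF S that] .
    ultimately show ?thesis unfolding SI_def simple_integral_def[abs_def] using that
      by (intro borel_measurable_sum borel_measurable_times borel_measurable_diff Wm) auto
  qed
  \<comment> \<open>index 0 is the error of the integrand, index \<open>j + 1\<close> that of the integral at the grid point \<open>j\<close>\<close>
  define G where "G m i k \<omega> = (if i = 0 then E k \<omega> else ennreal \<bar>SI k (max 0 (g m (i - 1))) \<omega> - I (max 0 (g m (i - 1))) \<omega>\<bar>)"
    for m i k \<omega>
  have Gm: "G m i k \<in> borel_measurable M" for m i k unfolding G_def by (cases "i = 0") auto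
  have Glim: "(\<lambda>k. prob {\<omega> \<in> space M. G m i k \<omega> > ennreal \<epsilon>}) \<longlonglongrightarrow> 0" if e: "\<epsilon> > 0" for m i \<epsilon>
  proof (cases "i = 0")
    case True
    then show ?thesis using Elim[OF e] by (simp add: G_def)
  next
    case False
    then show ?thesis using Ilim[of "max 0 (g m (i - 1))"] e
      by (simp add: G_def SI_def tendsto_0_in_prob_def)
  qed
  obtain \<kappa> where \<kappa>: "AE \<omega> in M. \<forall>\<^sub>F m in sequentially. \<forall>i<Suc (Suc (Suc m)). G m i (\<kappa> m) \<omega> \<le> ennreal ((1/2)^m)"
    using prob_gt_fast_subsequence[where G=G and N="\<lambda>m. Suc (Suc m)", OF Gm Glim] .
  have \<kappa>E: "AE \<omega> in M. \<forall>\<^sub>F m in sequentially. E (\<kappa> m) \<omega> \<le> ennreal ((1/2)^m)"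
    using \<kappa>
  proof eventually_elim
    case (elim \<omega>)
    then show ?case by eventually_elim (auto simp: G_def dest: spec[of _ 0])
  qed
  have \<kappa>I: "AE \<omega> in M. \<forall>\<^sub>F m in sequentially. \<forall>j\<le>Suc m. \<bar>SI (\<kappa> m) (g m j) \<omega> - I (g m j) \<omega>\<bar> \<le> (1/2)^m"
    using \<kappa>
  proof eventually_elim
    case (elim \<omega>)
    then show ?case
    proof eventually_elim
      case (elim m)
      show ?case
      proof (intro allI impI)
        fix j assume j: "j \<le> Suc m"
        then have "0 \<le> g m j" using g(1)[OF j] ts by simp
        then show "\<bar>SI (\<kappa> m) (g m j) \<omega> - I (g m j) \<omega>\<bar> \<le> (1/2)^m"
          using elim[rule_format, of "Suc j"] j by (simp add: G_def max_def)
      qed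
    qed
  qed
  note AM [measurable] = sets_F_M[OF A]
  note TM [measurable] = stopping_time_measurable[OF T]
  define c where "c m i \<omega> = (indicator A \<omega> * (if g m i < T \<omega> then 1 else 0) :: real)" for m i \<omega>
  \<comment> \<open>the approximating integrand, restricted to \<open>A\<close> and to the time interval from \<open>t\<close> to \<open>T\<close> rounded up\<close>
  define y where "y m u \<omega> = (\<Sum>i<Suc m. c m i \<omega> * (X (\<kappa> m) u \<omega> * indicator {g m i<..g m (Suc i)} u))" for m u \<omega>
  define Y where "Y m \<omega> = (\<Sum>i<Suc m. c m i \<omega> * (SI (\<kappa> m) (g m (Suc i)) \<omega> - SI (\<kappa> m) (g m i) \<omega>))" for m \<omega>
  have el: "elementary (y m) (Y m)" for m
    unfolding y_def[abs_def] Y_def[abs_def]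
  proof (rule elementary_sum)
    fix i assume "i \<in> {..<Suc m}"
    then have i: "i \<le> Suc m" by simp
    show "elementary (\<lambda>u \<omega>. c m i \<omega> * (X (\<kappa> m) u \<omega> * indicator {g m i<..g m (Suc i)} u))
      (\<lambda>\<omega>. c m i \<omega> * (SI (\<kappa> m) (g m (Suc i)) \<omega> - SI (\<kappa> m) (g m i) \<omega>))"
      unfolding X_def SI_def
    proof (rule elementary_simple_between[OF S])
      show "0 \<le> g m i" using g(1)[OF i] ts by simp
      have [measurable]: "A \<in> sets (F (g m i))" using A sets_F_mono[OF g(1)[OF i]] by blast
      have [measurable]: "{\<omega> \<in> space (F (g m i)). g m i < T \<omega>} \<in> sets (F (g m i))"
        using stopping_time_sets_F(1)[OF T order_refl] by (simp add: space_F)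
      show "c m i \<in> borel_measurable (F (g m i))" unfolding c_def by measurable
    qed (auto simp: gmono c_def indicator_def)
  qed
  define h where "h u \<omega> = indicator A \<omega> * (indicator {t<..T \<omega>} u * H' u \<omega>)" for u \<omega>
  have hm: "(\<lambda>(\<omega>, u). h u \<omega>) \<in> borel_measurable (M \<Otimes>\<^sub>M lborel)"
  proof -
    have "(\<lambda>(\<omega>, u). indicator A \<omega> * ((if t < u \<and> u \<le> T \<omega> then 1 else 0) * H' u \<omega>)) \<in> borel_measurable (M \<Otimes>\<^sub>M lborel)"
      by measurable
    moreover have "(\<lambda>(\<omega>, u). h u \<omega>) = (\<lambda>(\<omega>, u). indicator A \<omega> * ((if t < u \<and> u \<le> T \<omega> then 1 else 0) * H' u \<omega>))"
      by (auto simp: h_def indicator_def fun_eq_iff)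
    ultimately show ?thesis by simp
  qed
  have h2: "(h u \<omega>)\<^sup>2 = indicator A \<omega> * (indicator {t<..T \<omega>} u * (H u \<omega>)\<^sup>2)" if "\<omega> \<in> space M" for u \<omega>
    using Tb[OF that] ts by (auto simp: h_def H'_def indicator_def)
  have hR: "AE \<omega> in M. (\<integral>\<^sup>+u. ennreal ((h u \<omega>)\<^sup>2) \<partial>lborel) \<le> ennreal R"
    using R(2) AE_space by eventually_elim (auto simp: h2 indicator_def)
  have ss: "stopped_sum V t s (Suc m) (T \<omega>) * indicator A \<omega> = (\<Sum>i<Suc m. c m i \<omega> * (V (g m (Suc i)) - V (g m i)))" for V m \<omega>
    unfolding stopped_sum_def sum_distrib_right g_def[symmetric] by (intro sum.cong) (auto simp: c_def)
  have y_bound: "\<exists>d. T \<omega> \<le> d \<and> d \<le> s \<and> d \<le> T \<omega> + (s - t) / real (Suc m) \<and>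
      (\<forall>u. y m u \<omega> = indicator A \<omega> * (indicator {t<..d} u * X (\<kappa> m) u \<omega>)) \<and>
      (\<exists>j\<le>Suc m. d = g m j \<and> Y m \<omega> = indicator A \<omega> * (SI (\<kappa> m) d \<omega> - SI (\<kappa> m) t \<omega>) \<and>
      (\<forall>V. stopped_sum V t s (Suc m) (T \<omega>) = V d - V t))"
    if w: "\<omega> \<in> space M" for m \<omega>
  proof -
    obtain j where j: "j \<le> Suc m" "T \<omega> \<le> g m j" "g m j \<le> T \<omega> + (s - t) / real (Suc m)"
      and V: "\<And>V. stopped_sum V t s (Suc m) (T \<omega>) = V (g m j) - V t"
      unfolding g_def by (rule stopped_sum_unif_grid[OF Tb[OF w], of "Suc m"]) auto
    have "y m u \<omega> = indicator A \<omega> * (indicator {t<..g m j} u * X (\<kappa> m) u \<omega>)" for u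
    proof -
      let ?V = "\<lambda>w. if u \<le> w then 1 else (0::real)"
      have "y m u \<omega> = X (\<kappa> m) u \<omega> * (\<Sum>i<Suc m. c m i \<omega> * (?V (g m (Suc i)) - ?V (g m i)))"
        unfolding y_def sum_distrib_left
      proof (intro sum.cong refl)
        fix i
        have "indicator {g m i<..g m (Suc i)} u = ?V (g m (Suc i)) - ?V (g m i)"
          using gmono[of m i] by (auto simp: indicator_def)
        then show "c m i \<omega> * (X (\<kappa> m) u \<omega> * indicator {g m i<..g m (Suc i)} u) =
          X (\<kappa> m) u \<omega> * (c m i \<omega> * (?V (g m (Suc i)) - ?V (g m i)))" by simp
      qed
      also have "\<dots> = X (\<kappa> m) u \<omega> * ((?V (g m j) - ?V t) * indicator A \<omega>)"
        by (simp only: ss[of ?V m \<omega>, symmetric] V)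
      also have "?V (g m j) - ?V t = indicator {t<..g m j} u" using g(1)[OF j(1)] by (auto simp: indicator_def)
      finally show ?thesis by simp
    qed
    moreover have "Y m \<omega> = indicator A \<omega> * (SI (\<kappa> m) (g m j) \<omega> - SI (\<kappa> m) t \<omega>)"
      using ss[of "\<lambda>u. SI (\<kappa> m) u \<omega>" m \<omega>] V[of "\<lambda>u. SI (\<kappa> m) u \<omega>"] by (simp add: Y_def mult.commute)
    ultimately show ?thesis using j V g(2)[OF j(1)] by blast
  qed
  have yh: "AE \<omega> in M. (\<lambda>m. \<integral>\<^sup>+u. ennreal ((y m u \<omega> - h u \<omega>)\<^sup>2) \<partial>lborel) \<longlonglongrightarrow> 0"
    using \<kappa>E AE_space
  proof eventually_elim
    case (elim \<omega>)
    note w = elim(2)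
    have [measurable]: "(\<lambda>u. H' u \<omega>) \<in> borel_measurable lborel"
      using measurable_compose[OF measurable_Pair1'[OF w] H'M] by simp
    have [measurable]: "(\<lambda>u. X k u \<omega>) \<in> borel_measurable lborel" for k
      using measurable_compose[OF measurable_Pair1'[OF w] XM] by simp
    define \<delta> where "\<delta> m = (s - t) / real (Suc m)" for m
    have \<delta>0: "\<delta> \<longlonglongrightarrow> 0" unfolding \<delta>_def by (rule LIMSEQ_Suc) (rule lim_const_over_n)
    have Efin: "(\<integral>\<^sup>+u. ennreal ((H' u \<omega>)\<^sup>2) * indicator {0..s} u \<partial>lborel) < \<infinity>"
    proof -
      obtain m where m: "E (\<kappa> m) \<omega> \<le> ennreal ((1/2)^m)"
        using eventually_happens[OF elim(1)] by auto
      have "(\<integral>\<^sup>+u. ennreal ((indicator {0..s} u * H' u \<omega> - 0)\<^sup>2) \<partial>lborel)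
        \<le> 2 * (\<integral>\<^sup>+u. ennreal ((indicator {0..s} u * H' u \<omega> - indicator {0..s} u * X (\<kappa> m) u \<omega>)\<^sup>2) \<partial>lborel)
        + 2 * (\<integral>\<^sup>+u. ennreal ((0 - indicator {0..s} u * X (\<kappa> m) u \<omega>)\<^sup>2) \<partial>lborel)"
        by (intro nn_integral_square_diff_le) auto
      also have "(\<integral>\<^sup>+u. ennreal ((indicator {0..s} u * H' u \<omega> - indicator {0..s} u * X (\<kappa> m) u \<omega>)\<^sup>2) \<partial>lborel) = E (\<kappa> m) \<omega>"
        unfolding E_def by (intro nn_integral_cong) (auto simp: indicator_def power2_commute)
      also have "(\<integral>\<^sup>+u. ennreal ((0 - indicator {0..s} u * X (\<kappa> m) u \<omega>)\<^sup>2) \<partial>lborel)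
          \<le> (\<integral>\<^sup>+u. ennreal ((X (\<kappa> m) u \<omega>)\<^sup>2) \<partial>lborel)"
        by (intro nn_integral_mono) (auto simp: indicator_def)
      also have "\<dots> = ennreal (simple_energy (n (\<kappa> m)) (p (\<kappa> m)) (x (\<kappa> m)) \<omega>)"
        unfolding X_def by (rule nn_integral_simple_value_square[OF S])
      finally have "(\<integral>\<^sup>+u. ennreal ((indicator {0..s} u * H' u \<omega> - 0)\<^sup>2) \<partial>lborel)
        \<le> 2 * E (\<kappa> m) \<omega> + 2 * ennreal (simple_energy (n (\<kappa> m)) (p (\<kappa> m)) (x (\<kappa> m)) \<omega>)"
        by (simp add: add_left_mono mult_left_mono)
      also have "\<dots> < \<infinity>" using m by (auto simp: ennreal_mult_less_top intro: le_less_trans)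
      also have "(\<integral>\<^sup>+u. ennreal ((indicator {0..s} u * H' u \<omega> - 0)\<^sup>2) \<partial>lborel)
         = (\<integral>\<^sup>+u. ennreal ((H' u \<omega>)\<^sup>2) * indicator {0..s} u \<partial>lborel)"
        by (intro nn_integral_cong) (auto simp: indicator_def)
      finally show ?thesis .
    qed
    \<comment> \<open>a bound for the energy between \<open>T\<close> and its rounded value, which is at most one cell later\<close>
    define e2 where "e2 m = (\<integral>\<^sup>+u. ennreal (indicator {T \<omega><..T \<omega> + \<delta> m} u * (H' u \<omega>)\<^sup>2) * indicator {0..s} u \<partial>lborel)" for m
    have e2: "e2 \<longlonglongrightarrow> 0"
    proof -
      have "e2 \<longlonglongrightarrow> (\<integral>\<^sup>+(u::real). 0 \<partial>lborel)" unfolding e2_def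
      proof (rule nn_integral_dominated_convergence[where w="\<lambda>u. ennreal ((H' u \<omega>)\<^sup>2) * indicator {0..s} u"])
        show "AE u in lborel. (\<lambda>m. ennreal (indicator {T \<omega><..T \<omega> + \<delta> m} u * (H' u \<omega>)\<^sup>2) * indicator {0..s} u) \<longlonglongrightarrow> 0"
        proof (rule AE_I2)
          fix u
          have "\<forall>\<^sub>F m in sequentially. indicator {T \<omega><..T \<omega> + \<delta> m} u = (0::real)"
          proof (cases "u \<le> T \<omega>")
            case False
            then have "\<forall>\<^sub>F m in sequentially. \<delta> m < u - T \<omega>" by (intro order_tendstoD(2)[OF \<delta>0]) simp
            then show ?thesis by eventually_elim auto
          qed simp
          then have "\<forall>\<^sub>F m in sequentially. 0 = ennreal (indicator {T \<omega><..T \<omega> + \<delta> m} u * (H' u \<omega>)\<^sup>2) * indicator {0..s} u"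
            by eventually_elim simp
          then show "(\<lambda>m. ennreal (indicator {T \<omega><..T \<omega> + \<delta> m} u * (H' u \<omega>)\<^sup>2) * indicator {0..s} u) \<longlonglongrightarrow> 0"
            by (rule Lim_transform_eventually[OF tendsto_const])
        qed
      qed (use Efin in \<open>auto simp: indicator_def\<close>)
      then show ?thesis by simp
    qed
    have up: "\<forall>\<^sub>F m in sequentially. (\<integral>\<^sup>+u. ennreal ((y m u \<omega> - h u \<omega>)\<^sup>2) \<partial>lborel) \<le> 2 * ennreal ((1/2)^m) + 2 * e2 m"
      using elim(1)
    proof eventually_elim
      case (elim m)
      obtain d where d: "T \<omega> \<le> d" "d \<le> s" "d \<le> T \<omega> + \<delta> m"
        and yd: "\<And>u. y m u \<omega> = indicator A \<omega> * (indicator {t<..d} u * X (\<kappa> m) u \<omega>)"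
        using y_bound[OF w, of m] unfolding \<delta>_def by blast
      let ?z = "\<lambda>u. indicator A \<omega> * (indicator {t<..d} u * H' u \<omega>)"
      have "(\<integral>\<^sup>+u. ennreal ((y m u \<omega> - h u \<omega>)\<^sup>2) \<partial>lborel)
        \<le> 2 * (\<integral>\<^sup>+u. ennreal ((y m u \<omega> - ?z u)\<^sup>2) \<partial>lborel) + 2 * (\<integral>\<^sup>+u. ennreal ((h u \<omega> - ?z u)\<^sup>2) \<partial>lborel)"
        unfolding h_def yd by (intro nn_integral_square_diff_le) auto
      also have "(\<integral>\<^sup>+u. ennreal ((y m u \<omega> - ?z u)\<^sup>2) \<partial>lborel) \<le> E (\<kappa> m) \<omega>"
        unfolding E_def yd using ts d by (intro nn_integral_mono) (auto simp: indicator_def)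
      also have "E (\<kappa> m) \<omega> \<le> ennreal ((1/2)^m)" by (rule elim)
      also have "(\<integral>\<^sup>+u. ennreal ((h u \<omega> - ?z u)\<^sup>2) \<partial>lborel) \<le> e2 m"
        unfolding e2_def h_def using ts d Tb[OF w] by (intro nn_integral_mono) (auto simp: indicator_def)
      finally show ?case by (simp add: add_mono mult_left_mono)
    qed
    have "(\<lambda>m. (1/2)^m :: real) \<longlonglongrightarrow> 0" by (rule LIMSEQ_power_zero) simp
    then have half: "(\<lambda>m. ennreal ((1/2)^m)) \<longlonglongrightarrow> 0" using tendsto_ennrealI by fastforce
    have "(\<lambda>m. 2 * ennreal ((1/2)^m) + 2 * e2 m) \<longlonglongrightarrow> 2 * 0 + 2 * 0"
      by (intro tendsto_add ennreal_tendsto_cmult half e2) auto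
    then have "(\<lambda>m. 2 * ennreal ((1/2)^m) + 2 * e2 m) \<longlonglongrightarrow> 0" by simp
    from tendsto_sandwich[OF _ up tendsto_const this] show ?case by simp
  qed
  have YJ: "AE \<omega> in M. (\<lambda>m. Y m \<omega>) \<longlonglongrightarrow> J \<omega>"
    using \<kappa>I J(2) Ic AE_space
  proof eventually_elim
    case (elim \<omega>)
    note w = elim(4)
    have "0 \<le> T \<omega>" using Tb[OF w] ts by simp
    from stopped_sum_tendsto[OF Tb[OF w] continuous_on_imp_right[OF elim(3) this]]
    have I1: "(\<lambda>m. indicator A \<omega> * stopped_sum (\<lambda>u. I u \<omega>) t s (Suc m) (T \<omega>)) \<longlonglongrightarrow> J \<omega>"
      unfolding elim(2) by (intro tendsto_mult tendsto_const)
    have diff: "\<forall>\<^sub>F m in sequentially. norm (Y m \<omega> - indicator A \<omega> * stopped_sum (\<lambda>u. I u \<omega>) t s (Suc m) (T \<omega>)) \<le> 2 * (1/2)^m"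
      using elim(1)
    proof eventually_elim
      case (elim m)
      obtain j where j: "j \<le> Suc m" and Yj: "Y m \<omega> = indicator A \<omega> * (SI (\<kappa> m) (g m j) \<omega> - SI (\<kappa> m) t \<omega>)"
        and V: "\<And>V. stopped_sum V t s (Suc m) (T \<omega>) = V (g m j) - V t"
        using y_bound[OF w, of m] by blast
      have b: "\<bar>SI (\<kappa> m) (g m j) \<omega> - I (g m j) \<omega>\<bar> \<le> (1/2)^m" "\<bar>SI (\<kappa> m) t \<omega> - I t \<omega>\<bar> \<le> (1/2)^m"
        using elim[rule_format, OF j] elim[rule_format, of 0] by (auto simp: g_def)
      have "Y m \<omega> - indicator A \<omega> * stopped_sum (\<lambda>u. I u \<omega>) t s (Suc m) (T \<omega>)
        = indicator A \<omega> * ((SI (\<kappa> m) (g m j) \<omega> - I (g m j) \<omega>) - (SI (\<kappa> m) t \<omega> - I t \<omega>))"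
        unfolding Yj V by (simp add: algebra_simps)
      also have "norm \<dots> \<le> \<bar>(SI (\<kappa> m) (g m j) \<omega> - I (g m j) \<omega>) - (SI (\<kappa> m) t \<omega> - I t \<omega>)\<bar>"
        by (auto simp: indicator_def)
      also have "\<dots> \<le> 2 * (1/2)^m" using b by linarith
      finally show ?case .
    qed
    have "(\<lambda>m. 2 * (1/2)^m :: real) \<longlonglongrightarrow> 2 * 0" by (intro tendsto_mult tendsto_const LIMSEQ_power_zero) simp
    then have "(\<lambda>m. Y m \<omega> - indicator A \<omega> * stopped_sum (\<lambda>u. I u \<omega>) t s (Suc m) (T \<omega>)) \<longlonglongrightarrow> 0"
      by (intro Lim_null_comparison[OF diff]) simp
    from tendsto_add[OF this I1] show ?case by simp
  qed
  note res = ito_isometry_limit[OF el hm hR R(1) yh J(1) YJ]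
  show "integrable M (\<lambda>\<omega>. (J \<omega>)\<^sup>2)" "(\<integral>\<omega>. J \<omega> \<partial>M) = 0" by (rule res)+
  have "(\<integral>\<^sup>+\<omega>. (\<integral>\<^sup>+u. ennreal ((h u \<omega>)\<^sup>2) \<partial>lborel) \<partial>M)
      = (\<integral>\<^sup>+\<omega>. (\<integral>\<^sup>+u. ennreal (indicator A \<omega> * (indicator {t<..T \<omega>} u * (H u \<omega>)\<^sup>2)) \<partial>lborel) \<partial>M)"
    by (intro nn_integral_cong) (simp only: h2)
  then show "(\<integral>\<^sup>+\<omega>. ennreal ((J \<omega>)\<^sup>2) \<partial>M)
      = (\<integral>\<^sup>+\<omega>. (\<integral>\<^sup>+u. ennreal (indicator A \<omega> * (indicator {t<..T \<omega>} u * (H u \<omega>)\<^sup>2)) \<partial>lborel) \<partial>M)"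
    using res(3) by simp
qed

end

section \<open>Optional stopping\<close>

context filtered_prob_space
begin

text \<open>Jensen's inequality for the convex function \<open>max 0 (\<bar>x\<bar> - K)\<close>. It is proved on the
  events where \<open>U\<close> exceeds \<open>K\<close> or lies below \<open>-K\<close>, on which this
  function has a supporting line of slope \<open>1\<close> or \<open>-1\<close>.\<close>

lemma excess_submartingale:
  fixes U V :: "'a \<Rightarrow> real"
  assumes U: "U \<in> borel_measurable (F u)" and int: "integrable M U" "integrable M V"
    and eq: "\<And>C. C \<in> sets (F u) \<Longrightarrow> (\<integral>\<omega>. indicator C \<omega> * V \<omega> \<partial>M) = (\<integral>\<omega>. indicator C \<omega> * U \<omega> \<partial>M)"
    and C: "C \<in> sets (F u)" and K: "0 \<le> K"
  shows "(\<integral>\<omega>. indicator C \<omega> * max 0 (\<bar>U \<omega>\<bar> - K) \<partial>M) \<le> (\<integral>\<omega>. indicator C \<omega> * max 0 (\<bar>V \<omega>\<bar> - K) \<partial>M)"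
proof -
  define P where "P = {\<omega> \<in> space M. U \<omega> > K} \<inter> C"
  define Q where "Q = {\<omega> \<in> space M. U \<omega> < - K} \<inter> C"
  have PQ: "P \<in> sets (F u)" "Q \<in> sets (F u)" unfolding P_def Q_def
    using borel_measurable_less[OF borel_measurable_const U, of K] borel_measurable_less[OF U borel_measurable_const, of "-K"] C
    by (auto simp: space_F)
  note m [measurable] = sets_F_M[OF PQ(1)] sets_F_M[OF PQ(2)] sets_F_M[OF C]
  have i: "integrable M (\<lambda>\<omega>. indicator B \<omega> * f \<omega>)" if "B \<in> sets M" "integrable M f" for B and f :: "'a \<Rightarrow> real"
    using integrable_mult_indicator[OF that] by simp
  note PQi = i[OF m(1) int(1)] i[OF m(2) int(1)] i[OF m(1) int(2)] i[OF m(2) int(2)]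
  have Ki: "integrable M (\<lambda>\<omega>. indicator P \<omega> * K + indicator Q \<omega> * K)"
    by (intro Bochner_Integration.integrable_add i m) auto
  have "(\<integral>\<omega>. indicator C \<omega> * max 0 (\<bar>U \<omega>\<bar> - K) \<partial>M)
     = (\<integral>\<omega>. (indicator P \<omega> * U \<omega> - indicator Q \<omega> * U \<omega>) - (indicator P \<omega> * K + indicator Q \<omega> * K) \<partial>M)"
    using K C by (intro Bochner_Integration.integral_cong) (auto simp: P_def Q_def indicator_def sets.sets_into_space)
  also have "\<dots> = (\<integral>\<omega>. indicator P \<omega> * U \<omega> \<partial>M) - (\<integral>\<omega>. indicator Q \<omega> * U \<omega> \<partial>M)
     - (\<integral>\<omega>. indicator P \<omega> * K + indicator Q \<omega> * K \<partial>M)"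
    by (simp only: Bochner_Integration.integral_diff Bochner_Integration.integrable_diff PQi Ki)
  also have "\<dots> = (\<integral>\<omega>. indicator P \<omega> * V \<omega> \<partial>M) - (\<integral>\<omega>. indicator Q \<omega> * V \<omega> \<partial>M)
     - (\<integral>\<omega>. indicator P \<omega> * K + indicator Q \<omega> * K \<partial>M)"
    by (simp only: eq[OF PQ(1)] eq[OF PQ(2)])
  also have "\<dots> = (\<integral>\<omega>. (indicator P \<omega> * V \<omega> - indicator Q \<omega> * V \<omega>) - (indicator P \<omega> * K + indicator Q \<omega> * K) \<partial>M)"
    by (simp only: Bochner_Integration.integral_diff Bochner_Integration.integrable_diff PQi Ki)
  also have "\<dots> \<le> (\<integral>\<omega>. indicator C \<omega> * max 0 (\<bar>V \<omega>\<bar> - K) \<partial>M)"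
  proof (rule integral_mono)
    show "integrable M (\<lambda>\<omega>. (indicator P \<omega> * V \<omega> - indicator Q \<omega> * V \<omega>) - (indicator P \<omega> * K + indicator Q \<omega> * K))"
      by (intro Bochner_Integration.integrable_diff PQi Ki)
    show "integrable M (\<lambda>\<omega>. indicator C \<omega> * max 0 (\<bar>V \<omega>\<bar> - K))"
      using int m by (intro i integrable_max) auto
    fix \<omega>
    show "(indicator P \<omega> * V \<omega> - indicator Q \<omega> * V \<omega>) - (indicator P \<omega> * K + indicator Q \<omega> * K) \<le> indicator C \<omega> * max 0 (\<bar>V \<omega>\<bar> - K)"
      using K by (auto simp: P_def Q_def indicator_def)
  qed
  finally show ?thesis .
qed

text \<open>Optional stopping for a bounded stopping time and a martingale whose paths are only known to be
  right-continuous at \<open>T\<close>. At the rounded times the mean increment vanishes cell by cell. The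
  limit is justified by uniform integrability: by \<open>excess_submartingale\<close>, the mean excess of a
  rounded stopped value is at most that of the terminal value, for every grid.\<close>

lemma optional_stopping:
  fixes Y :: "real \<Rightarrow> 'a \<Rightarrow> real"
  assumes Ym: "\<And>u. t \<le> u \<Longrightarrow> u \<le> s \<Longrightarrow> Y u \<in> borel_measurable (F u)"
    and Yi: "\<And>u. t \<le> u \<Longrightarrow> u \<le> s \<Longrightarrow> integrable M (Y u)"
    and mart: "\<And>u v C. t \<le> u \<Longrightarrow> u \<le> v \<Longrightarrow> v \<le> s \<Longrightarrow> C \<in> sets (F u) \<Longrightarrow>
      (\<integral>\<omega>. indicator C \<omega> * Y v \<omega> \<partial>M) = (\<integral>\<omega>. indicator C \<omega> * Y u \<omega> \<partial>M)"
    and T: "stopping_time F T" and ts: "t \<le> s"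
    and Tb: "\<And>\<omega>. \<omega> \<in> space M \<Longrightarrow> t \<le> T \<omega>" "\<And>\<omega>. \<omega> \<in> space M \<Longrightarrow> T \<omega> \<le> s"
    and rc: "AE \<omega> in M. ((\<lambda>u. Y u \<omega>) \<longlongrightarrow> Y (T \<omega>) \<omega>) (at_right (T \<omega>))"
    and A: "A \<in> sets (F t)"
    and L: "L \<in> borel_measurable M" "AE \<omega> in M. L \<omega> = indicator A \<omega> * (Y (T \<omega>) \<omega> - Y t \<omega>)"
  shows "integrable M L" "(\<integral>\<omega>. L \<omega> \<partial>M) = 0"
proof -
  define g where "g m = unif_grid t s (Suc m)" for m
  have g: "t \<le> g m i" "g m i \<le> s" if "i \<le> Suc m" for m i
    using unif_grid_bounds[OF ts that] by (auto simp: g_def)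
  have gmono: "g m i \<le> g m (Suc i)" for m i unfolding g_def by (rule unif_grid_mono[OF ts]) simp
  have g0: "g m 0 = t" "g m (Suc m) = s" for m by (auto simp: g_def)
  define Z where "Z u \<omega> = indicator A \<omega> * (Y u \<omega> - Y t \<omega>)" for u \<omega>
  note AM [measurable] = sets_F_M[OF A]
  have i: "integrable M (\<lambda>\<omega>. indicator B \<omega> * f \<omega>)" if "B \<in> sets M" "integrable M f" for B and f :: "'a \<Rightarrow> real"
    using integrable_mult_indicator[OF that] by simp
  have Zi: "integrable M (Z u)" if "t \<le> u" "u \<le> s" for u
    unfolding Z_def using that Yi ts by (intro i AM Bochner_Integration.integrable_diff) auto
  have Zm: "Z u \<in> borel_measurable (F u)" if "t \<le> u" "u \<le> s" for u
  proof -
    have [measurable]: "A \<in> sets (F u)" using A sets_F_mono[OF that(1)] by blast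
    have [measurable]: "Y t \<in> borel_measurable (F u)" by (rule measurable_F_mono[OF Ym]) (use that ts in auto)
    note [measurable] = Ym[OF that]
    show ?thesis unfolding Z_def by measurable
  qed
  have Zmart: "(\<integral>\<omega>. indicator C \<omega> * Z v \<omega> \<partial>M) = (\<integral>\<omega>. indicator C \<omega> * Z u \<omega> \<partial>M)"
    if uv: "t \<le> u" "u \<le> v" "v \<le> s" and C: "C \<in> sets (F u)" for u v C
  proof -
    have CA: "C \<inter> A \<in> sets (F u)" using A C sets_F_mono[OF uv(1)] by blast
    have eq: "(\<integral>\<omega>. indicator C \<omega> * Z w \<omega> \<partial>M) = (\<integral>\<omega>. indicator (C \<inter> A) \<omega> * Y w \<omega> \<partial>M) - (\<integral>\<omega>. indicator (C \<inter> A) \<omega> * Y t \<omega> \<partial>M)"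
      if "t \<le> w" "w \<le> s" for w
    proof -
      have "(\<integral>\<omega>. indicator C \<omega> * Z w \<omega> \<partial>M) = (\<integral>\<omega>. indicator (C \<inter> A) \<omega> * Y w \<omega> - indicator (C \<inter> A) \<omega> * Y t \<omega> \<partial>M)"
        by (intro Bochner_Integration.integral_cong) (auto simp: Z_def indicator_def)
      also have "\<dots> = (\<integral>\<omega>. indicator (C \<inter> A) \<omega> * Y w \<omega> \<partial>M) - (\<integral>\<omega>. indicator (C \<inter> A) \<omega> * Y t \<omega> \<partial>M)"
        by (intro Bochner_Integration.integral_diff i sets_F_M[OF CA] Yi) (use that ts in auto)
      finally show ?thesis .
    qed
    show ?thesis using uv mart[OF uv CA] by (simp add: eq)
  qed
  define V where "V m \<omega> = stopped_sum (\<lambda>u. Z u \<omega>) t s (Suc m) (T \<omega>)" for m \<omega>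
  define B where "B m i = {\<omega> \<in> space M. g m i < T \<omega>}" for m i
  have BF: "B m i \<in> sets (F (g m i))" for m i unfolding B_def by (rule stopping_time_sets_F(1)[OF T order_refl])
  note BM [measurable] = sets_F_M[OF BF]
  have V_eq: "V m \<omega> = (\<Sum>i<Suc m. indicator (B m i) \<omega> * (Z (g m (Suc i)) \<omega> - Z (g m i) \<omega>))" if "\<omega> \<in> space M" for m \<omega>
    unfolding V_def stopped_sum_def g_def[symmetric] using that by (intro sum.cong) (auto simp: B_def indicator_def)
  have cell: "integrable M (\<lambda>\<omega>. indicator (B m i) \<omega> * (Z (g m (Suc i)) \<omega> - Z (g m i) \<omega>))"
    "(\<integral>\<omega>. indicator (B m i) \<omega> * (Z (g m (Suc i)) \<omega> - Z (g m i) \<omega>) \<partial>M) = 0" if "i < Suc m" for m i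
  proof -
    have b: "t \<le> g m i" "g m i \<le> g m (Suc i)" "g m (Suc i) \<le> s" using that g gmono by auto
    then have b': "g m i \<le> s" "t \<le> g m (Suc i)" by linarith+
    show "integrable M (\<lambda>\<omega>. indicator (B m i) \<omega> * (Z (g m (Suc i)) \<omega> - Z (g m i) \<omega>))"
      using b b' by (intro i BM Bochner_Integration.integrable_diff Zi) auto
    show "(\<integral>\<omega>. indicator (B m i) \<omega> * (Z (g m (Suc i)) \<omega> - Z (g m i) \<omega>) \<partial>M) = 0"
      using Zmart[OF b BF] b b' by (simp add: right_diff_distrib i Zi)
  qed
  have Vi: "integrable M (V m)" for m
    by (subst Bochner_Integration.integrable_cong[OF refl V_eq], assumption)
      (intro Bochner_Integration.integrable_sum cell, simp)
  have V0: "(\<integral>\<omega>. V m \<omega> \<partial>M) = 0" for m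
  proof -
    have "(\<integral>\<omega>. V m \<omega> \<partial>M) = (\<Sum>i<Suc m. \<integral>\<omega>. indicator (B m i) \<omega> * (Z (g m (Suc i)) \<omega> - Z (g m i) \<omega>) \<partial>M)"
      by (subst Bochner_Integration.integral_cong[OF refl V_eq], assumption)
        (intro Bochner_Integration.integral_sum cell, simp)
    also have "\<dots> = 0" by (intro sum.neutral ballI cell) simp
    finally show ?thesis .
  qed
  have VL: "AE \<omega> in M. (\<lambda>m. V m \<omega>) \<longlonglongrightarrow> L \<omega>"
    using L(2) rc AE_space
  proof eventually_elim
    case (elim \<omega>)
    have "((\<lambda>u. Z u \<omega>) \<longlongrightarrow> Z (T \<omega>) \<omega>) (at_right (T \<omega>))" unfolding Z_def by (intro tendsto_intros elim)
    from stopped_sum_tendsto[OF Tb[OF elim(3)] this]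
    have "(\<lambda>m. V m \<omega>) \<longlonglongrightarrow> Z (T \<omega>) \<omega> - Z t \<omega>" unfolding V_def .
    then show ?case unfolding elim(1) by (simp add: Z_def)
  qed
  have ui: "\<exists>K. \<forall>m. (\<integral>\<omega>. max 0 (\<bar>V m \<omega>\<bar> - K) \<partial>M) \<le> \<epsilon>" if e: "\<epsilon> > 0" for \<epsilon>
  proof -
    have Zsm [measurable]: "Z s \<in> borel_measurable M" using Zi[OF ts] by auto
    have "(\<lambda>k. \<integral>\<omega>. max 0 (\<bar>Z s \<omega>\<bar> - real k) \<partial>M) \<longlonglongrightarrow> (\<integral>\<omega>. 0 \<partial>M)"
    proof (rule integral_dominated_convergence[where w="\<lambda>\<omega>. \<bar>Z s \<omega>\<bar>"])
      show "AE \<omega> in M. (\<lambda>k. max 0 (\<bar>Z s \<omega>\<bar> - real k)) \<longlonglongrightarrow> 0"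
      proof (rule AE_I2)
        fix \<omega>
        obtain k0 where "\<bar>Z s \<omega>\<bar> \<le> real k0" using real_arch_simple by blast
        then have "\<forall>\<^sub>F k in sequentially. max 0 (\<bar>Z s \<omega>\<bar> - real k) = 0"
          by (intro eventually_sequentiallyI[of k0]) auto
        then show "(\<lambda>k. max 0 (\<bar>Z s \<omega>\<bar> - real k)) \<longlonglongrightarrow> 0" by (rule tendsto_eventually)
      qed
    qed (use Zi[OF ts] ts in auto)
    then have "\<forall>\<^sub>F k in sequentially. (\<integral>\<omega>. max 0 (\<bar>Z s \<omega>\<bar> - real k) \<partial>M) < \<epsilon>"
      using e by (intro order_tendstoD(2)) auto
    then obtain k where k: "(\<integral>\<omega>. max 0 (\<bar>Z s \<omega>\<bar> - real k) \<partial>M) < \<epsilon>"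
      using eventually_happens trivial_limit_sequentially by blast
    let ?\<phi> = "\<lambda>x. max 0 (\<bar>x\<bar> - real k)"
    have pi: "integrable M (\<lambda>\<omega>. ?\<phi> (f \<omega>))" if "integrable M f" for f
      using that by (intro integrable_max) auto
    have "(\<integral>\<omega>. ?\<phi> (V m \<omega>) \<partial>M) \<le> \<epsilon>" for m
    proof -
      \<comment> \<open>the increments of the submartingale \<open>\<phi> (Z u)\<close> after \<open>T\<close>: they lead from the stopped to the
        terminal value, and each has nonnegative mean\<close>
      define d where "d i \<omega> = indicator (space M - B m i) \<omega> * (?\<phi> (Z (g m (Suc i)) \<omega>) - ?\<phi> (Z (g m i) \<omega>))" for i \<omega>
      have dF: "space M - B m i \<in> sets (F (g m i))" for i using BF sets.compl_sets[OF BF] by (metis space_F)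
      have d: "integrable M (d i)" "0 \<le> (\<integral>\<omega>. d i \<omega> \<partial>M)" if "i < Suc m" for i
      proof -
        have b: "t \<le> g m i" "g m i \<le> g m (Suc i)" "g m (Suc i) \<le> s" using that g gmono by auto
        then have b': "g m i \<le> s" "t \<le> g m (Suc i)" by linarith+
        show "integrable M (d i)" unfolding d_def
          using b b' by (intro i sets_F_M[OF dF] Bochner_Integration.integrable_diff pi Zi) auto
        have "(\<integral>\<omega>. indicator (space M - B m i) \<omega> * ?\<phi> (Z (g m i) \<omega>) \<partial>M) \<le> (\<integral>\<omega>. indicator (space M - B m i) \<omega> * ?\<phi> (Z (g m (Suc i)) \<omega>) \<partial>M)"
          by (rule excess_submartingale[OF Zm Zi Zi Zmart dF]) (use b b' in auto)
        also have "\<dots> = (\<integral>\<omega>. indicator (space M - B m i) \<omega> * ?\<phi> (Z (g m i) \<omega>) \<partial>M) + (\<integral>\<omega>. d i \<omega> \<partial>M)"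
          unfolding d_def right_diff_distrib using b b'
          by (subst Bochner_Integration.integral_diff) (auto intro!: i sets_F_M[OF dF] pi Zi)
        finally show "0 \<le> (\<integral>\<omega>. d i \<omega> \<partial>M)" by simp
      qed
      have eq: "?\<phi> (V m \<omega>) = ?\<phi> (Z s \<omega>) - (\<Sum>i<Suc m. d i \<omega>)" if w: "\<omega> \<in> space M" for \<omega>
      proof -
        obtain j where j: "j \<le> Suc m" "\<And>f. stopped_sum f t s (Suc m) (T \<omega>) = f (unif_grid t s (Suc m) j) - f t"
          by (rule stopped_sum_unif_grid[OF Tb[OF w], of "Suc m"]) auto
        have "?\<phi> (V m \<omega>) = stopped_sum (\<lambda>u. ?\<phi> (Z u \<omega>)) t s (Suc m) (T \<omega>)"
          unfolding V_def j(2) by (simp add: Z_def)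
        also have "\<dots> = (\<Sum>i<Suc m. (?\<phi> (Z (g m (Suc i)) \<omega>) - ?\<phi> (Z (g m i) \<omega>)) - d i \<omega>)"
          unfolding stopped_sum_def g_def[symmetric] d_def using w
          by (intro sum.cong) (auto simp: B_def indicator_def)
        also have "\<dots> = (\<Sum>i<Suc m. ?\<phi> (Z (g m (Suc i)) \<omega>) - ?\<phi> (Z (g m i) \<omega>)) - (\<Sum>i<Suc m. d i \<omega>)"
          by (rule sum_subtractf)
        also have "(\<Sum>i<Suc m. ?\<phi> (Z (g m (Suc i)) \<omega>) - ?\<phi> (Z (g m i) \<omega>)) = ?\<phi> (Z (g m (Suc m)) \<omega>) - ?\<phi> (Z (g m 0) \<omega>)"
          by (rule sum_lessThan_telescope)
        also have "?\<phi> (Z (g m 0) \<omega>) = 0" by (simp add: g0 Z_def)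
        finally show ?thesis by (simp only: g0 diff_zero)
      qed
      have "(\<integral>\<omega>. ?\<phi> (V m \<omega>) \<partial>M) = (\<integral>\<omega>. ?\<phi> (Z s \<omega>) - (\<Sum>i<Suc m. d i \<omega>) \<partial>M)"
        by (rule Bochner_Integration.integral_cong[OF refl eq])
      also have "\<dots> = (\<integral>\<omega>. ?\<phi> (Z s \<omega>) \<partial>M) - (\<Sum>i<Suc m. \<integral>\<omega>. d i \<omega> \<partial>M)"
      proof (subst Bochner_Integration.integral_diff)
        show "integrable M (\<lambda>\<omega>. ?\<phi> (Z s \<omega>))" by (intro pi Zi ts order_refl)
        show "integrable M (\<lambda>\<omega>. \<Sum>i<Suc m. d i \<omega>)" by (intro Bochner_Integration.integrable_sum d(1)) simp
        have "(\<integral>\<omega>. (\<Sum>i<Suc m. d i \<omega>) \<partial>M) = (\<Sum>i<Suc m. \<integral>\<omega>. d i \<omega> \<partial>M)"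
          by (intro Bochner_Integration.integral_sum d(1)) simp
        then show "(\<integral>\<omega>. ?\<phi> (Z s \<omega>) \<partial>M) - (\<integral>\<omega>. (\<Sum>i<Suc m. d i \<omega>) \<partial>M)
          = (\<integral>\<omega>. ?\<phi> (Z s \<omega>) \<partial>M) - (\<Sum>i<Suc m. \<integral>\<omega>. d i \<omega> \<partial>M)" by simp
      qed
      also have "\<dots> \<le> (\<integral>\<omega>. ?\<phi> (Z s \<omega>) \<partial>M)"
        using sum_nonneg[of "{..<Suc m}" "\<lambda>i. \<integral>\<omega>. d i \<omega> \<partial>M"] d(2) by (simp del: sum.lessThan_Suc)
      finally show ?thesis using k by simp
    qed
    then show ?thesis by blast
  qed
  from Vitali_convergence[OF Vi L(1) VL ui] V0
  show "integrable M L" "(\<integral>\<omega>. L \<omega> \<partial>M) = 0" by (auto simp: LIMSEQ_const_iff)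
qed

text \<open>Off the diagonal, the factor of the earlier cell is known when the later cell starts, and the other one has
  zero mean on events of that time.\<close>

lemma martingale_difference_products:
  fixes D D' :: "nat \<Rightarrow> 'a \<Rightarrow> real"
  assumes g: "\<And>i j. i \<le> j \<Longrightarrow> g i \<le> g j"
    and D: "\<And>i. i < n \<Longrightarrow> D i \<in> borel_measurable (F (g (Suc i)))" "\<And>i. i < n \<Longrightarrow> integrable M (\<lambda>\<omega>. (D i \<omega>)\<^sup>2)"
      "\<And>i C. i < n \<Longrightarrow> C \<in> sets (F (g i)) \<Longrightarrow> (\<integral>\<omega>. indicator C \<omega> * D i \<omega> \<partial>M) = 0"
    and D': "\<And>i. i < n \<Longrightarrow> D' i \<in> borel_measurable (F (g (Suc i)))" "\<And>i. i < n \<Longrightarrow> integrable M (\<lambda>\<omega>. (D' i \<omega>)\<^sup>2)"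
      "\<And>i C. i < n \<Longrightarrow> C \<in> sets (F (g i)) \<Longrightarrow> (\<integral>\<omega>. indicator C \<omega> * D' i \<omega> \<partial>M) = 0"
  shows "(\<integral>\<omega>. (\<Sum>i<n. D i \<omega>) * (\<Sum>i<n. D' i \<omega>) \<partial>M) = (\<Sum>i<n. \<integral>\<omega>. D i \<omega> * D' i \<omega> \<partial>M)"
proof (rule integral_orthogonal_sums(2))
  have DM: "D i \<in> borel_measurable M" "D' i \<in> borel_measurable M" if "i < n" for i
    using D(1)[OF that] D'(1)[OF that] by (auto intro: measurable_F_M)
  show int: "integrable M (\<lambda>\<omega>. D i \<omega> * D' j \<omega>)" if "i < n" "j < n" for i j
    using that DM D(2) D'(2) by (intro integrable_mult_of_squares) auto
  show "(\<integral>\<omega>. D i \<omega> * D' j \<omega> \<partial>M) = 0" if ij: "i < n" "j < n" "i \<noteq> j" for i j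
  proof (cases "i < j")
    case True
    then have le: "g (Suc i) \<le> g j" by (intro g) simp
    show ?thesis
      by (rule integral_mult_eq_0_of_subalgebra[OF subalgebra_F integrable_of_square[OF DM(2)[OF ij(2)] D'(2)[OF ij(2)]]
            D'(3)[OF ij(2)] measurable_F_mono[OF D(1)[OF ij(1)] le] int[OF ij(1,2)]])
  next
    case False
    then have le: "g (Suc j) \<le> g i" using ij by (intro g) simp
    have int': "integrable M (\<lambda>\<omega>. D' j \<omega> * D i \<omega>)" using int[OF ij(1,2)] by (simp only: mult.commute)
    have "(\<integral>\<omega>. D' j \<omega> * D i \<omega> \<partial>M) = 0"
      by (rule integral_mult_eq_0_of_subalgebra[OF subalgebra_F integrable_of_square[OF DM(1)[OF ij(1)] D(2)[OF ij(1)]]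
            D(3)[OF ij(1)] measurable_F_mono[OF D'(1)[OF ij(2)] le] int'])
    then show ?thesis by (simp add: mult.commute)
  qed
qed

section \<open>Hitting times of increasing processes\<close>

definition hitting :: "(real \<Rightarrow> 'a \<Rightarrow> real) \<Rightarrow> real \<Rightarrow> real \<Rightarrow> real \<Rightarrow> 'a \<Rightarrow> real" where
  "hitting Q R t s \<omega> = Inf (insert s {u \<in> {t..s}. R \<le> Q u \<omega>})"

lemma hitting_bounds:
  assumes "t \<le> s"
  shows "t \<le> hitting Q R t s \<omega>" "hitting Q R t s \<omega> \<le> s"
proof -
  let ?S = "insert s {u \<in> {t..s}. R \<le> Q u \<omega>}"
  have "bdd_below ?S" using assms by (intro bdd_belowI[of _ t]) auto
  then show "hitting Q R t s \<omega> \<le> s" unfolding hitting_def by (intro cInf_lower) auto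
  show "t \<le> hitting Q R t s \<omega>" unfolding hitting_def using assms by (intro cInf_greatest) auto
qed

lemma hitting_below:
  assumes "t \<le> u" "u < hitting Q R t s \<omega>" "u \<le> s"
  shows "Q u \<omega> < R"
proof (rule ccontr)
  assume "\<not> Q u \<omega> < R"
  let ?S = "insert s {u \<in> {t..s}. R \<le> Q u \<omega>}"
  have "bdd_below ?S" using assms by (intro bdd_belowI[of _ t]) auto
  then have "hitting Q R t s \<omega> \<le> u" unfolding hitting_def
    using assms \<open>\<not> Q u \<omega> < R\<close> by (intro cInf_lower) auto
  then show False using assms by simp
qed

lemma hitting_eq_end:
  assumes "t \<le> s" "\<And>u. t \<le> u \<Longrightarrow> u \<le> s \<Longrightarrow> Q u \<omega> < R"
  shows "hitting Q R t s \<omega> = s"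
proof -
  have "{u \<in> {t..s}. R \<le> Q u \<omega>} = {}" using assms by (auto simp: not_le[symmetric])
  then show ?thesis unfolding hitting_def by (simp only: cInf_singleton)
qed

text \<open>A hitting time of an increasing process is at most \<open>u\<close> exactly if the level is reached at time
  \<open>u\<close> itself: by monotonicity the level is reached at all later times, and by right-continuity
  also at \<open>u\<close>. This decides the event at time \<open>u\<close>, with no information from later
  times.\<close>

lemma stopping_time_hitting:
  assumes Q: "\<And>u. t \<le> u \<Longrightarrow> u \<le> s \<Longrightarrow> Q u \<in> borel_measurable (F u)"
    and mono: "\<And>\<omega> u v. \<omega> \<in> space M \<Longrightarrow> t \<le> u \<Longrightarrow> u \<le> v \<Longrightarrow> v \<le> s \<Longrightarrow> Q u \<omega> \<le> Q v \<omega>"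
    and rc: "\<And>\<omega> u. \<omega> \<in> space M \<Longrightarrow> t \<le> u \<Longrightarrow> ((\<lambda>v. Q v \<omega>) \<longlongrightarrow> Q u \<omega>) (at_right u)"
    and ts: "t \<le> s"
  shows "stopping_time F (hitting Q R t s)"
proof (rule stopping_timeI)
  fix u
  consider "u < t" | "t \<le> u" "u < s" | "s \<le> u" by linarith
  then show "Measurable.pred (F u) (\<lambda>\<omega>. hitting Q R t s \<omega> \<le> u)"
  proof cases
    case 1
    then have "hitting Q R t s \<omega> \<le> u \<longleftrightarrow> False" for \<omega> using hitting_bounds(1)[OF ts, of Q R \<omega>] by auto
    then show ?thesis by simp
  next
    case 3
    then have "hitting Q R t s \<omega> \<le> u \<longleftrightarrow> True" for \<omega> using hitting_bounds(2)[OF ts, of Q R \<omega>] by auto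
    then show ?thesis by simp
  next
    case 2
    have "hitting Q R t s \<omega> \<le> u \<longleftrightarrow> R \<le> Q u \<omega>" if w: "\<omega> \<in> space M" for \<omega>
    proof
      assume le: "hitting Q R t s \<omega> \<le> u"
      let ?S = "insert s {u \<in> {t..s}. R \<le> Q u \<omega>}"
      have ge: "R \<le> Q v \<omega>" if v: "u < v" "v < s" for v
      proof -
        have "Inf ?S < v" using le v by (simp add: hitting_def)
        then obtain w' where w': "w' \<in> ?S" "w' < v" using cInf_lessD[of ?S v] by auto
        then have "w' \<in> {t..s}" "R \<le> Q w' \<omega>" using v by auto
        then show ?thesis using mono[OF w, of w' v] w' v by auto
      qed
      show "R \<le> Q u \<omega>"
      proof (rule tendsto_lowerbound[OF rc[OF w 2(1)]])
        show "\<forall>\<^sub>F v in at_right u. R \<le> Q v \<omega>"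
          unfolding eventually_at_right_field using 2 ge by blast
      qed simp
    next
      assume "R \<le> Q u \<omega>"
      then show "hitting Q R t s \<omega> \<le> u" using hitting_below[of t u Q R s \<omega>] 2 by (meson leD less_imp_le not_le)
    qed
    then have eq: "{\<omega> \<in> space (F u). hitting Q R t s \<omega> \<le> u} = {\<omega> \<in> space (F u). R \<le> Q u \<omega>}"
      by (auto simp: space_F)
    have [measurable]: "Q u \<in> borel_measurable (F u)" using Q 2 by auto
    show ?thesis unfolding pred_def eq by measurable
  qed
qed

end

section \<open>Path properties\<close>

lemma integrable_indicator_interval:
  "integrable lborel (indicator {u<..v} :: real \<Rightarrow> real)" "integrable lborel (indicator {u..v} :: real \<Rightarrow> real)"
  using emeasure_bounded_finite[of "{u<..v}"] emeasure_bounded_finite[of "{u..v}"]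
  by (auto intro!: integrable_real_indicator simp del: emeasure_lborel_Ioc emeasure_lborel_Icc)

text \<open>Bolzano's principle: one-sided limits bound the path near each point, and bounds on adjacent intervals
  combine.\<close>

lemma cadlag_bounded:
  assumes f: "cadlag f" and s: "0 \<le> s"
  shows "\<exists>B. \<forall>u\<in>{0..s}. \<bar>f u\<bar> \<le> B"
proof -
  have "\<exists>B. \<forall>u\<in>{0..s}. \<bar>f (max 0 u)\<bar> \<le> B" using s
  proof (induction rule: Bolzano[where P="\<lambda>a b. \<exists>B. \<forall>u\<in>{a..b}. \<bar>f (max 0 u)\<bar> \<le> B"])
    case (trans a b c)
    then obtain B1 B2 where B: "\<forall>u\<in>{a..b}. \<bar>f (max 0 u)\<bar> \<le> B1" "\<forall>u\<in>{b..c}. \<bar>f (max 0 u)\<bar> \<le> B2" by blast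
    have "\<bar>f (max 0 u)\<bar> \<le> max B1 B2" if "u \<in> {a..c}" for u
      using B that by (cases "u \<le> b") (auto simp: le_max_iff_disj)
    then show ?case by blast
  next
    case (local x)
    then have x: "0 \<le> x" by simp
    have "(f \<longlongrightarrow> f x) (at_right x)" using f x by (auto simp: cadlag_def)
    from tendstoD[OF this, of 1] obtain b where b: "b > x" "\<And>y. x < y \<Longrightarrow> y < b \<Longrightarrow> \<bar>f y - f x\<bar> < 1"
      unfolding eventually_at_right_field dist_real_def by auto
    have "\<exists>a<x. \<exists>l. \<forall>y. a < y \<and> y < x \<longrightarrow> \<bar>f (max 0 y)\<bar> \<le> l"
    proof (cases "x = 0")
      case True
      then show ?thesis by (intro exI[of _ "-1"] conjI exI[of _ "\<bar>f 0\<bar>"]) auto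
    next
      case False
      then have x0: "x > 0" using x by simp
      then obtain l where "(f \<longlongrightarrow> l) (at_left x)" using f by (auto simp: cadlag_def)
      from tendstoD[OF this, of 1] obtain a where a: "a < x" "\<And>y. a < y \<Longrightarrow> y < x \<Longrightarrow> \<bar>f y - l\<bar> < 1"
        unfolding eventually_at_left_field dist_real_def by auto
      have "\<bar>f (max 0 y)\<bar> \<le> \<bar>l\<bar> + 1" if "max a 0 < y \<and> y < x" for y
        using a(2)[of y] that by auto
      then show ?thesis using a x0 by (intro exI[of _ "max a 0"]) auto
    qed
    then obtain a l where a: "a < x" "\<And>y. a < y \<Longrightarrow> y < x \<Longrightarrow> \<bar>f (max 0 y)\<bar> \<le> l" by blast
    show ?case
    proof (rule exI[of _ "min (x - a) (b - x)"], intro conjI allI impI)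
      show "0 < min (x - a) (b - x)" using a b by simp
      fix c d assume cd: "c \<le> x \<and> x \<le> d \<and> d - c < min (x - a) (b - x)"
      have "\<bar>f (max 0 u)\<bar> \<le> max l (\<bar>f x\<bar> + 1)" if "u \<in> {c..d}" for u
      proof -
        consider "u < x" | "u = x" | "u > x" by linarith
        then show ?thesis
        proof cases
          case 1
          then show ?thesis using a(2)[of u] cd that by (auto simp: le_max_iff_disj)
        next
          case 2
          then show ?thesis using x by (auto simp: le_max_iff_disj)
        next
          case 3
          then have "\<bar>f u - f x\<bar> < 1" using cd that by (intro b(2)) auto
          then show ?thesis using 3 x by (auto simp: le_max_iff_disj)
        qed
      qed
      then show "\<exists>B. \<forall>u\<in>{c..d}. \<bar>f (max 0 u)\<bar> \<le> B" by blast
    qed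
  qed
  then show ?thesis by (force simp: max_def)
qed

text \<open>Jumps of size 1 mean that each point has a neighbourhood in which the path grows by at most 1; by
  compactness one mesh width serves all points of the interval.\<close>

lemma simple_counting_path_locally_unit:
  assumes f: "simple_counting_path f" and t: "0 \<le> t"
  obtains \<delta> where "\<delta> > 0" "\<And>u v. t \<le> u \<Longrightarrow> u \<le> v \<Longrightarrow> v \<le> s \<Longrightarrow> v - u < \<delta> \<Longrightarrow> f v \<le> f u + 1"
proof -
  have mono: "f u \<le> f v" if "0 \<le> u" "u \<le> v" for u v
    using f that by (auto simp: simple_counting_path_def mono_on_def)
  have "\<exists>e>0. \<forall>u v. 0 \<le> u \<and> u \<le> v \<and> x - e < u \<and> v < x + e \<longrightarrow> f v \<le> f u + 1" if x: "0 \<le> x" for x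
  proof -
    have "(f \<longlongrightarrow> f x) (at_right x)" using f x by (auto simp: simple_counting_path_def)
    then have "\<forall>\<^sub>F y in at_right x. f y = f x" by (simp add: tendsto_discrete)
    then obtain b where b: "b > x" "\<And>y. x < y \<Longrightarrow> y < b \<Longrightarrow> f y = f x"
      unfolding eventually_at_right_field by auto
    have "\<exists>a<x. \<forall>y. 0 \<le> y \<and> a < y \<and> y < x \<longrightarrow> f x \<le> f y + 1"
    proof (cases "x = 0")
      case False
      then have "\<forall>\<^sub>F y in at_left x. f x \<le> f y + 1" using f x by (auto simp: simple_counting_path_def)
      then show ?thesis unfolding eventually_at_left_field by auto
    qed (auto intro!: exI[of _ "-1"])
    then obtain a where a: "a < x" "\<And>y. 0 \<le> y \<Longrightarrow> a < y \<Longrightarrow> y < x \<Longrightarrow> f x \<le> f y + 1" by blast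
    show ?thesis
    proof (intro exI[of _ "min (x - a) (b - x)"] conjI allI impI)
      show "0 < min (x - a) (b - x)" using a b by simp
      fix u v assume uv: "0 \<le> u \<and> u \<le> v \<and> x - min (x - a) (b - x) < u \<and> v < x + min (x - a) (b - x)"
      have "min (x - a) (b - x) \<le> x - a" "min (x - a) (b - x) \<le> b - x" by auto
      then have ab: "a < u" "v < b" using uv by linarith+
      have v: "f v \<le> f x" using mono[of v x] b(2)[of v] uv ab by (cases "v \<le> x") auto
      show "f v \<le> f u + 1"
      proof (cases "u < x")
        case True
        then show ?thesis using a(2)[of u] uv v ab by auto
      next
        case False
        then show ?thesis using mono[of x u] x v by auto
      qed
    qed
  qed
  then obtain e where e: "\<And>x. 0 \<le> x \<Longrightarrow> e x > 0"
    "\<And>x u v. 0 \<le> x \<Longrightarrow> 0 \<le> u \<Longrightarrow> u \<le> v \<Longrightarrow> x - e x < u \<Longrightarrow> v < x + e x \<Longrightarrow> f v \<le> f u + 1"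
    by metis
  have "\<exists>d>0. \<forall>x\<in>{t..s}. \<exists>G\<in>(\<lambda>x. {x - e x<..<x + e x}) ` {t..s}. ball x d \<subseteq> G"
  proof (rule Heine_Borel_lemma)
    show "{t..s} \<subseteq> \<Union> ((\<lambda>x. {x - e x<..<x + e x}) ` {t..s})"
    proof
      fix x assume "x \<in> {t..s}"
      moreover have "x \<in> {x - e x<..<x + e x}" using e(1)[of x] calculation t by auto
      ultimately show "x \<in> \<Union> ((\<lambda>x. {x - e x<..<x + e x}) ` {t..s})" by blast
    qed
  qed auto
  then obtain d where d: "d > 0" "\<And>x. x \<in> {t..s} \<Longrightarrow> \<exists>y\<in>{t..s}. ball x d \<subseteq> {y - e y<..<y + e y}" by auto
  show ?thesis
  proof (rule that[OF d(1)])
    fix u v assume uv: "t \<le> u" "u \<le> v" "v \<le> s" "v - u < d"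
    obtain y where y: "y \<in> {t..s}" "ball u d \<subseteq> {y - e y<..<y + e y}" using d(2)[of u] uv by auto
    have "u \<in> ball u d" "v \<in> ball u d" using uv d(1) by (auto simp: dist_real_def)
    then have "u \<in> {y - e y<..<y + e y}" "v \<in> {y - e y<..<y + e y}" using y(2) by blast+
    then have "y - e y < u" "v < y + e y" by auto
    then show "f v \<le> f u + 1" using e(2)[of y u v] y(1) uv t by auto
  qed
qed

lemma sum_squares_le_square_sum:
  fixes f :: "'i \<Rightarrow> real"
  assumes "finite I" "\<And>i. i \<in> I \<Longrightarrow> 0 \<le> f i"
  shows "(\<Sum>i\<in>I. (f i)\<^sup>2) \<le> (\<Sum>i\<in>I. f i)\<^sup>2"
proof -
  have "(\<Sum>i\<in>I. (f i)\<^sup>2) \<le> (\<Sum>i\<in>I. f i * (\<Sum>i\<in>I. f i))"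
    unfolding power2_eq_square using assms by (intro sum_mono mult_left_mono member_le_sum) auto
  then show ?thesis by (simp add: power2_eq_square sum_distrib_right)
qed

text \<open>The covariation of a path of bounded variation and a continuous path is zero: by uniform continuity the
  increments of \<open>J\<close> become small simultaneously, and they are weighted by a bounded total.\<close>

lemma sum_increments_continuous_tendsto_0:
  fixes J :: "real \<Rightarrow> real" and D :: "nat \<Rightarrow> nat \<Rightarrow> real"
  assumes J: "continuous_on {t..s} J" and w: "\<And>n i. i \<le> N n \<Longrightarrow> w n i \<in> {t..s}"
    and mesh: "\<And>n i. i < N n \<Longrightarrow> \<bar>w n (Suc i) - w n i\<bar> \<le> \<delta> n" "\<delta> \<longlonglongrightarrow> 0"
    and bv: "\<And>n. (\<Sum>i<N n. \<bar>D n i\<bar>) \<le> B"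
  shows "(\<lambda>n. \<Sum>i<N n. D n i * (J (w n (Suc i)) - J (w n i))) \<longlonglongrightarrow> 0"
proof (rule LIMSEQ_I)
  fix e :: real assume e: "e > 0"
  have B: "0 \<le> B" using bv[of 0] by (rule order_trans[rotated]) (auto intro: sum_nonneg)
  have e': "e / (B + 1) > 0" using e B by simp
  have "uniformly_continuous_on {t..s} J" using J by (intro compact_uniformly_continuous) auto
  then obtain d where d: "d > 0" "\<And>x y. x \<in> {t..s} \<Longrightarrow> y \<in> {t..s} \<Longrightarrow> dist y x < d \<Longrightarrow> dist (J y) (J x) < e / (B + 1)"
    unfolding uniformly_continuous_on_def using e' by metis
  have "\<forall>\<^sub>F n in sequentially. \<delta> n < d" by (rule order_tendstoD(2)[OF mesh(2) d(1)])
  then obtain n0 where n0: "\<And>n. n \<ge> n0 \<Longrightarrow> \<delta> n < d" unfolding eventually_sequentially by auto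
  show "\<exists>no. \<forall>n\<ge>no. norm ((\<Sum>i<N n. D n i * (J (w n (Suc i)) - J (w n i))) - 0) < e"
  proof (intro exI allI impI)
    fix n assume n: "n \<ge> n0"
    have "\<bar>\<Sum>i<N n. D n i * (J (w n (Suc i)) - J (w n i))\<bar> \<le> (\<Sum>i<N n. \<bar>D n i\<bar> * (e / (B + 1)))"
    proof (rule order_trans[OF sum_abs], rule sum_mono)
      fix i assume "i \<in> {..<N n}"
      then have "dist (J (w n (Suc i))) (J (w n i)) < e / (B + 1)"
        using w[of i n] w[of "Suc i" n] mesh(1)[of i n] n0[OF n] by (intro d(2)) (auto simp: dist_real_def)
      then show "\<bar>D n i * (J (w n (Suc i)) - J (w n i))\<bar> \<le> \<bar>D n i\<bar> * (e / (B + 1))"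
        unfolding abs_mult dist_real_def by (intro mult_left_mono) auto
    qed
    also have "\<dots> = (\<Sum>i<N n. \<bar>D n i\<bar>) * (e / (B + 1))" by (rule sum_distrib_right[symmetric])
    also have "\<dots> \<le> B * (e / (B + 1))" using e' by (intro mult_right_mono bv) auto
    also have "\<dots> < e" using B e by (simp add: field_simps)
    finally show "norm ((\<Sum>i<N n. D n i * (J (w n (Suc i)) - J (w n i))) - 0) < e" by simp
  qed
qed

section \<open>The Cox-Ingersoll-Ross process with Hawkes jumps\<close>

locale stable_cir_hawkes = cir_hawkes +
  assumes params: "a > 0" "b > 0" "c > 0" "\<alpha> > 0" "\<beta> > 0" "\<sigma> > 0" and stable: "b > a * \<beta>"

sublocale stable_cir_hawkes \<subseteq> brownian_space M F W
  by unfold_locales (rule brownian)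

context stable_cir_hawkes
begin

definition cum :: "real \<Rightarrow> 'a \<Rightarrow> real" where
  "cum u \<omega> = (LINT v:{0..u}|lborel. r v \<omega>)"

definition compensated :: "real \<Rightarrow> 'a \<Rightarrow> real" where
  "compensated u \<omega> = real (N u \<omega>) - \<alpha> * u - \<beta> * cum u \<omega>"

text \<open>A version of the Ito integral of \<open>sqrt r\<close>, obtained by solving the equation for it. Unlike the
  integral it is adapted and right-continuous at every point of the sample space, with no null set to be
  added to the filtration.\<close>

definition ito_part :: "real \<Rightarrow> 'a \<Rightarrow> real" where
  "ito_part u \<omega> = (r u \<omega> - r 0 \<omega> - b * c * u + b * cum u \<omega> - a * real (N u \<omega>)) / \<sigma>"

lemma r_measurable: "0 \<le> u \<Longrightarrow> r u \<in> borel_measurable (F u)"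
  using r_adapted by (auto simp: adapted_def)

lemma r_right_continuous:
  "\<omega> \<in> space M \<Longrightarrow> 0 \<le> u \<Longrightarrow> ((\<lambda>v. r v \<omega>) \<longlongrightarrow> r u \<omega>) (at_right u)"
  using r_cadlag by (auto simp: cadlag_def)

lemma N_path: "\<omega> \<in> space M \<Longrightarrow> simple_counting_path (\<lambda>u. N u \<omega>)"
  using point_process by (auto simp: simple_point_process_def)

lemma N_mono: "\<omega> \<in> space M \<Longrightarrow> 0 \<le> u \<Longrightarrow> u \<le> v \<Longrightarrow> N u \<omega> \<le> N v \<omega>"
  using N_path by (auto simp: simple_counting_path_def mono_on_def)

lemma N_right_continuous:
  assumes "\<omega> \<in> space M" "0 \<le> u"
  shows "((\<lambda>v. real (N v \<omega>)) \<longlongrightarrow> real (N u \<omega>)) (at_right u)"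
proof -
  have "((\<lambda>v. N v \<omega>) \<longlongrightarrow> N u \<omega>) (at_right u)"
    using N_path[OF assms(1)] assms(2) by (auto simp: simple_counting_path_def)
  then have "\<forall>\<^sub>F v in at_right u. N v \<omega> = N u \<omega>" by (simp add: tendsto_discrete)
  then have "\<forall>\<^sub>F v in at_right u. real (N v \<omega>) = real (N u \<omega>)" by eventually_elim simp
  then show ?thesis by (rule tendsto_eventually)
qed

lemma N_measurable: "0 \<le> u \<Longrightarrow> (\<lambda>\<omega>. real (N u \<omega>)) \<in> borel_measurable (F u)"
proof -
  assume "0 \<le> u"
  then have "N u \<in> borel_measurable (F u)"
    using point_process by (auto simp: simple_point_process_def adapted_def)
  moreover have "(real :: nat \<Rightarrow> real) \<in> borel_measurable borel"
    by (intro borel_measurable_continuous_onI) (auto simp: continuous_on_def tendsto_discrete intro!: tendsto_eventually)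
  ultimately show ?thesis by (rule measurable_compose)
qed

lemma sqrt_r_progressive: "progressively_measurable (\<lambda>u \<omega>. sqrt (r u \<omega>))"
  using sde by (auto simp: ito_integral_def)

text \<open>The definition of the Ito integral provides progressive measurability of \<open>sqrt r\<close>, and
  \<open>r\<close> is its square.\<close>

lemma r_jointly_measurable:
  assumes "0 \<le> s"
  shows "(\<lambda>(\<omega>, u). r (max 0 (min s u)) \<omega>) \<in> borel_measurable (F s \<Otimes>\<^sub>M borel)"
proof -
  have "(\<lambda>x. (case x of (\<omega>, u) \<Rightarrow> sqrt (r (max 0 (min s u)) \<omega>))\<^sup>2) \<in> borel_measurable (F s \<Otimes>\<^sub>M borel)"
    by (intro borel_measurable_power progressive_clamped_measurable[OF sqrt_r_progressive assms])
  then show ?thesis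
    by (rule measurable_cong[THEN iffD1, rotated])
      (auto simp: space_pair_measure space_F intro!: r_nonneg)
qed

lemma r_path_bounded:
  assumes "\<omega> \<in> space M" "0 \<le> s"
  obtains B where "\<And>u. 0 \<le> u \<Longrightarrow> u \<le> s \<Longrightarrow> r u \<omega> \<le> B"
  using cadlag_bounded[OF r_cadlag[OF assms(1)] assms(2)] by (meson abs_le_D1 atLeastAtMost_iff)

lemma r_path_measurable:
  assumes "\<omega> \<in> space M" "0 \<le> s"
  shows "(\<lambda>u. r (max 0 (min s u)) \<omega>) \<in> borel_measurable borel"
proof -
  have "\<omega> \<in> space (F s)" using assms by (simp add: space_F)
  from measurable_compose[OF measurable_Pair1'[OF this] r_jointly_measurable[OF assms(2)]] show ?thesis by simp
qed

lemma r_interval_integrable: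
  assumes w: "\<omega> \<in> space M" and uv: "0 \<le> u" "u \<le> v"
  shows "integrable lborel (\<lambda>x. indicator {u<..v} x * r x \<omega>)" "integrable lborel (\<lambda>x. indicator {0..v} x * r x \<omega>)"
proof -
  have v: "0 \<le> v" using uv by simp
  obtain B where B: "\<And>x. 0 \<le> x \<Longrightarrow> x \<le> v \<Longrightarrow> r x \<omega> \<le> B" using r_path_bounded[OF w v] by blast
  note [measurable] = r_path_measurable[OF w v]
  show *: "integrable lborel (\<lambda>x. indicator {0..v} x * r x \<omega>)"
  proof (rule Bochner_Integration.integrable_bound)
    show "integrable lborel (\<lambda>x. indicator {0..v} x * B)"
      by (intro integrable_mult_left integrable_indicator_interval)
    have "(\<lambda>x. indicator {0..v} x * r (max 0 (min v x)) \<omega>) \<in> borel_measurable lborel" by measurable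
    moreover have "(\<lambda>x. indicator {0..v} x * r (max 0 (min v x)) \<omega>) = (\<lambda>x. indicator {0..v} x * r x \<omega>)"
      by (auto simp: indicator_def fun_eq_iff)
    ultimately show "(\<lambda>x. indicator {0..v} x * r x \<omega>) \<in> borel_measurable lborel" by simp
    show "AE x in lborel. norm (indicator {0..v} x * r x \<omega>) \<le> norm (indicator {0..v} x * B)"
    proof (rule AE_I2)
      fix x
      show "norm (indicator {0..v} x * r x \<omega>) \<le> norm (indicator {0..v} x * B)"
        using B[of x] r_nonneg[of x \<omega>] w by (cases "x \<in> {0..v}") (auto intro: order_trans)
    qed
  qed
  have "integrable lborel (\<lambda>x. indicator {u<..v} x *\<^sub>R (indicator {0..v} x * r x \<omega>))"
    by (rule integrable_mult_indicator[OF _ *]) simp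
  moreover have "(\<lambda>x. indicator {u<..v} x *\<^sub>R (indicator {0..v} x * r x \<omega>)) = (\<lambda>x. indicator {u<..v} x * r x \<omega>)"
    using uv by (auto simp: indicator_def fun_eq_iff)
  ultimately show "integrable lborel (\<lambda>x. indicator {u<..v} x * r x \<omega>)" by simp
qed

lemma cum_diff:
  assumes w: "\<omega> \<in> space M" and uv: "0 \<le> u" "u \<le> v"
  shows "cum v \<omega> - cum u \<omega> = (\<integral>x. indicator {u<..v} x * r x \<omega> \<partial>lborel)"
    "ennreal (cum v \<omega> - cum u \<omega>) = (\<integral>\<^sup>+x. ennreal (indicator {u<..v} x * r x \<omega>) \<partial>lborel)"
    "cum u \<omega> \<le> cum v \<omega>"
proof -
  have "(\<integral>x. indicator {u<..v} x * r x \<omega> \<partial>lborel)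
      = (\<integral>x. indicator {0..v} x * r x \<omega> - indicator {0..u} x * r x \<omega> \<partial>lborel)"
    using uv by (intro Bochner_Integration.integral_cong) (auto simp: indicator_def)
  also have "\<dots> = cum v \<omega> - cum u \<omega>"
    unfolding cum_def set_lebesgue_integral_def real_scaleR_def
    using r_interval_integrable(2)[OF w, of u u] r_interval_integrable(2)[OF w, of u v] uv
    by (intro Bochner_Integration.integral_diff) auto
  finally show 1: "cum v \<omega> - cum u \<omega> = (\<integral>x. indicator {u<..v} x * r x \<omega> \<partial>lborel)" ..
  have nn: "0 \<le> indicator {u<..v} x * r x \<omega>" for x
    using r_nonneg[of x \<omega>] w uv by (auto simp: indicator_def)
  show "ennreal (cum v \<omega> - cum u \<omega>) = (\<integral>\<^sup>+x. ennreal (indicator {u<..v} x * r x \<omega>) \<partial>lborel)"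
    unfolding 1 by (rule nn_integral_eq_integral[symmetric, OF r_interval_integrable(1)[OF w uv]]) (simp add: nn)
  have "0 \<le> (\<integral>x. indicator {u<..v} x * r x \<omega> \<partial>lborel)" by (rule integral_nonneg_AE) (simp add: nn)
  then show "cum u \<omega> \<le> cum v \<omega>" using 1 by simp
qed

text \<open>Paths of \<open>r\<close> are bounded on bounded intervals, so their integrals are locally Lipschitz.\<close>

lemma cum_continuous:
  assumes w: "\<omega> \<in> space M"
  shows "continuous_on {0..} (\<lambda>u. cum u \<omega>)"
  unfolding continuous_on_iff
proof (intro ballI allI impI)
  fix x e :: real assume x: "x \<in> {0..}" and e: "0 < e"
  obtain B where B: "\<And>u. 0 \<le> u \<Longrightarrow> u \<le> x + 1 \<Longrightarrow> r u \<omega> \<le> B"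
    using r_path_bounded[OF w, of "x + 1"] x by auto
  have B0: "0 \<le> B" using B[of 0] r_nonneg[of 0 \<omega>] w x by auto
  have lip: "cum v \<omega> - cum u \<omega> \<le> B * (v - u)" if "0 \<le> u" "u \<le> v" "v \<le> x + 1" for u v
  proof -
    have "cum v \<omega> - cum u \<omega> \<le> (\<integral>y. indicator {u<..v} y * B \<partial>lborel)"
      unfolding cum_diff(1)[OF w that(1,2)]
    proof (rule integral_mono[OF r_interval_integrable(1)[OF w that(1,2)]])
      show "integrable lborel (\<lambda>y. indicator {u<..v} y * B)"
        by (intro integrable_mult_left integrable_indicator_interval)
    qed (use that B in \<open>auto simp: indicator_def\<close>)
    also have "\<dots> = B * (v - u)" using that by simp
    finally show ?thesis .
  qed
  show "\<exists>d>0. \<forall>x'\<in>{0..}. dist x' x < d \<longrightarrow> dist (cum x' \<omega>) (cum x \<omega>) < e"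
  proof (rule exI[of _ "min 1 (e / (B + 1))"], intro conjI ballI impI)
    show "0 < min 1 (e / (B + 1))" using e B0 by simp
    fix y assume y: "y \<in> {0..}" "dist y x < min 1 (e / (B + 1))"
    have "\<bar>cum y \<omega> - cum x \<omega>\<bar> \<le> B * \<bar>y - x\<bar>"
    proof (cases "x \<le> y")
      case True
      then show ?thesis using lip[of x y] cum_diff(3)[OF w, of x y] x y by (auto simp: dist_real_def)
    next
      case False
      then show ?thesis using lip[of y x] cum_diff(3)[OF w, of y x] x y by (auto simp: dist_real_def)
    qed
    also have "\<dots> \<le> (B + 1) * \<bar>y - x\<bar>" by (intro mult_right_mono) auto
    also have "\<dots> < (B + 1) * (e / (B + 1))" using y B0 by (intro mult_strict_left_mono) (auto simp: dist_real_def)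
    also have "\<dots> = e" using B0 by simp
    finally show "dist (cum y \<omega>) (cum x \<omega>) < e" by (simp add: dist_real_def)
  qed
qed

lemma cum_measurable:
  assumes "0 \<le> u" shows "cum u \<in> borel_measurable (F u)"
proof -
  note [measurable] = r_jointly_measurable[OF assms]
  have "(\<lambda>\<omega>. \<integral>x. indicator {0..u} x * r (max 0 (min u x)) \<omega> \<partial>lborel) \<in> borel_measurable (F u)"
    by (rule lborel.borel_measurable_lebesgue_integral) measurable
  moreover have "(\<lambda>\<omega>. \<integral>x. indicator {0..u} x * r (max 0 (min u x)) \<omega> \<partial>lborel) = cum u"
    unfolding cum_def[abs_def] set_lebesgue_integral_def
    by (intro ext Bochner_Integration.integral_cong) (auto simp: indicator_def)
  ultimately show ?thesis by simp
qed

lemma cum_right_continuous: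
  "\<omega> \<in> space M \<Longrightarrow> 0 \<le> u \<Longrightarrow> ((\<lambda>v. cum v \<omega>) \<longlongrightarrow> cum u \<omega>) (at_right u)"
  by (rule continuous_on_imp_right[OF cum_continuous])

lemma compensated_measurable: "0 \<le> u \<Longrightarrow> compensated u \<in> borel_measurable (F u)"
  unfolding compensated_def[abs_def] using N_measurable[of u] cum_measurable[of u] by auto

lemma compensated_right_continuous:
  "\<omega> \<in> space M \<Longrightarrow> 0 \<le> u \<Longrightarrow> ((\<lambda>v. compensated v \<omega>) \<longlongrightarrow> compensated u \<omega>) (at_right u)"
  unfolding compensated_def by (intro tendsto_intros N_right_continuous cum_right_continuous)

lemma ito_part_measurable:
  assumes "0 \<le> u" shows "ito_part u \<in> borel_measurable (F u)"
proof -
  have [measurable]: "r 0 \<in> borel_measurable (F u)" by (rule measurable_F_mono[OF r_measurable]) (use assms in auto)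
  note [measurable] = r_measurable[OF assms] cum_measurable[OF assms] N_measurable[OF assms]
  show ?thesis unfolding ito_part_def[abs_def] by measurable
qed

lemma ito_part_right_continuous:
  "\<omega> \<in> space M \<Longrightarrow> 0 \<le> u \<Longrightarrow> ((\<lambda>v. ito_part v \<omega>) \<longlongrightarrow> ito_part u \<omega>) (at_right u)"
  unfolding ito_part_def using params
  by (intro tendsto_intros N_right_continuous cum_right_continuous r_right_continuous) auto

lemma r_decomposition:
  "r u \<omega> = r 0 \<omega> + (b * c + a * \<alpha>) * u - (b - a * \<beta>) * cum u \<omega> + (a * compensated u \<omega> + \<sigma> * ito_part u \<omega>)"
proof -
  have "\<sigma> * ito_part u \<omega> = r u \<omega> - r 0 \<omega> - b * c * u + b * cum u \<omega> - a * real (N u \<omega>)"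
    using params by (simp add: ito_part_def)
  then show ?thesis by (simp add: compensated_def algebra_simps)
qed

lemma ito_part_is_integral:
  obtains I where "ito_integral W (\<lambda>u \<omega>. sqrt (r u \<omega>)) I" "AE \<omega> in M. \<forall>u\<ge>0. I u \<omega> = ito_part u \<omega>"
proof -
  obtain I where I: "ito_integral W (\<lambda>u \<omega>. sqrt (r u \<omega>)) I"
    and eq: "AE \<omega> in M. \<forall>t\<ge>0. r t \<omega> = r 0 \<omega> + (LINT u:{0..t}|lborel. b * (c - r u \<omega>)) + a * real (N t \<omega>) + \<sigma> * I t \<omega>"
    using sde by blast
  have "AE \<omega> in M. \<forall>u\<ge>0. I u \<omega> = ito_part u \<omega>"
    using eq AE_space
  proof eventually_elim
    case (elim \<omega>)
    show ?case
    proof (intro allI impI)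
      fix u :: real assume u: "0 \<le> u"
      have "(LINT v:{0..u}|lborel. b * (c - r v \<omega>)) = (\<integral>v. (b * c) * indicator {0..u} v - b * (indicator {0..u} v * r v \<omega>) \<partial>lborel)"
        unfolding set_lebesgue_integral_def
        by (intro Bochner_Integration.integral_cong) (auto simp: indicator_def algebra_simps)
      also have "\<dots> = (\<integral>v. (b * c) * indicator {0..u} v \<partial>lborel) - (\<integral>v. b * (indicator {0..u} v * r v \<omega>) \<partial>lborel)"
        by (intro Bochner_Integration.integral_diff integrable_mult_right integrable_indicator_interval
            r_interval_integrable(2)[OF elim(2) order_refl u])
      also have "\<dots> = b * c * u - b * cum u \<omega>"
        using u by (simp add: cum_def set_lebesgue_integral_def)
      finally have L: "(LINT v:{0..u}|lborel. b * (c - r v \<omega>)) = b * c * u - b * cum u \<omega>" .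
      have "r u \<omega> = r 0 \<omega> + (LINT v:{0..u}|lborel. b * (c - r v \<omega>)) + a * real (N u \<omega>) + \<sigma> * I u \<omega>"
        using elim(1) u by blast
      then have "r u \<omega> = r 0 \<omega> + (b * c * u - b * cum u \<omega>) + a * real (N u \<omega>) + \<sigma> * I u \<omega>"
        unfolding L .
      then have "r u \<omega> - r 0 \<omega> - b * c * u + b * cum u \<omega> - a * real (N u \<omega>) = \<sigma> * I u \<omega>" by linarith
      then show "I u \<omega> = ito_part u \<omega>" unfolding ito_part_def using params by simp
    qed
  qed
  with I show ?thesis by (rule that)
qed

lemma ito_part_continuous: "AE \<omega> in M. continuous_on {0..} (\<lambda>u. ito_part u \<omega>)"
proof -
  obtain I where I: "ito_integral W (\<lambda>u \<omega>. sqrt (r u \<omega>)) I" "AE \<omega> in M. \<forall>u\<ge>0. I u \<omega> = ito_part u \<omega>"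
    by (rule ito_part_is_integral)
  have "AE \<omega> in M. continuous_on {0..} (\<lambda>u. I u \<omega>)" using I(1) by (auto simp: ito_integral_def)
  with I(2) show ?thesis
  proof eventually_elim
    case (elim \<omega>)
    have "continuous_on {0..} (\<lambda>u. I u \<omega>) = continuous_on {0..} (\<lambda>u. ito_part u \<omega>)"
      by (rule continuous_on_cong[OF refl]) (use elim(1) in auto)
    then show ?case using elim(2) by simp
  qed
qed

text \<open>The process \<open>r\<close> can be discontinuous only where \<open>N\<close> is, since all other terms of
  the equation are continuous, and the increasing path of \<open>N\<close> has countably many
  discontinuities.\<close>

lemma AE_left_lim_r:
  "AE \<omega> in M. countable {u. 0 \<le> u \<and> left_lim (\<lambda>v. r v \<omega>) u \<noteq> r u \<omega>}"
  using ito_part_continuous AE_space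
proof eventually_elim
  case (elim \<omega>)
  note w = elim(2)
  define f where "f u = real (N u \<omega>)" for u
  have "mono_on {0..} f" using N_mono[OF w] by (auto simp: f_def mono_on_def)
  then have "countable {u \<in> {0..}. \<not> continuous (at u within {0..}) f}" by (rule mono_on_ctble_discont)
  then show ?case
  proof (rule countable_subset[rotated], safe)
    fix u :: real assume u: "0 \<le> u" and ne: "left_lim (\<lambda>v. r v \<omega>) u \<noteq> r u \<omega>" and cont: "continuous (at u within {0..}) f"
    have u0: "u > 0" using u ne by (cases "u = 0") (auto simp: left_lim_def)
    have le: "at_left u \<le> at u within {0..}"
    proof -
      have "at_left u = at u within {0<..<u}" using u0 by (intro at_within_nhd[of _ "{0<..}"]) auto
      also have "\<dots> \<le> at u within {0..}" by (intro at_le) auto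
      finally show ?thesis .
    qed
    have l: "(f \<longlongrightarrow> f u) (at_left u)" using cont by (intro tendsto_mono[OF le]) (simp add: continuous_within)
    have l2: "((\<lambda>u. cum u \<omega>) \<longlongrightarrow> cum u \<omega>) (at_left u)" "((\<lambda>u. ito_part u \<omega>) \<longlongrightarrow> ito_part u \<omega>) (at_left u)"
      using cum_continuous[OF w] elim(1) u by (auto simp: continuous_on_def intro!: tendsto_mono[OF le])
    have eq: "r v \<omega> = r 0 \<omega> + b * c * v - b * cum v \<omega> + a * f v + \<sigma> * ito_part v \<omega>" for v
      using params by (simp add: ito_part_def f_def)
    have "((\<lambda>v. r 0 \<omega> + b * c * v - b * cum v \<omega> + a * f v + \<sigma> * ito_part v \<omega>) \<longlongrightarrow>
        r 0 \<omega> + b * c * u - b * cum u \<omega> + a * f u + \<sigma> * ito_part u \<omega>) (at_left u)"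
      by (intro tendsto_intros l l2)
    then have "((\<lambda>v. r v \<omega>) \<longlongrightarrow> r u \<omega>) (at_left u)" by (simp only: eq[symmetric])
    then have "left_lim (\<lambda>v. r v \<omega>) u = r u \<omega>"
      using u0 by (auto simp: left_lim_def intro: tendsto_Lim)
    then show False using ne by simp
  qed
qed

text \<open>The intensity is evaluated at left limits, which differ from \<open>r\<close> only on a countable set of
  times, invisible to the time integral.\<close>

lemma compensated_is_compensated:
  "AE \<omega> in M. \<forall>u\<ge>0. real (N u \<omega>) - (LINT v:{0..u}|lborel. \<alpha> + \<beta> * left_lim (\<lambda>w. r w \<omega>) v) = compensated u \<omega>"
proof -
  have "AE \<omega> in M. \<forall>t\<ge>0. set_integrable lborel {0..t} (\<lambda>u. \<alpha> + \<beta> * left_lim (\<lambda>u. r u \<omega>) u)"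
    using intensity by (auto simp: has_intensity_def)
  then show ?thesis using AE_left_lim_r AE_space
  proof eventually_elim
    case (elim \<omega>)
    show ?case
    proof (intro allI impI)
      fix u :: real assume u: "0 \<le> u"
      have "(LINT v:{0..u}|lborel. \<alpha> + \<beta> * left_lim (\<lambda>w. r w \<omega>) v)
        = (\<integral>v. \<alpha> * indicator {0..u} v + \<beta> * (indicator {0..u} v * r v \<omega>) \<partial>lborel)"
        unfolding set_lebesgue_integral_def
      proof (rule integral_cong_AE)
        show "(\<lambda>v. indicator {0..u} v *\<^sub>R (\<alpha> + \<beta> * left_lim (\<lambda>w. r w \<omega>) v)) \<in> borel_measurable lborel"
          using elim(1) u by (auto simp: set_integrable_def dest: borel_measurable_integrable)
        show "(\<lambda>v. \<alpha> * indicator {0..u} v + \<beta> * (indicator {0..u} v * r v \<omega>)) \<in> borel_measurable lborel"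
          using borel_measurable_integrable[OF r_interval_integrable(2)[OF elim(3) order_refl u]] by auto
        have "AE v in lborel. v \<notin> {v. 0 \<le> v \<and> left_lim (\<lambda>w. r w \<omega>) v \<noteq> r v \<omega>}"
          by (rule AE_not_in) (rule countable_imp_null_set_lborel[OF elim(2)])
        then show "AE v in lborel. indicator {0..u} v *\<^sub>R (\<alpha> + \<beta> * left_lim (\<lambda>w. r w \<omega>) v) =
          \<alpha> * indicator {0..u} v + \<beta> * (indicator {0..u} v * r v \<omega>)"
          by eventually_elim (auto simp: indicator_def)
      qed
      also have "\<dots> = (\<integral>v. \<alpha> * indicator {0..u} v \<partial>lborel) + (\<integral>v. \<beta> * (indicator {0..u} v * r v \<omega>) \<partial>lborel)"
        by (intro Bochner_Integration.integral_add integrable_mult_right integrable_indicator_interval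
            r_interval_integrable(2)[OF elim(3) order_refl u])
      also have "\<dots> = \<alpha> * u + \<beta> * cum u \<omega>"
        using u by (simp add: cum_def set_lebesgue_integral_def)
      finally show "real (N u \<omega>) - (LINT v:{0..u}|lborel. \<alpha> + \<beta> * left_lim (\<lambda>w. r w \<omega>) v) = compensated u \<omega>"
        by (simp add: compensated_def)
    qed
  qed
qed

lemma compensated_diff_bound:
  assumes "\<omega> \<in> space M" "0 \<le> u" "u \<le> v"
  shows "\<bar>compensated v \<omega> - compensated u \<omega>\<bar>
    \<le> (real (N v \<omega>) - real (N u \<omega>)) + \<alpha> * (v - u) + \<beta> * (cum v \<omega> - cum u \<omega>)"
proof -
  have "0 \<le> real (N v \<omega>) - real (N u \<omega>)" using N_mono[OF assms] by simp
  moreover have "0 \<le> \<alpha> * (v - u)" using params assms by simp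
  moreover have "0 \<le> \<beta> * (cum v \<omega> - cum u \<omega>)" using params cum_diff(3)[OF assms] by simp
  ultimately show ?thesis by (simp add: compensated_def algebra_simps)
qed

end

section \<open>Moments of the stopped noise\<close>

context stable_cir_hawkes
begin

definition stopping_between :: "('a \<Rightarrow> real) \<Rightarrow> real \<Rightarrow> real \<Rightarrow> bool" where
  "stopping_between T t s \<longleftrightarrow> stopping_time F T \<and> 0 \<le> t \<and> t \<le> s \<and> (\<forall>\<omega>\<in>space M. t \<le> T \<omega> \<and> T \<omega> \<le> s)"

lemma stopping_betweenD:
  assumes "stopping_between T t s"
  shows "stopping_time F T" "0 \<le> t" "t \<le> s" "0 \<le> s"
    "\<And>\<omega>. \<omega> \<in> space M \<Longrightarrow> t \<le> T \<omega>" "\<And>\<omega>. \<omega> \<in> space M \<Longrightarrow> T \<omega> \<le> s" "\<And>\<omega>. \<omega> \<in> space M \<Longrightarrow> 0 \<le> T \<omega>"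
  using assms unfolding stopping_between_def by (auto intro: order_trans)

lemma stopping_between_clamp:
  assumes T: "stopping_between T t s" and "t \<le> u" "u \<le> v"
  shows "stopping_between (\<lambda>\<omega>. max u (min v (T \<omega>))) u v"
  using stopping_betweenD[OF T] assms(2,3) unfolding stopping_between_def
  by (auto intro!: stopping_time_max stopping_time_min stopping_time_const)

lemma stopped_measurable:
  assumes T: "stopping_between T t s"
  shows "(\<lambda>\<omega>. compensated (T \<omega>) \<omega>) \<in> borel_measurable (F s)" "(\<lambda>\<omega>. ito_part (T \<omega>) \<omega>) \<in> borel_measurable (F s)"
    "(\<lambda>\<omega>. cum (T \<omega>) \<omega>) \<in> borel_measurable (F s)" "(\<lambda>\<omega>. real (N (T \<omega>) \<omega>)) \<in> borel_measurable (F s)"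
    "(\<lambda>\<omega>. r (T \<omega>) \<omega>) \<in> borel_measurable (F s)"
  using stopping_betweenD[OF T]
  by (auto intro!: stopped_value_measurable[of compensated T t s] stopped_value_measurable[of ito_part T t s]
      stopped_value_measurable[of cum T t s] stopped_value_measurable[of "\<lambda>u \<omega>. real (N u \<omega>)" T t s]
      stopped_value_measurable[of r T t s] compensated_measurable compensated_right_continuous
      ito_part_measurable ito_part_right_continuous cum_measurable cum_right_continuous N_measurable N_right_continuous
      r_measurable r_right_continuous)

text \<open>An increasing process that dominates both the jumps and the energy of the diffusion; bounding it makes all
  quantities up to a stopping time bounded.\<close>

definition load :: "real \<Rightarrow> 'a \<Rightarrow> real" where
  "load u \<omega> = real (N u \<omega>) + cum u \<omega>"

lemma load_mono: "\<omega> \<in> space M \<Longrightarrow> 0 \<le> u \<Longrightarrow> u \<le> v \<Longrightarrow> load u \<omega> \<le> load v \<omega>"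
  using N_mono[of \<omega> u v] cum_diff(3)[of \<omega> u v] by (simp add: load_def)

lemma load_parts:
  assumes "\<omega> \<in> space M" "0 \<le> u" "u \<le> v"
  shows "real (N v \<omega>) - real (N u \<omega>) \<le> load v \<omega> - load u \<omega>" "cum v \<omega> - cum u \<omega> \<le> load v \<omega> - load u \<omega>"
    "0 \<le> real (N v \<omega>) - real (N u \<omega>)" "0 \<le> cum v \<omega> - cum u \<omega>"
  using N_mono[OF assms] cum_diff(3)[OF assms] by (auto simp: load_def)

lemma compensated_load_bound:
  assumes w: "\<omega> \<in> space M" and uv: "0 \<le> u" "u \<le> v"
  shows "\<bar>compensated v \<omega> - compensated u \<omega>\<bar> \<le> (1 + \<beta>) * (load v \<omega> - load u \<omega>) + \<alpha> * (v - u)"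
proof -
  note l = load_parts[OF assms]
  have "\<beta> * (cum v \<omega> - cum u \<omega>) \<le> \<beta> * (load v \<omega> - load u \<omega>)" using params l by (intro mult_left_mono) auto
  then show ?thesis using compensated_diff_bound[OF assms] l by (simp add: algebra_simps)
qed

text \<open>The compensated process is a martingale only when stopped at the localizing times. Optional stopping is
  applied to these martingales, and the localization is removed by dominated convergence, the bound on the
  load providing the dominating constant.\<close>

lemma compensated_stopped:
  assumes T: "stopping_between T t s" and A: "A \<in> sets (F t)"
    and B0: "\<forall>\<omega>\<in>space M. \<omega> \<in> A \<longrightarrow> load (T \<omega>) \<omega> - load t \<omega> \<le> B"
  shows "(\<integral>\<omega>. indicator A \<omega> * (compensated (T \<omega>) \<omega> - compensated t \<omega>) \<partial>M) = 0"
proof -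
  note B = B0[rule_format]
  note TD = stopping_betweenD[OF T]
  note AM [measurable] = sets_F_M[OF A]
  define X where "X u \<omega> = real (N u \<omega>) - (LINT v:{0..u}|lborel. \<alpha> + \<beta> * left_lim (\<lambda>w. r w \<omega>) v)" for u \<omega>
  have XC: "AE \<omega> in M. \<forall>u\<ge>0. X u \<omega> = compensated u \<omega>"
    unfolding X_def by (rule compensated_is_compensated)
  have "local_martingale X"
    using intensity unfolding has_intensity_def X_def by simp
  then obtain \<tau> where \<tau>: "\<And>n. stopping_time F (\<tau> n)" "\<And>n \<omega>. \<omega> \<in> space M \<Longrightarrow> 0 \<le> \<tau> n \<omega>"
    "AE \<omega> in M. filterlim (\<lambda>n. \<tau> n \<omega>) at_top sequentially"
    "\<And>n. martingale (\<lambda>t \<omega>. X (min t (\<tau> n \<omega>)) \<omega> - X 0 \<omega>)"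
    unfolding local_martingale_def by (auto simp: eventually_conj_iff)
  define L where "L k \<omega> = indicator A \<omega> * (compensated (min (T \<omega>) (\<tau> k \<omega>)) \<omega> - compensated (min t (\<tau> k \<omega>)) \<omega>)" for k \<omega>
  have stop: "stopping_between (\<lambda>\<omega>. min (T \<omega>) (\<tau> k \<omega>)) 0 s" "stopping_between (\<lambda>\<omega>. min t (\<tau> k \<omega>)) 0 s" for k
    unfolding stopping_between_def using \<tau> TD
    by (auto intro!: stopping_time_min stopping_time_const simp: min_le_iff_disj)
  have Lm [measurable]: "L k \<in> borel_measurable M" for k
    unfolding L_def using measurable_F_M[OF stopped_measurable(1)[OF stop(1)]] measurable_F_M[OF stopped_measurable(1)[OF stop(2)]]
    by auto
  have L0: "(\<integral>\<omega>. L k \<omega> \<partial>M) = 0" for k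
  proof (rule optional_stopping(2)[where Y="\<lambda>u \<omega>. X (min u (\<tau> k \<omega>)) \<omega> - X 0 \<omega>"])
    show "stopping_time F T" "t \<le> s" "A \<in> sets (F t)" "L k \<in> borel_measurable M"
      using TD A by auto
    show "\<And>\<omega>. \<omega> \<in> space M \<Longrightarrow> t \<le> T \<omega>" "\<And>\<omega>. \<omega> \<in> space M \<Longrightarrow> T \<omega> \<le> s" using TD by auto
    note mart = \<tau>(4)[of k, unfolded martingale_def adapted_def]
    show "(\<lambda>\<omega>. X (min u (\<tau> k \<omega>)) \<omega> - X 0 \<omega>) \<in> borel_measurable (F u)" if "t \<le> u" for u
      using mart that TD by auto
    show Yi: "integrable M (\<lambda>\<omega>. X (min u (\<tau> k \<omega>)) \<omega> - X 0 \<omega>)" if "t \<le> u" for u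
      using mart that TD by auto
    show "(\<integral>\<omega>. indicator C \<omega> * (X (min v (\<tau> k \<omega>)) \<omega> - X 0 \<omega>) \<partial>M) = (\<integral>\<omega>. indicator C \<omega> * (X (min u (\<tau> k \<omega>)) \<omega> - X 0 \<omega>) \<partial>M)"
      if uv: "t \<le> u" "u \<le> v" and C: "C \<in> sets (F u)" for u v C
    proof -
      interpret G: finite_measure_subalgebra M "F u" by unfold_locales (rule subalgebra_F)
      have ce: "AE \<omega> in M. real_cond_exp M (F u) (\<lambda>\<omega>. X (min v (\<tau> k \<omega>)) \<omega> - X 0 \<omega>) \<omega> = X (min u (\<tau> k \<omega>)) \<omega> - X 0 \<omega>"
        using mart uv TD by auto
      have "(\<integral>\<omega>. indicator C \<omega> * (X (min v (\<tau> k \<omega>)) \<omega> - X 0 \<omega>) \<partial>M)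
        = (\<integral>\<omega>. indicator C \<omega> * real_cond_exp M (F u) (\<lambda>\<omega>. X (min v (\<tau> k \<omega>)) \<omega> - X 0 \<omega>) \<omega> \<partial>M)"
        using G.real_cond_exp_intA[OF Yi[of v] C] uv by (simp add: set_lebesgue_integral_def)
      also have "\<dots> = (\<integral>\<omega>. indicator C \<omega> * (X (min u (\<tau> k \<omega>)) \<omega> - X 0 \<omega>) \<partial>M)"
      proof (rule integral_cong_AE)
        show "AE \<omega> in M. indicator C \<omega> * real_cond_exp M (F u) (\<lambda>\<omega>. X (min v (\<tau> k \<omega>)) \<omega> - X 0 \<omega>) \<omega> =
          indicator C \<omega> * (X (min u (\<tau> k \<omega>)) \<omega> - X 0 \<omega>)"
          using ce by eventually_elim simp
      qed (use sets_F_M[OF C] borel_measurable_integrable[OF Yi[OF uv(1)]] in auto)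
      finally show ?thesis .
    qed
    show "AE \<omega> in M. ((\<lambda>u. X (min u (\<tau> k \<omega>)) \<omega> - X 0 \<omega>) \<longlongrightarrow> X (min (T \<omega>) (\<tau> k \<omega>)) \<omega> - X 0 \<omega>) (at_right (T \<omega>))"
      using XC AE_space
    proof eventually_elim
      case (elim \<omega>)
      have T0: "0 \<le> T \<omega>" "0 \<le> \<tau> k \<omega>" using TD \<tau> elim(2) by auto
      have "((\<lambda>u. compensated (min u (\<tau> k \<omega>)) \<omega>) \<longlongrightarrow> compensated (min (T \<omega>) (\<tau> k \<omega>)) \<omega>) (at_right (T \<omega>))"
        using T0 by (intro min_right_continuous compensated_right_continuous elim) auto
      moreover have "\<forall>\<^sub>F u in at_right (T \<omega>). compensated (min u (\<tau> k \<omega>)) \<omega> = X (min u (\<tau> k \<omega>)) \<omega>"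
        using T0 elim(1) unfolding eventually_at_right_field by (intro exI[of _ "T \<omega> + 1"]) auto
      ultimately have "((\<lambda>u. X (min u (\<tau> k \<omega>)) \<omega>) \<longlongrightarrow> compensated (min (T \<omega>) (\<tau> k \<omega>)) \<omega>) (at_right (T \<omega>))"
        by (rule Lim_transform_eventually)
      then have "((\<lambda>u. X (min u (\<tau> k \<omega>)) \<omega>) \<longlongrightarrow> X (min (T \<omega>) (\<tau> k \<omega>)) \<omega>) (at_right (T \<omega>))"
        using T0 elim(1) by simp
      then show ?case by (intro tendsto_diff tendsto_const)
    qed
    show "AE \<omega> in M. L k \<omega> = indicator A \<omega> * (X (min (T \<omega>) (\<tau> k \<omega>)) \<omega> - X 0 \<omega> - (X (min t (\<tau> k \<omega>)) \<omega> - X 0 \<omega>))"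
      using XC AE_space
    proof eventually_elim
      case (elim \<omega>)
      have "0 \<le> min (T \<omega>) (\<tau> k \<omega>)" "0 \<le> min t (\<tau> k \<omega>)" using TD \<tau> elim(2) by auto
      then show ?case using elim(1) by (simp add: L_def)
    qed
  qed
  have "(\<lambda>k. \<integral>\<omega>. L k \<omega> \<partial>M) \<longlonglongrightarrow> (\<integral>\<omega>. indicator A \<omega> * (compensated (T \<omega>) \<omega> - compensated t \<omega>) \<partial>M)"
  proof (rule integral_dominated_convergence[where w="\<lambda>_. (1 + \<beta>) * \<bar>B\<bar> + \<alpha> * (s - t)"])
    show "(\<lambda>\<omega>. indicator A \<omega> * (compensated (T \<omega>) \<omega> - compensated t \<omega>)) \<in> borel_measurable M"
      using measurable_F_M[OF stopped_measurable(1)[OF T]] measurable_F_M[OF compensated_measurable[OF TD(2)]] by auto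
    show "AE \<omega> in M. (\<lambda>k. L k \<omega>) \<longlonglongrightarrow> indicator A \<omega> * (compensated (T \<omega>) \<omega> - compensated t \<omega>)"
      using \<tau>(3) AE_space
    proof eventually_elim
      case (elim \<omega>)
      have "\<forall>\<^sub>F k in sequentially. s \<le> \<tau> k \<omega>" using elim(1) by (auto simp: filterlim_at_top)
      then have "\<forall>\<^sub>F k in sequentially. L k \<omega> = indicator A \<omega> * (compensated (T \<omega>) \<omega> - compensated t \<omega>)"
        by eventually_elim (use TD(3) TD(6)[OF elim(2)] in \<open>simp add: L_def min_def\<close>)
      then show ?case by (rule tendsto_eventually)
    qed
    show "AE \<omega> in M. norm (L k \<omega>) \<le> (1 + \<beta>) * \<bar>B\<bar> + \<alpha> * (s - t)" for k
    proof (rule AE_I2)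
      fix \<omega> assume w: "\<omega> \<in> space M"
      have pos: "0 \<le> (1 + \<beta>) * \<bar>B\<bar> + \<alpha> * (s - t)" using params TD by simp
      show "norm (L k \<omega>) \<le> (1 + \<beta>) * \<bar>B\<bar> + \<alpha> * (s - t)"
      proof (cases "\<omega> \<in> A \<and> t < \<tau> k \<omega>")
        case True
        let ?v = "min (T \<omega>) (\<tau> k \<omega>)"
        have v: "t \<le> ?v" "?v \<le> s" "?v \<le> T \<omega>" using True TD(5,6)[OF w] by auto
        have "load ?v \<omega> - load t \<omega> \<le> \<bar>B\<bar>"
          using load_mono[OF w _ v(3)] v TD(2) B[OF w] True by auto
        then have "(1 + \<beta>) * (load ?v \<omega> - load t \<omega>) \<le> (1 + \<beta>) * \<bar>B\<bar>" using params by (intro mult_left_mono) auto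
        moreover have "\<alpha> * (?v - t) \<le> \<alpha> * (s - t)" using params v by (intro mult_left_mono) auto
        ultimately have "\<bar>compensated ?v \<omega> - compensated t \<omega>\<bar> \<le> (1 + \<beta>) * \<bar>B\<bar> + \<alpha> * (s - t)"
          using compensated_load_bound[OF w TD(2) v(1)] by linarith
        then show ?thesis using True by (simp add: L_def min_def)
      next
        case False
        have "min (T \<omega>) (\<tau> k \<omega>) = min t (\<tau> k \<omega>)" if "\<omega> \<in> A"
          using False that TD(5)[OF w] by auto
        then show ?thesis using pos by (cases "\<omega> \<in> A") (auto simp: L_def)
      qed
    qed
  qed auto
  then show ?thesis using L0 by (simp add: LIMSEQ_const_iff)
qed

text \<open>The energy of \<open>sqrt r\<close> is the integral of \<open>r\<close>, which the load dominates.\<close>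

lemma ito_stopped:
  assumes T: "stopping_between T t s" and A: "A \<in> sets (F t)"
    and B0: "\<forall>\<omega>\<in>space M. \<omega> \<in> A \<longrightarrow> load (T \<omega>) \<omega> - load t \<omega> \<le> B"
  shows "integrable M (\<lambda>\<omega>. (indicator A \<omega> * (ito_part (T \<omega>) \<omega> - ito_part t \<omega>))\<^sup>2)"
    "(\<integral>\<omega>. indicator A \<omega> * (ito_part (T \<omega>) \<omega> - ito_part t \<omega>) \<partial>M) = 0"
    "integrable M (\<lambda>\<omega>. indicator A \<omega> * (cum (T \<omega>) \<omega> - cum t \<omega>))"
    "(\<integral>\<omega>. (indicator A \<omega> * (ito_part (T \<omega>) \<omega> - ito_part t \<omega>))\<^sup>2 \<partial>M)
      = (\<integral>\<omega>. indicator A \<omega> * (cum (T \<omega>) \<omega> - cum t \<omega>) \<partial>M)"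
proof -
  note B = B0[rule_format]
  note TD = stopping_betweenD[OF T]
  note AM [measurable] = sets_F_M[OF A]
  obtain I where I: "ito_integral W (\<lambda>u \<omega>. sqrt (r u \<omega>)) I" "AE \<omega> in M. \<forall>u\<ge>0. I u \<omega> = ito_part u \<omega>"
    by (rule ito_part_is_integral)
  note [measurable] = measurable_F_M[OF stopped_measurable(2)[OF T]] measurable_F_M[OF ito_part_measurable[OF TD(2)]]
    measurable_F_M[OF stopped_measurable(3)[OF T]] measurable_F_M[OF cum_measurable[OF TD(2)]]
  let ?J = "\<lambda>\<omega>. indicator A \<omega> * (ito_part (T \<omega>) \<omega> - ito_part t \<omega>)"
  have Jm: "?J \<in> borel_measurable M" by measurable
  have en: "(\<integral>\<^sup>+u. ennreal (indicator {t<..T \<omega>} u * (sqrt (r u \<omega>))\<^sup>2) \<partial>lborel) = ennreal (cum (T \<omega>) \<omega> - cum t \<omega>)"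
    if w: "\<omega> \<in> space M" for \<omega>
    unfolding cum_diff(2)[OF w TD(2) TD(5)[OF w]]
    using r_nonneg[OF _ w] TD(2) by (intro nn_integral_cong) (auto simp: indicator_def)
  have R: "AE \<omega> in M. \<omega> \<in> A \<longrightarrow> (\<integral>\<^sup>+u. ennreal (indicator {t<..T \<omega>} u * (sqrt (r u \<omega>))\<^sup>2) \<partial>lborel) \<le> ennreal \<bar>B\<bar>"
  proof (rule AE_I2, rule impI)
    fix \<omega> assume w: "\<omega> \<in> space M" and "\<omega> \<in> A"
    then show "(\<integral>\<^sup>+u. ennreal (indicator {t<..T \<omega>} u * (sqrt (r u \<omega>))\<^sup>2) \<partial>lborel) \<le> ennreal \<bar>B\<bar>"
      unfolding en[OF w] using B[of \<omega>] load_parts(2)[OF w TD(2) TD(5)[OF w]] by (intro ennreal_leI) auto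
  qed
  have JI: "AE \<omega> in M. ?J \<omega> = indicator A \<omega> * (I (T \<omega>) \<omega> - I t \<omega>)"
    using I(2) AE_space by eventually_elim (use TD in auto)
  note res = stopped_ito_integral[OF I(1) TD(1,2,3,5,6) A abs_ge_zero R Jm JI]
  show J2: "integrable M (\<lambda>\<omega>. (?J \<omega>)\<^sup>2)" "(\<integral>\<omega>. ?J \<omega> \<partial>M) = 0" using res by auto
  have nn: "0 \<le> indicator A \<omega> * (cum (T \<omega>) \<omega> - cum t \<omega>)" if "\<omega> \<in> space M" for \<omega>
    using cum_diff(3)[OF that TD(2) TD(5)[OF that]] by simp
  show ci: "integrable M (\<lambda>\<omega>. indicator A \<omega> * (cum (T \<omega>) \<omega> - cum t \<omega>))"
  proof (rule integrable_const_bound[of _ "\<bar>B\<bar>"])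
    show "AE \<omega> in M. norm (indicator A \<omega> * (cum (T \<omega>) \<omega> - cum t \<omega>)) \<le> \<bar>B\<bar>"
    proof (rule AE_I2)
      fix \<omega> assume w: "\<omega> \<in> space M"
      then show "norm (indicator A \<omega> * (cum (T \<omega>) \<omega> - cum t \<omega>)) \<le> \<bar>B\<bar>"
        using B[of \<omega>] load_parts(2,4)[OF w TD(2) TD(5)[OF w]] by (cases "\<omega> \<in> A") auto
    qed
  qed measurable
  have "ennreal (\<integral>\<omega>. (?J \<omega>)\<^sup>2 \<partial>M) = (\<integral>\<^sup>+\<omega>. ennreal ((?J \<omega>)\<^sup>2) \<partial>M)"
    by (rule nn_integral_eq_integral[symmetric, OF J2(1)]) simp
  also have "\<dots> = (\<integral>\<^sup>+\<omega>. ennreal (indicator A \<omega> * (cum (T \<omega>) \<omega> - cum t \<omega>)) \<partial>M)"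
  proof -
    have "(\<integral>\<^sup>+u. ennreal (indicator A \<omega> * (indicator {t<..T \<omega>} u * (sqrt (r u \<omega>))\<^sup>2)) \<partial>lborel)
      = ennreal (indicator A \<omega> * (cum (T \<omega>) \<omega> - cum t \<omega>))" if w: "\<omega> \<in> space M" for \<omega>
      using en[OF w] by (cases "\<omega> \<in> A") auto
    moreover have "(\<integral>\<^sup>+\<omega>. ennreal ((?J \<omega>)\<^sup>2) \<partial>M)
      = (\<integral>\<^sup>+\<omega>. (\<integral>\<^sup>+u. ennreal (indicator A \<omega> * (indicator {t<..T \<omega>} u * (sqrt (r u \<omega>))\<^sup>2)) \<partial>lborel) \<partial>M)"
      by (rule res(3))
    ultimately show ?thesis by (simp only: cong: nn_integral_cong)
  qed
  also have "\<dots> = ennreal (\<integral>\<omega>. indicator A \<omega> * (cum (T \<omega>) \<omega> - cum t \<omega>) \<partial>M)"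
    by (rule nn_integral_eq_integral[OF ci]) (use nn in auto)
  finally show "(\<integral>\<omega>. (?J \<omega>)\<^sup>2 \<partial>M) = (\<integral>\<omega>. indicator A \<omega> * (cum (T \<omega>) \<omega> - cum t \<omega>) \<partial>M)"
    by (subst (asm) ennreal_inj) (auto intro!: integral_nonneg_AE nn)
qed

text \<open>All three claims are computed as limits of sums over a grid, in which only products of increments over the
  same cell have nonzero mean. For \<open>Y\<^sup>2\<close>: increments of \<open>N\<close> over small cells
  are 0 or 1, so their squares add up to the number of jumps, and the continuous compensator contributes
  nothing; the mean number of jumps is the mean of the compensator. For \<open>Y * J\<close>: the sum of
  products is the covariation of a path of bounded variation and a continuous path, hence tends to zero, and
  it is bounded in mean square by the Cauchy-Schwarz inequality.\<close>

lemma stopped_products: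
  assumes T: "stopping_between T t s" and A: "A \<in> sets (F t)"
    and B0: "\<forall>\<omega>\<in>space M. \<omega> \<in> A \<longrightarrow> load (T \<omega>) \<omega> - load t \<omega> \<le> B"
  defines "Y \<equiv> \<lambda>\<omega>. indicator A \<omega> * (compensated (T \<omega>) \<omega> - compensated t \<omega>)"
    and "J \<equiv> \<lambda>\<omega>. indicator A \<omega> * (ito_part (T \<omega>) \<omega> - ito_part t \<omega>)"
  shows "integrable M (\<lambda>\<omega>. (Y \<omega>)\<^sup>2)"
    "(\<integral>\<omega>. (Y \<omega>)\<^sup>2 \<partial>M) = (\<integral>\<omega>. indicator A \<omega> * (\<alpha> * (T \<omega> - t) + \<beta> * (cum (T \<omega>) \<omega> - cum t \<omega>)) \<partial>M)"
    "(\<integral>\<omega>. Y \<omega> * J \<omega> \<partial>M) = 0"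
proof -
  note B = B0[rule_format]
  note TD = stopping_betweenD[OF T]
  note AM [measurable] = sets_F_M[OF A]
  note [measurable] = measurable_F_M[OF stopped_measurable(1)[OF T]] measurable_F_M[OF compensated_measurable[OF TD(2)]]
    measurable_F_M[OF stopped_measurable(2)[OF T]] measurable_F_M[OF ito_part_measurable[OF TD(2)]]
    measurable_F_M[OF stopped_measurable(3)[OF T]] measurable_F_M[OF cum_measurable[OF TD(2)]]
    measurable_F_M[OF stopped_measurable(4)[OF T]] measurable_F_M[OF N_measurable[OF TD(2)]]
    stopping_time_measurable[OF TD(1)]
  define V where "V = (1 + \<beta>) * \<bar>B\<bar> + \<alpha> * (s - t)"
  have V0: "0 \<le> V" using params TD by (simp add: V_def)
  define g where "g m = unif_grid t s (Suc m)" for m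
  have g: "t \<le> g m i" "g m i \<le> s" if "i \<le> Suc m" for m i
    using unif_grid_bounds[OF TD(3) that] by (auto simp: g_def)
  have gmono: "g m i \<le> g m j" if "i \<le> j" for m i j unfolding g_def by (rule unif_grid_mono[OF TD(3) that])
  define w where "w m i \<omega> = min (g m i) (T \<omega>)" for m i \<omega>
  have w0: "w m 0 \<omega> = t" "w m (Suc m) \<omega> = T \<omega>" if "\<omega> \<in> space M" for m \<omega>
    using TD(5,6)[OF that] by (auto simp: w_def g_def min_def)
  have wb: "t \<le> w m i \<omega>" "w m i \<omega> \<le> s" "0 \<le> w m i \<omega>" "w m i \<omega> \<le> T \<omega>" if "\<omega> \<in> space M" "i \<le> Suc m" for m i \<omega>
    using TD(2) TD(5,6)[OF that(1)] g[OF that(2)] by (auto simp: w_def)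
  have wmono: "w m i \<omega> \<le> w m (Suc i) \<omega>" for m i \<omega> using gmono[of i "Suc i" m] by (auto simp: w_def)
  define DY where "DY m i \<omega> = indicator A \<omega> * (compensated (w m (Suc i) \<omega>) \<omega> - compensated (w m i \<omega>) \<omega>)" for m i \<omega>
  define DJ where "DJ m i \<omega> = indicator A \<omega> * (ito_part (w m (Suc i) \<omega>) \<omega> - ito_part (w m i \<omega>) \<omega>)" for m i \<omega>
  \<comment> \<open>\<open>T\<close> clamped to the cell \<open>i\<close>: a stopping time to which the results on stopped increments apply, with
    the same increment as between \<open>w m i\<close> and \<open>w m (Suc i)\<close>\<close>
  define T' where "T' m i \<omega> = max (g m i) (min (g m (Suc i)) (T \<omega>))" for m i \<omega>
  have T': "stopping_between (T' m i) (g m i) (g m (Suc i))" if "i < Suc m" for m i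
    unfolding T'_def by (rule stopping_between_clamp[OF T]) (use g that gmono in auto)
  have T'w: "f (T' m i \<omega>) - f (g m i) = f (w m (Suc i) \<omega>) - f (w m i \<omega>)" for f :: "real \<Rightarrow> real" and m i \<omega>
    using gmono[of i "Suc i" m] by (auto simp: T'_def w_def min_def max_def)
  have AF: "A \<in> sets (F (g m i))" if "i \<le> Suc m" for m i using A sets_F_mono[OF g(1)[OF that]] by blast
  have B': "\<forall>\<omega>\<in>space M. \<omega> \<in> A \<longrightarrow> load (T' m i \<omega>) \<omega> - load (g m i) \<omega> \<le> \<bar>B\<bar>" if i: "i < Suc m" for m i
  proof (intro ballI impI)
    fix \<omega> assume om: "\<omega> \<in> space M" "\<omega> \<in> A"
    have "load (T' m i \<omega>) \<omega> - load (g m i) \<omega> = load (w m (Suc i) \<omega>) \<omega> - load (w m i \<omega>) \<omega>"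
      by (rule T'w[of "\<lambda>u. load u \<omega>"])
    also have "\<dots> \<le> load (T \<omega>) \<omega> - load t \<omega>"
      using load_mono[OF om(1), of "w m (Suc i) \<omega>" "T \<omega>"] load_mono[OF om(1), of t "w m i \<omega>"]
        wb[OF om(1), of i m] wb[OF om(1), of "Suc i" m] i TD(2) by auto
    also have "\<dots> \<le> \<bar>B\<bar>" using B[OF om] by simp
    finally show "load (T' m i \<omega>) \<omega> - load (g m i) \<omega> \<le> \<bar>B\<bar>" .
  qed
  have C0: "(\<integral>\<omega>. indicator C \<omega> * DY m i \<omega> \<partial>M) = 0" "(\<integral>\<omega>. indicator C \<omega> * DJ m i \<omega> \<partial>M) = 0"
    if i: "i < Suc m" and C: "C \<in> sets (F (g m i))" for m i C
  proof -
    have CA: "C \<inter> A \<in> sets (F (g m i))" using C AF[of i m] i by auto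
    have BC: "\<forall>\<omega>\<in>space M. \<omega> \<in> C \<inter> A \<longrightarrow> load (T' m i \<omega>) \<omega> - load (g m i) \<omega> \<le> \<bar>B\<bar>"
      using B'[OF i] by blast
    have "(\<integral>\<omega>. indicator (C \<inter> A) \<omega> * (compensated (T' m i \<omega>) \<omega> - compensated (g m i) \<omega>) \<partial>M) = 0"
      by (rule compensated_stopped[OF T'[OF i] CA BC])
    then show "(\<integral>\<omega>. indicator C \<omega> * DY m i \<omega> \<partial>M) = 0"
      unfolding T'w[of "\<lambda>u. compensated u _"] DY_def by (simp add: indicator_inter_arith mult.assoc)
    have "(\<integral>\<omega>. indicator (C \<inter> A) \<omega> * (ito_part (T' m i \<omega>) \<omega> - ito_part (g m i) \<omega>) \<partial>M) = 0"
      by (rule ito_stopped(2)[OF T'[OF i] CA BC])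
    then show "(\<integral>\<omega>. indicator C \<omega> * DJ m i \<omega> \<partial>M) = 0"
      unfolding T'w[of "\<lambda>u. ito_part u _"] DJ_def by (simp add: indicator_inter_arith mult.assoc)
  qed
  have ws: "stopping_between (w m i) t (g m i)" if "i \<le> Suc m" for m i
    unfolding stopping_between_def w_def using TD g[OF that]
    by (auto intro!: stopping_time_min stopping_time_const simp: min_le_iff_disj)
  have DF: "DY m i \<in> borel_measurable (F (g m (Suc i)))" "DJ m i \<in> borel_measurable (F (g m (Suc i)))"
    if i: "i < Suc m" for m i
  proof -
    have [measurable]: "A \<in> sets (F (g m (Suc i)))" using AF i by simp
    have le: "g m i \<le> g m (Suc i)" by (rule gmono) simp
    have i': "i \<le> Suc m" "Suc i \<le> Suc m" using i by auto
    note [measurable] = stopped_measurable(1,2)[OF ws[OF i'(2)]]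
      measurable_F_mono[OF stopped_measurable(1)[OF ws[OF i'(1)]] le] measurable_F_mono[OF stopped_measurable(2)[OF ws[OF i'(1)]] le]
    show "DY m i \<in> borel_measurable (F (g m (Suc i)))" "DJ m i \<in> borel_measurable (F (g m (Suc i)))"
      unfolding DY_def[abs_def] DJ_def[abs_def] by measurable
  qed
  have DM [measurable]: "DY m i \<in> borel_measurable M" "DJ m i \<in> borel_measurable M" if "i < Suc m" for m i
    using DF[OF that] by (auto intro: measurable_F_M)
  have tv: "(\<Sum>i<Suc m. \<bar>DY m i \<omega>\<bar>) \<le> V" if om: "\<omega> \<in> space M" for m \<omega>
  proof (cases "\<omega> \<in> A")
    case True
    have "(\<Sum>i<Suc m. \<bar>DY m i \<omega>\<bar>) \<le> (\<Sum>i<Suc m. ((1 + \<beta>) * load (w m (Suc i) \<omega>) \<omega> + \<alpha> * w m (Suc i) \<omega>)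
        - ((1 + \<beta>) * load (w m i \<omega>) \<omega> + \<alpha> * w m i \<omega>))"
    proof (rule sum_mono)
      fix i assume "i \<in> {..<Suc m}"
      then show "\<bar>DY m i \<omega>\<bar> \<le> ((1 + \<beta>) * load (w m (Suc i) \<omega>) \<omega> + \<alpha> * w m (Suc i) \<omega>) - ((1 + \<beta>) * load (w m i \<omega>) \<omega> + \<alpha> * w m i \<omega>)"
        using compensated_load_bound[OF om wb(3)[OF om, of i m] wmono[of m i \<omega>]] True
        by (simp add: DY_def algebra_simps)
    qed
    also have "\<dots> = (1 + \<beta>) * (load (T \<omega>) \<omega> - load t \<omega>) + \<alpha> * (T \<omega> - t)"
      by (subst sum_lessThan_telescope) (simp add: w0[OF om] algebra_simps)
    also have "\<dots> \<le> V" unfolding V_def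
      using B[OF om True] TD(6)[OF om] params by (intro add_mono mult_left_mono) auto
    finally show ?thesis .
  qed (use V0 in \<open>simp add: DY_def\<close>)
  have DY2_sum: "(\<Sum>i<Suc m. (DY m i \<omega>)\<^sup>2) \<le> V\<^sup>2" if om: "\<omega> \<in> space M" for m \<omega>
  proof -
    have "(\<Sum>i<Suc m. (DY m i \<omega>)\<^sup>2) \<le> (\<Sum>i<Suc m. \<bar>DY m i \<omega>\<bar>)\<^sup>2"
      using sum_squares_le_square_sum[of "{..<Suc m}" "\<lambda>i. \<bar>DY m i \<omega>\<bar>"] by (simp only: power2_abs finite_lessThan abs_ge_zero)
    also have "\<dots> \<le> V\<^sup>2" using tv[OF om] by (intro power_mono sum_nonneg) auto
    finally show ?thesis .
  qed
  have DYb: "\<bar>DY m i \<omega>\<bar> \<le> V" if "i < Suc m" "\<omega> \<in> space M" for m i \<omega>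
    using member_le_sum[of i "{..<Suc m}" "\<lambda>i. \<bar>DY m i \<omega>\<bar>"] tv[OF that(2), of m] that(1) by (simp del: sum.lessThan_Suc)
  have DY2: "integrable M (\<lambda>\<omega>. (DY m i \<omega>)\<^sup>2)" if i: "i < Suc m" for m i
  proof (rule integrable_const_bound[of _ "V\<^sup>2"])
    show "AE \<omega> in M. norm ((DY m i \<omega>)\<^sup>2) \<le> V\<^sup>2"
      using DYb[OF i] by (intro AE_I2) (auto simp: abs_le_square_iff[symmetric] V0)
  qed (use i in measurable)
  have DJ2: "integrable M (\<lambda>\<omega>. (DJ m i \<omega>)\<^sup>2)" if i: "i < Suc m" for m i
    using ito_stopped(1)[OF T'[OF i] AF B'[OF i]] i unfolding T'w[of "\<lambda>u. ito_part u _"] DJ_def by simp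
  have Ysum: "Y \<omega> = (\<Sum>i<Suc m. DY m i \<omega>)" if om: "\<omega> \<in> space M" for m \<omega>
    unfolding DY_def sum_distrib_left[symmetric]
    by (subst sum_lessThan_telescope) (simp add: w0[OF om] Y_def)
  have Jsum: "J \<omega> = (\<Sum>i<Suc m. DJ m i \<omega>)" if om: "\<omega> \<in> space M" for m \<omega>
    unfolding DJ_def sum_distrib_left[symmetric]
    by (subst sum_lessThan_telescope) (simp add: w0[OF om] J_def)
  have EYY: "(\<integral>\<omega>. (Y \<omega>)\<^sup>2 \<partial>M) = (\<Sum>i<Suc m. \<integral>\<omega>. DY m i \<omega> * DY m i \<omega> \<partial>M)" for m
  proof -
    have "(\<integral>\<omega>. (Y \<omega>)\<^sup>2 \<partial>M) = (\<integral>\<omega>. (\<Sum>i<Suc m. DY m i \<omega>) * (\<Sum>i<Suc m. DY m i \<omega>) \<partial>M)"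
      by (intro Bochner_Integration.integral_cong refl) (simp only: Ysum[of _ m] power2_eq_square)
    also have "\<dots> = (\<Sum>i<Suc m. \<integral>\<omega>. DY m i \<omega> * DY m i \<omega> \<partial>M)"
      by (rule martingale_difference_products[where g="g m"]; (rule gmono DF DY2 C0 | assumption)+)
    finally show ?thesis .
  qed
  have EJJ: "(\<integral>\<omega>. (J \<omega>)\<^sup>2 \<partial>M) = (\<Sum>i<Suc m. \<integral>\<omega>. DJ m i \<omega> * DJ m i \<omega> \<partial>M)" for m
  proof -
    have "(\<integral>\<omega>. (J \<omega>)\<^sup>2 \<partial>M) = (\<integral>\<omega>. (\<Sum>i<Suc m. DJ m i \<omega>) * (\<Sum>i<Suc m. DJ m i \<omega>) \<partial>M)"
      by (intro Bochner_Integration.integral_cong refl) (simp only: Jsum[of _ m] power2_eq_square)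
    also have "\<dots> = (\<Sum>i<Suc m. \<integral>\<omega>. DJ m i \<omega> * DJ m i \<omega> \<partial>M)"
      by (rule martingale_difference_products[where g="g m"]; (rule gmono DF DJ2 C0 | assumption)+)
    finally show ?thesis .
  qed
  have EYJ: "(\<integral>\<omega>. Y \<omega> * J \<omega> \<partial>M) = (\<Sum>i<Suc m. \<integral>\<omega>. DY m i \<omega> * DJ m i \<omega> \<partial>M)" for m
  proof -
    have "(\<integral>\<omega>. Y \<omega> * J \<omega> \<partial>M) = (\<integral>\<omega>. (\<Sum>i<Suc m. DY m i \<omega>) * (\<Sum>i<Suc m. DJ m i \<omega>) \<partial>M)"
      by (intro Bochner_Integration.integral_cong refl) (simp only: Ysum[of _ m] Jsum[of _ m])
    also have "\<dots> = (\<Sum>i<Suc m. \<integral>\<omega>. DY m i \<omega> * DJ m i \<omega> \<partial>M)"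
      by (rule martingale_difference_products[where g="g m"]; (rule gmono DF DY2 DJ2 C0 | assumption)+)
    finally show ?thesis .
  qed
  have mesh: "\<bar>w m (Suc i) \<omega> - w m i \<omega>\<bar> \<le> (s - t) / real (Suc m)" for m i \<omega>
  proof -
    have "g m (Suc i) = g m i + (s - t) / real (Suc m)" unfolding g_def by (rule unif_grid_Suc)
    moreover have "0 \<le> (s - t) / real (Suc m)" using TD(3) by simp
    ultimately show ?thesis unfolding w_def by linarith
  qed
  have mesh0: "(\<lambda>m. (s - t) / real (Suc m)) \<longlonglongrightarrow> 0" by (rule LIMSEQ_Suc) (rule lim_const_over_n)
  have bvc: "(\<lambda>m. \<Sum>i<Suc m. D m i * (f (w m (Suc i) \<omega>) - f (w m i \<omega>))) \<longlonglongrightarrow> 0"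
    if om: "\<omega> \<in> space M" and f: "continuous_on {0..} f" and D: "\<And>m. (\<Sum>i<Suc m. \<bar>D m i\<bar>) \<le> K"
    for \<omega> D K and f :: "real \<Rightarrow> real"
  proof (rule sum_increments_continuous_tendsto_0[where N=Suc and t=t and s=s and J=f and D=D and B=K
        and w="\<lambda>m i. w m i \<omega>" and \<delta>="\<lambda>m. (s - t) / real (Suc m)"])
    show "continuous_on {t..s} f" by (rule continuous_on_subset[OF f]) (use TD in auto)
    show "w m i \<omega> \<in> {t..s}" if "i \<le> Suc m" for m i using wb[OF om that] by auto
  qed (rule mesh, rule mesh0, rule D)
  have YJ2: "\<And>m i. i < Suc m \<Longrightarrow> integrable M (\<lambda>\<omega>. DY m i \<omega> * DJ m i \<omega>)"
    using DM DY2 DJ2 by (intro integrable_mult_of_squares) auto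
  define X where "X m \<omega> = (\<Sum>i<Suc m. DY m i \<omega> * DJ m i \<omega>)" for m \<omega>
  have Xm [measurable]: "X m \<in> borel_measurable M" for m unfolding X_def by (intro borel_measurable_sum borel_measurable_times DM) auto
  have EX: "(\<integral>\<omega>. X m \<omega> \<partial>M) = (\<integral>\<omega>. Y \<omega> * J \<omega> \<partial>M)" for m
    unfolding X_def EYJ[of m] by (intro Bochner_Integration.integral_sum YJ2) auto
  \<comment> \<open>domination in mean square, as no pointwise bound for \<open>J\<close> is at hand\<close>
  have X2: "(X m \<omega>)\<^sup>2 \<le> V\<^sup>2 * (\<Sum>i<Suc m. (DJ m i \<omega>)\<^sup>2)" if om: "\<omega> \<in> space M" for m \<omega>
  proof -
    have "(X m \<omega>)\<^sup>2 \<le> (\<Sum>i<Suc m. (DY m i \<omega>)\<^sup>2) * (\<Sum>i<Suc m. (DJ m i \<omega>)\<^sup>2)"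
      unfolding X_def by (rule Cauchy_Schwarz_ineq_sum)
    also have "\<dots> \<le> V\<^sup>2 * (\<Sum>i<Suc m. (DJ m i \<omega>)\<^sup>2)"
      by (intro mult_right_mono DY2_sum[OF om] sum_nonneg) auto
    finally show ?thesis .
  qed
  have SJ: "integrable M (\<lambda>\<omega>. V\<^sup>2 * (\<Sum>i<Suc m. (DJ m i \<omega>)\<^sup>2))" for m
    by (intro integrable_mult_right Bochner_Integration.integrable_sum DJ2) auto
  have X2i: "integrable M (\<lambda>\<omega>. (X m \<omega>)\<^sup>2)" for m
    by (rule Bochner_Integration.integrable_bound[OF SJ[of m]]) (auto intro!: order_trans[OF X2] AE_I2 simp del: sum.lessThan_Suc)
  have X2b: "(\<integral>\<omega>. (X m \<omega>)\<^sup>2 \<partial>M) \<le> V\<^sup>2 * (\<integral>\<omega>. (J \<omega>)\<^sup>2 \<partial>M)" for m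
  proof -
    have "(\<integral>\<omega>. (X m \<omega>)\<^sup>2 \<partial>M) \<le> (\<integral>\<omega>. V\<^sup>2 * (\<Sum>i<Suc m. (DJ m i \<omega>)\<^sup>2) \<partial>M)"
      by (rule integral_mono[OF X2i SJ X2])
    also have "\<dots> = V\<^sup>2 * (\<integral>\<omega>. (\<Sum>i<Suc m. (DJ m i \<omega>)\<^sup>2) \<partial>M)" by (rule integral_mult_right_zero)
    also have "(\<integral>\<omega>. (\<Sum>i<Suc m. (DJ m i \<omega>)\<^sup>2) \<partial>M) = (\<integral>\<omega>. (J \<omega>)\<^sup>2 \<partial>M)"
      unfolding EJJ[of m] power2_eq_square[symmetric]
      by (intro Bochner_Integration.integral_sum DJ2) auto
    finally show ?thesis .
  qed
  have "AE \<omega> in M. (\<lambda>m. X m \<omega>) \<longlonglongrightarrow> 0"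
    using ito_part_continuous AE_space
  proof eventually_elim
    case (elim \<omega>)
    have "X m \<omega> = (\<Sum>i<Suc m. DY m i \<omega> * (ito_part (w m (Suc i) \<omega>) \<omega> - ito_part (w m i \<omega>) \<omega>))" for m
      unfolding X_def by (intro sum.cong) (auto simp: DY_def DJ_def indicator_def)
    then show ?case using bvc[OF elim(2,1), of "\<lambda>m i. DY m i \<omega>", OF tv[OF elim(2)]] by simp
  qed
  from Vitali_square(2)[OF Xm _ X2i X2b this]
  show "(\<integral>\<omega>. Y \<omega> * J \<omega> \<partial>M) = 0" by (simp add: EX LIMSEQ_const_iff)
  have Yb: "\<bar>Y \<omega>\<bar> \<le> V" if "\<omega> \<in> space M" for \<omega>
    using order_trans[OF sum_abs tv[OF that, of 0]] by (simp only: Ysum[OF that, of 0])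
  have Ym [measurable]: "Y \<in> borel_measurable M" unfolding Y_def by measurable
  show Y2: "integrable M (\<lambda>\<omega>. (Y \<omega>)\<^sup>2)"
  proof (rule integrable_const_bound[of _ "V\<^sup>2"])
    show "AE \<omega> in M. norm ((Y \<omega>)\<^sup>2) \<le> V\<^sup>2"
      using Yb by (intro AE_I2) (auto simp: abs_le_square_iff[symmetric] V0)
  qed measurable
  let ?n = "\<lambda>\<omega>. indicator A \<omega> * (real (N (T \<omega>) \<omega>) - real (N t \<omega>))"
  have "(\<lambda>m. \<integral>\<omega>. (\<Sum>i<Suc m. (DY m i \<omega>)\<^sup>2) \<partial>M) \<longlonglongrightarrow> (\<integral>\<omega>. ?n \<omega> \<partial>M)"
  proof (rule integral_dominated_convergence[where w="\<lambda>_. V\<^sup>2"])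
    show "(\<lambda>\<omega>. \<Sum>i<Suc m. (DY m i \<omega>)\<^sup>2) \<in> borel_measurable M" for m
      by (intro borel_measurable_sum borel_measurable_power DM) auto
    show "AE \<omega> in M. norm (\<Sum>i<Suc m. (DY m i \<omega>)\<^sup>2) \<le> V\<^sup>2" for m
      using DY2_sum by (intro AE_I2) (simp add: sum_nonneg del: sum.lessThan_Suc)
    show "AE \<omega> in M. (\<lambda>m. \<Sum>i<Suc m. (DY m i \<omega>)\<^sup>2) \<longlonglongrightarrow> ?n \<omega>"
    proof (rule AE_I2)
      fix \<omega> assume om: "\<omega> \<in> space M"
      show "(\<lambda>m. \<Sum>i<Suc m. (DY m i \<omega>)\<^sup>2) \<longlonglongrightarrow> ?n \<omega>"
      proof (cases "\<omega> \<in> A")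
        case True
        define n where "n u = real (N u \<omega>)" for u
        define l where "l u = \<alpha> * u + \<beta> * cum u \<omega>" for u
        define Dn where "Dn m i = n (w m (Suc i) \<omega>) - n (w m i \<omega>)" for m i
        have lc: "continuous_on {0..} l" unfolding l_def by (intro continuous_intros cum_continuous[OF om])
        have Dn0: "0 \<le> Dn m i" if "i < Suc m" for m i
          using N_mono[OF om wb(3)[OF om] wmono] that by (simp add: Dn_def n_def)
        have Dn_sum: "(\<Sum>i<Suc m. Dn m i) = n (T \<omega>) - n t" for m
          unfolding Dn_def by (subst sum_lessThan_telescope) (simp add: w0[OF om])
        have "(\<Sum>i<Suc m. \<bar>Dn m i\<bar>) \<le> n (T \<omega>) - n t" for m
          unfolding Dn_sum[of m, symmetric] using Dn0 by (intro sum_mono) auto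
        from bvc[OF om lc, of Dn, OF this]
        have l1: "(\<lambda>m. \<Sum>i<Suc m. Dn m i * (l (w m (Suc i) \<omega>) - l (w m i \<omega>))) \<longlonglongrightarrow> 0" .
        have l2: "(\<lambda>m. \<Sum>i<Suc m. DY m i \<omega> * (l (w m (Suc i) \<omega>) - l (w m i \<omega>))) \<longlonglongrightarrow> 0"
          by (rule bvc[OF om lc, of "\<lambda>m i. DY m i \<omega>", OF tv[OF om]])
        obtain \<delta> where \<delta>: "\<delta> > 0" "\<And>u v. t \<le> u \<Longrightarrow> u \<le> v \<Longrightarrow> v \<le> s \<Longrightarrow> v - u < \<delta> \<Longrightarrow> N v \<omega> \<le> N u \<omega> + 1"
          using simple_counting_path_locally_unit[OF N_path[OF om] TD(2), where s=s] by blast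
        \<comment> \<open>on a fine grid each cell contains at most one unit of growth, and 0 and 1 are their own squares\<close>
        have ev: "\<forall>\<^sub>F m in sequentially. n (T \<omega>) - n t = (\<Sum>i<Suc m. (Dn m i)\<^sup>2)"
          using order_tendstoD(2)[OF mesh0 \<delta>(1)]
        proof eventually_elim
          case (elim m)
          have "(Dn m i)\<^sup>2 = Dn m i" if "i < Suc m" for i
          proof -
            have "w m (Suc i) \<omega> - w m i \<omega> < \<delta>" using mesh[of m i \<omega>] elim by linarith
            then have "N (w m (Suc i) \<omega>) \<omega> \<le> N (w m i \<omega>) \<omega> + 1"
              using that by (intro \<delta>(2) wb[OF om] wmono) auto
            moreover have "N (w m i \<omega>) \<omega> \<le> N (w m (Suc i) \<omega>) \<omega>"
              using that by (intro N_mono[OF om] wb[OF om] wmono) auto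
            ultimately have "N (w m (Suc i) \<omega>) \<omega> = N (w m i \<omega>) \<omega> \<or> N (w m (Suc i) \<omega>) \<omega> = N (w m i \<omega>) \<omega> + 1"
              by linarith
            then have "Dn m i = 0 \<or> Dn m i = 1" unfolding Dn_def n_def by auto
            then show ?thesis by auto
          qed
          then show ?case unfolding Dn_sum[of m, symmetric] by (intro sum.cong) auto
        qed
        have "(\<lambda>m. \<Sum>i<Suc m. (Dn m i)\<^sup>2) \<longlonglongrightarrow> n (T \<omega>) - n t"
          using ev by (rule Lim_transform_eventually[OF tendsto_const])
        from tendsto_diff[OF tendsto_diff[OF this l1] l2]
        have "(\<lambda>m. (\<Sum>i<Suc m. (Dn m i)\<^sup>2) - (\<Sum>i<Suc m. Dn m i * (l (w m (Suc i) \<omega>) - l (w m i \<omega>)))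
           - (\<Sum>i<Suc m. DY m i \<omega> * (l (w m (Suc i) \<omega>) - l (w m i \<omega>)))) \<longlonglongrightarrow> n (T \<omega>) - n t" by simp
        moreover have "(\<Sum>i<Suc m. (Dn m i)\<^sup>2) - (\<Sum>i<Suc m. Dn m i * (l (w m (Suc i) \<omega>) - l (w m i \<omega>)))
           - (\<Sum>i<Suc m. DY m i \<omega> * (l (w m (Suc i) \<omega>) - l (w m i \<omega>))) = (\<Sum>i<Suc m. (DY m i \<omega>)\<^sup>2)" for m
          unfolding sum_subtractf[symmetric]
        proof (rule sum.cong[OF refl])
          fix i
          have DYe: "DY m i \<omega> = Dn m i - (l (w m (Suc i) \<omega>) - l (w m i \<omega>))"
            using True by (simp add: DY_def compensated_def Dn_def n_def l_def)
          show "(Dn m i)\<^sup>2 - Dn m i * (l (w m (Suc i) \<omega>) - l (w m i \<omega>)) - DY m i \<omega> * (l (w m (Suc i) \<omega>) - l (w m i \<omega>))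
            = (DY m i \<omega>)\<^sup>2" unfolding DYe by algebra
        qed
        ultimately show ?thesis using True by (simp add: n_def)
      qed (simp add: DY_def)
    qed
  qed auto
  moreover have "(\<integral>\<omega>. (\<Sum>i<Suc m. (DY m i \<omega>)\<^sup>2) \<partial>M) = (\<integral>\<omega>. (Y \<omega>)\<^sup>2 \<partial>M)" for m
    unfolding EYY[of m] power2_eq_square[symmetric]
    by (intro Bochner_Integration.integral_sum DY2) auto
  ultimately have "(\<integral>\<omega>. (Y \<omega>)\<^sup>2 \<partial>M) = (\<integral>\<omega>. ?n \<omega> \<partial>M)" by (simp only: LIMSEQ_const_iff)
  moreover have "(\<integral>\<omega>. ?n \<omega> \<partial>M) = (\<integral>\<omega>. indicator A \<omega> * (\<alpha> * (T \<omega> - t) + \<beta> * (cum (T \<omega>) \<omega> - cum t \<omega>)) \<partial>M)"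
  proof -
    let ?l = "\<lambda>\<omega>. indicator A \<omega> * (\<alpha> * (T \<omega> - t) + \<beta> * (cum (T \<omega>) \<omega> - cum t \<omega>))"
    have li: "integrable M ?l"
    proof (rule integrable_const_bound[of _ "\<alpha> * (s - t) + \<beta> * \<bar>B\<bar>"])
      show "AE \<omega> in M. norm (?l \<omega>) \<le> \<alpha> * (s - t) + \<beta> * \<bar>B\<bar>"
      proof (rule AE_I2)
        fix \<omega> assume om: "\<omega> \<in> space M"
        note l = load_parts[OF om TD(2) TD(5)[OF om]]
        have p: "0 \<le> \<alpha> * (s - t) + \<beta> * \<bar>B\<bar>" using params TD by simp
        show "norm (?l \<omega>) \<le> \<alpha> * (s - t) + \<beta> * \<bar>B\<bar>"
        proof (cases "\<omega> \<in> A")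
          case True
          have "0 \<le> \<alpha> * (T \<omega> - t)" "0 \<le> \<beta> * (cum (T \<omega>) \<omega> - cum t \<omega>)" using params TD(5)[OF om] l by auto
          moreover have "\<alpha> * (T \<omega> - t) \<le> \<alpha> * (s - t)" using params TD(6)[OF om] by simp
          moreover have "\<beta> * (cum (T \<omega>) \<omega> - cum t \<omega>) \<le> \<beta> * \<bar>B\<bar>"
            using params l B[OF om True] by (intro mult_left_mono) auto
          ultimately show ?thesis using True by simp
        qed (use p in simp)
      qed
    qed measurable
    have Yi: "integrable M Y" by (rule integrable_of_square[OF Ym Y2])
    have "(\<integral>\<omega>. ?n \<omega> \<partial>M) = (\<integral>\<omega>. Y \<omega> + ?l \<omega> \<partial>M)"
      by (intro Bochner_Integration.integral_cong) (auto simp: Y_def compensated_def algebra_simps)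
    also have "\<dots> = (\<integral>\<omega>. Y \<omega> \<partial>M) + (\<integral>\<omega>. ?l \<omega> \<partial>M)" by (rule Bochner_Integration.integral_add[OF Yi li])
    also have "(\<integral>\<omega>. Y \<omega> \<partial>M) = 0" unfolding Y_def by (rule compensated_stopped[OF T A B0])
    finally show ?thesis by simp
  qed
  ultimately show "(\<integral>\<omega>. (Y \<omega>)\<^sup>2 \<partial>M) = (\<integral>\<omega>. indicator A \<omega> * (\<alpha> * (T \<omega> - t) + \<beta> * (cum (T \<omega>) \<omega> - cum t \<omega>)) \<partial>M)"
    by simp
qed

end

section \<open>Moments of the noise on a fixed interval\<close>

context stable_cir_hawkes
begin

abbreviation \<kappa> :: real where "\<kappa> \<equiv> b - a * \<beta>"
abbreviation \<mu> :: real where "\<mu> \<equiv> b * c + a * \<alpha>"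

lemma kappa_pos: "\<kappa> > 0" and mu_pos: "\<mu> > 0"
  using stable params by (auto simp: add_pos_pos)

definition noise :: "real \<Rightarrow> 'a \<Rightarrow> real" where
  "noise u \<omega> = a * compensated u \<omega> + \<sigma> * ito_part u \<omega>"

text \<open>The predictable quadratic variation of \<open>noise\<close> over \<open>[t, u]\<close>.\<close>

definition bracket :: "real \<Rightarrow> real \<Rightarrow> 'a \<Rightarrow> real" where
  "bracket t u \<omega> = \<sigma>\<^sup>2 * (cum u \<omega> - cum t \<omega>) + a\<^sup>2 * (\<alpha> * (u - t) + \<beta> * (cum u \<omega> - cum t \<omega>))"

lemma r_noise: "r v \<omega> = r u \<omega> + \<mu> * (v - u) - \<kappa> * (cum v \<omega> - cum u \<omega>) + (noise v \<omega> - noise u \<omega>)"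
  using r_decomposition[of v \<omega>] r_decomposition[of u \<omega>] by (simp add: noise_def algebra_simps)

lemma noise_measurable: "0 \<le> u \<Longrightarrow> noise u \<in> borel_measurable (F u)"
  unfolding noise_def[abs_def] using compensated_measurable[of u] ito_part_measurable[of u] by auto

lemma noise_right_continuous:
  "\<omega> \<in> space M \<Longrightarrow> 0 \<le> u \<Longrightarrow> ((\<lambda>v. noise v \<omega>) \<longlongrightarrow> noise u \<omega>) (at_right u)"
  unfolding noise_def by (intro tendsto_intros compensated_right_continuous ito_part_right_continuous)

lemma bracket_mono:
  assumes "\<omega> \<in> space M" "0 \<le> t" "t \<le> u" "u \<le> v"
  shows "0 \<le> bracket t u \<omega>" "bracket t u \<omega> \<le> bracket t v \<omega>"
proof -
  have 1: "0 \<le> cum u \<omega> - cum t \<omega>" "cum u \<omega> - cum t \<omega> \<le> cum v \<omega> - cum t \<omega>"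
    using cum_diff(3)[OF assms(1), of t u] cum_diff(3)[OF assms(1), of u v] assms by auto
  show "0 \<le> bracket t u \<omega>" unfolding bracket_def using 1 assms params
    by (intro add_nonneg_nonneg mult_nonneg_nonneg) auto
  show "bracket t u \<omega> \<le> bracket t v \<omega>" unfolding bracket_def using 1 assms params
    by (intro add_mono mult_left_mono) auto
qed

lemma noise_stopped:
  assumes T: "stopping_between T t s" and A: "A \<in> sets (F t)"
    and B: "\<forall>\<omega>\<in>space M. \<omega> \<in> A \<longrightarrow> load (T \<omega>) \<omega> - load t \<omega> \<le> B"
  shows "integrable M (\<lambda>\<omega>. (indicator A \<omega> * (noise (T \<omega>) \<omega> - noise t \<omega>))\<^sup>2)"
    "integrable M (\<lambda>\<omega>. indicator A \<omega> * (noise (T \<omega>) \<omega> - noise t \<omega>))"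
    "(\<integral>\<omega>. indicator A \<omega> * (noise (T \<omega>) \<omega> - noise t \<omega>) \<partial>M) = 0"
    "integrable M (\<lambda>\<omega>. indicator A \<omega> * bracket t (T \<omega>) \<omega>)"
    "(\<integral>\<omega>. (indicator A \<omega> * (noise (T \<omega>) \<omega> - noise t \<omega>))\<^sup>2 \<partial>M) = (\<integral>\<omega>. indicator A \<omega> * bracket t (T \<omega>) \<omega> \<partial>M)"
proof -
  note TD = stopping_betweenD[OF T]
  note AM [measurable] = sets_F_M[OF A]
  note [measurable] = measurable_F_M[OF stopped_measurable(1)[OF T]] measurable_F_M[OF compensated_measurable[OF TD(2)]]
    measurable_F_M[OF stopped_measurable(2)[OF T]] measurable_F_M[OF ito_part_measurable[OF TD(2)]]
    stopping_time_measurable[OF TD(1)]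
  define Y where "Y \<omega> = indicator A \<omega> * (compensated (T \<omega>) \<omega> - compensated t \<omega>)" for \<omega>
  define J where "J \<omega> = indicator A \<omega> * (ito_part (T \<omega>) \<omega> - ito_part t \<omega>)" for \<omega>
  have [measurable]: "Y \<in> borel_measurable M" "J \<in> borel_measurable M" unfolding Y_def J_def by measurable
  note sp = stopped_products[OF T A B, folded Y_def J_def]
  note it = ito_stopped[OF T A B, folded J_def]
  have Y0: "(\<integral>\<omega>. Y \<omega> \<partial>M) = 0" unfolding Y_def by (rule compensated_stopped[OF T A B])
  have YJ: "integrable M (\<lambda>\<omega>. Y \<omega> * J \<omega>)" by (rule integrable_mult_of_squares[OF _ _ sp(1) it(1)]) auto
  have Yi: "integrable M Y" by (rule integrable_of_square[OF _ sp(1)]) auto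
  have Ji: "integrable M J" by (rule integrable_of_square[OF _ it(1)]) auto
  have Z: "indicator A \<omega> * (noise (T \<omega>) \<omega> - noise t \<omega>) = a * Y \<omega> + \<sigma> * J \<omega>" for \<omega>
    by (simp add: noise_def Y_def J_def algebra_simps)
  have Z2: "(indicator A \<omega> * (noise (T \<omega>) \<omega> - noise t \<omega>))\<^sup>2 = a\<^sup>2 * (Y \<omega>)\<^sup>2 + 2 * a * \<sigma> * (Y \<omega> * J \<omega>) + \<sigma>\<^sup>2 * (J \<omega>)\<^sup>2" for \<omega>
    unfolding Z by (simp add: power2_eq_square algebra_simps)
  show "integrable M (\<lambda>\<omega>. (indicator A \<omega> * (noise (T \<omega>) \<omega> - noise t \<omega>))\<^sup>2)"
    unfolding Z2 by (intro Bochner_Integration.integrable_add integrable_mult_right sp it YJ)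
  show "integrable M (\<lambda>\<omega>. indicator A \<omega> * (noise (T \<omega>) \<omega> - noise t \<omega>))"
    unfolding Z by (intro Bochner_Integration.integrable_add integrable_mult_right Yi Ji)
  show "(\<integral>\<omega>. indicator A \<omega> * (noise (T \<omega>) \<omega> - noise t \<omega>) \<partial>M) = 0"
    unfolding Z using Yi Ji Y0 it(2) by simp
  have Ti: "integrable M (\<lambda>\<omega>. indicator A \<omega> * (T \<omega> - t))"
  proof (rule integrable_const_bound[of _ "s - t"])
    show "AE \<omega> in M. norm (indicator A \<omega> * (T \<omega> - t)) \<le> s - t"
    proof (rule AE_I2)
      fix \<omega> assume "\<omega> \<in> space M"
      then show "norm (indicator A \<omega> * (T \<omega> - t)) \<le> s - t" using TD(5,6)[of \<omega>] by (cases "\<omega> \<in> A") auto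
    qed
  qed measurable
  have br: "indicator A \<omega> * bracket t (T \<omega>) \<omega> = \<sigma>\<^sup>2 * (indicator A \<omega> * (cum (T \<omega>) \<omega> - cum t \<omega>))
    + a\<^sup>2 * (\<alpha> * (indicator A \<omega> * (T \<omega> - t)) + \<beta> * (indicator A \<omega> * (cum (T \<omega>) \<omega> - cum t \<omega>)))" for \<omega>
    by (simp add: bracket_def algebra_simps)
  show "integrable M (\<lambda>\<omega>. indicator A \<omega> * bracket t (T \<omega>) \<omega>)"
    unfolding br by (intro Bochner_Integration.integrable_add integrable_mult_right it Ti)
  have "(\<integral>\<omega>. (indicator A \<omega> * (noise (T \<omega>) \<omega> - noise t \<omega>))\<^sup>2 \<partial>M)
    = a\<^sup>2 * (\<integral>\<omega>. (Y \<omega>)\<^sup>2 \<partial>M) + 2 * a * \<sigma> * (\<integral>\<omega>. Y \<omega> * J \<omega> \<partial>M) + \<sigma>\<^sup>2 * (\<integral>\<omega>. (J \<omega>)\<^sup>2 \<partial>M)"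
    unfolding Z2 using sp(1) it(1) YJ by simp
  also have "\<dots> = a\<^sup>2 * (\<integral>\<omega>. \<alpha> * (indicator A \<omega> * (T \<omega> - t)) + \<beta> * (indicator A \<omega> * (cum (T \<omega>) \<omega> - cum t \<omega>)) \<partial>M)
    + \<sigma>\<^sup>2 * (\<integral>\<omega>. indicator A \<omega> * (cum (T \<omega>) \<omega> - cum t \<omega>) \<partial>M)"
  proof -
    have "(\<integral>\<omega>. (Y \<omega>)\<^sup>2 \<partial>M) = (\<integral>\<omega>. \<alpha> * (indicator A \<omega> * (T \<omega> - t)) + \<beta> * (indicator A \<omega> * (cum (T \<omega>) \<omega> - cum t \<omega>)) \<partial>M)"
      unfolding sp(2) by (intro Bochner_Integration.integral_cong) (simp_all add: algebra_simps)
    then show ?thesis by (simp only: sp(3) it(4) mult_zero_right add_0_right)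
  qed
  also have "\<dots> = (\<integral>\<omega>. indicator A \<omega> * bracket t (T \<omega>) \<omega> \<partial>M)"
    unfolding br using it(3) Ti by simp
  finally show "(\<integral>\<omega>. (indicator A \<omega> * (noise (T \<omega>) \<omega> - noise t \<omega>))\<^sup>2 \<partial>M) = (\<integral>\<omega>. indicator A \<omega> * bracket t (T \<omega>) \<omega> \<partial>M)" .
qed

definition exit_time :: "real \<Rightarrow> real \<Rightarrow> nat \<Rightarrow> 'a \<Rightarrow> real" where
  "exit_time t s k = hitting (\<lambda>u \<omega>. load u \<omega> - load t \<omega>) (real k + 1) t s"

lemma exit_time_stopping:
  assumes ts: "0 \<le> t" "t \<le> s"
  shows "stopping_between (exit_time t s k) t s"
proof -
  have "stopping_time F (exit_time t s k)" unfolding exit_time_def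
  proof (rule stopping_time_hitting)
    show "(\<lambda>\<omega>. load u \<omega> - load t \<omega>) \<in> borel_measurable (F u)" if "t \<le> u" for u
    proof -
      have u: "0 \<le> u" using that ts by simp
      note [measurable] = N_measurable[OF u] cum_measurable[OF u]
        measurable_F_mono[OF N_measurable[OF ts(1)] that] measurable_F_mono[OF cum_measurable[OF ts(1)] that]
      show ?thesis unfolding load_def by measurable
    qed
    show "load u \<omega> - load t \<omega> \<le> load v \<omega> - load t \<omega>" if "\<omega> \<in> space M" "t \<le> u" "u \<le> v" for \<omega> u v
      using load_mono[OF that(1) _ that(3)] that ts by simp
    show "((\<lambda>v. load v \<omega> - load t \<omega>) \<longlongrightarrow> load u \<omega> - load t \<omega>) (at_right u)" if "\<omega> \<in> space M" "t \<le> u" for \<omega> u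
      unfolding load_def using that ts by (intro tendsto_intros N_right_continuous cum_right_continuous) auto
  qed (rule ts)
  then show ?thesis unfolding stopping_between_def exit_time_def using ts hitting_bounds[OF ts(2)] by auto
qed

text \<open>The load is below \<open>k + 1\<close> before the exit time, and its jump at this time is at most 1.\<close>

lemma exit_time_load:
  assumes ts: "0 \<le> t" "t \<le> s" and w: "\<omega> \<in> space M"
  shows "load (exit_time t s k \<omega>) \<omega> - load t \<omega> \<le> real k + 2"
proof (cases "exit_time t s k \<omega> = t")
  case False
  define T where "T = exit_time t s k \<omega>"
  have T: "t < T" "T \<le> s" using False hitting_bounds[OF ts(2)] by (auto simp: T_def exit_time_def less_le)
  have below: "load u \<omega> - load t \<omega> < real k + 1" if "t \<le> u" "u < T" for u
    using hitting_below[of t u "\<lambda>u \<omega>. load u \<omega> - load t \<omega>" "real k + 1" s \<omega>] that T by (simp add: T_def exit_time_def)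
  have ev1: "\<forall>\<^sub>F u in at_left T. N T \<omega> \<le> N u \<omega> + 1" using N_path[OF w] T ts by (auto simp: simple_counting_path_def)
  have ev2: "\<forall>\<^sub>F u in at_left T. t < u" using T by (intro eventually_at_left_real[THEN eventually_mono]) auto
  have ev3: "\<forall>\<^sub>F u in at_left T. u < T" by (simp add: eventually_at_filter)
  have "((\<lambda>u. cum u \<omega>) \<longlongrightarrow> cum T \<omega>) (at T within {0..})"
    using cum_continuous[OF w] T ts by (auto simp: continuous_on_def)
  moreover have "at_left T \<le> at T within {0..}"
  proof -
    have "at_left T = at T within {0<..<T}" using T ts by (intro at_within_nhd[of _ "{0<..}"]) auto
    also have "\<dots> \<le> at T within {0..}" by (intro at_le) auto
    finally show ?thesis .
  qed
  ultimately have "((\<lambda>u. cum u \<omega>) \<longlongrightarrow> cum T \<omega>) (at_left T)" by (rule tendsto_mono[rotated])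
  then have lim: "((\<lambda>u. real (N T \<omega>) + cum u \<omega> - load t \<omega>) \<longlongrightarrow> real (N T \<omega>) + cum T \<omega> - load t \<omega>) (at_left T)"
    by (intro tendsto_intros)
  have "real (N T \<omega>) + cum T \<omega> - load t \<omega> \<le> real k + 2"
  proof (rule tendsto_upperbound[OF lim])
    show "\<forall>\<^sub>F u in at_left T. real (N T \<omega>) + cum u \<omega> - load t \<omega> \<le> real k + 2"
      using ev1 ev2 ev3
    proof eventually_elim
      case (elim u)
      then have "real (N T \<omega>) \<le> real (N u \<omega>) + 1" by linarith
      then show ?case using below[of u] elim by (simp add: load_def)
    qed
  qed simp
  then show ?thesis by (simp add: load_def T_def)
qed simp

lemma exit_time_eventually:
  assumes ts: "0 \<le> t" "t \<le> s" and w: "\<omega> \<in> space M"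
  shows "\<forall>\<^sub>F k in sequentially. exit_time t s k \<omega> = s"
proof -
  obtain k0 where k0: "load s \<omega> - load t \<omega> \<le> real k0" using real_arch_simple by blast
  have "exit_time t s k \<omega> = s" if "k \<ge> k0" for k
    unfolding exit_time_def
  proof (rule hitting_eq_end[OF ts(2)])
    fix u assume "t \<le> u" "u \<le> s"
    then show "load u \<omega> - load t \<omega> < real k + 1"
      using load_mono[OF w, of u s] k0 that ts by simp
  qed
  then show ?thesis by (rule eventually_sequentiallyI)
qed

text \<open>Up to the exit time \<open>T k\<close>, the identity \<open>r_noise\<close> and the zero mean of the stopped
  noise bound the mean of the nonnegative variable \<open>r + \<kappa> * (\<integral>r)\<close>
  independently of \<open>k\<close>. Since \<open>T k\<close> is eventually \<open>s\<close>, Fatou's lemma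
  applies; then the stopped noise is bounded in mean square by the integrable bracket, and its moments pass
  to the limit, the second one as an inequality for the time being.\<close>

lemma noise_integrability:
  assumes ts: "0 \<le> t" "t \<le> s" and A: "A \<in> sets (F t)" and rt: "integrable M (\<lambda>\<omega>. indicator A \<omega> * r t \<omega>)"
  shows "integrable M (\<lambda>\<omega>. indicator A \<omega> * r s \<omega>)"
    "integrable M (\<lambda>\<omega>. indicator A \<omega> * (cum s \<omega> - cum t \<omega>))"
    "integrable M (\<lambda>\<omega>. indicator A \<omega> * bracket t s \<omega>)"
    "integrable M (\<lambda>\<omega>. (indicator A \<omega> * (noise s \<omega> - noise t \<omega>))\<^sup>2)"
    "integrable M (\<lambda>\<omega>. indicator A \<omega> * (noise s \<omega> - noise t \<omega>))"
    "(\<integral>\<omega>. indicator A \<omega> * (noise s \<omega> - noise t \<omega>) \<partial>M) = 0"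
    "(\<integral>\<omega>. (indicator A \<omega> * (noise s \<omega> - noise t \<omega>))\<^sup>2 \<partial>M) \<le> (\<integral>\<omega>. indicator A \<omega> * bracket t s \<omega> \<partial>M)"
proof -
  have s: "0 \<le> s" using ts by simp
  note AM [measurable] = sets_F_M[OF A]
  note [measurable] = measurable_F_M[OF r_measurable[OF s]] measurable_F_M[OF r_measurable[OF ts(1)]]
    measurable_F_M[OF cum_measurable[OF s]] measurable_F_M[OF cum_measurable[OF ts(1)]]
    measurable_F_M[OF noise_measurable[OF s]] measurable_F_M[OF noise_measurable[OF ts(1)]]
  define T where "T = exit_time t s"
  have T: "stopping_between (T k) t s" for k unfolding T_def by (rule exit_time_stopping[OF ts])
  have B: "\<forall>\<omega>\<in>space M. \<omega> \<in> A \<longrightarrow> load (T k \<omega>) \<omega> - load t \<omega> \<le> real k + 2" for k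
    unfolding T_def using exit_time_load[OF ts] by blast
  have Tev: "\<forall>\<^sub>F k in sequentially. T k \<omega> = s" if "\<omega> \<in> space M" for \<omega>
    unfolding T_def by (rule exit_time_eventually[OF ts that])
  note TD = stopping_betweenD[OF T]
  note ns = noise_stopped[OF T A B]
  define V where "V k \<omega> = indicator A \<omega> * (noise (T k \<omega>) \<omega> - noise t \<omega>)" for k \<omega>
  \<comment> \<open>\<open>P\<close> differs from initial data by terms of bounded mean, and is nonnegative because \<open>\<kappa> > 0\<close>\<close>
  define P where "P k \<omega> = indicator A \<omega> * (r (T k \<omega>) \<omega> + \<kappa> * (cum (T k \<omega>) \<omega> - cum t \<omega>))" for k \<omega>
  have P_eq: "P k \<omega> = indicator A \<omega> * r t \<omega> + \<mu> * (indicator A \<omega> * (T k \<omega> - t)) + V k \<omega>" for k \<omega>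
    using r_noise[of "T k \<omega>" \<omega> t] by (cases "\<omega> \<in> A") (simp_all add: P_def V_def)
  have Ti: "integrable M (\<lambda>\<omega>. indicator A \<omega> * (T k \<omega> - t))" for k
  proof (rule integrable_const_bound[of _ "s - t"])
    show "AE \<omega> in M. norm (indicator A \<omega> * (T k \<omega> - t)) \<le> s - t"
    proof (rule AE_I2)
      fix \<omega> assume "\<omega> \<in> space M"
      then show "norm (indicator A \<omega> * (T k \<omega> - t)) \<le> s - t" using TD(5,6)[of \<omega>] ts by (cases "\<omega> \<in> A") auto
    qed
    have [measurable]: "T k \<in> borel_measurable M" by (rule stopping_time_measurable[OF TD(1)])
    show "(\<lambda>\<omega>. indicator A \<omega> * (T k \<omega> - t)) \<in> borel_measurable M" by measurable
  qed
  have Pi: "integrable M (P k)" for k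
    unfolding P_eq[abs_def] V_def by (intro Bochner_Integration.integrable_add integrable_mult_right rt Ti ns)
  have P0: "0 \<le> P k \<omega>" if "\<omega> \<in> space M" for k \<omega>
    unfolding P_def using r_nonneg[OF TD(7)[OF that] that] cum_diff(3)[OF that ts(1) TD(5)[OF that]] kappa_pos by simp
  define C where "C = (\<integral>\<omega>. indicator A \<omega> * r t \<omega> \<partial>M) + \<mu> * (s - t)"
  have PC: "(\<integral>\<omega>. P k \<omega> \<partial>M) \<le> C" for k
  proof -
    have "(\<integral>\<omega>. P k \<omega> \<partial>M) = (\<integral>\<omega>. indicator A \<omega> * r t \<omega> \<partial>M) + \<mu> * (\<integral>\<omega>. indicator A \<omega> * (T k \<omega> - t) \<partial>M)"
      unfolding P_eq V_def using rt Ti[of k] ns(2,3)[of k] by simp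
    also have "(\<integral>\<omega>. indicator A \<omega> * (T k \<omega> - t) \<partial>M) \<le> (\<integral>\<omega>. (s - t) \<partial>M)"
    proof (rule integral_mono[OF Ti])
      fix \<omega> assume "\<omega> \<in> space M"
      then show "indicator A \<omega> * (T k \<omega> - t) \<le> s - t" using TD(6)[of \<omega>] ts by (cases "\<omega> \<in> A") auto
    qed simp
    finally show ?thesis using mu_pos by (simp add: C_def prob_space)
  qed
  define Q where "Q \<omega> = indicator A \<omega> * (r s \<omega> + \<kappa> * (cum s \<omega> - cum t \<omega>))" for \<omega>
  have [measurable]: "Q \<in> borel_measurable M" unfolding Q_def by measurable
  have Q0: "0 \<le> Q \<omega>" if "\<omega> \<in> space M" for \<omega>
    unfolding Q_def using r_nonneg[OF s that] cum_diff(3)[OF that ts] kappa_pos by simp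
  have Qi: "integrable M Q"
  proof (rule integrableI_bounded)
    have "(\<integral>\<^sup>+\<omega>. ennreal (norm (Q \<omega>)) \<partial>M) = (\<integral>\<^sup>+\<omega>. liminf (\<lambda>k. ennreal (P k \<omega>)) \<partial>M)"
    proof (rule nn_integral_cong)
      fix \<omega> assume w: "\<omega> \<in> space M"
      have "\<forall>\<^sub>F k in sequentially. ennreal (P k \<omega>) = ennreal (norm (Q \<omega>))"
        using Tev[OF w] by eventually_elim (use Q0[OF w] in \<open>simp add: P_def Q_def\<close>)
      then have "(\<lambda>k. ennreal (P k \<omega>)) \<longlonglongrightarrow> ennreal (norm (Q \<omega>))" by (rule tendsto_eventually)
      then show "ennreal (norm (Q \<omega>)) = liminf (\<lambda>k. ennreal (P k \<omega>))"
        by (rule lim_imp_Liminf[OF trivial_limit_sequentially, symmetric])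
    qed
    also have "\<dots> \<le> liminf (\<lambda>k. \<integral>\<^sup>+\<omega>. ennreal (P k \<omega>) \<partial>M)"
      by (rule nn_integral_liminf) (use Pi in auto)
    also have "\<dots> \<le> ennreal C"
    proof (rule Liminf_le, simp, rule always_eventually, rule allI)
      fix k show "(\<integral>\<^sup>+\<omega>. ennreal (P k \<omega>) \<partial>M) \<le> ennreal C"
        by (subst nn_integral_eq_integral[OF Pi]) (auto intro!: ennreal_leI PC P0)
    qed
    also have "\<dots> < \<infinity>" by simp
    finally show "(\<integral>\<^sup>+\<omega>. ennreal (norm (Q \<omega>)) \<partial>M) < \<infinity>" .
  qed measurable
  show "integrable M (\<lambda>\<omega>. indicator A \<omega> * r s \<omega>)"
  proof (rule Bochner_Integration.integrable_bound[OF Qi])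
    show "AE \<omega> in M. norm (indicator A \<omega> * r s \<omega>) \<le> norm (Q \<omega>)"
    proof (rule AE_I2)
      fix \<omega> assume w: "\<omega> \<in> space M"
      have "0 \<le> \<kappa> * (cum s \<omega> - cum t \<omega>)" using cum_diff(3)[OF w ts] kappa_pos by (intro mult_nonneg_nonneg) auto
      then show "norm (indicator A \<omega> * r s \<omega>) \<le> norm (Q \<omega>)" using r_nonneg[OF s w] by (cases "\<omega> \<in> A") (auto simp: Q_def)
    qed
  qed measurable
  show ci: "integrable M (\<lambda>\<omega>. indicator A \<omega> * (cum s \<omega> - cum t \<omega>))"
  proof (rule Bochner_Integration.integrable_bound)
    show "integrable M (\<lambda>\<omega>. Q \<omega> / \<kappa>)" using Qi by simp
    show "AE \<omega> in M. norm (indicator A \<omega> * (cum s \<omega> - cum t \<omega>)) \<le> norm (Q \<omega> / \<kappa>)"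
    proof (rule AE_I2)
      fix \<omega> assume w: "\<omega> \<in> space M"
      have c0: "0 \<le> cum s \<omega> - cum t \<omega>" using cum_diff(3)[OF w ts] by simp
      have "cum s \<omega> - cum t \<omega> \<le> (r s \<omega> + \<kappa> * (cum s \<omega> - cum t \<omega>)) / \<kappa>"
        using kappa_pos r_nonneg[OF s w] by (simp add: add_divide_distrib)
      then show "norm (indicator A \<omega> * (cum s \<omega> - cum t \<omega>)) \<le> norm (Q \<omega> / \<kappa>)"
        using c0 abs_ge_self[of "(r s \<omega> + \<kappa> * (cum s \<omega> - cum t \<omega>)) / \<kappa>"]
        by (cases "\<omega> \<in> A") (simp_all add: Q_def del: abs_divide)
    qed
  qed measurable
  have br: "indicator A \<omega> * bracket t s \<omega> = \<sigma>\<^sup>2 * (indicator A \<omega> * (cum s \<omega> - cum t \<omega>))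
    + a\<^sup>2 * (\<alpha> * (s - t) * indicator A \<omega> + \<beta> * (indicator A \<omega> * (cum s \<omega> - cum t \<omega>)))" for \<omega>
    by (simp add: bracket_def algebra_simps)
  show bi: "integrable M (\<lambda>\<omega>. indicator A \<omega> * bracket t s \<omega>)"
    unfolding br by (intro Bochner_Integration.integrable_add integrable_mult_right ci) (auto simp: emeasure_eq_measure)
  define Z where "Z \<omega> = indicator A \<omega> * (noise s \<omega> - noise t \<omega>)" for \<omega>
  have Zm [measurable]: "Z \<in> borel_measurable M" unfolding Z_def by measurable
  have VZ: "AE \<omega> in M. (\<lambda>k. V k \<omega>) \<longlonglongrightarrow> Z \<omega>"
  proof (rule AE_I2)
    fix \<omega> assume w: "\<omega> \<in> space M"
    have "\<forall>\<^sub>F k in sequentially. V k \<omega> = Z \<omega>" using Tev[OF w] by eventually_elim (simp add: V_def Z_def)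
    then show "(\<lambda>k. V k \<omega>) \<longlonglongrightarrow> Z \<omega>" by (rule tendsto_eventually)
  qed
  have V2: "integrable M (\<lambda>\<omega>. (V k \<omega>)\<^sup>2)" for k unfolding V_def by (rule ns)
  have Vm [measurable]: "V k \<in> borel_measurable M" for k
    unfolding V_def by (rule borel_measurable_integrable[OF ns(2)])
  have Vb: "(\<integral>\<omega>. (V k \<omega>)\<^sup>2 \<partial>M) \<le> (\<integral>\<omega>. indicator A \<omega> * bracket t s \<omega> \<partial>M)" for k
    unfolding V_def ns(5)
  proof (rule integral_mono[OF ns(4) bi])
    fix \<omega> assume w: "\<omega> \<in> space M"
    show "indicator A \<omega> * bracket t (T k \<omega>) \<omega> \<le> indicator A \<omega> * bracket t s \<omega>"
      using bracket_mono(2)[OF w ts(1) TD(5)[OF w] TD(6)[OF w]] by (intro mult_left_mono) auto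
  qed
  note fs = Fatou_square[OF Vm Zm V2 Vb VZ]
  show "integrable M (\<lambda>\<omega>. (indicator A \<omega> * (noise s \<omega> - noise t \<omega>))\<^sup>2)"
    "(\<integral>\<omega>. (indicator A \<omega> * (noise s \<omega> - noise t \<omega>))\<^sup>2 \<partial>M) \<le> (\<integral>\<omega>. indicator A \<omega> * bracket t s \<omega> \<partial>M)"
    using fs unfolding Z_def by auto
  note vs = Vitali_square[OF Vm Zm V2 Vb VZ]
  show "integrable M (\<lambda>\<omega>. indicator A \<omega> * (noise s \<omega> - noise t \<omega>))" using vs(1) unfolding Z_def .
  have "(\<integral>\<omega>. V k \<omega> \<partial>M) = 0" for k unfolding V_def by (rule ns)
  with vs(2) show "(\<integral>\<omega>. indicator A \<omega> * (noise s \<omega> - noise t \<omega>) \<partial>M) = 0"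
    unfolding Z_def by (simp add: LIMSEQ_const_iff)
qed

text \<open>The missing inequality. The increments of the unstopped noise over a grid are orthogonal by the previous
  lemma, applied on each cell, and stopping keeps some of them and discards the others; so stopping cannot
  increase the second moment, and the stopped second moments increase to the mean of the bracket.\<close>

lemma noise_second_moment:
  assumes ts: "0 \<le> t" "t \<le> s" and A: "A \<in> sets (F t)" and rt: "integrable M (\<lambda>\<omega>. indicator A \<omega> * r t \<omega>)"
  shows "(\<integral>\<omega>. (indicator A \<omega> * (noise s \<omega> - noise t \<omega>))\<^sup>2 \<partial>M) = (\<integral>\<omega>. indicator A \<omega> * bracket t s \<omega> \<partial>M)"
proof (rule antisym)
  note ni = noise_integrability[OF assms]
  show "(\<integral>\<omega>. (indicator A \<omega> * (noise s \<omega> - noise t \<omega>))\<^sup>2 \<partial>M) \<le> (\<integral>\<omega>. indicator A \<omega> * bracket t s \<omega> \<partial>M)"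
    by (rule ni)
  have s: "0 \<le> s" using ts by simp
  note AM [measurable] = sets_F_M[OF A]
  define T where "T = exit_time t s"
  have T: "stopping_between (T k) t s" for k unfolding T_def by (rule exit_time_stopping[OF ts])
  have B: "\<forall>\<omega>\<in>space M. \<omega> \<in> A \<longrightarrow> load (T k \<omega>) \<omega> - load t \<omega> \<le> real k + 2" for k
    unfolding T_def using exit_time_load[OF ts] by blast
  have Tev: "\<forall>\<^sub>F k in sequentially. T k \<omega> = s" if "\<omega> \<in> space M" for \<omega>
    unfolding T_def by (rule exit_time_eventually[OF ts that])
  note TD = stopping_betweenD[OF T]
  note ns = noise_stopped[OF T A B]
  define g where "g m = unif_grid t s (Suc m)" for m
  have g: "t \<le> g m i" "g m i \<le> s" if "i \<le> Suc m" for m i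
    using unif_grid_bounds[OF ts(2) that] by (auto simp: g_def)
  have gmono: "g m i \<le> g m j" if "i \<le> j" for m i j unfolding g_def by (rule unif_grid_mono[OF ts(2) that])
  define D where "D m i \<omega> = indicator A \<omega> * (noise (g m (Suc i)) \<omega> - noise (g m i) \<omega>)" for m i \<omega>
  have AF: "A \<in> sets (F (g m i))" if "i \<le> Suc m" for m i using A sets_F_mono[OF g(1)[OF that]] by blast
  have D: "D m i \<in> borel_measurable (F (g m (Suc i)))" "integrable M (\<lambda>\<omega>. (D m i \<omega>)\<^sup>2)"
    "\<And>C. C \<in> sets (F (g m i)) \<Longrightarrow> (\<integral>\<omega>. indicator C \<omega> * D m i \<omega> \<partial>M) = 0" if i: "i < Suc m" for m i
  proof -
    have i': "i \<le> Suc m" "Suc i \<le> Suc m" using i by auto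
    have b: "0 \<le> g m i" "g m i \<le> g m (Suc i)" "0 \<le> g m (Suc i)"
      using g(1)[OF i'(1)] g(1)[OF i'(2)] gmono[of i "Suc i" m] ts by auto
    note [measurable] = AF[OF i'(2)] noise_measurable[OF b(3)] measurable_F_mono[OF noise_measurable[OF b(1)] b(2)]
    show "D m i \<in> borel_measurable (F (g m (Suc i)))" unfolding D_def by measurable
    have ri: "integrable M (\<lambda>\<omega>. indicator A \<omega> * r (g m i) \<omega>)"
      by (rule noise_integrability(1)[OF ts(1) g(1)[OF i'(1)] A rt])
    show "integrable M (\<lambda>\<omega>. (D m i \<omega>)\<^sup>2)" unfolding D_def
      by (rule noise_integrability(4)[OF b(1,2) AF[OF i'(1)] ri])
    fix C assume C: "C \<in> sets (F (g m i))"
    have CA: "C \<inter> A \<in> sets (F (g m i))" using C AF[OF i'(1)] by auto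
    have eq: "indicator (C \<inter> A) \<omega> * x = indicator C \<omega> * (indicator A \<omega> * x)" for \<omega> and x :: real
      by (simp add: indicator_inter_arith)
    have "integrable M (\<lambda>\<omega>. indicator (C \<inter> A) \<omega> * r (g m i) \<omega>)"
      unfolding eq using integrable_mult_indicator[OF sets_F_M[OF C] ri] by simp
    from noise_integrability(6)[OF b(1,2) CA this]
    show "(\<integral>\<omega>. indicator C \<omega> * D m i \<omega> \<partial>M) = 0" unfolding D_def eq .
  qed
  define Z where "Z \<omega> = indicator A \<omega> * (noise s \<omega> - noise t \<omega>)" for \<omega>
  have Zsum: "Z \<omega> = (\<Sum>i<Suc m. D m i \<omega>)" for m \<omega>
    unfolding D_def sum_distrib_left[symmetric] by (subst sum_lessThan_telescope) (simp add: Z_def g_def)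
  have EZ: "(\<integral>\<omega>. (Z \<omega>)\<^sup>2 \<partial>M) = (\<Sum>i<Suc m. \<integral>\<omega>. (D m i \<omega>)\<^sup>2 \<partial>M)" for m
  proof -
    have "(\<integral>\<omega>. (Z \<omega>)\<^sup>2 \<partial>M) = (\<integral>\<omega>. (\<Sum>i<Suc m. D m i \<omega>) * (\<Sum>i<Suc m. D m i \<omega>) \<partial>M)"
      by (intro Bochner_Integration.integral_cong refl) (simp only: Zsum[of _ m] power2_eq_square)
    also have "\<dots> = (\<Sum>i<Suc m. \<integral>\<omega>. D m i \<omega> * D m i \<omega> \<partial>M)"
      by (rule martingale_difference_products[where g="g m"]; (rule gmono D | assumption)+)
    finally show ?thesis by (simp only: power2_eq_square)
  qed
  \<comment> \<open>stopping only discards increments, and the increments are orthogonal\<close>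
  have le: "(\<integral>\<omega>. indicator A \<omega> * bracket t (T k \<omega>) \<omega> \<partial>M) \<le> (\<integral>\<omega>. (Z \<omega>)\<^sup>2 \<partial>M)" for k
  proof -
    define E where "E m i \<omega> = indicator {\<omega> \<in> space M. g m i < T k \<omega>} \<omega> * D m i \<omega>" for m i \<omega>
    have BF: "{\<omega> \<in> space M. g m i < T k \<omega>} \<in> sets (F (g m i))" for m i
      by (rule stopping_time_sets_F(1)[OF TD(1) order_refl])
    have E: "E m i \<in> borel_measurable (F (g m (Suc i)))" "integrable M (\<lambda>\<omega>. (E m i \<omega>)\<^sup>2)"
      "\<And>C. C \<in> sets (F (g m i)) \<Longrightarrow> (\<integral>\<omega>. indicator C \<omega> * E m i \<omega> \<partial>M) = 0"
      "(\<integral>\<omega>. (E m i \<omega>)\<^sup>2 \<partial>M) \<le> (\<integral>\<omega>. (D m i \<omega>)\<^sup>2 \<partial>M)" if i: "i < Suc m" for m i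
    proof -
      have [measurable]: "{\<omega> \<in> space M. g m i < T k \<omega>} \<in> sets (F (g m (Suc i)))"
        by (rule stopping_time_sets_F(1)[OF TD(1)]) (rule gmono, simp)
      note [measurable] = D(1)[OF i]
      show "E m i \<in> borel_measurable (F (g m (Suc i)))" unfolding E_def by measurable
      have E2: "(E m i \<omega>)\<^sup>2 = indicator {\<omega> \<in> space M. g m i < T k \<omega>} \<omega> * (D m i \<omega>)\<^sup>2" for \<omega>
        by (simp add: E_def power_mult_distrib indicator_def)
      show E2i: "integrable M (\<lambda>\<omega>. (E m i \<omega>)\<^sup>2)"
        unfolding E2 using integrable_mult_indicator[OF sets_F_M[OF BF] D(2)[OF i]] by simp
      show "(\<integral>\<omega>. (E m i \<omega>)\<^sup>2 \<partial>M) \<le> (\<integral>\<omega>. (D m i \<omega>)\<^sup>2 \<partial>M)"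
        by (rule integral_mono[OF E2i D(2)[OF i]]) (auto simp: E2 indicator_def)
      fix C assume C: "C \<in> sets (F (g m i))"
      have "C \<inter> {\<omega> \<in> space M. g m i < T k \<omega>} \<in> sets (F (g m i))" using C BF by auto
      from D(3)[OF i this] show "(\<integral>\<omega>. indicator C \<omega> * E m i \<omega> \<partial>M) = 0"
        by (simp add: E_def indicator_inter_arith mult.assoc)
    qed
    define S where "S m \<omega> = (\<Sum>i<Suc m. E m i \<omega>)" for m \<omega>
    have ES: "(\<integral>\<omega>. (S m \<omega>)\<^sup>2 \<partial>M) \<le> (\<integral>\<omega>. (Z \<omega>)\<^sup>2 \<partial>M)" for m
    proof -
      have "(\<integral>\<omega>. (S m \<omega>)\<^sup>2 \<partial>M) = (\<Sum>i<Suc m. \<integral>\<omega>. E m i \<omega> * E m i \<omega> \<partial>M)"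
        unfolding S_def power2_eq_square
        by (rule martingale_difference_products[where g="g m"]; (rule gmono E | assumption)+)
      also have "\<dots> \<le> (\<Sum>i<Suc m. \<integral>\<omega>. (D m i \<omega>)\<^sup>2 \<partial>M)"
        unfolding power2_eq_square[symmetric] by (intro sum_mono E) auto
      finally show ?thesis unfolding EZ[of m] .
    qed
    have EM: "E m i \<in> borel_measurable M" if "i < Suc m" for m i by (rule measurable_F_M[OF E(1)[OF that]])
    have Sm: "S m \<in> borel_measurable M" for m
      unfolding S_def by (intro borel_measurable_sum EM) auto
    have S2: "integrable M (\<lambda>\<omega>. (S m \<omega>)\<^sup>2)" for m
      unfolding S_def power2_eq_square sum_product
      by (intro Bochner_Integration.integrable_sum integrable_mult_of_squares EM E) auto
    have "AE \<omega> in M. (\<lambda>m. S m \<omega>) \<longlonglongrightarrow> indicator A \<omega> * (noise (T k \<omega>) \<omega> - noise t \<omega>)"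
    proof (rule AE_I2)
      fix \<omega> assume w: "\<omega> \<in> space M"
      have "S m \<omega> = indicator A \<omega> * stopped_sum (\<lambda>u. noise u \<omega>) t s (Suc m) (T k \<omega>)" for m
        unfolding S_def stopped_sum_def sum_distrib_left g_def[symmetric] E_def D_def using w
        by (intro sum.cong) (auto simp: indicator_def)
      then show "(\<lambda>m. S m \<omega>) \<longlonglongrightarrow> indicator A \<omega> * (noise (T k \<omega>) \<omega> - noise t \<omega>)"
        using stopped_sum_tendsto[OF TD(5,6)[OF w] noise_right_continuous[OF w TD(7)[OF w]], of k]
        by (simp add: tendsto_mult_left)
    qed
    from Fatou_square(2)[OF Sm borel_measurable_integrable[OF ns(2)] S2 ES this]
    show ?thesis unfolding ns(5) .
  qed
  have "(\<lambda>k. \<integral>\<omega>. indicator A \<omega> * bracket t (T k \<omega>) \<omega> \<partial>M) \<longlonglongrightarrow> (\<integral>\<omega>. indicator A \<omega> * bracket t s \<omega> \<partial>M)"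
  proof (rule integral_dominated_convergence[where w="\<lambda>\<omega>. indicator A \<omega> * bracket t s \<omega>"])
    show "AE \<omega> in M. (\<lambda>k. indicator A \<omega> * bracket t (T k \<omega>) \<omega>) \<longlonglongrightarrow> indicator A \<omega> * bracket t s \<omega>"
    proof (rule AE_I2)
      fix \<omega> assume w: "\<omega> \<in> space M"
      have "\<forall>\<^sub>F k in sequentially. indicator A \<omega> * bracket t (T k \<omega>) \<omega> = indicator A \<omega> * bracket t s \<omega>"
        using Tev[OF w] by eventually_elim simp
      then show "(\<lambda>k. indicator A \<omega> * bracket t (T k \<omega>) \<omega>) \<longlonglongrightarrow> indicator A \<omega> * bracket t s \<omega>"
        by (rule tendsto_eventually)
    qed
    show "AE \<omega> in M. norm (indicator A \<omega> * bracket t (T k \<omega>) \<omega>) \<le> indicator A \<omega> * bracket t s \<omega>" for k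
    proof (rule AE_I2)
      fix \<omega> assume w: "\<omega> \<in> space M"
      show "norm (indicator A \<omega> * bracket t (T k \<omega>) \<omega>) \<le> indicator A \<omega> * bracket t s \<omega>"
        using bracket_mono[OF w ts(1) TD(5)[OF w] TD(6)[OF w]] by (simp add: abs_mult mult_left_mono)
    qed
  qed (use ni(3) ns(4) in auto)
  then show "(\<integral>\<omega>. indicator A \<omega> * bracket t s \<omega> \<partial>M) \<le> (\<integral>\<omega>. (indicator A \<omega> * (noise s \<omega> - noise t \<omega>))\<^sup>2 \<partial>M)"
    unfolding Z_def[symmetric] by (rule LIMSEQ_le_const2) (use le in blast)
qed

end

section \<open>Linear integral equations\<close>

text \<open>Integration by parts for absolutely continuous functions: by symmetry, the integral over a square is twice
  the integral over the triangle below the diagonal.\<close>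

lemma square_of_integral:
  fixes f :: "real \<Rightarrow> real"
  assumes f: "integrable lborel f"
  shows "integrable lborel (\<lambda>u. f u * (\<integral>w. indicator {..u} w * f w \<partial>lborel))"
    "(\<integral>u. f u \<partial>lborel)\<^sup>2 = 2 * (\<integral>u. f u * (\<integral>w. indicator {..u} w * f w \<partial>lborel) \<partial>lborel)"
proof -
  have [measurable]: "f \<in> borel_measurable borel" using f by auto
  \<comment> \<open>the product \<open>f u * f w\<close> below the diagonal\<close>
  define g where "g u w = f u * ((if w \<le> u then 1 else 0) * f w)" for u w
  have gm [measurable]: "(\<lambda>(u, w). g u w) \<in> borel_measurable (lborel \<Otimes>\<^sub>M lborel)" unfolding g_def by measurable
  have P: "integrable (lborel \<Otimes>\<^sub>M lborel) (\<lambda>(u, w). f u * f w)"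
  proof (rule lborel_pair.Fubini_integrable)
    have "(\<lambda>u. \<integral>w. norm (case (u, w) of (u, w) \<Rightarrow> f u * f w) \<partial>lborel) = (\<lambda>u. \<bar>f u\<bar> * (\<integral>w. \<bar>f w\<bar> \<partial>lborel))"
      by (simp add: abs_mult)
    then show "integrable lborel (\<lambda>u. \<integral>w. norm (case (u, w) of (u, w) \<Rightarrow> f u * f w) \<partial>lborel)"
      using f by simp
  qed (use f in auto)
  have G: "integrable (lborel \<Otimes>\<^sub>M lborel) (\<lambda>(u, w). g u w)"
    by (rule Bochner_Integration.integrable_bound[OF P]) (auto simp: g_def abs_mult)
  have G': "integrable (lborel \<Otimes>\<^sub>M lborel) (\<lambda>(u, w). g w u)"
    using lborel_pair.integrable_product_swap[OF G] by simp
  have gi: "(\<integral>w. g u w \<partial>lborel) = f u * (\<integral>w. indicator {..u} w * f w \<partial>lborel)" for u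
    unfolding g_def by (subst integral_mult_right_zero[symmetric]) (auto intro!: Bochner_Integration.integral_cong simp: indicator_def)
  show i1: "integrable lborel (\<lambda>u. f u * (\<integral>w. indicator {..u} w * f w \<partial>lborel))"
    using lborel_pair.integrable_fst'[OF G] by (simp add: gi)
  have i2: "integrable lborel (\<lambda>u. \<integral>w. g w u \<partial>lborel)"
    using lborel_pair.integrable_fst'[OF G'] by simp
  have sw: "(\<integral>u. (\<integral>w. g w u \<partial>lborel) \<partial>lborel) = (\<integral>u. (\<integral>w. g u w \<partial>lborel) \<partial>lborel)"
    by (rule lborel_pair.Fubini_integral[OF G])
  have "(\<integral>u. f u \<partial>lborel)\<^sup>2 = (\<integral>u. (\<integral>w. f u * f w \<partial>lborel) \<partial>lborel)"
    by (simp add: power2_eq_square)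
  also have "\<dots> = (\<integral>u. (\<integral>w. g u w \<partial>lborel) + (\<integral>w. g w u \<partial>lborel) \<partial>lborel)"
  proof (rule integral_cong_AE)
    show "AE u in lborel. (\<integral>w. f u * f w \<partial>lborel) = (\<integral>w. g u w \<partial>lborel) + (\<integral>w. g w u \<partial>lborel)"
      using lborel_pair.AE_integrable_fst'[OF G] lborel_pair.AE_integrable_fst'[OF G']
    proof eventually_elim
      case (elim u)
      have "(\<integral>w. g u w \<partial>lborel) + (\<integral>w. g w u \<partial>lborel) = (\<integral>w. g u w + g w u \<partial>lborel)"
        using elim by (intro Bochner_Integration.integral_add[symmetric]) auto
      also have "\<dots> = (\<integral>w. f u * f w \<partial>lborel)"
      proof (rule integral_cong_AE)
        show "AE w in lborel. g u w + g w u = f u * f w"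
          using AE_lborel_singleton[of u] by eventually_elim (auto simp: g_def)
        show "(\<lambda>w. g u w + g w u) \<in> borel_measurable lborel" unfolding g_def by measurable
      qed simp
      finally show ?case ..
    qed
  qed (use i1 i2 in \<open>auto simp: gi\<close>)
  also have "\<dots> = (\<integral>u. (\<integral>w. g u w \<partial>lborel) \<partial>lborel) + (\<integral>u. (\<integral>w. g w u \<partial>lborel) \<partial>lborel)"
    using i1 i2 by (intro Bochner_Integration.integral_add) (simp_all add: gi)
  finally show "(\<integral>u. f u \<partial>lborel)\<^sup>2 = 2 * (\<integral>u. f u * (\<integral>w. indicator {..u} w * f w \<partial>lborel) \<partial>lborel)"
    by (simp add: sw gi)
qed

lemma (in prob_space) Fubini_interval:
  fixes f :: "real \<Rightarrow> 'a \<Rightarrow> real"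
  assumes fm [measurable]: "(\<lambda>(u, \<omega>). f u \<omega>) \<in> borel_measurable (lborel \<Otimes>\<^sub>M M)"
    and zero: "\<And>u \<omega>. u \<notin> {t<..v} \<Longrightarrow> f u \<omega> = 0"
    and int: "\<And>u. t < u \<Longrightarrow> u \<le> v \<Longrightarrow> integrable M (f u)"
    and bound: "\<And>u. t < u \<Longrightarrow> u \<le> v \<Longrightarrow> (\<integral>\<omega>. \<bar>f u \<omega>\<bar> \<partial>M) \<le> C"
  shows "integrable M (\<lambda>\<omega>. \<integral>u. f u \<omega> \<partial>lborel)" "integrable lborel (\<lambda>u. \<integral>\<omega>. f u \<omega> \<partial>M)"
    "(\<integral>\<omega>. (\<integral>u. f u \<omega> \<partial>lborel) \<partial>M) = (\<integral>u. (\<integral>\<omega>. f u \<omega> \<partial>M) \<partial>lborel)"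
proof -
  interpret P: pair_sigma_finite lborel M ..
  have int': "integrable M (f u)" for u
  proof (cases "u \<in> {t<..v}")
    case False
    then have "f u = (\<lambda>\<omega>. 0)" using zero by auto
    then show ?thesis by simp
  qed (use int in auto)
  have I: "integrable (lborel \<Otimes>\<^sub>M M) (\<lambda>(u, \<omega>). f u \<omega>)"
  proof (rule P.Fubini_integrable)
    show "integrable lborel (\<lambda>u. \<integral>\<omega>. norm (case (u, \<omega>) of (u, \<omega>) \<Rightarrow> f u \<omega>) \<partial>M)"
    proof (rule Bochner_Integration.integrable_bound)
      show "integrable lborel (\<lambda>u. indicator {t<..v} u * C)"
        by (intro integrable_mult_left integrable_indicator_interval)
      show "(\<lambda>u. \<integral>\<omega>. norm (case (u, \<omega>) of (u, \<omega>) \<Rightarrow> f u \<omega>) \<partial>M) \<in> borel_measurable lborel"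
        by (rule borel_measurable_lebesgue_integral) measurable
      show "AE u in lborel. norm (\<integral>\<omega>. norm (case (u, \<omega>) of (u, \<omega>) \<Rightarrow> f u \<omega>) \<partial>M) \<le> norm (indicator {t<..v} u * C)"
      proof (rule AE_I2)
        fix u
        have "0 \<le> (\<integral>\<omega>. \<bar>f u \<omega>\<bar> \<partial>M)" by simp
        then show "norm (\<integral>\<omega>. norm (case (u, \<omega>) of (u, \<omega>) \<Rightarrow> f u \<omega>) \<partial>M) \<le> norm (indicator {t<..v} u * C)"
          using bound[of u] zero[of u] by (cases "u \<in> {t<..v}") auto
      qed
    qed
  qed (use int' in auto)
  show "integrable M (\<lambda>\<omega>. \<integral>u. f u \<omega> \<partial>lborel)" using P.integrable_snd[OF I] by simp
  show "integrable lborel (\<lambda>u. \<integral>\<omega>. f u \<omega> \<partial>M)" using P.integrable_fst'[OF I] by simp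
  show "(\<integral>\<omega>. (\<integral>u. f u \<omega> \<partial>lborel) \<partial>M) = (\<integral>u. (\<integral>\<omega>. f u \<omega> \<partial>M) \<partial>lborel)"
    by (rule P.Fubini_integral[OF I])
qed

text \<open>The integral equation makes \<open>y\<close> continuous and then differentiable on \<open>[t, s]\<close>,
  and \<open>exp (k * v) * (y v - Y v)\<close> has derivative zero.\<close>

lemma linear_integral_equation_unique:
  fixes y Y g :: "real \<Rightarrow> real"
  assumes ts: "t \<le> s"
    and int: "integrable lborel (\<lambda>u. indicator {t<..s} u * (g u - k * y u))"
    and eq: "\<And>v. t \<le> v \<Longrightarrow> v \<le> s \<Longrightarrow> y v = y t + (\<integral>u. indicator {t<..v} u * (g u - k * y u) \<partial>lborel)"
    and g: "continuous_on {t..s} g"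
    and Y: "\<And>v. (Y has_real_derivative g v - k * Y v) (at v)" "Y t = y t"
  shows "y s = Y s"
proof -
  define f where "f u = g u - k * y u" for u
  have oi: "integrable lborel (\<lambda>u. indicator {t<..v} u * f u)" if "v \<le> s" for v
  proof -
    have "integrable lborel (\<lambda>u. indicator {..v} u *\<^sub>R (indicator {t<..s} u * f u))"
      by (rule integrable_mult_indicator) (use int in \<open>auto simp: f_def\<close>)
    moreover have "(\<lambda>u. indicator {..v} u *\<^sub>R (indicator {t<..s} u * f u)) = (\<lambda>u. indicator {t<..v} u * f u)"
      using that by (auto simp: indicator_def fun_eq_iff)
    ultimately show ?thesis by simp
  qed
  have H: "f integrable_on {t..v}" "(\<integral>u. indicator {t<..v} u * f u \<partial>lborel) = integral {t..v} f" if v: "t \<le> v" "v \<le> s" for v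
  proof -
    have split: "indicator {t..v} u *\<^sub>R f u = indicator {t<..v} u * f u + indicator {t} u * f t" for u
      using v by (auto simp: indicator_def)
    have pt: "integrable lborel (\<lambda>u. indicator {t} u * f t)" "(\<integral>u. indicator {t} u * f t \<partial>lborel) = 0"
      by (auto intro!: integrable_mult_left integrable_real_indicator)
    have si: "set_integrable lborel {t..v} f"
      unfolding set_integrable_def split by (intro Bochner_Integration.integrable_add oi[OF v(2)] pt)
    show "f integrable_on {t..v}" by (rule set_borel_integral_eq_integral(1)[OF si])
    show "(\<integral>u. indicator {t<..v} u * f u \<partial>lborel) = integral {t..v} f"
      unfolding set_borel_integral_eq_integral(2)[OF si, symmetric] set_lebesgue_integral_def split
      using oi[OF v(2)] pt by simp
  qed
  have y: "y v = y t + integral {t..v} f" if "v \<in> {t..s}" for v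
    using eq[of v] H(2)[of v] that by (simp add: f_def)
  have "continuous_on {t..s} (\<lambda>v. y t + integral {t..v} f)"
    by (intro continuous_intros indefinite_integral_continuous_1 H) (use ts in auto)
  then have yc: "continuous_on {t..s} y" by (subst continuous_on_cong[OF refl y]) auto
  have fc: "continuous_on {t..s} f" unfolding f_def by (intro continuous_intros g yc)
  \<comment> \<open>\<open>y\<close> is replaced by the right-hand side of its equation, which is differentiable\<close>
  define d where "d v = exp (k * v) * (y t + integral {t..v} f - Y v)" for v
  have "\<exists>c. \<forall>v\<in>{t..s}. d v = c"
  proof (rule has_field_derivative_zero_constant)
    fix v assume v: "v \<in> {t..s}"
    have "(d has_real_derivative k * exp (k * v) * (y t + integral {t..v} f - Y v) + exp (k * v) * (f v - (g v - k * Y v))) (at v within {t..s})"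
      unfolding d_def using integral_has_real_derivative[OF fc v] DERIV_subset[OF Y(1)[of v] subset_UNIV]
      by (auto intro!: derivative_eq_intros)
    also have "k * exp (k * v) * (y t + integral {t..v} f - Y v) + exp (k * v) * (f v - (g v - k * Y v)) = 0"
      unfolding y[OF v, symmetric] by (simp add: f_def algebra_simps)
    finally show "(d has_real_derivative 0) (at v within {t..s})" .
  qed simp
  then have "d s = d t" using ts by auto
  then show ?thesis using y[of s] ts Y(2) by (simp add: d_def)
qed

text \<open>The solution of \<open>m' = k * l - k * m\<close>: exponential relaxation to the level \<open>l\<close>.\<close>

lemma exp_relaxation_derivative:
  fixes k :: real
  shows "((\<lambda>v. l - exp (- k * (v - t)) * (l - m)) has_real_derivative k * l - k * (l - exp (- k * (v - t)) * (l - m))) (at v)"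
  by (auto intro!: derivative_eq_intros simp: algebra_simps)

text \<open>The solution of the linear equation with rate \<open>2 * k\<close> whose forcing term itself relaxes at rate
  \<open>k\<close>. This is the shape of the second moment.\<close>

lemma second_order_relaxation_derivative:
  fixes k y0 c1 c2 t :: real
  defines "Y \<equiv> \<lambda>v. y0 * exp (- 2 * k * (v - t)) + c1 * (1 - exp (- 2 * k * (v - t)))
      - c2 * (exp (- k * (v - t)) - exp (- 2 * k * (v - t)))"
  shows "(Y has_real_derivative (2 * k * c1 - k * c2 * exp (- k * (v - t))) - (2 * k) * Y v) (at v)"
  unfolding Y_def by (auto intro!: derivative_eq_intros simp: algebra_simps)

section \<open>Conditional moments\<close>

context stable_cir_hawkes
begin

text \<open>Only square integrability on \<open>A\<close> is asked of \<open>U\<close>; the two indicators in the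
  product combine.\<close>

lemma noise_increment_orthogonal:
  assumes uv: "0 \<le> u" "u \<le> v" and A: "A \<in> sets (F u)" and ru: "integrable M (\<lambda>\<omega>. indicator A \<omega> * r u \<omega>)"
    and U: "U \<in> borel_measurable (F u)" and U2: "integrable M (\<lambda>\<omega>. (indicator A \<omega> * U \<omega>)\<^sup>2)"
  shows "integrable M (\<lambda>\<omega>. U \<omega> * (indicator A \<omega> * (noise v \<omega> - noise u \<omega>)))"
    "(\<integral>\<omega>. U \<omega> * (indicator A \<omega> * (noise v \<omega> - noise u \<omega>)) \<partial>M) = 0"
proof -
  note ni = noise_integrability[OF uv A ru]
  have [measurable]: "A \<in> sets M" by (rule sets_F_M[OF A])
  have [measurable]: "U \<in> borel_measurable M" by (rule measurable_F_M[OF U])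
  have "integrable M (\<lambda>\<omega>. (indicator A \<omega> * U \<omega>) * (indicator A \<omega> * (noise v \<omega> - noise u \<omega>)))"
    by (rule integrable_mult_of_squares[OF _ borel_measurable_integrable[OF ni(5)] U2 ni(4)]) measurable
  moreover have "(\<lambda>\<omega>. (indicator A \<omega> * U \<omega>) * (indicator A \<omega> * (noise v \<omega> - noise u \<omega>)))
      = (\<lambda>\<omega>. U \<omega> * (indicator A \<omega> * (noise v \<omega> - noise u \<omega>)))"
    by (auto simp: indicator_def fun_eq_iff)
  ultimately show i: "integrable M (\<lambda>\<omega>. U \<omega> * (indicator A \<omega> * (noise v \<omega> - noise u \<omega>)))" by simp
  show "(\<integral>\<omega>. U \<omega> * (indicator A \<omega> * (noise v \<omega> - noise u \<omega>)) \<partial>M) = 0"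
  proof (rule integral_mult_eq_0_of_subalgebra[OF subalgebra_F ni(5) _ U i])
    fix C assume C: "C \<in> sets (F u)"
    have eq: "indicator (C \<inter> A) \<omega> * x = indicator C \<omega> * (indicator A \<omega> * x)" for \<omega> and x :: real
      by (simp add: indicator_inter_arith)
    have "integrable M (\<lambda>\<omega>. indicator (C \<inter> A) \<omega> * r u \<omega>)"
      unfolding eq by (rule indicator_mult_integrable[OF sets_F_M[OF C] ru])
    from noise_integrability(6)[OF uv sets.Int[OF C A] this]
    show "(\<integral>\<omega>. indicator C \<omega> * (indicator A \<omega> * (noise v \<omega> - noise u \<omega>)) \<partial>M) = 0" unfolding eq .
  qed
qed

lemma r_clamped_measurable:
  assumes "0 \<le> s"
  shows "(\<lambda>(u, \<omega>). r (max 0 (min s u)) \<omega>) \<in> borel_measurable (lborel \<Otimes>\<^sub>M M)"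
proof -
  have m: "(\<lambda>x. (snd x, fst x)) \<in> measurable (lborel \<Otimes>\<^sub>M M) (F s \<Otimes>\<^sub>M (borel :: real measure))"
  proof (rule measurable_Pair)
    show "snd \<in> measurable (lborel \<Otimes>\<^sub>M M) (F s)"
      using measurable_compose[OF measurable_snd measurable_F_M[OF measurable_ident]] by (simp add: comp_def id_def)
  qed simp
  show ?thesis using measurable_compose[OF m r_jointly_measurable[OF assms]] by (simp add: split_beta')
qed

lemma cum_clamped_measurable:
  assumes "0 \<le> s"
  shows "(\<lambda>(u, \<omega>). cum (max 0 (min s u)) \<omega>) \<in> borel_measurable (lborel \<Otimes>\<^sub>M M)"
proof -
  note [measurable] = r_clamped_measurable[OF assms]
  have [measurable]: "(\<lambda>z. r (max 0 (min s (snd z))) (snd (fst z))) \<in> borel_measurable ((lborel \<Otimes>\<^sub>M M) \<Otimes>\<^sub>M (lborel :: real measure))"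
  proof -
    have "(\<lambda>z. (snd z, snd (fst z))) \<in> measurable ((lborel \<Otimes>\<^sub>M M) \<Otimes>\<^sub>M (lborel :: real measure)) (lborel \<Otimes>\<^sub>M M)"
      by measurable
    from measurable_compose[OF this r_clamped_measurable[OF assms]] show ?thesis by simp
  qed
  have "(\<lambda>x. \<integral>w. (if 0 \<le> w \<and> w \<le> max 0 (min s (fst x)) then 1 else 0) * r (max 0 (min s w)) (snd x) \<partial>lborel)
     \<in> borel_measurable (lborel \<Otimes>\<^sub>M M)"
    by (rule lborel.borel_measurable_lebesgue_integral) (simp add: split_beta')
  moreover have "(\<integral>w. (if 0 \<le> w \<and> w \<le> max 0 (min s u) then 1 else 0) * r (max 0 (min s w)) \<omega> \<partial>lborel) = cum (max 0 (min s u)) \<omega>" for u \<omega>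
    unfolding cum_def set_lebesgue_integral_def
  proof (intro Bochner_Integration.integral_cong refl)
    fix w :: real
    have "max 0 (min s w) = w" if "0 \<le> w" "w \<le> max 0 (min s u)" using that assms by linarith
    then show "(if 0 \<le> w \<and> w \<le> max 0 (min s u) then 1 else 0) * r (max 0 (min s w)) \<omega>
      = indicator {0..max 0 (min s u)} w *\<^sub>R r w \<omega>" by (auto simp: indicator_def)
  qed
  ultimately show ?thesis by (simp add: split_beta')
qed

text \<open>The noise drops out of the mean of \<open>r_noise\<close>. The second claim is a crude bound, uniform on
  bounded intervals, used as a domination for Fubini's theorem.\<close>

lemma mean_bound:
  assumes ts: "0 \<le> t" "t \<le> s" and A: "A \<in> sets (F t)" and rt: "integrable M (\<lambda>\<omega>. indicator A \<omega> * r t \<omega>)"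
  shows "(\<integral>\<omega>. indicator A \<omega> * r s \<omega> \<partial>M) = (\<integral>\<omega>. indicator A \<omega> * r t \<omega> \<partial>M) + \<mu> * (s - t) * prob A
      - \<kappa> * (\<integral>\<omega>. indicator A \<omega> * (cum s \<omega> - cum t \<omega>) \<partial>M)"
    "(\<integral>\<omega>. indicator A \<omega> * r s \<omega> \<partial>M) \<le> (\<integral>\<omega>. indicator A \<omega> * r t \<omega> \<partial>M) + \<mu> * (s - t)"
proof -
  note ni = noise_integrability[OF assms]
  have [measurable]: "A \<in> sets M" by (rule sets_F_M[OF A])
  have eq: "indicator A \<omega> * r s \<omega> = indicator A \<omega> * r t \<omega> + \<mu> * (s - t) * indicator A \<omega>
     - \<kappa> * (indicator A \<omega> * (cum s \<omega> - cum t \<omega>)) + indicator A \<omega> * (noise s \<omega> - noise t \<omega>)" for \<omega>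
    using r_noise[of s \<omega> t] by (cases "\<omega> \<in> A") simp_all
  have iA: "integrable M (\<lambda>\<omega>. \<mu> * (s - t) * indicator A \<omega>)" by (auto simp: emeasure_eq_measure)
  note i = Bochner_Integration.integrable_add Bochner_Integration.integrable_diff integrable_mult_right rt iA ni(2) ni(5)
  have "(\<integral>\<omega>. indicator A \<omega> * r s \<omega> \<partial>M) = (\<integral>\<omega>. indicator A \<omega> * r t \<omega> + \<mu> * (s - t) * indicator A \<omega>
     - \<kappa> * (indicator A \<omega> * (cum s \<omega> - cum t \<omega>)) \<partial>M) + (\<integral>\<omega>. indicator A \<omega> * (noise s \<omega> - noise t \<omega>) \<partial>M)"
    unfolding eq by (rule Bochner_Integration.integral_add) (intro i)+
  also have "(\<integral>\<omega>. indicator A \<omega> * r t \<omega> + \<mu> * (s - t) * indicator A \<omega> - \<kappa> * (indicator A \<omega> * (cum s \<omega> - cum t \<omega>)) \<partial>M)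
    = (\<integral>\<omega>. indicator A \<omega> * r t \<omega> + \<mu> * (s - t) * indicator A \<omega> \<partial>M) - (\<integral>\<omega>. \<kappa> * (indicator A \<omega> * (cum s \<omega> - cum t \<omega>)) \<partial>M)"
    by (rule Bochner_Integration.integral_diff) (intro i)+
  also have "(\<integral>\<omega>. indicator A \<omega> * r t \<omega> + \<mu> * (s - t) * indicator A \<omega> \<partial>M)
    = (\<integral>\<omega>. indicator A \<omega> * r t \<omega> \<partial>M) + (\<integral>\<omega>. \<mu> * (s - t) * indicator A \<omega> \<partial>M)"
    by (rule Bochner_Integration.integral_add) (intro i)+
  finally show e: "(\<integral>\<omega>. indicator A \<omega> * r s \<omega> \<partial>M) = (\<integral>\<omega>. indicator A \<omega> * r t \<omega> \<partial>M) + \<mu> * (s - t) * prob A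
      - \<kappa> * (\<integral>\<omega>. indicator A \<omega> * (cum s \<omega> - cum t \<omega>) \<partial>M)"
    using ni(6) by simp
  have "0 \<le> (\<integral>\<omega>. indicator A \<omega> * (cum s \<omega> - cum t \<omega>) \<partial>M)"
    by (rule integral_nonneg_AE) (use cum_diff(3)[OF _ ts] in \<open>auto intro!: AE_I2\<close>)
  then have "0 \<le> \<kappa> * (\<integral>\<omega>. indicator A \<omega> * (cum s \<omega> - cum t \<omega>) \<partial>M)" using kappa_pos by simp
  moreover have "\<mu> * (s - t) * prob A \<le> \<mu> * (s - t) * 1" using mu_pos ts by (intro mult_left_mono) auto
  ultimately show "(\<integral>\<omega>. indicator A \<omega> * r s \<omega> \<partial>M) \<le> (\<integral>\<omega>. indicator A \<omega> * r t \<omega> \<partial>M) + \<mu> * (s - t)"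
    using e by linarith
qed

lemma mean_integrated:
  assumes ts: "0 \<le> t" "t \<le> s" and A: "A \<in> sets (F t)" and rt: "integrable M (\<lambda>\<omega>. indicator A \<omega> * r t \<omega>)"
  shows "integrable lborel (\<lambda>u. indicator {t<..s} u * (\<integral>\<omega>. indicator A \<omega> * r u \<omega> \<partial>M))"
    "(\<integral>\<omega>. indicator A \<omega> * (cum s \<omega> - cum t \<omega>) \<partial>M) = (\<integral>u. indicator {t<..s} u * (\<integral>\<omega>. indicator A \<omega> * r u \<omega> \<partial>M) \<partial>lborel)"
proof -
  have s: "0 \<le> s" using ts by simp
  have [measurable]: "A \<in> sets M" by (rule sets_F_M[OF A])
  note [measurable] = r_clamped_measurable[OF s]
  define f where "f u \<omega> = indicator {t<..s} u * (indicator A \<omega> * r (max 0 (min s u)) \<omega>)" for u \<omega>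
  have f: "f u \<omega> = indicator {t<..s} u * (indicator A \<omega> * r u \<omega>)" for u \<omega>
    using ts by (auto simp: f_def indicator_def)
  have fm: "(\<lambda>(u, \<omega>). f u \<omega>) \<in> borel_measurable (lborel \<Otimes>\<^sub>M M)" unfolding f_def by measurable
  note F = Fubini_interval[OF fm, of t s "(\<integral>\<omega>. indicator A \<omega> * r t \<omega> \<partial>M) + \<mu> * (s - t)"]
  have z: "f u \<omega> = 0" if "u \<notin> {t<..s}" for u \<omega> using that by (simp add: f)
  have i: "integrable M (f u)" if "t < u" "u \<le> s" for u
    unfolding f[abs_def] using that noise_integrability(1)[OF ts(1) _ A rt, of u] by simp
  have b: "(\<integral>\<omega>. \<bar>f u \<omega>\<bar> \<partial>M) \<le> (\<integral>\<omega>. indicator A \<omega> * r t \<omega> \<partial>M) + \<mu> * (s - t)" if "t < u" "u \<le> s" for u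
  proof -
    have "(\<integral>\<omega>. \<bar>f u \<omega>\<bar> \<partial>M) = (\<integral>\<omega>. indicator A \<omega> * r u \<omega> \<partial>M)"
      unfolding f using that ts r_nonneg[of u] by (intro Bochner_Integration.integral_cong) auto
    also have "\<dots> \<le> (\<integral>\<omega>. indicator A \<omega> * r t \<omega> \<partial>M) + \<mu> * (u - t)"
      by (rule mean_bound(2)[OF ts(1) _ A rt]) (use that in simp)
    also have "\<dots> \<le> (\<integral>\<omega>. indicator A \<omega> * r t \<omega> \<partial>M) + \<mu> * (s - t)"
      using mu_pos that by (intro add_left_mono mult_left_mono) auto
    finally show ?thesis .
  qed
  have inner: "(\<integral>\<omega>. f u \<omega> \<partial>M) = indicator {t<..s} u * (\<integral>\<omega>. indicator A \<omega> * r u \<omega> \<partial>M)" for u unfolding f by simp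
  show "integrable lborel (\<lambda>u. indicator {t<..s} u * (\<integral>\<omega>. indicator A \<omega> * r u \<omega> \<partial>M))"
    using F(2)[OF z i b] unfolding inner .
  have "(\<integral>\<omega>. indicator A \<omega> * (cum s \<omega> - cum t \<omega>) \<partial>M) = (\<integral>\<omega>. (\<integral>u. f u \<omega> \<partial>lborel) \<partial>M)"
  proof (rule Bochner_Integration.integral_cong[OF refl])
    fix \<omega> assume w: "\<omega> \<in> space M"
    show "indicator A \<omega> * (cum s \<omega> - cum t \<omega>) = (\<integral>u. f u \<omega> \<partial>lborel)"
      unfolding cum_diff(1)[OF w ts] f by (cases "\<omega> \<in> A") simp_all
  qed
  then show "(\<integral>\<omega>. indicator A \<omega> * (cum s \<omega> - cum t \<omega>) \<partial>M) = (\<integral>u. indicator {t<..s} u * (\<integral>\<omega>. indicator A \<omega> * r u \<omega> \<partial>M) \<partial>lborel)"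
    using F(3)[OF z i b] unfolding inner by simp
qed

lemma mean_formula:
  assumes ts: "0 \<le> t" "t \<le> s" and A: "A \<in> sets (F t)" and rt: "integrable M (\<lambda>\<omega>. indicator A \<omega> * r t \<omega>)"
  shows "(\<integral>\<omega>. indicator A \<omega> * r s \<omega> \<partial>M)
    = \<mu> / \<kappa> * prob A - exp (- \<kappa> * (s - t)) * (\<mu> / \<kappa> * prob A - (\<integral>\<omega>. indicator A \<omega> * r t \<omega> \<partial>M))"
proof -
  define m where "m u = (\<integral>\<omega>. indicator A \<omega> * r u \<omega> \<partial>M)" for u
  note mi = mean_integrated[OF ts(1) _ A rt, folded m_def]
  have ig: "integrable lborel (\<lambda>u. indicator {t<..v} u * (\<mu> * prob A - \<kappa> * m u))" if "t \<le> v" for v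
  proof -
    have "integrable lborel (\<lambda>u. indicator {t<..v} u * (\<mu> * prob A) - \<kappa> * (indicator {t<..v} u * m u))"
      by (intro Bochner_Integration.integrable_diff integrable_mult_left integrable_mult_right integrable_indicator_interval mi that)
    then show ?thesis by (simp add: algebra_simps)
  qed
  have "m s = \<mu> / \<kappa> * prob A - exp (- \<kappa> * (s - t)) * (\<mu> / \<kappa> * prob A - m t)"
  proof (rule linear_integral_equation_unique[where t=t and k=\<kappa> and g="\<lambda>_. \<mu> * prob A"
        and Y="\<lambda>v. \<mu> / \<kappa> * prob A - exp (- \<kappa> * (v - t)) * (\<mu> / \<kappa> * prob A - m t)"])
    show "integrable lborel (\<lambda>u. indicator {t<..s} u * (\<mu> * prob A - \<kappa> * m u))" by (rule ig[OF ts(2)])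
    show "((\<lambda>v. \<mu> / \<kappa> * prob A - exp (- \<kappa> * (v - t)) * (\<mu> / \<kappa> * prob A - m t)) has_real_derivative
      \<mu> * prob A - \<kappa> * (\<mu> / \<kappa> * prob A - exp (- \<kappa> * (v - t)) * (\<mu> / \<kappa> * prob A - m t))) (at v)" for v
    proof -
      have "\<mu> * prob A = \<kappa> * (\<mu> / \<kappa> * prob A)" using kappa_pos by simp
      then show ?thesis using exp_relaxation_derivative[of "\<mu> / \<kappa> * prob A" \<kappa> t "m t" v] by (simp only:)
    qed
    fix v assume v: "t \<le> v" "v \<le> s"
    have "(\<integral>u. indicator {t<..v} u * (\<mu> * prob A - \<kappa> * m u) \<partial>lborel)
      = (\<integral>u. indicator {t<..v} u * (\<mu> * prob A) - \<kappa> * (indicator {t<..v} u * m u) \<partial>lborel)"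
      by (intro Bochner_Integration.integral_cong) (auto simp: algebra_simps)
    also have "\<dots> = (\<integral>u. indicator {t<..v} u * (\<mu> * prob A) \<partial>lborel) - (\<integral>u. \<kappa> * (indicator {t<..v} u * m u) \<partial>lborel)"
      by (intro Bochner_Integration.integral_diff integrable_mult_left integrable_mult_right integrable_indicator_interval mi v)
    also have "\<dots> = (v - t) * (\<mu> * prob A) - \<kappa> * (\<integral>u. indicator {t<..v} u * m u \<partial>lborel)"
      using v by simp
    also have "(\<integral>u. indicator {t<..v} u * m u \<partial>lborel) = (\<integral>\<omega>. indicator A \<omega> * (cum v \<omega> - cum t \<omega>) \<partial>M)"
      using mi(2)[OF v(1)] by simp
    finally show "m v = m t + (\<integral>u. indicator {t<..v} u * (\<mu> * prob A - \<kappa> * m u) \<partial>lborel)"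
      using mean_bound(1)[OF ts(1) v(1) A rt] by (simp add: m_def algebra_simps)
  qed (use ts in auto)
  then show ?thesis by (simp add: m_def)
qed


text \<open>The drift \<open>\<mu> - \<kappa> * r\<close> is at most \<open>\<mu>\<close>, so \<open>r u\<close> is at
  most \<open>r t + \<mu> * (s - t)\<close> plus the absolute noise increment, whose mean square is known.\<close>

lemma square_integrability:
  assumes ts: "0 \<le> t" "t \<le> s" and A: "A \<in> sets (F t)" and rt: "integrable M (\<lambda>\<omega>. (indicator A \<omega> * r t \<omega>)\<^sup>2)"
  obtains C where "\<And>u. t \<le> u \<Longrightarrow> u \<le> s \<Longrightarrow> integrable M (\<lambda>\<omega>. (indicator A \<omega> * r u \<omega>)\<^sup>2)"
    "\<And>u. t \<le> u \<Longrightarrow> u \<le> s \<Longrightarrow> (\<integral>\<omega>. (indicator A \<omega> * r u \<omega>)\<^sup>2 \<partial>M) \<le> C"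
proof -
  have [measurable]: "A \<in> sets M" by (rule sets_F_M[OF A])
  have [measurable]: "r t \<in> borel_measurable M" by (rule measurable_F_M[OF r_measurable[OF ts(1)]])
  have rt1: "integrable M (\<lambda>\<omega>. indicator A \<omega> * r t \<omega>)" by (rule integrable_of_square[OF _ rt]) measurable
  define B where "B u \<omega> = 3 * ((indicator A \<omega> * r t \<omega>)\<^sup>2 + (\<mu> * (s - t))\<^sup>2 + (indicator A \<omega> * (noise u \<omega> - noise t \<omega>))\<^sup>2)" for u \<omega>
  have Bi: "integrable M (B u)" if "t \<le> u" for u
    unfolding B_def using noise_integrability(4)[OF ts(1) that A rt1] rt by simp
  have le: "(indicator A \<omega> * r u \<omega>)\<^sup>2 \<le> B u \<omega>" if u: "t \<le> u" "u \<le> s" and w: "\<omega> \<in> space M" for u \<omega>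
  proof (cases "\<omega> \<in> A")
    case True
    have "0 \<le> \<kappa> * (cum u \<omega> - cum t \<omega>)"
      using kappa_pos cum_diff(3)[OF w ts(1) u(1)] by (intro mult_nonneg_nonneg) auto
    moreover have "\<mu> * (u - t) \<le> \<mu> * (s - t)" using mu_pos u by (intro mult_left_mono) auto
    ultimately have 1: "r u \<omega> \<le> r t \<omega> + \<mu> * (s - t) + \<bar>noise u \<omega> - noise t \<omega>\<bar>"
      using r_noise[of u \<omega> t] by linarith
    have three: "(x + y + z)\<^sup>2 \<le> 3 * (x\<^sup>2 + y\<^sup>2 + z\<^sup>2)" for x y z :: real
    proof -
      have "0 \<le> (x - y)\<^sup>2 + (y - z)\<^sup>2 + (x - z)\<^sup>2" by simp
      then show ?thesis by (simp add: power2_eq_square algebra_simps)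
    qed
    have "(r u \<omega>)\<^sup>2 \<le> (r t \<omega> + \<mu> * (s - t) + \<bar>noise u \<omega> - noise t \<omega>\<bar>)\<^sup>2"
      using 1 r_nonneg[of u \<omega>] ts u w by (intro power_mono) auto
    also have "\<dots> \<le> 3 * ((r t \<omega>)\<^sup>2 + (\<mu> * (s - t))\<^sup>2 + \<bar>noise u \<omega> - noise t \<omega>\<bar>\<^sup>2)" by (rule three)
    finally show ?thesis using True by (simp add: B_def)
  qed (simp add: B_def)
  show ?thesis
  proof (rule that)
    fix u assume u: "t \<le> u" "u \<le> s"
    have [measurable]: "r u \<in> borel_measurable M" by (rule measurable_F_M[OF r_measurable]) (use ts u in simp)
    show i: "integrable M (\<lambda>\<omega>. (indicator A \<omega> * r u \<omega>)\<^sup>2)"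
      by (rule Bochner_Integration.integrable_bound[OF Bi[OF u(1)]])
        (auto intro!: AE_I2 order_trans[OF le[OF u]])
    note ni = noise_integrability[OF ts(1) u(1) A rt1]
    have "(\<integral>\<omega>. (indicator A \<omega> * r u \<omega>)\<^sup>2 \<partial>M) \<le> (\<integral>\<omega>. B u \<omega> \<partial>M)"
      by (rule integral_mono[OF i Bi[OF u(1)] le[OF u]])
    also have "\<dots> = 3 * ((\<integral>\<omega>. (indicator A \<omega> * r t \<omega>)\<^sup>2 \<partial>M) + (\<mu> * (s - t))\<^sup>2 + (\<integral>\<omega>. (indicator A \<omega> * (noise u \<omega> - noise t \<omega>))\<^sup>2 \<partial>M))"
      unfolding B_def using rt ni(4) by (simp add: prob_space)
    also have "(\<integral>\<omega>. (indicator A \<omega> * (noise u \<omega> - noise t \<omega>))\<^sup>2 \<partial>M) \<le> (\<integral>\<omega>. indicator A \<omega> * bracket t u \<omega> \<partial>M)" by (rule ni)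
    also have "\<dots> \<le> (\<integral>\<omega>. indicator A \<omega> * bracket t s \<omega> \<partial>M)"
    proof (rule integral_mono[OF ni(3) noise_integrability(3)[OF ts A rt1]])
      fix \<omega> assume "\<omega> \<in> space M"
      then show "indicator A \<omega> * bracket t u \<omega> \<le> indicator A \<omega> * bracket t s \<omega>"
        using bracket_mono(2)[of \<omega> t u s] ts u by (intro mult_left_mono) auto
    qed
    finally show "(\<integral>\<omega>. (indicator A \<omega> * r u \<omega>)\<^sup>2 \<partial>M)
      \<le> 3 * ((\<integral>\<omega>. (indicator A \<omega> * r t \<omega>)\<^sup>2 \<partial>M) + (\<mu> * (s - t))\<^sup>2 + (\<integral>\<omega>. indicator A \<omega> * bracket t s \<omega> \<partial>M))"
      by simp
  qed
qed

text \<open>Itself a pathwise identity: \<open>r s\<close> is \<open>r t\<close> plus the drift integral plus the noise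
  increment, and the square of the drift integral is expanded by \<open>square_of_integral\<close>. The
  terms are arranged so that the drift \<open>d u\<close> is multiplied by the increment of the noise after
  \<open>u\<close>.\<close>

lemma square_path_expansion:
  assumes w: "\<omega> \<in> space M" and ts: "0 \<le> t" "t \<le> s"
  defines "d \<equiv> \<lambda>u. indicator {t<..s} u * (\<mu> - \<kappa> * r u \<omega>)"
  shows "(r s \<omega>)\<^sup>2 = (r t \<omega>)\<^sup>2 + 2 * (\<integral>u. d u * r u \<omega> \<partial>lborel) + 2 * (\<integral>u. d u * (noise s \<omega> - noise u \<omega>) \<partial>lborel)
    + 2 * (r t \<omega> * (noise s \<omega> - noise t \<omega>)) + (noise s \<omega> - noise t \<omega>)\<^sup>2"
proof -
  have s: "0 \<le> s" using ts by simp
  have d_eq: "d u = indicator {t<..s} u * \<mu> - \<kappa> * (indicator {t<..s} u * r u \<omega>)" for u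
    by (simp add: d_def algebra_simps)
  have di: "integrable lborel d"
    unfolding d_eq[abs_def]
    by (intro Bochner_Integration.integrable_diff integrable_mult_left integrable_mult_right integrable_indicator_interval
        r_interval_integrable(1)[OF w ts])
  have int: "(\<integral>x. indicator {..u} x * d x \<partial>lborel) = \<mu> * (u - t) - \<kappa> * (cum u \<omega> - cum t \<omega>)" if u: "t \<le> u" "u \<le> s" for u
  proof -
    have "(\<integral>x. indicator {..u} x * d x \<partial>lborel) = (\<integral>x. indicator {t<..u} x * \<mu> - \<kappa> * (indicator {t<..u} x * r x \<omega>) \<partial>lborel)"
      using u by (intro Bochner_Integration.integral_cong) (auto simp: d_def indicator_def)
    also have "\<dots> = (\<integral>x. indicator {t<..u} x * \<mu> \<partial>lborel) - (\<integral>x. \<kappa> * (indicator {t<..u} x * r x \<omega>) \<partial>lborel)"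
      by (intro Bochner_Integration.integral_diff integrable_mult_left integrable_mult_right integrable_indicator_interval
        r_interval_integrable(1)[OF w ts(1) u(1)])
    also have "\<dots> = \<mu> * (u - t) - \<kappa> * (cum u \<omega> - cum t \<omega>)"
      using u cum_diff(1)[OF w ts(1) u(1)] by simp
    finally show ?thesis .
  qed
  define D where "D = (\<integral>u. d u \<partial>lborel)"
  have D: "D = \<mu> * (s - t) - \<kappa> * (cum s \<omega> - cum t \<omega>)"
  proof -
    have "(\<integral>u. d u \<partial>lborel) = (\<integral>x. indicator {..s} x * d x \<partial>lborel)"
      by (intro Bochner_Integration.integral_cong) (auto simp: d_def indicator_def)
    then show ?thesis using int[OF ts(2) order_refl] by (simp add: D_def)
  qed
  have rs: "r s \<omega> = r t \<omega> + D + (noise s \<omega> - noise t \<omega>)" using r_noise[of s \<omega> t] unfolding D by simp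
  have dD: "d u * (\<integral>x. indicator {..u} x * d x \<partial>lborel) = d u * (r u \<omega> - r t \<omega> - (noise u \<omega> - noise t \<omega>))" for u
  proof (cases "u \<in> {t<..s}")
    case True
    then show ?thesis using int[of u] r_noise[of u \<omega> t] by simp
  qed (simp add: d_def)
  note sq = square_of_integral[OF di, unfolded dD, folded D_def]
  have dr: "integrable lborel (\<lambda>u. d u * r u \<omega>)"
  proof -
    obtain B where B: "\<And>u. 0 \<le> u \<Longrightarrow> u \<le> s \<Longrightarrow> r u \<omega> \<le> B" using r_path_bounded[OF w s] by blast
    have [measurable]: "(\<lambda>u. r (max 0 (min s u)) \<omega>) \<in> borel_measurable borel" by (rule r_path_measurable[OF w s])
    have [measurable]: "d \<in> borel_measurable borel" using di by auto
    have eq: "d u * r u \<omega> = d u * r (max 0 (min s u)) \<omega>" for u using ts by (auto simp: d_def indicator_def)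
    show ?thesis unfolding eq
    proof (rule Bochner_Integration.integrable_bound)
      show "integrable lborel (\<lambda>u. B * d u)" using di by simp
      show "AE u in lborel. norm (d u * r (max 0 (min s u)) \<omega>) \<le> norm (B * d u)"
      proof (rule AE_I2)
        fix u
        have "\<bar>r (max 0 (min s u)) \<omega>\<bar> \<le> \<bar>B\<bar>" using B[of "max 0 (min s u)"] r_nonneg[of "max 0 (min s u)" \<omega>] s w by auto
        then have "\<bar>d u\<bar> * \<bar>r (max 0 (min s u)) \<omega>\<bar> \<le> \<bar>d u\<bar> * \<bar>B\<bar>" by (intro mult_left_mono) auto
        then show "norm (d u * r (max 0 (min s u)) \<omega>) \<le> norm (B * d u)" by (simp add: abs_mult mult.commute)
      qed
    qed measurable
  qed
  define \<Delta> where "\<Delta> = noise s \<omega> - noise t \<omega>"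
  have dn_eq: "d u * (noise s \<omega> - noise u \<omega>) = \<Delta> * d u + d u * (r u \<omega> - r t \<omega> - (noise u \<omega> - noise t \<omega>)) - d u * r u \<omega> + r t \<omega> * d u" for u
    by (simp add: \<Delta>_def algebra_simps)
  have "(\<integral>u. d u * (noise s \<omega> - noise u \<omega>) \<partial>lborel)
    = \<Delta> * D + (\<integral>u. d u * (r u \<omega> - r t \<omega> - (noise u \<omega> - noise t \<omega>)) \<partial>lborel) - (\<integral>u. d u * r u \<omega> \<partial>lborel) + r t \<omega> * D"
    unfolding dn_eq D_def using di sq(1) dr by simp
  then have "2 * (\<integral>u. d u * r u \<omega> \<partial>lborel) + 2 * (\<integral>u. d u * (noise s \<omega> - noise u \<omega>) \<partial>lborel) = 2 * \<Delta> * D + D\<^sup>2 + 2 * r t \<omega> * D"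
    unfolding sq(2) by (simp add: algebra_simps)
  then show ?thesis unfolding \<Delta>_def[symmetric] rs[folded \<Delta>_def] by (simp add: power2_eq_square algebra_simps)
qed

text \<open>The mean of \<open>square_path_expansion\<close>. By Fubini's theorem the mean is taken inside the time
  integrals, where the products of the drift with later noise increments vanish; the cross term with
  \<open>r t\<close> vanishes for the same reason.\<close>

lemma second_moment_equation:
  assumes ts: "0 \<le> t" "t \<le> s" and A: "A \<in> sets (F t)" and rt: "integrable M (\<lambda>\<omega>. (indicator A \<omega> * r t \<omega>)\<^sup>2)"
  defines "m \<equiv> \<lambda>u. \<integral>\<omega>. indicator A \<omega> * r u \<omega> \<partial>M" and "S \<equiv> \<lambda>u. \<integral>\<omega>. (indicator A \<omega> * r u \<omega>)\<^sup>2 \<partial>M"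
  shows "integrable lborel (\<lambda>u. indicator {t<..s} u * (\<mu> * m u - \<kappa> * S u))"
    "S s = S t + 2 * (\<integral>u. indicator {t<..s} u * (\<mu> * m u - \<kappa> * S u) \<partial>lborel) + (\<integral>\<omega>. indicator A \<omega> * bracket t s \<omega> \<partial>M)"
proof -
  have s: "0 \<le> s" using ts by simp
  have AM [measurable]: "A \<in> sets M" by (rule sets_F_M[OF A])
  have rM [measurable]: "r u \<in> borel_measurable M" if "0 \<le> u" for u by (rule measurable_F_M[OF r_measurable[OF that]])
  have nM [measurable]: "noise u \<in> borel_measurable M" if "0 \<le> u" for u by (rule measurable_F_M[OF noise_measurable[OF that]])
  have rt1: "integrable M (\<lambda>\<omega>. indicator A \<omega> * r t \<omega>)" using ts by (intro integrable_of_square[OF _ rt]) measurable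
  obtain C where Ci: "\<And>u. t \<le> u \<Longrightarrow> u \<le> s \<Longrightarrow> integrable M (\<lambda>\<omega>. (indicator A \<omega> * r u \<omega>)\<^sup>2)"
    and CS: "\<And>u. t \<le> u \<Longrightarrow> u \<le> s \<Longrightarrow> S u \<le> C"
    using square_integrability[OF ts A rt] unfolding S_def by blast
  have mi: "integrable M (\<lambda>\<omega>. indicator A \<omega> * r u \<omega>)" if "t \<le> u" for u
    by (rule noise_integrability(1)[OF ts(1) that A rt1])
  have AF: "A \<in> sets (F u)" if "t \<le> u" for u using A sets_F_mono[OF that] by blast
  define Cm where "Cm = m t + \<mu> * (s - t)"
  have Cm: "m u \<le> Cm" if "t \<le> u" "u \<le> s" for u
  proof -
    have "m u \<le> m t + \<mu> * (u - t)" unfolding m_def by (rule mean_bound(2)[OF ts(1) that(1) A rt1])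
    also have "\<dots> \<le> Cm" unfolding Cm_def using mu_pos that by (intro add_left_mono mult_left_mono) auto
    finally show ?thesis .
  qed
  note [measurable] = r_clamped_measurable[OF s] cum_clamped_measurable[OF s]
  define f1 where "f1 u \<omega> = indicator {t<..s} u * (indicator A \<omega> * ((\<mu> - \<kappa> * r u \<omega>) * r u \<omega>))" for u \<omega>
  define f2 where "f2 u \<omega> = indicator {t<..s} u * (indicator A \<omega> * ((\<mu> - \<kappa> * r u \<omega>) * (noise s \<omega> - noise u \<omega>)))" for u \<omega>
  have f1m: "(\<lambda>(u, \<omega>). f1 u \<omega>) \<in> borel_measurable (lborel \<Otimes>\<^sub>M M)"
  proof -
    have "(\<lambda>(u, \<omega>). indicator {t<..s} u * (indicator A \<omega> * ((\<mu> - \<kappa> * r (max 0 (min s u)) \<omega>) * r (max 0 (min s u)) \<omega>))) \<in> borel_measurable (lborel \<Otimes>\<^sub>M M)"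
      by measurable
    moreover have "indicator {t<..s} u * (indicator A \<omega> * ((\<mu> - \<kappa> * r (max 0 (min s u)) \<omega>) * r (max 0 (min s u)) \<omega>)) = f1 u \<omega>" for u \<omega>
      using ts by (auto simp: f1_def indicator_def)
    ultimately show ?thesis by simp
  qed
  have f2m: "(\<lambda>(u, \<omega>). f2 u \<omega>) \<in> borel_measurable (lborel \<Otimes>\<^sub>M M)"
  proof -
    have [measurable]: "r 0 \<in> borel_measurable M" "noise s \<in> borel_measurable M" using s by auto
    have "(\<lambda>(u, \<omega>). indicator {t<..s} u * (indicator A \<omega> * ((\<mu> - \<kappa> * r (max 0 (min s u)) \<omega>)
        * (noise s \<omega> - (r (max 0 (min s u)) \<omega> - r 0 \<omega> - \<mu> * u + \<kappa> * cum (max 0 (min s u)) \<omega>))))) \<in> borel_measurable (lborel \<Otimes>\<^sub>M M)"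
      by measurable
    moreover have "indicator {t<..s} u * (indicator A \<omega> * ((\<mu> - \<kappa> * r (max 0 (min s u)) \<omega>)
        * (noise s \<omega> - (r (max 0 (min s u)) \<omega> - r 0 \<omega> - \<mu> * u + \<kappa> * cum (max 0 (min s u)) \<omega>)))) = f2 u \<omega>" for u \<omega>
    proof (cases "u \<in> {t<..s}")
      case True
      then have "max 0 (min s u) = u" using ts by auto
      moreover have "r u \<omega> - r 0 \<omega> - \<mu> * u + \<kappa> * cum u \<omega> = noise u \<omega>"
        using r_decomposition[of u \<omega>] by (simp add: noise_def)
      ultimately show ?thesis by (simp only: f2_def)
    qed (simp add: f2_def)
    ultimately show ?thesis by simp
  qed
  have f1_eq: "indicator A \<omega> * ((\<mu> - \<kappa> * r u \<omega>) * r u \<omega>) = \<mu> * (indicator A \<omega> * r u \<omega>) - \<kappa> * (indicator A \<omega> * r u \<omega>)\<^sup>2" for u \<omega>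
    by (auto simp: indicator_def power2_eq_square algebra_simps)
  have f1i: "integrable M (\<lambda>\<omega>. indicator A \<omega> * ((\<mu> - \<kappa> * r u \<omega>) * r u \<omega>))" if "t < u" "u \<le> s" for u
    unfolding f1_eq using mi Ci that by auto
  have f1I: "(\<integral>\<omega>. f1 u \<omega> \<partial>M) = indicator {t<..s} u * (\<mu> * m u - \<kappa> * S u)" for u
  proof (cases "u \<in> {t<..s}")
    case True
    then show ?thesis unfolding f1_def f1_eq m_def S_def using mi[of u] Ci[of u] by simp
  qed (simp add: f1_def)
  have F1: "integrable M (\<lambda>\<omega>. \<integral>u. f1 u \<omega> \<partial>lborel)" "integrable lborel (\<lambda>u. \<integral>\<omega>. f1 u \<omega> \<partial>M)"
    "(\<integral>\<omega>. (\<integral>u. f1 u \<omega> \<partial>lborel) \<partial>M) = (\<integral>u. (\<integral>\<omega>. f1 u \<omega> \<partial>M) \<partial>lborel)"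
  proof -
    have z: "f1 u \<omega> = 0" if "u \<notin> {t<..s}" for u \<omega> using that by (simp add: f1_def)
    have i: "integrable M (f1 u)" if "t < u" "u \<le> s" for u
      unfolding f1_def[abs_def] using f1i[OF that] that by simp
    have b: "(\<integral>\<omega>. \<bar>f1 u \<omega>\<bar> \<partial>M) \<le> \<mu> * Cm + \<kappa> * C" if u: "t < u" "u \<le> s" for u
    proof -
      have "(\<integral>\<omega>. \<bar>f1 u \<omega>\<bar> \<partial>M) \<le> (\<integral>\<omega>. \<mu> * (indicator A \<omega> * r u \<omega>) + \<kappa> * (indicator A \<omega> * r u \<omega>)\<^sup>2 \<partial>M)"
      proof (rule integral_mono)
        show "integrable M (\<lambda>\<omega>. \<mu> * (indicator A \<omega> * r u \<omega>) + \<kappa> * (indicator A \<omega> * r u \<omega>)\<^sup>2)"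
          using mi[of u] Ci[of u] u by auto
        fix \<omega> assume w: "\<omega> \<in> space M"
        have 0: "0 \<le> \<mu> * (indicator A \<omega> * r u \<omega>)" "0 \<le> \<kappa> * (indicator A \<omega> * r u \<omega>)\<^sup>2"
          using mu_pos kappa_pos r_nonneg[of u \<omega>] w u ts by auto
        have "f1 u \<omega> = \<mu> * (indicator A \<omega> * r u \<omega>) - \<kappa> * (indicator A \<omega> * r u \<omega>)\<^sup>2"
          unfolding f1_def f1_eq using u by simp
        then show "\<bar>f1 u \<omega>\<bar> \<le> \<mu> * (indicator A \<omega> * r u \<omega>) + \<kappa> * (indicator A \<omega> * r u \<omega>)\<^sup>2"
          using 0 by linarith
      qed (use i[OF u] in auto)
      also have "\<dots> = \<mu> * m u + \<kappa> * S u" unfolding m_def S_def using mi[of u] Ci[of u] u by simp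
      also have "\<dots> \<le> \<mu> * Cm + \<kappa> * C" using mu_pos kappa_pos Cm[of u] CS[of u] u by (intro add_mono mult_left_mono) auto
      finally show ?thesis .
    qed
    show "integrable M (\<lambda>\<omega>. \<integral>u. f1 u \<omega> \<partial>lborel)" "integrable lborel (\<lambda>u. \<integral>\<omega>. f1 u \<omega> \<partial>M)"
      "(\<integral>\<omega>. (\<integral>u. f1 u \<omega> \<partial>lborel) \<partial>M) = (\<integral>u. (\<integral>\<omega>. f1 u \<omega> \<partial>M) \<partial>lborel)"
      by (rule Fubini_interval[OF f1m z i b]; assumption)+
  qed
  have F2: "integrable M (\<lambda>\<omega>. \<integral>u. f2 u \<omega> \<partial>lborel)" "(\<integral>\<omega>. (\<integral>u. f2 u \<omega> \<partial>lborel) \<partial>M) = 0"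
  proof -
    have z: "f2 u \<omega> = 0" if "u \<notin> {t<..s}" for u \<omega> using that by (simp add: f2_def)
    have Uf: "(\<lambda>\<omega>. \<mu> - \<kappa> * r u \<omega>) \<in> borel_measurable (F u)" if "0 \<le> u" for u
      using r_measurable[OF that] by auto
    have U2_eq: "(indicator A \<omega> * (\<mu> - \<kappa> * r u \<omega>))\<^sup>2 = indicator A \<omega> * \<mu>\<^sup>2 - 2 * \<mu> * \<kappa> * (indicator A \<omega> * r u \<omega>) + \<kappa>\<^sup>2 * (indicator A \<omega> * r u \<omega>)\<^sup>2" for u \<omega>
      by (auto simp: indicator_def power2_eq_square algebra_simps)
    have U2: "integrable M (\<lambda>\<omega>. (indicator A \<omega> * (\<mu> - \<kappa> * r u \<omega>))\<^sup>2)" if "t < u" "u \<le> s" for u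
      unfolding U2_eq using mi[of u] Ci[of u] that
      by (intro Bochner_Integration.integrable_add Bochner_Integration.integrable_diff integrable_mult_left integrable_mult_right)
        (auto simp: emeasure_eq_measure)
    have f2_eq: "f2 u \<omega> = (\<mu> - \<kappa> * r u \<omega>) * (indicator A \<omega> * (noise s \<omega> - noise u \<omega>))" if "t < u" "u \<le> s" for u \<omega>
      using that by (simp add: f2_def)
    have i: "integrable M (f2 u)" and i0: "(\<integral>\<omega>. f2 u \<omega> \<partial>M) = 0" if u: "t < u" "u \<le> s" for u
      unfolding f2_eq[OF u, abs_def] using u ts
      by (auto intro!: noise_increment_orthogonal AF mi Uf U2)
    have b: "(\<integral>\<omega>. \<bar>f2 u \<omega>\<bar> \<partial>M) \<le> \<mu>\<^sup>2 + \<kappa>\<^sup>2 * C + (\<integral>\<omega>. indicator A \<omega> * bracket t s \<omega> \<partial>M)" if u: "t < u" "u \<le> s" for u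
    proof -
      note u0 = order_trans[OF ts(1) less_imp_le[OF u(1)]]
      note ni = noise_integrability[OF u0 u(2) AF[OF less_imp_le[OF u(1)]] mi[OF less_imp_le[OF u(1)]]]
      have "(\<integral>\<omega>. \<bar>f2 u \<omega>\<bar> \<partial>M) \<le> (\<integral>\<omega>. (indicator A \<omega> * (\<mu> - \<kappa> * r u \<omega>))\<^sup>2 + (indicator A \<omega> * (noise s \<omega> - noise u \<omega>))\<^sup>2 \<partial>M)"
      proof (rule integral_mono)
        show "integrable M (\<lambda>\<omega>. (indicator A \<omega> * (\<mu> - \<kappa> * r u \<omega>))\<^sup>2 + (indicator A \<omega> * (noise s \<omega> - noise u \<omega>))\<^sup>2)"
          using U2[OF u] ni(4) by simp
        fix \<omega>
        let ?x = "indicator A \<omega> * (\<mu> - \<kappa> * r u \<omega>)" and ?y = "indicator A \<omega> * (noise s \<omega> - noise u \<omega>)"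
        have "0 \<le> (\<bar>?x\<bar> - \<bar>?y\<bar>)\<^sup>2" by simp
        then have "2 * (\<bar>?x\<bar> * \<bar>?y\<bar>) \<le> ?x\<^sup>2 + ?y\<^sup>2" unfolding power2_diff power2_abs by linarith
        moreover have "\<bar>f2 u \<omega>\<bar> = \<bar>?x\<bar> * \<bar>?y\<bar>"
          unfolding f2_eq[OF u] abs_mult[symmetric] by (auto simp: indicator_def)
        moreover have "0 \<le> \<bar>?x\<bar> * \<bar>?y\<bar>" by simp
        ultimately show "\<bar>f2 u \<omega>\<bar> \<le> ?x\<^sup>2 + ?y\<^sup>2" by linarith
      qed (use i[OF u] in auto)
      also have "\<dots> = (\<integral>\<omega>. (indicator A \<omega> * (\<mu> - \<kappa> * r u \<omega>))\<^sup>2 \<partial>M) + (\<integral>\<omega>. (indicator A \<omega> * (noise s \<omega> - noise u \<omega>))\<^sup>2 \<partial>M)"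
        using U2[OF u] ni(4) by simp
      also have "(\<integral>\<omega>. (indicator A \<omega> * (\<mu> - \<kappa> * r u \<omega>))\<^sup>2 \<partial>M) \<le> (\<integral>\<omega>. \<mu>\<^sup>2 + \<kappa>\<^sup>2 * (indicator A \<omega> * r u \<omega>)\<^sup>2 \<partial>M)"
      proof (rule integral_mono[OF U2[OF u]])
        show "integrable M (\<lambda>\<omega>. \<mu>\<^sup>2 + \<kappa>\<^sup>2 * (indicator A \<omega> * r u \<omega>)\<^sup>2)" using Ci[of u] u by simp
        fix \<omega> assume w: "\<omega> \<in> space M"
        have "0 \<le> 2 * \<mu> * \<kappa> * (indicator A \<omega> * r u \<omega>)"
          using mu_pos kappa_pos r_nonneg[OF u0 w] by (intro mult_nonneg_nonneg) auto
        moreover have "indicator A \<omega> * \<mu>\<^sup>2 \<le> \<mu>\<^sup>2" by (simp add: indicator_def)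
        ultimately show "(indicator A \<omega> * (\<mu> - \<kappa> * r u \<omega>))\<^sup>2 \<le> \<mu>\<^sup>2 + \<kappa>\<^sup>2 * (indicator A \<omega> * r u \<omega>)\<^sup>2"
          unfolding U2_eq by linarith
      qed
      also have "(\<integral>\<omega>. \<mu>\<^sup>2 + \<kappa>\<^sup>2 * (indicator A \<omega> * r u \<omega>)\<^sup>2 \<partial>M) = \<mu>\<^sup>2 + \<kappa>\<^sup>2 * S u"
        unfolding S_def using Ci[of u] u by (simp add: prob_space)
      also have "\<mu>\<^sup>2 + \<kappa>\<^sup>2 * S u \<le> \<mu>\<^sup>2 + \<kappa>\<^sup>2 * C" using CS[of u] u by (intro add_left_mono mult_left_mono) auto
      also have "(\<integral>\<omega>. (indicator A \<omega> * (noise s \<omega> - noise u \<omega>))\<^sup>2 \<partial>M) \<le> (\<integral>\<omega>. indicator A \<omega> * bracket t s \<omega> \<partial>M)"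
      proof (rule order_trans[OF ni(7) integral_mono[OF ni(3) noise_integrability(3)[OF ts A rt1]]])
        fix \<omega> assume w: "\<omega> \<in> space M"
        have "bracket t s \<omega> = bracket t u \<omega> + bracket u s \<omega>" by (simp add: bracket_def algebra_simps)
        then have "bracket u s \<omega> \<le> bracket t s \<omega>" using bracket_mono(1)[OF w ts(1), of u u] u by simp
        then show "indicator A \<omega> * bracket u s \<omega> \<le> indicator A \<omega> * bracket t s \<omega>" by (intro mult_left_mono) auto
      qed
      finally show ?thesis by simp
    qed
    show "integrable M (\<lambda>\<omega>. \<integral>u. f2 u \<omega> \<partial>lborel)" by (rule Fubini_interval[OF f2m z i b]; assumption)
    have "(\<integral>\<omega>. (\<integral>u. f2 u \<omega> \<partial>lborel) \<partial>M) = (\<integral>u. (\<integral>\<omega>. f2 u \<omega> \<partial>M) \<partial>lborel)"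
      by (rule Fubini_interval[OF f2m z i b]; assumption)
    also have "\<dots> = (\<integral>(u::real). 0 \<partial>lborel)"
    proof (rule Bochner_Integration.integral_cong[OF refl])
      fix u show "(\<integral>\<omega>. f2 u \<omega> \<partial>M) = 0" by (cases "u \<in> {t<..s}") (use i0[of u] z in auto)
    qed
    finally show "(\<integral>\<omega>. (\<integral>u. f2 u \<omega> \<partial>lborel) \<partial>M) = 0" by simp
  qed
  note ni = noise_integrability[OF ts A rt1]
  define f3 where "f3 \<omega> = r t \<omega> * (indicator A \<omega> * (noise s \<omega> - noise t \<omega>))" for \<omega>
  have f3: "integrable M f3" "(\<integral>\<omega>. f3 \<omega> \<partial>M) = 0"
    unfolding f3_def using noise_increment_orthogonal[OF ts A rt1 r_measurable[OF ts(1)] rt] by auto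
  have path: "(indicator A \<omega> * r s \<omega>)\<^sup>2 = (indicator A \<omega> * r t \<omega>)\<^sup>2 + 2 * (\<integral>u. f1 u \<omega> \<partial>lborel) + 2 * (\<integral>u. f2 u \<omega> \<partial>lborel)
    + 2 * f3 \<omega> + (indicator A \<omega> * (noise s \<omega> - noise t \<omega>))\<^sup>2" if w: "\<omega> \<in> space M" for \<omega>
  proof (cases "\<omega> \<in> A")
    case True
    then show ?thesis using square_path_expansion[OF w ts] by (simp add: f1_def f2_def f3_def mult.assoc)
  qed (simp add: f1_def f2_def f3_def)
  show "integrable lborel (\<lambda>u. indicator {t<..s} u * (\<mu> * m u - \<kappa> * S u))" using F1(2) unfolding f1I .
  have "S s = (\<integral>\<omega>. (indicator A \<omega> * r t \<omega>)\<^sup>2 + 2 * (\<integral>u. f1 u \<omega> \<partial>lborel) + 2 * (\<integral>u. f2 u \<omega> \<partial>lborel)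
    + 2 * f3 \<omega> + (indicator A \<omega> * (noise s \<omega> - noise t \<omega>))\<^sup>2 \<partial>M)"
    unfolding S_def by (rule Bochner_Integration.integral_cong[OF refl path])
  also have "\<dots> = S t + 2 * (\<integral>\<omega>. (\<integral>u. f1 u \<omega> \<partial>lborel) \<partial>M) + 2 * (\<integral>\<omega>. (\<integral>u. f2 u \<omega> \<partial>lborel) \<partial>M) + 2 * (\<integral>\<omega>. f3 \<omega> \<partial>M)
    + (\<integral>\<omega>. (indicator A \<omega> * (noise s \<omega> - noise t \<omega>))\<^sup>2 \<partial>M)"
    unfolding S_def using rt F1(1) F2(1) f3(1) ni(4) by simp
  also have "\<dots> = S t + 2 * (\<integral>u. indicator {t<..s} u * (\<mu> * m u - \<kappa> * S u) \<partial>lborel) + (\<integral>\<omega>. indicator A \<omega> * bracket t s \<omega> \<partial>M)"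
    unfolding F1(3) F2(2) f3(2) noise_second_moment[OF ts A rt1] f1I by simp
  finally show "S s = S t + 2 * (\<integral>u. indicator {t<..s} u * (\<mu> * m u - \<kappa> * S u) \<partial>lborel) + (\<integral>\<omega>. indicator A \<omega> * bracket t s \<omega> \<partial>M)" .
qed

text \<open>Inserting the known mean turns \<open>second_moment_equation\<close> into a linear equation for
  \<open>S\<close> with rate \<open>2 * \<kappa>\<close>.\<close>

lemma second_moment_formula:
  fixes t s :: real and A :: "'a set"
  assumes ts: "0 \<le> t" "t \<le> s" and A: "A \<in> sets (F t)" and rt: "integrable M (\<lambda>\<omega>. (indicator A \<omega> * r t \<omega>)\<^sup>2)"
  defines "K \<equiv> 2 * \<mu> + \<sigma>\<^sup>2 + a\<^sup>2 * \<beta>" and "E1 \<equiv> exp (- \<kappa> * (s - t))" and "E2 \<equiv> exp (- 2 * \<kappa> * (s - t))"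
  shows "(\<integral>\<omega>. (indicator A \<omega> * r s \<omega>)\<^sup>2 \<partial>M) = (\<integral>\<omega>. (indicator A \<omega> * r t \<omega>)\<^sup>2 \<partial>M) * E2
    + (K * (\<mu> / \<kappa>) + a\<^sup>2 * \<alpha>) / (2 * \<kappa>) * prob A * (1 - E2)
    - K / \<kappa> * (\<mu> / \<kappa> * prob A - (\<integral>\<omega>. indicator A \<omega> * r t \<omega> \<partial>M)) * (E1 - E2)"
proof -
  define m where "m u = (\<integral>\<omega>. indicator A \<omega> * r u \<omega> \<partial>M)" for u
  define S where "S u = (\<integral>\<omega>. (indicator A \<omega> * r u \<omega>)\<^sup>2 \<partial>M)" for u
  have rM [measurable]: "r t \<in> borel_measurable M" "A \<in> sets M" using measurable_F_M[OF r_measurable[OF ts(1)]] sets_F_M[OF A] by auto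
  have rt1: "integrable M (\<lambda>\<omega>. indicator A \<omega> * r t \<omega>)" by (rule integrable_of_square[OF _ rt]) measurable
  define c1 where "c1 = (K * (\<mu> / \<kappa>) + a\<^sup>2 * \<alpha>) / (2 * \<kappa>) * prob A"
  define c2 where "c2 = K / \<kappa> * (\<mu> / \<kappa> * prob A - m t)"
  \<comment> \<open>the forcing term \<open>K * m u + a\<^sup>2 * \<alpha> * prob A\<close>, with the explicit mean inserted\<close>
  define g where "g u = 2 * \<kappa> * c1 - \<kappa> * c2 * exp (- \<kappa> * (u - t))" for u
  have g: "g u = K * m u + a\<^sup>2 * \<alpha> * prob A" if "t \<le> u" for u
  proof -
    have "\<kappa> \<noteq> 0" using kappa_pos by simp
    then have c: "2 * \<kappa> * c1 = (K * (\<mu> / \<kappa>) + a\<^sup>2 * \<alpha>) * prob A" "\<kappa> * c2 = K * (\<mu> / \<kappa> * prob A - m t)"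
      unfolding c1_def c2_def by simp_all
    have "m u = \<mu> / \<kappa> * prob A - exp (- \<kappa> * (u - t)) * (\<mu> / \<kappa> * prob A - m t)"
      unfolding m_def by (rule mean_formula[OF ts(1) that A rt1])
    moreover have "(K * l + w) * p - K * (l * p - x) * e = K * (l * p - e * (l * p - x)) + w * p" for l w p x e :: real
      by (simp add: algebra_simps)
    ultimately show ?thesis unfolding g_def c by (simp only:)
  qed
  note se = second_moment_equation[OF ts(1) _ A rt, folded m_def S_def]
  note mi = mean_integrated[OF ts(1) _ A rt1, folded m_def]
  have eq: "indicator {t<..v} u * (g u - 2 * \<kappa> * S u) = 2 * (indicator {t<..v} u * (\<mu> * m u - \<kappa> * S u))
     + (\<sigma>\<^sup>2 + a\<^sup>2 * \<beta>) * (indicator {t<..v} u * m u) + indicator {t<..v} u * (a\<^sup>2 * \<alpha> * prob A)" for u v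
    using g[of u] by (cases "u \<in> {t<..v}") (simp_all add: K_def algebra_simps)
  have "S s = S t * exp (- 2 * \<kappa> * (s - t)) + c1 * (1 - exp (- 2 * \<kappa> * (s - t)))
      - c2 * (exp (- \<kappa> * (s - t)) - exp (- 2 * \<kappa> * (s - t)))"
  proof (rule linear_integral_equation_unique[where t=t and k="2 * \<kappa>" and g=g and Y="\<lambda>v. S t * exp (- 2 * \<kappa> * (v - t)) + c1 * (1 - exp (- 2 * \<kappa> * (v - t)))
      - c2 * (exp (- \<kappa> * (v - t)) - exp (- 2 * \<kappa> * (v - t)))"])
    show "integrable lborel (\<lambda>u. indicator {t<..s} u * (g u - 2 * \<kappa> * S u))"
      unfolding eq by (intro Bochner_Integration.integrable_add integrable_mult_left integrable_mult_right integrable_indicator_interval se mi ts)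
    show "continuous_on {t..s} g" unfolding g_def by (intro continuous_intros)
    show "((\<lambda>v. S t * exp (- 2 * \<kappa> * (v - t)) + c1 * (1 - exp (- 2 * \<kappa> * (v - t)))
      - c2 * (exp (- \<kappa> * (v - t)) - exp (- 2 * \<kappa> * (v - t)))) has_real_derivative
        g v - 2 * \<kappa> * (S t * exp (- 2 * \<kappa> * (v - t)) + c1 * (1 - exp (- 2 * \<kappa> * (v - t)))
      - c2 * (exp (- \<kappa> * (v - t)) - exp (- 2 * \<kappa> * (v - t))))) (at v)" for v
      unfolding g_def by (rule second_order_relaxation_derivative)
    fix v assume v: "t \<le> v" "v \<le> s"
    have "(\<integral>u. indicator {t<..v} u * (g u - 2 * \<kappa> * S u) \<partial>lborel)
      = (\<integral>u. 2 * (indicator {t<..v} u * (\<mu> * m u - \<kappa> * S u)) + (\<sigma>\<^sup>2 + a\<^sup>2 * \<beta>) * (indicator {t<..v} u * m u) \<partial>lborel)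
        + (\<integral>u. indicator {t<..v} u * (a\<^sup>2 * \<alpha> * prob A) \<partial>lborel)"
      unfolding eq by (intro Bochner_Integration.integral_add Bochner_Integration.integrable_add integrable_mult_left
          integrable_mult_right integrable_indicator_interval se mi v)
    also have "(\<integral>u. 2 * (indicator {t<..v} u * (\<mu> * m u - \<kappa> * S u)) + (\<sigma>\<^sup>2 + a\<^sup>2 * \<beta>) * (indicator {t<..v} u * m u) \<partial>lborel)
      = (\<integral>u. 2 * (indicator {t<..v} u * (\<mu> * m u - \<kappa> * S u)) \<partial>lborel) + (\<integral>u. (\<sigma>\<^sup>2 + a\<^sup>2 * \<beta>) * (indicator {t<..v} u * m u) \<partial>lborel)"
      by (intro Bochner_Integration.integral_add integrable_mult_right se mi v)
    finally have I: "(\<integral>u. indicator {t<..v} u * (g u - 2 * \<kappa> * S u) \<partial>lborel)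
      = 2 * (\<integral>u. indicator {t<..v} u * (\<mu> * m u - \<kappa> * S u) \<partial>lborel)
        + (\<sigma>\<^sup>2 + a\<^sup>2 * \<beta>) * (\<integral>\<omega>. indicator A \<omega> * (cum v \<omega> - cum t \<omega>) \<partial>M) + (v - t) * (a\<^sup>2 * \<alpha> * prob A)"
      using v mi(2)[OF v(1)] by simp
    have br: "indicator A \<omega> * bracket t v \<omega> = (\<sigma>\<^sup>2 + a\<^sup>2 * \<beta>) * (indicator A \<omega> * (cum v \<omega> - cum t \<omega>)) + (a\<^sup>2 * \<alpha> * (v - t)) * indicator A \<omega>" for \<omega>
      by (simp add: bracket_def algebra_simps)
    have "(\<integral>\<omega>. indicator A \<omega> * bracket t v \<omega> \<partial>M)
      = (\<integral>\<omega>. (\<sigma>\<^sup>2 + a\<^sup>2 * \<beta>) * (indicator A \<omega> * (cum v \<omega> - cum t \<omega>)) \<partial>M) + (\<integral>\<omega>. (a\<^sup>2 * \<alpha> * (v - t)) * indicator A \<omega> \<partial>M)"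
      unfolding br
      by (intro Bochner_Integration.integral_add integrable_mult_right noise_integrability(2)[OF ts(1) v(1) A rt1])
        (use rM in \<open>auto simp: emeasure_eq_measure\<close>)
    also have "\<dots> = (\<sigma>\<^sup>2 + a\<^sup>2 * \<beta>) * (\<integral>\<omega>. indicator A \<omega> * (cum v \<omega> - cum t \<omega>) \<partial>M) + (a\<^sup>2 * \<alpha> * (v - t)) * prob A"
      using rM(2) by simp
    finally have Ebr: "(\<integral>\<omega>. indicator A \<omega> * bracket t v \<omega> \<partial>M)
      = (\<sigma>\<^sup>2 + a\<^sup>2 * \<beta>) * (\<integral>\<omega>. indicator A \<omega> * (cum v \<omega> - cum t \<omega>) \<partial>M) + (a\<^sup>2 * \<alpha> * (v - t)) * prob A" .
    have "(v - t) * (a\<^sup>2 * \<alpha> * prob A) = (a\<^sup>2 * \<alpha> * (v - t)) * prob A" by (simp only: ac_simps)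
    then show "S v = S t + (\<integral>u. indicator {t<..v} u * (g u - 2 * \<kappa> * S u) \<partial>lborel)"
      unfolding I using se(2)[OF v(1)] Ebr by linarith
  qed (use ts in auto)
  then show ?thesis unfolding S_def m_def c1_def c2_def E1_def E2_def .
qed

text \<open>Characterisation of the conditional expectation by bounded test events. Integrability may fail on a general
  event \<open>r t \<in> B\<close>, as \<open>r 0\<close> is arbitrary, so the identity is required on
  \<open>r t \<in> B\<close>, \<open>r t \<le> k\<close> only and extended by monotone convergence, which is
  why \<open>X\<close> and \<open>G\<close> have to be nonnegative.\<close>

lemma nn_cond_exp_given_r:
  assumes t: "0 \<le> t" and X [measurable]: "X \<in> borel_measurable M" and X0: "\<And>\<omega>. \<omega> \<in> space M \<Longrightarrow> 0 \<le> X \<omega>"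
    and G [measurable]: "G \<in> borel_measurable borel" and G0: "\<And>x. 0 \<le> x \<Longrightarrow> 0 \<le> G x"
    and eq: "\<And>A k. A \<in> sets (F t) \<Longrightarrow> (\<And>\<omega>. \<omega> \<in> A \<Longrightarrow> r t \<omega> \<le> real k) \<Longrightarrow>
      integrable M (\<lambda>\<omega>. indicator A \<omega> * X \<omega>) \<and> integrable M (\<lambda>\<omega>. indicator A \<omega> * G (r t \<omega>)) \<and>
      (\<integral>\<omega>. indicator A \<omega> * X \<omega> \<partial>M) = (\<integral>\<omega>. indicator A \<omega> * G (r t \<omega>) \<partial>M)"
  shows "AE \<omega> in M. nn_cond_exp_given M X (r t) \<omega> = ennreal (G (r t \<omega>))"
proof -
  let ?V = "vimage_algebra (space M) (r t) borel"
  have rM [measurable]: "r t \<in> borel_measurable M" by (rule measurable_F_M[OF r_measurable[OF t]])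
  have sub: "subalgebra M ?V"
    unfolding subalgebra_def using measurable_sets[OF rM] by (auto simp: sets_vimage_algebra2)
  interpret V: finite_measure_subalgebra M ?V by unfold_locales (rule sub)
  have "AE \<omega> in M. ennreal (G (r t \<omega>)) = nn_cond_exp M ?V (\<lambda>\<omega>. ennreal (X \<omega>)) \<omega>"
  proof (rule V.nn_cond_exp_charact)
    have "r t \<in> measurable ?V borel" by (rule measurable_vimage_algebra1) simp
    then show "(\<lambda>\<omega>. ennreal (G (r t \<omega>))) \<in> borel_measurable ?V" by measurable
    fix B assume "B \<in> sets ?V"
    then obtain B' where B': "B' \<in> sets borel" "B = r t -` B' \<inter> space M" by (auto simp: sets_vimage_algebra2)
    define A where "A k = {\<omega> \<in> space M. r t \<omega> \<in> B' \<and> r t \<omega> \<le> real k}" for k :: nat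
    have AF: "A k \<in> sets (F t)" for k
    proof -
      note [measurable] = r_measurable[OF t] B'(1)
      have "A k = {\<omega> \<in> space (F t). r t \<omega> \<in> B' \<and> r t \<omega> \<le> real k}" by (simp add: A_def space_F)
      then show ?thesis by simp
    qed
    have AM [measurable]: "A k \<in> sets M" for k by (rule sets_F_M[OF AF])
    have lim: "(\<lambda>k. \<integral>\<^sup>+\<omega>. ennreal (f \<omega>) * indicator (A k) \<omega> \<partial>M) \<longlonglongrightarrow> (\<integral>\<^sup>+\<omega>. ennreal (f \<omega>) * indicator B \<omega> \<partial>M)"
      if [measurable]: "f \<in> borel_measurable M" for f
    proof (rule nn_integral_LIMSEQ)
      show "incseq (\<lambda>k \<omega>. ennreal (f \<omega>) * indicator (A k) \<omega>)"
        by (auto simp: incseq_def le_fun_def A_def indicator_def)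
      fix \<omega>
      obtain k0 where k0: "r t \<omega> \<le> real k0" using real_arch_simple by blast
      have "\<forall>\<^sub>F k in sequentially. ennreal (f \<omega>) * indicator (A k) \<omega> = ennreal (f \<omega>) * indicator B \<omega>"
        by (rule eventually_sequentiallyI[of k0]) (use k0 in \<open>auto simp: A_def B'(2) indicator_def\<close>)
      then show "(\<lambda>k. ennreal (f \<omega>) * indicator (A k) \<omega>) \<longlonglongrightarrow> ennreal (f \<omega>) * indicator B \<omega>" by (rule tendsto_eventually)
    qed measurable
    have k: "(\<integral>\<^sup>+\<omega>. ennreal (X \<omega>) * indicator (A k) \<omega> \<partial>M) = (\<integral>\<^sup>+\<omega>. ennreal (G (r t \<omega>)) * indicator (A k) \<omega> \<partial>M)" for k
    proof -
      have e: "integrable M (\<lambda>\<omega>. indicator (A k) \<omega> * X \<omega>)" "integrable M (\<lambda>\<omega>. indicator (A k) \<omega> * G (r t \<omega>))"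
        "(\<integral>\<omega>. indicator (A k) \<omega> * X \<omega> \<partial>M) = (\<integral>\<omega>. indicator (A k) \<omega> * G (r t \<omega>) \<partial>M)"
        using eq[OF AF[of k], of k] by (auto simp: A_def)
      have nn: "(\<integral>\<^sup>+\<omega>. ennreal (f \<omega>) * indicator (A k) \<omega> \<partial>M) = ennreal (\<integral>\<omega>. indicator (A k) \<omega> * f \<omega> \<partial>M)"
        if i: "integrable M (\<lambda>\<omega>. indicator (A k) \<omega> * f \<omega>)" and f0: "\<And>\<omega>. \<omega> \<in> space M \<Longrightarrow> 0 \<le> f \<omega>" for f
      proof -
        have "(\<integral>\<^sup>+\<omega>. ennreal (f \<omega>) * indicator (A k) \<omega> \<partial>M) = (\<integral>\<^sup>+\<omega>. ennreal (indicator (A k) \<omega> * f \<omega>) \<partial>M)"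
          by (intro nn_integral_cong) (auto simp: indicator_def)
        also have "\<dots> = ennreal (\<integral>\<omega>. indicator (A k) \<omega> * f \<omega> \<partial>M)"
          by (rule nn_integral_eq_integral[OF i]) (use f0 in auto)
        finally show ?thesis .
      qed
      show ?thesis using nn[OF e(1) X0] nn[OF e(2)] G0 r_nonneg[OF t] e(3) by simp
    qed
    have "(\<lambda>k. \<integral>\<^sup>+\<omega>. ennreal (X \<omega>) * indicator (A k) \<omega> \<partial>M) \<longlonglongrightarrow> (\<integral>\<^sup>+\<omega>. ennreal (G (r t \<omega>)) * indicator B \<omega> \<partial>M)"
      unfolding k by (rule lim) measurable
    from LIMSEQ_unique[OF lim[OF X] this]
    show "(\<integral>\<^sup>+\<omega>\<in>B. ennreal (X \<omega>) \<partial>M) = (\<integral>\<^sup>+\<omega>\<in>B. ennreal (G (r t \<omega>)) \<partial>M)" .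
  qed measurable
  then show ?thesis unfolding nn_cond_exp_given_def by eventually_elim simp
qed

lemma bounded_on_event:
  assumes t: "0 \<le> t" and A: "A \<in> sets (F t)" and k: "\<And>\<omega>. \<omega> \<in> A \<Longrightarrow> r t \<omega> \<le> real k"
  shows "integrable M (\<lambda>\<omega>. indicator A \<omega> * r t \<omega>)" "integrable M (\<lambda>\<omega>. (indicator A \<omega> * r t \<omega>)\<^sup>2)"
proof -
  have [measurable]: "r t \<in> borel_measurable M" "A \<in> sets M" using measurable_F_M[OF r_measurable[OF t]] sets_F_M[OF A] by auto
  have b: "\<bar>indicator A \<omega> * r t \<omega>\<bar> \<le> real k" if "\<omega> \<in> space M" for \<omega>
    using k[of \<omega>] r_nonneg[OF t that] by (cases "\<omega> \<in> A") auto
  show "integrable M (\<lambda>\<omega>. (indicator A \<omega> * r t \<omega>)\<^sup>2)"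
  proof (rule integrable_const_bound[of _ "(real k)\<^sup>2"])
    show "AE \<omega> in M. norm ((indicator A \<omega> * r t \<omega>)\<^sup>2) \<le> (real k)\<^sup>2"
    proof (rule AE_I2)
      fix \<omega> assume "\<omega> \<in> space M"
      from power_mono[OF b[OF this], of 2] show "norm ((indicator A \<omega> * r t \<omega>)\<^sup>2) \<le> (real k)\<^sup>2" by simp
    qed
  qed measurable
  then show "integrable M (\<lambda>\<omega>. indicator A \<omega> * r t \<omega>)" by (rule integrable_of_square[rotated]) measurable
qed

lemma decay_le_one: "t \<le> s \<Longrightarrow> exp (- \<kappa> * (s - t)) \<le> 1"
proof -
  assume "t \<le> s"
  then have "0 \<le> \<kappa> * (s - t)" using kappa_pos by (intro mult_nonneg_nonneg) auto
  then have "- \<kappa> * (s - t) \<le> 0" by (simp only: mult_minus_left neg_le_0_iff_le)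
  then show ?thesis by (simp only: exp_le_one_iff)
qed

lemma conditional_mean:
  assumes t: "0 \<le> t" "t \<le> s"
  shows "AE \<omega> in M. nn_cond_exp_given M (r s) (r t) \<omega> = ennreal (\<mu> / \<kappa> - exp (- \<kappa> * (s - t)) * (\<mu> / \<kappa> - r t \<omega>))"
proof (rule nn_cond_exp_given_r[OF t(1), where G="\<lambda>x. \<mu> / \<kappa> - exp (- \<kappa> * (s - t)) * (\<mu> / \<kappa> - x)"])
  have s: "0 \<le> s" using t by simp
  show "r s \<in> borel_measurable M" by (rule measurable_F_M[OF r_measurable[OF s]])
  show "0 \<le> r s \<omega>" if "\<omega> \<in> space M" for \<omega> by (rule r_nonneg[OF s that])
  show "0 \<le> \<mu> / \<kappa> - exp (- \<kappa> * (s - t)) * (\<mu> / \<kappa> - x)" if x: "0 \<le> x" for x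
  proof -
    have "exp (- \<kappa> * (s - t)) * (\<mu> / \<kappa> - x) \<le> exp (- \<kappa> * (s - t)) * (\<mu> / \<kappa>)" using x by (intro mult_left_mono) auto
    also have "\<dots> \<le> 1 * (\<mu> / \<kappa>)"
      using mu_pos kappa_pos by (intro mult_right_mono decay_le_one t divide_nonneg_nonneg less_imp_le)
    finally show ?thesis by simp
  qed
  fix A k assume A: "A \<in> sets (F t)" and k: "\<And>\<omega>. \<omega> \<in> A \<Longrightarrow> r t \<omega> \<le> real k"
  note rt = bounded_on_event(1)[OF t(1) A k]
  have AM: "A \<in> sets M" by (rule sets_F_M[OF A])
  define e where "e = exp (- \<kappa> * (s - t))"
  have eq: "indicator A \<omega> * (\<mu> / \<kappa> - e * (\<mu> / \<kappa> - r t \<omega>)) = (\<mu> / \<kappa> - e * (\<mu> / \<kappa>)) * indicator A \<omega> + e * (indicator A \<omega> * r t \<omega>)" for \<omega>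
    by (simp add: algebra_simps)
  have i: "integrable M (\<lambda>\<omega>. (\<mu> / \<kappa> - e * (\<mu> / \<kappa>)) * indicator A \<omega>)" using AM by (auto simp: emeasure_eq_measure)
  have "(\<integral>\<omega>. indicator A \<omega> * (\<mu> / \<kappa> - e * (\<mu> / \<kappa> - r t \<omega>)) \<partial>M)
    = (\<integral>\<omega>. (\<mu> / \<kappa> - e * (\<mu> / \<kappa>)) * indicator A \<omega> \<partial>M) + (\<integral>\<omega>. e * (indicator A \<omega> * r t \<omega>) \<partial>M)"
    unfolding eq by (rule Bochner_Integration.integral_add[OF i integrable_mult_right[OF rt]]) simp
  also have "\<dots> = (\<mu> / \<kappa> - e * (\<mu> / \<kappa>)) * prob A + e * (\<integral>\<omega>. indicator A \<omega> * r t \<omega> \<partial>M)"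
    using AM by simp
  also have "\<dots> = (\<integral>\<omega>. indicator A \<omega> * r s \<omega> \<partial>M)"
  proof -
    have "(l - e * l) * p + e * x = l * p - e * (l * p - x)" for l p x by (simp add: algebra_simps)
    then have "(\<mu> / \<kappa> - e * (\<mu> / \<kappa>)) * prob A + e * (\<integral>\<omega>. indicator A \<omega> * r t \<omega> \<partial>M)
      = \<mu> / \<kappa> * prob A - e * (\<mu> / \<kappa> * prob A - (\<integral>\<omega>. indicator A \<omega> * r t \<omega> \<partial>M))" .
    also have "\<dots> = (\<integral>\<omega>. indicator A \<omega> * r s \<omega> \<partial>M)" unfolding e_def by (rule mean_formula[OF t A rt, symmetric])
    finally show ?thesis .
  qed
  finally show "integrable M (\<lambda>\<omega>. indicator A \<omega> * r s \<omega>) \<and> integrable M (\<lambda>\<omega>. indicator A \<omega> * (\<mu> / \<kappa> - exp (- \<kappa> * (s - t)) * (\<mu> / \<kappa> - r t \<omega>))) \<and>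
    (\<integral>\<omega>. indicator A \<omega> * r s \<omega> \<partial>M) = (\<integral>\<omega>. indicator A \<omega> * (\<mu> / \<kappa> - exp (- \<kappa> * (s - t)) * (\<mu> / \<kappa> - r t \<omega>)) \<partial>M)"
    unfolding e_def[symmetric] using noise_integrability(1)[OF t A rt] i rt unfolding eq by auto
qed measurable

text \<open>What \<open>second_moment_formula\<close> leaves open is that the formula is nonnegative. Writing
  \<open>E2 = E1\<^sup>2\<close>, the terms without \<open>r t\<close> combine to
  \<open>p * (1 - E1)\<^sup>2 + q * (1 - E1\<^sup>2)\<close>.\<close>

lemma conditional_second_moment:
  assumes t: "0 \<le> t" "t \<le> s"
  defines "K \<equiv> 2 * b * c + \<sigma>\<^sup>2 + 2 * a * \<alpha> + a\<^sup>2 * \<beta>" and "E1 \<equiv> exp (- \<kappa> * (s - t))" and "E2 \<equiv> exp (- 2 * \<kappa> * (s - t))"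
  shows "AE \<omega> in M. nn_cond_exp_given M (\<lambda>\<omega>. (r s \<omega>)\<^sup>2) (r t) \<omega> = ennreal (
      (r t \<omega>)\<^sup>2 * E2 + (K * (\<mu> / (2 * \<kappa>\<^sup>2)) + a\<^sup>2 * \<alpha> / (2 * \<kappa>)) * (1 - E2)
      - K * (\<mu> / \<kappa>\<^sup>2) * (E1 - E2) + K * (r t \<omega> / \<kappa>) * (E1 - E2))"
proof (rule nn_cond_exp_given_r[OF t(1), where G="\<lambda>x. x\<^sup>2 * E2 + (K * (\<mu> / (2 * \<kappa>\<^sup>2)) + a\<^sup>2 * \<alpha> / (2 * \<kappa>)) * (1 - E2)
      - K * (\<mu> / \<kappa>\<^sup>2) * (E1 - E2) + K * (x / \<kappa>) * (E1 - E2)"])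
  have s: "0 \<le> s" using t by simp
  have rs [measurable]: "r s \<in> borel_measurable M" by (rule measurable_F_M[OF r_measurable[OF s]])
  show "(\<lambda>\<omega>. (r s \<omega>)\<^sup>2) \<in> borel_measurable M" by measurable
  have K: "K > 0" unfolding K_def using params by (simp add: add_pos_pos)
  have E: "0 < E1" "E1 \<le> 1" "E2 = E1\<^sup>2"
    unfolding E1_def E2_def using decay_le_one[OF t(2)] by (auto simp: power2_eq_square simp flip: exp_add)
  define p where "p = K * (\<mu> / (2 * \<kappa>\<^sup>2))"
  define q where "q = a\<^sup>2 * \<alpha> / (2 * \<kappa>)"
  define h where "h = K / \<kappa>"
  have pqh: "0 < p" "0 < q" "0 < h" unfolding p_def q_def h_def using K kappa_pos mu_pos params by auto
  have form: "x\<^sup>2 * E2 + (K * (\<mu> / (2 * \<kappa>\<^sup>2)) + a\<^sup>2 * \<alpha> / (2 * \<kappa>)) * (1 - E2)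
      - K * (\<mu> / \<kappa>\<^sup>2) * (E1 - E2) + K * (x / \<kappa>) * (E1 - E2)
    = E2 * x\<^sup>2 + ((p + q) * (1 - E2) - 2 * p * (E1 - E2)) + h * (E1 - E2) * x" for x
  proof -
    have "K * (\<mu> / \<kappa>\<^sup>2) = 2 * p" "K * (x / \<kappa>) = h * x" unfolding p_def h_def by simp_all
    then show ?thesis unfolding p_def[symmetric] q_def[symmetric] by (simp add: algebra_simps)
  qed
  show "0 \<le> x\<^sup>2 * E2 + (K * (\<mu> / (2 * \<kappa>\<^sup>2)) + a\<^sup>2 * \<alpha> / (2 * \<kappa>)) * (1 - E2)
      - K * (\<mu> / \<kappa>\<^sup>2) * (E1 - E2) + K * (x / \<kappa>) * (E1 - E2)" if x: "0 \<le> x" for x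
  proof -
    have "0 \<le> p * (1 - E1)\<^sup>2 + q * (1 - E1\<^sup>2)"
      using pqh E by (intro add_nonneg_nonneg mult_nonneg_nonneg) (auto simp: power_le_one)
    then have "0 \<le> (p + q) * (1 - E2) - 2 * p * (E1 - E2)"
      unfolding E(3) by (simp add: power2_eq_square algebra_simps)
    moreover have "0 \<le> h * (E1 - E2) * x"
    proof -
      have "E1 * E1 \<le> E1 * 1" using E by (intro mult_left_mono) auto
      then show ?thesis using pqh x unfolding E(3) power2_eq_square by (intro mult_nonneg_nonneg) auto
    qed
    moreover have "0 \<le> E2 * x\<^sup>2" unfolding E(3) by simp
    ultimately show ?thesis unfolding form by linarith
  qed
  fix A k assume A: "A \<in> sets (F t)" and k: "\<And>\<omega>. \<omega> \<in> A \<Longrightarrow> r t \<omega> \<le> real k"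
  note rt = bounded_on_event[OF t(1) A k]
  have AM: "A \<in> sets M" by (rule sets_F_M[OF A])
  let ?c = "(p + q) * (1 - E2) - 2 * p * (E1 - E2)"
  have eq: "indicator A \<omega> * (E2 * (r t \<omega>)\<^sup>2 + ?c + h * (E1 - E2) * r t \<omega>)
    = E2 * (indicator A \<omega> * r t \<omega>)\<^sup>2 + (?c * indicator A \<omega> + (h * (E1 - E2)) * (indicator A \<omega> * r t \<omega>))" for \<omega>
    by (cases "\<omega> \<in> A") (simp_all)
  have i: "integrable M (\<lambda>\<omega>. ?c * indicator A \<omega>)" using AM by (auto simp: emeasure_eq_measure)
  have i2: "integrable M (\<lambda>\<omega>. ?c * indicator A \<omega> + (h * (E1 - E2)) * (indicator A \<omega> * r t \<omega>))"
    by (intro Bochner_Integration.integrable_add i integrable_mult_right rt)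
  have "(\<integral>\<omega>. indicator A \<omega> * (E2 * (r t \<omega>)\<^sup>2 + ?c + h * (E1 - E2) * r t \<omega>) \<partial>M)
    = (\<integral>\<omega>. E2 * (indicator A \<omega> * r t \<omega>)\<^sup>2 \<partial>M) + (\<integral>\<omega>. ?c * indicator A \<omega> + (h * (E1 - E2)) * (indicator A \<omega> * r t \<omega>) \<partial>M)"
    unfolding eq by (rule Bochner_Integration.integral_add[OF integrable_mult_right[OF rt(2)] i2])
  also have "(\<integral>\<omega>. ?c * indicator A \<omega> + (h * (E1 - E2)) * (indicator A \<omega> * r t \<omega>) \<partial>M)
    = (\<integral>\<omega>. ?c * indicator A \<omega> \<partial>M) + (\<integral>\<omega>. (h * (E1 - E2)) * (indicator A \<omega> * r t \<omega>) \<partial>M)"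
    by (rule Bochner_Integration.integral_add[OF i integrable_mult_right[OF rt(1)]])
  finally have L: "(\<integral>\<omega>. indicator A \<omega> * (E2 * (r t \<omega>)\<^sup>2 + ?c + h * (E1 - E2) * r t \<omega>) \<partial>M)
    = E2 * (\<integral>\<omega>. (indicator A \<omega> * r t \<omega>)\<^sup>2 \<partial>M) + (?c * prob A + h * (E1 - E2) * (\<integral>\<omega>. indicator A \<omega> * r t \<omega> \<partial>M))"
    using AM by simp
  have sqeq: "indicator A \<omega> * (r s \<omega>)\<^sup>2 = (indicator A \<omega> * r s \<omega>)\<^sup>2" for \<omega> by (simp add: indicator_def)
  have si: "integrable M (\<lambda>\<omega>. (indicator A \<omega> * r s \<omega>)\<^sup>2)"
    using square_integrability[OF t A rt(2)] t by blast
  have Keq: "2 * \<mu> + \<sigma>\<^sup>2 + a\<^sup>2 * \<beta> = K" by (simp add: K_def algebra_simps)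
  have R: "(\<integral>\<omega>. (indicator A \<omega> * r s \<omega>)\<^sup>2 \<partial>M) = (\<integral>\<omega>. (indicator A \<omega> * r t \<omega>)\<^sup>2 \<partial>M) * E2
    + (p + q) * prob A * (1 - E2) - (2 * p * prob A - h * (\<integral>\<omega>. indicator A \<omega> * r t \<omega> \<partial>M)) * (E1 - E2)"
  proof -
    have "(y * (z / w) + x) / (2 * w) = y * (z / (2 * w\<^sup>2)) + x / (2 * w)" for w x y z :: real
      by (simp add: add_divide_distrib power2_eq_square)
    then have "(K * (\<mu> / \<kappa>) + a\<^sup>2 * \<alpha>) / (2 * \<kappa>) = p + q" unfolding p_def q_def by (simp only:)
    moreover have "K / \<kappa> * (\<mu> / \<kappa> * prob A - x) = 2 * p * prob A - h * x" for x
    proof -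
      have "y / w * (z / w * v - x) = 2 * (y * (z / (2 * w\<^sup>2))) * v - y / w * x" for w y z v :: real
        by (simp add: right_diff_distrib power2_eq_square)
      then show ?thesis unfolding p_def h_def by (simp only:)
    qed
    ultimately show ?thesis
      using second_moment_formula[OF t A rt(2)] unfolding Keq E1_def[symmetric] E2_def[symmetric] by (simp only:)
  qed
  show "integrable M (\<lambda>\<omega>. indicator A \<omega> * (r s \<omega>)\<^sup>2) \<and>
    integrable M (\<lambda>\<omega>. indicator A \<omega> * ((r t \<omega>)\<^sup>2 * E2 + (K * (\<mu> / (2 * \<kappa>\<^sup>2)) + a\<^sup>2 * \<alpha> / (2 * \<kappa>)) * (1 - E2)
      - K * (\<mu> / \<kappa>\<^sup>2) * (E1 - E2) + K * (r t \<omega> / \<kappa>) * (E1 - E2))) \<and>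
    (\<integral>\<omega>. indicator A \<omega> * (r s \<omega>)\<^sup>2 \<partial>M) = (\<integral>\<omega>. indicator A \<omega> * ((r t \<omega>)\<^sup>2 * E2 + (K * (\<mu> / (2 * \<kappa>\<^sup>2)) + a\<^sup>2 * \<alpha> / (2 * \<kappa>)) * (1 - E2)
      - K * (\<mu> / \<kappa>\<^sup>2) * (E1 - E2) + K * (r t \<omega> / \<kappa>) * (E1 - E2)) \<partial>M)"
    unfolding form
  proof (intro conjI)
    show "integrable M (\<lambda>\<omega>. indicator A \<omega> * (r s \<omega>)\<^sup>2)" unfolding sqeq by (rule si)
    show "integrable M (\<lambda>\<omega>. indicator A \<omega> * (E2 * (r t \<omega>)\<^sup>2 + ?c + h * (E1 - E2) * r t \<omega>))"
      unfolding eq by (intro Bochner_Integration.integrable_add[OF integrable_mult_right[OF rt(2)] i2])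
    show "(\<integral>\<omega>. indicator A \<omega> * (r s \<omega>)\<^sup>2 \<partial>M) = (\<integral>\<omega>. indicator A \<omega> * (E2 * (r t \<omega>)\<^sup>2 + ?c + h * (E1 - E2) * r t \<omega>) \<partial>M)"
      unfolding L sqeq R by (simp add: algebra_simps)
  qed
qed measurable

end

theorem proposition1:
  fixes M :: "'a measure" and F :: "real \<Rightarrow> 'a measure"
    and a b c \<alpha> \<beta> \<sigma> :: real
    and W :: "real \<Rightarrow> 'a \<Rightarrow> real" and N :: "real \<Rightarrow> 'a \<Rightarrow> nat" and r :: "real \<Rightarrow> 'a \<Rightarrow> real"
  assumes "a > 0" "b > 0" "c > 0" "\<alpha> > 0" "\<beta> > 0" "\<sigma> > 0"
    and "b > a * \<beta>" and "2 * b * c \<ge> \<sigma>\<^sup>2"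
    and "cir_hawkes M F a b c \<alpha> \<beta> \<sigma> W N r"
  shows
    "(\<forall>t s. 0 \<le> t \<and> t < s \<longrightarrow>
       (AE \<omega> in M. nn_cond_exp_given M (r s) (r t) \<omega> = ennreal (
          (b * c + a * \<alpha>) / (b - a * \<beta>)
          - exp (- (b - a * \<beta>) * (s - t)) * ((b * c + a * \<alpha>) / (b - a * \<beta>) - r t \<omega>)))) \<and>
     (\<forall>t s. 0 \<le> t \<and> t < s \<longrightarrow>
       (AE \<omega> in M. nn_cond_exp_given M (\<lambda>\<omega>'. (r s \<omega>')\<^sup>2) (r t) \<omega> = ennreal (
          (r t \<omega>)\<^sup>2 * exp (- 2 * (b - a * \<beta>) * (s - t))
          + ((2 * b * c + \<sigma>\<^sup>2 + 2 * a * \<alpha> + a\<^sup>2 * \<beta>) * ((b * c + a * \<alpha>) / (2 * (b - a * \<beta>)\<^sup>2))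
              + a\<^sup>2 * \<alpha> / (2 * (b - a * \<beta>)))
            * (1 - exp (- 2 * (b - a * \<beta>) * (s - t)))
          - (2 * b * c + \<sigma>\<^sup>2 + 2 * a * \<alpha> + a\<^sup>2 * \<beta>) * ((b * c + a * \<alpha>) / (b - a * \<beta>)\<^sup>2)
            * (exp (- (b - a * \<beta>) * (s - t)) - exp (- 2 * (b - a * \<beta>) * (s - t)))
          + (2 * b * c + \<sigma>\<^sup>2 + 2 * a * \<alpha> + a\<^sup>2 * \<beta>) * (r t \<omega> / (b - a * \<beta>))
            * (exp (- (b - a * \<beta>) * (s - t)) - exp (- 2 * (b - a * \<beta>) * (s - t))))))"
proof -
  interpret stable_cir_hawkes M F a b c \<alpha> \<beta> \<sigma> W N r
    unfolding stable_cir_hawkes_def stable_cir_hawkes_axioms_def using assms by auto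
  show ?thesis
  proof (intro conjI allI impI; elim conjE)
    fix t s :: real
    assume ts: "0 \<le> t" "t < s"
    show "AE \<omega> in M. nn_cond_exp_given M (r s) (r t) \<omega> = ennreal (
          (b * c + a * \<alpha>) / (b - a * \<beta>)
          - exp (- (b - a * \<beta>) * (s - t)) * ((b * c + a * \<alpha>) / (b - a * \<beta>) - r t \<omega>))"
      by (rule conditional_mean[OF ts(1) less_imp_le[OF ts(2)]])
  next
    fix t s :: real
    assume ts: "0 \<le> t" "t < s"
    show "AE \<omega> in M. nn_cond_exp_given M (\<lambda>\<omega>'. (r s \<omega>')\<^sup>2) (r t) \<omega> = ennreal (
          (r t \<omega>)\<^sup>2 * exp (- 2 * (b - a * \<beta>) * (s - t))
          + ((2 * b * c + \<sigma>\<^sup>2 + 2 * a * \<alpha> + a\<^sup>2 * \<beta>) * ((b * c + a * \<alpha>) / (2 * (b - a * \<beta>)\<^sup>2))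
              + a\<^sup>2 * \<alpha> / (2 * (b - a * \<beta>)))
            * (1 - exp (- 2 * (b - a * \<beta>) * (s - t)))
          - (2 * b * c + \<sigma>\<^sup>2 + 2 * a * \<alpha> + a\<^sup>2 * \<beta>) * ((b * c + a * \<alpha>) / (b - a * \<beta>)\<^sup>2)
            * (exp (- (b - a * \<beta>) * (s - t)) - exp (- 2 * (b - a * \<beta>) * (s - t)))
          + (2 * b * c + \<sigma>\<^sup>2 + 2 * a * \<alpha> + a\<^sup>2 * \<beta>) * (r t \<omega> / (b - a * \<beta>))
            * (exp (- (b - a * \<beta>) * (s - t)) - exp (- 2 * (b - a * \<beta>) * (s - t))))"
      by (rule conditional_second_moment[OF ts(1) less_imp_le[OF ts(2)]])
  qed
qed

end
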